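(* There exist a constant $c_0>0$, depending only on $\nu,\mu,\kappa,\alpha$, and a constant $\rho>0$ such that the following holds. For every initial data $(a_0,u_0)\in (PM^{d-1}\cap PM^{d})\times PM^{d-1}$ with $\|(a_0,|D|a_0,u_0)\|_{PM^{d-1}}\le \rho$, the Cauchy problem (NSK) with initial condition $(a,u)|_{t=0}=(a_0,u_0)$ has a global solution $(a,u)\in X_\infty$ which is analytic in the space variable at any positive time. Moreover, for any time $t>0$, $$\operatorname{rad}(a(t),u(t))\ \ge\ c_0\sqrt t .$$
   Context: Standing assumptions: $d\ge 2$ is an integer, $p>2$ is real with $d-3+\frac4p>0$; $\mu,\nu,\kappa,\alpha$ are real constants with $\mu>0$, $\mu+\nu>0$, $\kappa>0$, $\alpha>0$. Spaces. $\widehat{g}$ is the Fourier transform in the space variable and $m(D)$ the Fourier multiplier with symbol $m(\xi)$. For $r\ge0$, $PM^r=PM^r(\mathbb R^d)$ is the set of $g\in\mathcal S'(\mathbb R^d)$ with $\widehat g\in L^1_{loc}$ and $\|g\|_{PM^r}:=\sup_{\xi}|\xi|^r|\widehat g(\xi)|<\infty$ (essential supremum); for vector-valued $g$, $|\widehat g|$ is the Euclidean norm. In particular $\|(a_0,|D|a_0,u_0)\|_{PM^{r}}=\sup_\xi |\xi|^{r}|(\widehat a_0,|\xi|\widehat a_0,\widehat u_0)(\xi)|$. For $r>0$, $K^{p,r}_T$ ($0<T<\infty$) is the space of continuous $u:\,]0,T]\to PM^{r+2/p}$ with $\|u\|_{K^{p,r}_T}:=\sup_{t\in]0,T]}t^{1/p}\|u(t)\|_{PM^{r+2/p}}<\infty$;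 $K^{p,r}_\infty$ is defined in the same way on $]0,+\infty[$. For $T\in\,]0,\infty]$, $X_T$ is the space of $(a,u)\in(K^{p,d-1}_T\cap K^{p,d}_T)\times K^{p,d-1}_T$ ($a$ scalar, $u$ with $d$ components) with norm $\|(a,u)\|_{X_T}:=\max\{\|a\|_{K^{p,d-1}_T},\|a\|_{K^{p,d}_T}\}+\|u\|_{K^{p,d-1}_T}$. System (NSK): $$\partial_t a+\operatorname{div}u=f(u,a),\qquad \partial_t u-\mu\Delta u-(\mu+\nu)\nabla\operatorname{div}u+\alpha\nabla a-\kappa\nabla\Delta a=g(u,a),$$ with $f(u,a)=-u\cdot\nabla a$ and $g(u,a)=-u\cdot\nabla u+\mu\nabla a\cdot\nabla u+(\mu+\nu)\nabla a\cdot Du+\frac{\kappa}{2}\nabla(\nabla a\cdot\nabla a)$, where $(\nabla a\cdot\nabla u)_j=\sum_i\partial_i a\,\partial_i u_j$ and $(\nabla a\cdot Du)_j=\sum_i\partial_i a\,\partial_j u_i$. Products are understood through convolution of Fourier transforms. Solutions are mild solutions: $(a,u)\in X_T$ is a solution with data $(a_0,u_0)$ if for all $t$ in its time interval $$(a,u)(t)=W(t)(a_0,u_0)+\int_0^tW(t-s)\big(f(u,a)(s),g(u,a)(s)\big)ds,$$ where $W(t)=e^{-tA(D)}$ and, for $b\in\mathbb C$, $w\in\mathbb C^d$, $A(\xi)(b,w)=\big(i\xi\cdot w,\ i(\alpha+\kappa|\xi|^2)b\,\xi+\mu|\xi|^2w+(\mu+\nu)(\xi\cdot w)\xi\big)$.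 A solution is global if it is defined on $]0,+\infty[$. Radius of analyticity. For $r<d$ and $v\in PM^r$, $\operatorname{rad}(v):=\sup\{\sigma>0: e^{\sigma|D|}v\in PM^r\}$ (with $\sup\emptyset=0$); for a vector, $\operatorname{rad}$ is the minimum over the components. For $(a(t),u(t))$ one takes $r=d-1+\frac2p$ (which is $<d$). *)

theory Defs
  imports
    "HOL-Analysis.Analysis"
    "HOL-Analysis.Abstract_Euclidean_Space"
    "HOL-Probability.Essential_Supremum"
begin

section \<open>Euclidean space of variable dimension\<close>

text \<open>
  The dimension is an ordinary natural number, not a type, because the constant \<open>c\<^sub>0\<close> of the theorem
  has to be chosen before the dimension. Following \<^const>\<open>Euclidean_space\<close>, a point of the
  \<open>d\<close>-dimensional space is a sequence of reals that vanishes from index \<open>d\<close> on; the coordinates are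
  numbered from \<open>0\<close> to \<open>d - 1\<close>.
\<close>

type_synonym point = "nat \<Rightarrow> real"

abbreviation Rd :: "nat \<Rightarrow> point set" where
  "Rd d \<equiv> topspace (Euclidean_space d)"

abbreviation enorm :: "nat \<Rightarrow> point \<Rightarrow> real" where
  "enorm d x \<equiv> L2_set x {..<d}"

definition extend0 :: "nat \<Rightarrow> point \<Rightarrow> point" where
  "extend0 d x = (\<lambda>i. if i < d then x i else 0)"

text \<open>Lebesgue measure on \<^term>\<open>Rd d\<close>, as a Borel measure on sequences carried by \<^term>\<open>Rd d\<close>.
  (Points of the product measure space are \<^const>\<open>undefined\<close> from \<open>d\<close> on, hence \<^const>\<open>extend0\<close>.)\<close>

definition leb :: "nat \<Rightarrow> point measure" where
  "leb d = distr (Pi\<^sub>M {..<d} (\<lambda>_. lborel)) borel (extend0 d)"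

lemma measurable_extend0: "extend0 d \<in> Pi\<^sub>M {..<d} (\<lambda>_. lborel) \<rightarrow>\<^sub>M borel"
proof (rule measurable_coordinatewise_then_product)
  fix i
  show "(\<lambda>x. extend0 d x i) \<in> borel_measurable (Pi\<^sub>M {..<d} (\<lambda>_. lborel))"
  proof (cases "i < d")
    case True
    then have "(\<lambda>x. x i) \<in> Pi\<^sub>M {..<d} (\<lambda>_. lborel :: real measure) \<rightarrow>\<^sub>M lborel"
      by (intro measurable_component_singleton) auto
    with True show ?thesis by (simp add: extend0_def)
  qed (simp add: extend0_def)
qed

section \<open>Schwartz functions and tempered distributions\<close>

definition pdiff :: "nat \<Rightarrow> (point \<Rightarrow> complex) \<Rightarrow> point \<Rightarrow> complex" where
  "pdiff i \<phi> x = vector_derivative (\<lambda>s. \<phi> (x(i := s))) (at (x i))"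

definition pdiffs :: "nat list \<Rightarrow> (point \<Rightarrow> complex) \<Rightarrow> point \<Rightarrow> complex" where
  "pdiffs is \<phi> = foldr pdiff is \<phi>"

definition smooth :: "nat \<Rightarrow> (point \<Rightarrow> complex) \<Rightarrow> bool" where
  "smooth d \<phi> \<longleftrightarrow> (\<forall>is \<in> lists {..<d}.
      continuous_map (Euclidean_space d) euclidean (pdiffs is \<phi>) \<and>
      (\<forall>x \<in> Rd d. \<forall>i<d. (\<lambda>s. pdiffs is \<phi> (x(i := s))) differentiable (at (x i))))"

text \<open>Functions on \<^term>\<open>Rd d\<close> are normalised to vanish on the sequences outside \<^term>\<open>Rd d\<close>.\<close>

definition schwartz :: "nat \<Rightarrow> (point \<Rightarrow> complex) set" where
  "schwartz d = {\<phi>. (\<forall>x. x \<notin> Rd d \<longrightarrow> \<phi> x = 0) \<and> smooth d \<phi> \<and>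
      (\<forall>k. \<forall>is \<in> lists {..<d}. \<exists>C. \<forall>x \<in> Rd d. (1 + enorm d x) ^ k * cmod (pdiffs is \<phi> x) \<le> C)}"

definition schwartz_norm :: "nat \<Rightarrow> nat \<Rightarrow> (point \<Rightarrow> complex) \<Rightarrow> real" where
  "schwartz_norm d N \<phi> = (\<Sum>is \<in> {is \<in> lists {..<d}. length is \<le> N}.
      SUP x \<in> Rd d. (1 + enorm d x) ^ N * cmod (pdiffs is \<phi> x))"

text \<open>A distribution is a functional whose values matter on \<^term>\<open>schwartz d\<close> only; accordingly,
  equality of distributions always means equality on \<^term>\<open>schwartz d\<close>.\<close>

type_synonym distn = "(point \<Rightarrow> complex) \<Rightarrow> complex"

definition tempered :: "nat \<Rightarrow> distn set" where
  "tempered d = {g.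
      (\<forall>\<phi> \<in> schwartz d. \<forall>\<psi> \<in> schwartz d. g (\<lambda>x. \<phi> x + \<psi> x) = g \<phi> + g \<psi>) \<and>
      (\<forall>c. \<forall>\<phi> \<in> schwartz d. g (\<lambda>x. c * \<phi> x) = c * g \<phi>) \<and>
      (\<exists>C N. \<forall>\<phi> \<in> schwartz d. cmod (g \<phi>) \<le> C * schwartz_norm d N \<phi>)}"

text \<open>\<open>g\<close> is the regular distribution given by the locally integrable function \<open>h\<close>.\<close>

definition is_regular :: "nat \<Rightarrow> distn \<Rightarrow> (point \<Rightarrow> complex) \<Rightarrow> bool" where
  "is_regular d g h \<longleftrightarrow> h \<in> borel_measurable (leb d) \<and>
      (\<forall>R. set_integrable (leb d) {x. enorm d x \<le> R} h) \<and>
      (\<forall>\<phi> \<in> schwartz d. integrable (leb d) (\<lambda>x. h x * \<phi> x) \<and> g \<phi> = (LINT x|leb d. h x * \<phi> x))"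

definition dist_pdiff :: "nat \<Rightarrow> distn \<Rightarrow> distn" where
  "dist_pdiff i g = (\<lambda>\<phi>. - g (pdiff i \<phi>))"

section \<open>Fourier transform\<close>

definition fourier :: "nat \<Rightarrow> (point \<Rightarrow> complex) \<Rightarrow> point \<Rightarrow> complex" where
  "fourier d \<phi> \<xi> =
     (if \<xi> \<in> Rd d then LINT x|leb d. cis (- (\<Sum>i<d. x i * \<xi> i)) * \<phi> x else 0)"

definition dist_fourier :: "nat \<Rightarrow> distn \<Rightarrow> distn" where
  "dist_fourier d g = (\<lambda>\<phi>. g (fourier d \<phi>))"

text \<open>The Fourier transform of \<open>g\<close> is the locally integrable function \<open>h\<close>.\<close>

definition has_hat :: "nat \<Rightarrow> distn \<Rightarrow> (point \<Rightarrow> complex) \<Rightarrow> bool" where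
  "has_hat d g h \<longleftrightarrow> is_regular d (dist_fourier d g) h"

text \<open>A representative of the Fourier transform, which is determined almost everywhere only.\<close>

definition hat :: "nat \<Rightarrow> distn \<Rightarrow> point \<Rightarrow> complex" where
  "hat d g = (SOME h. has_hat d g h)"

text \<open>\<^term>\<open>inv_hat d h\<close> is the tempered distribution with Fourier transform \<open>h\<close>. It is
  meaningful only under \<^term>\<open>has_inv_hat d h\<close>, which is therefore required wherever it is used.\<close>

definition has_inv_hat :: "nat \<Rightarrow> (point \<Rightarrow> complex) \<Rightarrow> bool" where
  "has_inv_hat d h \<longleftrightarrow> (\<exists>g \<in> tempered d. has_hat d g h)"

definition inv_hat :: "nat \<Rightarrow> (point \<Rightarrow> complex) \<Rightarrow> distn" where
  "inv_hat d h = (SOME g. g \<in> tempered d \<and> has_hat d g h)"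

text \<open>Products of distributions: with the above normalisation of the Fourier transform,
  the transform of \<open>vw\<close> is \<open>(2\<pi>)\<^sup>-\<^sup>d\<close> times the convolution of the transforms.\<close>

definition prod_hat :: "nat \<Rightarrow> distn \<Rightarrow> distn \<Rightarrow> point \<Rightarrow> complex" where
  "prod_hat d v w \<xi> =
     (LINT \<eta>|leb d. hat d v (\<lambda>i. \<xi> i - \<eta> i) * hat d w \<eta>) / (2 * pi) ^ d"

definition dist_prod :: "nat \<Rightarrow> distn \<Rightarrow> distn \<Rightarrow> distn" where
  "dist_prod d v w = inv_hat d (prod_hat d v w)"

definition prod_defined :: "nat \<Rightarrow> distn \<Rightarrow> distn \<Rightarrow> bool" where
  "prod_defined d v w \<longleftrightarrow> (\<exists>h. has_hat d v h) \<and> (\<exists>h. has_hat d w h) \<and>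
      (AE \<xi> in leb d. integrable (leb d) (\<lambda>\<eta>. hat d v (\<lambda>i. \<xi> i - \<eta> i) * hat d w \<eta>)) \<and>
      has_inv_hat d (prod_hat d v w)"

section \<open>Function spaces\<close>

text \<open>Vector-valued distributions have components numbered from \<open>0\<close> to \<open>m - 1\<close>;
  a scalar \<open>a\<close> is treated as \<open>\<lambda>_. a\<close> with \<open>m = 1\<close>.\<close>

definition PM_norm :: "nat \<Rightarrow> nat \<Rightarrow> real \<Rightarrow> (nat \<Rightarrow> distn) \<Rightarrow> ereal" where
  "PM_norm d m r v = esssup (leb d)
     (\<lambda>\<xi>. ereal (enorm d \<xi> powr r * L2_set (\<lambda>j. cmod (hat d (v j) \<xi>)) {..<m}))"

definition PM :: "nat \<Rightarrow> nat \<Rightarrow> real \<Rightarrow> (nat \<Rightarrow> distn) set" where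
  "PM d m r = {v. (\<forall>j<m. v j \<in> tempered d \<and> (\<exists>h. has_hat d (v j) h)) \<and> PM_norm d m r v < \<infinity>}"

text \<open>The norm of \<open>(a, |D|a, u)\<close> in \<open>PM\<^sup>r\<close>.\<close>

definition data_norm :: "nat \<Rightarrow> real \<Rightarrow> distn \<Rightarrow> (nat \<Rightarrow> distn) \<Rightarrow> ereal" where
  "data_norm d r a u = esssup (leb d)
     (\<lambda>\<xi>. ereal (enorm d \<xi> powr r *
        sqrt ((cmod (hat d a \<xi>))\<^sup>2 + (enorm d \<xi> * cmod (hat d a \<xi>))\<^sup>2
              + (\<Sum>j<d. (cmod (hat d (u j) \<xi>))\<^sup>2))))"

definition time_set :: "ereal \<Rightarrow> real set" where
  "time_set T = {t. 0 < t \<and> ereal t \<le> T}"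

definition K_space :: "nat \<Rightarrow> nat \<Rightarrow> real \<Rightarrow> real \<Rightarrow> ereal \<Rightarrow> (real \<Rightarrow> nat \<Rightarrow> distn) set" where
  "K_space d m p r T = {v.
      (\<forall>t \<in> time_set T. v t \<in> PM d m (r + 2 / p)) \<and>
      (\<forall>s \<in> time_set T.
         ((\<lambda>t. PM_norm d m (r + 2 / p) (\<lambda>j \<phi>. v t j \<phi> - v s j \<phi>)) \<longlongrightarrow> 0) (at s within time_set T)) \<and>
      (SUP t \<in> time_set T. ereal (t powr (1 / p)) * PM_norm d m (r + 2 / p) (v t)) < \<infinity>}"

definition X_space :: "nat \<Rightarrow> real \<Rightarrow> ereal \<Rightarrow> ((real \<Rightarrow> distn) \<times> (real \<Rightarrow> nat \<Rightarrow> distn)) set" where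
  "X_space d p T = {(a, u). (\<lambda>t _. a t) \<in> K_space d 1 p (real d - 1) T \<inter> K_space d 1 p (real d) T \<and>
                      u \<in> K_space d d p (real d - 1) T}"

section \<open>The system\<close>

definition nsk_f :: "nat \<Rightarrow> (nat \<Rightarrow> distn) \<Rightarrow> distn \<Rightarrow> distn" where
  "nsk_f d u a = (\<lambda>\<phi>. - (\<Sum>i<d. dist_prod d (u i) (dist_pdiff i a) \<phi>))"

definition nsk_g ::
  "nat \<Rightarrow> real \<Rightarrow> real \<Rightarrow> real \<Rightarrow> (nat \<Rightarrow> distn) \<Rightarrow> distn \<Rightarrow> nat \<Rightarrow> distn" where
  "nsk_g d \<mu> \<nu> \<kappa> u a j = (\<lambda>\<phi>.
      - (\<Sum>i<d. dist_prod d (u i) (dist_pdiff i (u j)) \<phi>)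
      + complex_of_real \<mu> * (\<Sum>i<d. dist_prod d (dist_pdiff i a) (dist_pdiff i (u j)) \<phi>)
      + complex_of_real (\<mu> + \<nu>) * (\<Sum>i<d. dist_prod d (dist_pdiff i a) (dist_pdiff j (u i)) \<phi>)
      + complex_of_real (\<kappa> / 2) *
          dist_pdiff j (\<lambda>\<psi>. \<Sum>i<d. dist_prod d (dist_pdiff i a) (dist_pdiff i a) \<psi>) \<phi>)"

definition nonlinearity_defined :: "nat \<Rightarrow> (nat \<Rightarrow> distn) \<Rightarrow> distn \<Rightarrow> bool" where
  "nonlinearity_defined d u a \<longleftrightarrow> (\<forall>i<d.
      prod_defined d (u i) (dist_pdiff i a) \<and>
      prod_defined d (dist_pdiff i a) (dist_pdiff i a) \<and>
      (\<forall>j<d. prod_defined d (u i) (dist_pdiff i (u j)) \<and>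
             prod_defined d (dist_pdiff i a) (dist_pdiff i (u j)) \<and>
             prod_defined d (dist_pdiff i a) (dist_pdiff j (u i))))"

definition A_symbol :: "nat \<Rightarrow> real \<Rightarrow> real \<Rightarrow> real \<Rightarrow> real \<Rightarrow> point \<Rightarrow>
    complex \<times> (nat \<Rightarrow> complex) \<Rightarrow> complex \<times> (nat \<Rightarrow> complex)" where
  "A_symbol d \<mu> \<nu> \<kappa> \<alpha> \<xi> = (\<lambda>(b, w).
     let \<xi>w = (\<Sum>i<d. complex_of_real (\<xi> i) * w i) in
     (\<i> * \<xi>w,
      \<lambda>j. \<i> * complex_of_real (\<alpha> + \<kappa> * (enorm d \<xi>)\<^sup>2) * b * complex_of_real (\<xi> j)
          + complex_of_real (\<mu> * (enorm d \<xi>)\<^sup>2) * w j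
          + complex_of_real (\<mu> + \<nu>) * \<xi>w * complex_of_real (\<xi> j)))"

text \<open>The matrix exponential \<open>exp(-tA(\<xi>))\<close>, applied to a vector, as a componentwise power series.\<close>

definition W_symbol :: "nat \<Rightarrow> real \<Rightarrow> real \<Rightarrow> real \<Rightarrow> real \<Rightarrow> real \<Rightarrow> point \<Rightarrow>
    complex \<times> (nat \<Rightarrow> complex) \<Rightarrow> complex \<times> (nat \<Rightarrow> complex)" where
  "W_symbol d \<mu> \<nu> \<kappa> \<alpha> t \<xi> bw =
     ((\<Sum>n. complex_of_real ((- t) ^ n / fact n) * fst ((A_symbol d \<mu> \<nu> \<kappa> \<alpha> \<xi> ^^ n) bw)),
      (\<lambda>j. \<Sum>n. complex_of_real ((- t) ^ n / fact n) * snd ((A_symbol d \<mu> \<nu> \<kappa> \<alpha> \<xi> ^^ n) bw) j))"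

definition W_hat :: "nat \<Rightarrow> real \<Rightarrow> real \<Rightarrow> real \<Rightarrow> real \<Rightarrow> real \<Rightarrow>
    distn \<times> (nat \<Rightarrow> distn) \<Rightarrow> point \<Rightarrow> complex \<times> (nat \<Rightarrow> complex)" where
  "W_hat d \<mu> \<nu> \<kappa> \<alpha> t bw \<xi> =
     W_symbol d \<mu> \<nu> \<kappa> \<alpha> t \<xi> (hat d (fst bw) \<xi>, \<lambda>j. hat d (snd bw j) \<xi>)"

definition W_op :: "nat \<Rightarrow> real \<Rightarrow> real \<Rightarrow> real \<Rightarrow> real \<Rightarrow> real \<Rightarrow>
    distn \<times> (nat \<Rightarrow> distn) \<Rightarrow> distn \<times> (nat \<Rightarrow> distn)" where
  "W_op d \<mu> \<nu> \<kappa> \<alpha> t bw =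
     (inv_hat d (\<lambda>\<xi>. fst (W_hat d \<mu> \<nu> \<kappa> \<alpha> t bw \<xi>)),
      \<lambda>j. inv_hat d (\<lambda>\<xi>. snd (W_hat d \<mu> \<nu> \<kappa> \<alpha> t bw \<xi>) j))"

definition W_defined :: "nat \<Rightarrow> real \<Rightarrow> real \<Rightarrow> real \<Rightarrow> real \<Rightarrow> real \<Rightarrow>
    distn \<times> (nat \<Rightarrow> distn) \<Rightarrow> bool" where
  "W_defined d \<mu> \<nu> \<kappa> \<alpha> t bw \<longleftrightarrow>
      (\<exists>h. has_hat d (fst bw) h) \<and> (\<forall>j<d. \<exists>h. has_hat d (snd bw j) h) \<and>
      has_inv_hat d (\<lambda>\<xi>. fst (W_hat d \<mu> \<nu> \<kappa> \<alpha> t bw \<xi>)) \<and>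
      (\<forall>j<d. has_inv_hat d (\<lambda>\<xi>. snd (W_hat d \<mu> \<nu> \<kappa> \<alpha> t bw \<xi>) j))"

text \<open>Distribution-valued time integrals are taken in the weak sense, that is, after pairing
  with Schwartz functions.\<close>

definition has_weak_integral :: "nat \<Rightarrow> real \<Rightarrow> (real \<Rightarrow> distn) \<Rightarrow> distn \<Rightarrow> bool" where
  "has_weak_integral d t F I \<longleftrightarrow> (\<forall>\<phi> \<in> schwartz d.
      set_integrable lborel {0<..<t} (\<lambda>s. F s \<phi>) \<and> I \<phi> = (LINT s:{0<..<t}|lborel. F s \<phi>))"

definition mild_solution :: "nat \<Rightarrow> real \<Rightarrow> real \<Rightarrow> real \<Rightarrow> real \<Rightarrow> real \<Rightarrow> ereal \<Rightarrow>
    distn \<Rightarrow> (nat \<Rightarrow> distn) \<Rightarrow> (real \<Rightarrow> distn) \<Rightarrow> (real \<Rightarrow> nat \<Rightarrow> distn) \<Rightarrow> bool" where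
  "mild_solution d p \<mu> \<nu> \<kappa> \<alpha> T a\<^sub>0 u\<^sub>0 a u \<longleftrightarrow> (a, u) \<in> X_space d p T \<and>
     (\<forall>t \<in> time_set T. nonlinearity_defined d (u t) (a t)) \<and>
     (let N = (\<lambda>s. (nsk_f d (u s) (a s), nsk_g d \<mu> \<nu> \<kappa> (u s) (a s)))
      in \<forall>t \<in> time_set T.
        W_defined d \<mu> \<nu> \<kappa> \<alpha> t (a\<^sub>0, u\<^sub>0) \<and>
        (\<forall>s \<in> {0<..<t}. W_defined d \<mu> \<nu> \<kappa> \<alpha> (t - s) (N s)) \<and>
        has_weak_integral d t (\<lambda>s. fst (W_op d \<mu> \<nu> \<kappa> \<alpha> (t - s) (N s)))
          (\<lambda>\<phi>. a t \<phi> - fst (W_op d \<mu> \<nu> \<kappa> \<alpha> t (a\<^sub>0, u\<^sub>0)) \<phi>) \<and>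
        (\<forall>j<d. has_weak_integral d t (\<lambda>s. snd (W_op d \<mu> \<nu> \<kappa> \<alpha> (t - s) (N s)) j)
          (\<lambda>\<phi>. u t j \<phi> - snd (W_op d \<mu> \<nu> \<kappa> \<alpha> t (a\<^sub>0, u\<^sub>0)) j \<phi>)))"

section \<open>Analyticity\<close>

definition real_analytic :: "nat \<Rightarrow> (point \<Rightarrow> complex) \<Rightarrow> bool" where
  "real_analytic d F \<longleftrightarrow> (\<forall>x \<in> Rd d. \<exists>\<epsilon>>0. \<exists>c :: (nat \<Rightarrow> nat) \<Rightarrow> complex.
     \<forall>y \<in> Rd d. enorm d (\<lambda>i. y i - x i) < \<epsilon> \<longrightarrow>
       ((\<lambda>m. c m * (\<Prod>i<d. complex_of_real (y i - x i) ^ m i)) has_sum F y) {m. \<forall>i\<ge>d. m i = 0})"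

definition analytic_distn :: "nat \<Rightarrow> distn \<Rightarrow> bool" where
  "analytic_distn d g \<longleftrightarrow> (\<exists>F. real_analytic d F \<and> is_regular d g F)"

text \<open>\<open>w\<close> below is \<open>e\<^bsup>\<sigma>|D|\<^esup> v\<close>.\<close>

definition rad :: "nat \<Rightarrow> real \<Rightarrow> distn \<Rightarrow> ereal" where
  "rad d r v = Sup (insert 0 (ereal ` {\<sigma>. 0 < \<sigma> \<and>
     (\<exists>w. (\<lambda>_. w) \<in> PM d 1 r \<and>
          has_hat d w (\<lambda>\<xi>. complex_of_real (exp (\<sigma> * enorm d \<xi>)) * hat d v \<xi>))}))"

definition rad_pair :: "nat \<Rightarrow> real \<Rightarrow> distn \<Rightarrow> (nat \<Rightarrow> distn) \<Rightarrow> ereal" where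
  "rad_pair d r a u = Min (insert (rad d r a) ((\<lambda>j. rad d r (u j)) ` {..<d}))"

end

theory Submission
  imports Defs "HOL-Probability.Characteristic_Functions"
begin

text \<open>On the Fourier side the system is the Duhamel equation \<open>U = W U\<^sub>0 + \<integral> W(t - s) B(U, U)(s) ds\<close> with a
  pointwise semigroup \<open>W\<close>. A Lyapunov functional shows that \<open>W(t, \<xi>)\<close>, measured in
  \<open>(1 + |\<xi>|) |b| + |w|\<close>, decays like \<open>exp (- \<lambda> |\<xi>|\<^sup>2 t)\<close>. The iteration runs in the weighted sup norm
  with weight \<open>t\<^bsup>1/p\<^esup> exp (\<surd>t |\<xi>|) |\<xi>|\<^bsup>d-1+2/p\<^esup>\<close>. The exponential costs only a constant: it passes
  through convolutions because \<open>|\<xi>| \<le> |\<xi> - \<eta>| + |\<eta>|\<close>, and through the semigroup because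
  \<open>\<surd>t \<le> \<surd>(t - s) + \<surd>s\<close> and \<open>\<surd>(t - s) r\<close> is absorbed by half of the Gaussian decay. The powers of
  \<open>|\<xi>|\<close> are handled by the Riesz convolution integral and by a Beta integral in time. Hence the fixed point carries the factor
  \<open>exp (- \<surd>t |\<xi>|)\<close>, which is the radius bound with \<open>c\<^sub>0 = 1\<close>.\<close>

section \<open>Lebesgue measure\<close>

text \<open>The hypotheses on \<open>d\<close> and \<open>p\<close> close the exponents.
  \<open>p > 2\<close> keeps the solution weight d-1+2/p below d, hence integrable at the origin,
  and makes the Beta integral converge; d-3+4/p > 0 makes the convolution of a factor with a
  derivative converge at infinity. No constant depends on time, so small data give a global solution
  at once. Counting the density with the factor 1+|\<xi>| puts its gradient on the level of the
  velocity, and capillarity makes this norm equivalent to the energy.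

  The obstacle: a transform is determined almost everywhere only, and \<open>hat\<close> is an
  arbitrary representative, whereas the iteration is pointwise in time and frequency.
  Representatives of the data are therefore corrected on a null set, the fixed point is built at
  each nonzero frequency with joint measurability, and Fubini's theorem returns to distributions;
  Fourier inversion and uniqueness of densities legitimate this passage. Continuity in time is not
  part of the weighted bound: it comes from the equation at bounded frequencies and from the
  exponential factor at high ones.\<close>

lemma sets_leb [simp, measurable_cong]: "sets (leb d) = sets borel"
  by (simp add: leb_def)

lemma space_leb [simp]: "space (leb d) = UNIV"
  by (simp add: leb_def)

lemma borel_measurable_enorm [measurable]: "enorm d \<in> borel_measurable borel"
  unfolding L2_set_def by measurable

lemma Rd_iff: "x \<in> Rd d \<longleftrightarrow> (\<forall>i\<ge>d. x i = 0)"
  by (simp add: topspace_Euclidean_space)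

lemma extend0_in_Rd [simp]: "extend0 d x \<in> Rd d"
  by (simp add: Rd_iff extend0_def)

lemma extend0_apply [simp]: "i < d \<Longrightarrow> extend0 d x i = x i"
  by (simp add: extend0_def)

lemma borel_measurable_coord:
  fixes f :: "'a \<Rightarrow> point"
  assumes "f \<in> borel_measurable M"
  shows "(\<lambda>x. f x i) \<in> borel_measurable M"
  by (rule measurable_product_then_coordinatewise[OF assms])

lemma measurable_point_diff [measurable (raw)]:
  fixes f g :: "'a \<Rightarrow> point"
  assumes f: "f \<in> borel_measurable M" and g: "g \<in> borel_measurable M"
  shows "(\<lambda>x i. f x i - g x i) \<in> borel_measurable M"
proof (rule measurable_coordinatewise_then_product)
  fix i
  note [measurable] = borel_measurable_coord[OF f, of i] borel_measurable_coord[OF g, of i]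
  show "(\<lambda>x. f x i - g x i) \<in> borel_measurable M" by measurable
qed

lemma measurable_point_affine [measurable (raw)]:
  fixes f g :: "'a \<Rightarrow> point" and c :: real
  assumes f: "f \<in> borel_measurable M" and g: "g \<in> borel_measurable M"
  shows "(\<lambda>x i. f x i + c * g x i) \<in> borel_measurable M"
proof (rule measurable_coordinatewise_then_product)
  fix i
  note [measurable] = borel_measurable_coord[OF f, of i] borel_measurable_coord[OF g, of i]
  show "(\<lambda>x. f x i + c * g x i) \<in> borel_measurable M" by measurable
qed

lemma closed_Rd: "closed (Rd d)"
proof -
  have "Rd d = (\<Inter>i\<in>{d..}. {x. x i = 0})" by (auto simp: Rd_iff)
  moreover have "closed {x :: point. x i = 0}" for i
    by (intro closed_Collect_eq continuous_intros continuous_on_product_coordinates)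
  ultimately show ?thesis by (simp add: closed_INT)
qed

lemma sets_Rd [measurable]: "Rd d \<in> sets borel"
  by (rule borel_closed[OF closed_Rd])

interpretation lborel_prod: product_sigma_finite "\<lambda>_::nat. lborel :: real measure"
  by unfold_locales

lemma measurable_extend0' [measurable]: "extend0 d \<in> Pi\<^sub>M {..<d} (\<lambda>_. lborel) \<rightarrow>\<^sub>M borel"
  by (rule measurable_extend0)

lemma nn_integral_leb:
  assumes [measurable]: "f \<in> borel_measurable borel"
  shows "(\<integral>\<^sup>+x. f x \<partial>leb d) = (\<integral>\<^sup>+x. f (extend0 d x) \<partial>Pi\<^sub>M {..<d} (\<lambda>_. lborel))"
  unfolding leb_def by (intro nn_integral_distr) auto

lemma AE_leb_Rd: "AE x in leb d. x \<in> Rd d"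
  unfolding leb_def by (subst AE_distr_iff) auto

lemma nn_integral_leb_prod:
  assumes [measurable]: "\<And>i. i < d \<Longrightarrow> f i \<in> borel_measurable borel"
  shows "(\<integral>\<^sup>+x. (\<Prod>i<d. f i (x i)) \<partial>leb d) = (\<Prod>i<d. \<integral>\<^sup>+y. f i y \<partial>lborel)"
proof -
  have m: "(\<lambda>x::point. \<Prod>i<d. f i (x i)) \<in> borel_measurable borel"
    by (rule borel_measurable_prod_ennreal)
       (auto intro: measurable_compose[OF measurable_product_coordinates assms])
  have "(\<integral>\<^sup>+x. (\<Prod>i<d. f i (x i)) \<partial>leb d)
      = (\<integral>\<^sup>+x. (\<Prod>i<d. f i (x i)) \<partial>Pi\<^sub>M {..<d} (\<lambda>_. lborel))"
    unfolding nn_integral_leb[OF m] by (intro nn_integral_cong) auto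
  also have "\<dots> = (\<Prod>i<d. \<integral>\<^sup>+y. f i y \<partial>lborel)"
    by (intro lborel_prod.product_nn_integral_prod) auto
  finally show ?thesis .
qed

lemma integral_leb_prod:
  fixes f :: "nat \<Rightarrow> real \<Rightarrow> 'b::{real_normed_field,banach,second_countable_topology}"
  assumes "\<And>i. i < d \<Longrightarrow> integrable lborel (f i)"
  shows "(LINT x|leb d. (\<Prod>i<d. f i (x i))) = (\<Prod>i<d. LINT y|lborel. f i y)"
proof -
  have [measurable]: "f i \<in> borel_measurable borel" if "i < d" for i
    using assms[OF that] by auto
  have "(\<lambda>x::point. \<Prod>i<d. f i (x i)) \<in> borel_measurable borel"
  proof (rule borel_measurable_prod)
    fix i assume "i \<in> {..<d}"
    then show "(\<lambda>x::point. f i (x i)) \<in> borel_measurable borel"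
      by (intro measurable_compose[OF measurable_product_coordinates, of "f i"]) simp
  qed
  then have "(LINT x|leb d. (\<Prod>i<d. f i (x i)))
      = (LINT x|Pi\<^sub>M {..<d} (\<lambda>_. lborel). (\<Prod>i<d. f i (extend0 d x i)))"
    unfolding leb_def by (intro integral_distr) auto
  also have "\<dots> = (LINT x|Pi\<^sub>M {..<d} (\<lambda>_. lborel). (\<Prod>i<d. f i (x i)))"
    by (intro Bochner_Integration.integral_cong refl prod.cong) auto
  also have "\<dots> = (\<Prod>i<d. LINT y|lborel. f i y)"
    by (intro lborel_prod.product_integral_prod assms) auto
  finally show ?thesis .
qed

lemma sets_box:
  assumes "\<And>i. i < d \<Longrightarrow> A i \<in> sets borel"
  shows "{x::point. \<forall>i<d. x i \<in> A i} \<in> sets borel"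
proof -
  have "(\<lambda>x. x i) -` A i \<inter> space (borel :: point measure) \<in> sets borel" if "i < d" for i
    by (rule measurable_sets[OF measurable_product_coordinates assms[OF that]])
  then have "{x\<in>space borel. \<forall>i\<in>{..<d}. (x::point) i \<in> A i} \<in> sets borel"
    by (intro sets.sets_Collect_finite_All) (auto simp: vimage_def)
  moreover have "{x\<in>space borel. \<forall>i\<in>{..<d}. (x::point) i \<in> A i} = {x. \<forall>i<d. x i \<in> A i}"
    by auto
  ultimately show ?thesis by (simp only:)
qed

lemma emeasure_leb_box:
  assumes [measurable]: "\<And>i. i < d \<Longrightarrow> A i \<in> sets borel"
  shows "emeasure (leb d) {x. \<forall>i<d. x i \<in> A i} = (\<Prod>i<d. emeasure lborel (A i))"
proof -
  have [measurable]: "{x::point. \<forall>i<d. x i \<in> A i} \<in> sets borel"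
    by (intro sets_box assms)
  have ind: "indicator {x. \<forall>i<d. x i \<in> A i} x = (\<Prod>i<d. indicator (A i) (x i) :: ennreal)" for x :: point
    by (auto simp: indicator_def prod_zero_iff)
  have "emeasure (leb d) {x. \<forall>i<d. x i \<in> A i} = (\<integral>\<^sup>+x. (\<Prod>i<d. indicator (A i) (x i)) \<partial>leb d)"
    unfolding ind[symmetric] by simp
  also have "\<dots> = (\<Prod>i<d. \<integral>\<^sup>+y. indicator (A i) y \<partial>lborel)"
    by (intro nn_integral_leb_prod) auto
  also have "\<dots> = (\<Prod>i<d. emeasure lborel (A i))"
    by (intro prod.cong refl) auto
  finally show ?thesis .
qed

lemma sigma_finite_leb: "sigma_finite_measure (leb d)"
proof
  let ?B = "\<lambda>n::nat. {x::point. \<forall>i<d. x i \<in> {- real n..real n}}"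
  have B: "?B n \<in> sets borel" for n
    by (intro sets_box) auto
  have "emeasure (leb d) (?B n) \<noteq> \<infinity>" for n
    by (subst emeasure_leb_box) (auto simp: power_eq_top_ennreal)
  moreover have "x \<in> (\<Union>n. ?B n)" for x
  proof -
    obtain n :: nat where "enorm d x \<le> real n" using real_arch_simple by blast
    moreover have "\<bar>x i\<bar> \<le> enorm d x" if "i < d" for i
      using that member_le_L2_set[of "{..<d}" i "\<lambda>i. \<bar>x i\<bar>"] by (simp add: L2_set_def)
    ultimately show ?thesis by (force intro!: exI[of _ n] simp: abs_le_iff)
  qed
  ultimately show "\<exists>A. countable A \<and> A \<subseteq> sets (leb d) \<and> \<Union>A = space (leb d) \<and> (\<forall>a\<in>A. emeasure (leb d) a \<noteq> \<infinity>)"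
    using B by (intro exI[of _ "range ?B"]) auto
qed

interpretation leb: sigma_finite_measure "leb d" for d by (rule sigma_finite_leb)
interpretation leb_pair: pair_sigma_finite "leb d" "leb d" for d ..
interpretation lborel_leb: pair_sigma_finite lborel "leb d" for d ..

lemma abs_coord_le_enorm: "i < d \<Longrightarrow> \<bar>x i\<bar> \<le> enorm d x"
  using member_le_L2_set[of "{..<d}" i "\<lambda>i. \<bar>x i\<bar>"] by (simp add: L2_set_def)

text \<open>A coordinate hyperplane is a box with one side {0}, and in \<open>ennreal\<close> a zero
  factor annihilates the infinite ones.\<close>

lemma AE_leb_coord_nonzero: "AE x in leb d. \<forall>i<d. x i \<noteq> 0"
proof -
  have "AE x in leb d. x i \<noteq> 0" if "i < d" for i
  proof -
    have "emeasure (leb d) {x. \<forall>k<d. x k \<in> (if k = i then {0} else UNIV)} = 0"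
      using that by (subst emeasure_leb_box) auto
    moreover have "{x. \<forall>k<d. x k \<in> (if k = i then {0} else UNIV)} = {x. x i = (0::real)}"
      using that by auto
    ultimately show ?thesis
      by (intro AE_I[of _ _ "{x. x i = 0}"]) auto
  qed
  then have "AE x in leb d. \<forall>i\<in>{..<d}. x i \<noteq> 0" by (intro AE_finite_allI) auto
  then show ?thesis by eventually_elim auto
qed

text \<open>\<open>d > 0\<close> matters: \<open>leb 0\<close> is a point mass at the zero
  sequence.\<close>

lemma AE_leb_enorm_pos: assumes "d > 0" shows "AE x in leb d. enorm d x > 0"
  using AE_leb_coord_nonzero
proof eventually_elim
  case (elim x)
  then have "0 < \<bar>x 0\<bar>" using assms by simp
  also have "\<dots> \<le> enorm d x" using assms by (rule abs_coord_le_enorm)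
  finally show ?case .
qed

lemma emeasure_leb_UNIV: "emeasure (leb d) UNIV \<noteq> 0"
  using emeasure_leb_box[of d "\<lambda>_. UNIV"] by simp

text \<open>Uniqueness of the product measure reduces the change of variables to the one-dimensional
  affine rule in each coordinate. The shift has to lie in \<open>Rd d\<close>, since
  \<open>leb d\<close> is carried by \<open>Rd d\<close>.\<close>

lemma leb_affine:
  assumes t: "t \<in> Rd d" and c: "c \<noteq> 0"
  shows "leb d = density (distr (leb d) borel (\<lambda>x i. t i + c * x i)) (\<lambda>_. ennreal (\<bar>c\<bar> ^ d))"
proof -
  let ?L = "Pi\<^sub>M {..<d} (\<lambda>_. lborel :: real measure)"
  define T where "T = (\<lambda>x::point. \<lambda>i\<in>{..<d}. t i + c * x i)"
  have [measurable]: "T \<in> ?L \<rightarrow>\<^sub>M ?L" unfolding T_def by measurable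
  have "density (distr ?L ?L T) (\<lambda>_. ennreal (\<bar>c\<bar> ^ d)) = ?L"
  proof (rule lborel_prod.PiM_eqI)
    fix A :: "nat \<Rightarrow> real set" assume A: "\<And>i. i \<in> {..<d} \<Longrightarrow> A i \<in> sets lborel"
    have S: "T -` Pi\<^sub>E {..<d} A \<inter> space ?L = Pi\<^sub>E {..<d} (\<lambda>i. (\<lambda>y. t i + c * y) -` A i)"
      by (auto simp: T_def PiE_iff space_PiM)
    have m: "(\<lambda>y. t i + c * y) -` A i \<in> sets borel" if "i < d" for i
    proof -
      have "(\<lambda>y. t i + c * y) -` A i \<inter> space borel \<in> sets borel"
        by (rule measurable_sets[where A=borel]) (use A that in auto)
      then show ?thesis by simp
    qed
    have one: "emeasure lborel (A i) = ennreal \<bar>c\<bar> * emeasure lborel ((\<lambda>y. t i + c * y) -` A i)" if "i < d" for i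
      by (subst lborel_real_affine[OF c, of "t i"])
         (use A that in \<open>simp add: emeasure_density_const emeasure_distr\<close>)
    have PA: "Pi\<^sub>E {..<d} A \<in> sets ?L" using A by (intro sets_PiM_I_finite) auto
    have "emeasure (density (distr ?L ?L T) (\<lambda>_. ennreal (\<bar>c\<bar> ^ d))) (Pi\<^sub>E {..<d} A)
      = ennreal (\<bar>c\<bar> ^ d) * emeasure ?L (Pi\<^sub>E {..<d} (\<lambda>i. (\<lambda>y. t i + c * y) -` A i))"
      using PA by (simp add: emeasure_density_const emeasure_distr S)
    also have "\<dots> = ennreal (\<bar>c\<bar> ^ d) * (\<Prod>i<d. emeasure lborel ((\<lambda>y. t i + c * y) -` A i))"
      by (subst lborel_prod.emeasure_PiM) (use m in auto)
    also have "\<dots> = (\<Prod>i<d. emeasure lborel (A i))"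
      by (simp add: one prod.distrib ennreal_power)
    finally show "emeasure (density (distr ?L ?L T) (\<lambda>_. ennreal (\<bar>c\<bar> ^ d))) (Pi\<^sub>E {..<d} A) = (\<Prod>i\<in>{..<d}. emeasure lborel (A i))" by simp
  qed auto
  then have "leb d = distr (density (distr ?L ?L T) (\<lambda>_. ennreal (\<bar>c\<bar> ^ d))) borel (extend0 d)"
    unfolding leb_def by simp
  also have "\<dots> = density (distr (distr ?L ?L T) borel (extend0 d)) (\<lambda>_. ennreal (\<bar>c\<bar> ^ d))"
    by (rule density_distr[symmetric]) auto
  also have "distr (distr ?L ?L T) borel (extend0 d) = distr (leb d) borel (\<lambda>x i. t i + c * x i)"
    unfolding leb_def
    by (subst (1 2) distr_distr)
       (use t in \<open>auto simp: T_def extend0_def fun_eq_iff Rd_iff intro!: arg_cong[where f="distr _ _"] distr_cong\<close>)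
  finally show ?thesis .
qed

lemma
  fixes f :: "point \<Rightarrow> 'b::{banach,second_countable_topology}"
  assumes t: "t \<in> Rd d" and c: "c \<noteq> 0"
  shows integrable_leb_affine_iff: "f \<in> borel_measurable borel \<Longrightarrow>
          integrable (leb d) (\<lambda>x. f (\<lambda>i. t i + c * x i)) \<longleftrightarrow> integrable (leb d) f"
    and integral_leb_affine: "f \<in> borel_measurable borel \<Longrightarrow>
          (LINT x|leb d. f x) = \<bar>c\<bar> ^ d *\<^sub>R (LINT x|leb d. f (\<lambda>i. t i + c * x i))"
    and nn_integral_leb_affine: "g \<in> borel_measurable borel \<Longrightarrow>
          (\<integral>\<^sup>+x. g x \<partial>leb d) = ennreal (\<bar>c\<bar> ^ d) * (\<integral>\<^sup>+x. g (\<lambda>i. t i + c * x i) \<partial>leb d)"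
    and AE_leb_affine: "(AE x in leb d. P x) \<Longrightarrow> AE x in leb d. P (\<lambda>i. t i + c * x i)"
proof -
  note A = leb_affine[OF t c]
  have [measurable]: "(\<lambda>x i. t i + c * x i) \<in> leb d \<rightarrow>\<^sub>M borel" by measurable
  have sc: "integrable (leb d) g" if "integrable (leb d) (\<lambda>x. \<bar>c\<bar> ^ d *\<^sub>R g x)" for g :: "point \<Rightarrow> 'b"
    using integrable_scaleR_right[of "inverse (\<bar>c\<bar> ^ d)", OF that] c by simp
  { assume [measurable]: "f \<in> borel_measurable borel"
    show "integrable (leb d) (\<lambda>x. f (\<lambda>i. t i + c * x i)) \<longleftrightarrow> integrable (leb d) f"
      by (subst (2) A, subst integrable_density)
         (use c in \<open>auto simp: integrable_distr_eq dest: sc\<close>)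
    show "(LINT x|leb d. f x) = \<bar>c\<bar> ^ d *\<^sub>R (LINT x|leb d. f (\<lambda>i. t i + c * x i))"
      by (subst A, subst integral_density) (auto simp: integral_distr) }
  { assume [measurable]: "g \<in> borel_measurable borel"
    show "(\<integral>\<^sup>+x. g x \<partial>leb d) = ennreal (\<bar>c\<bar> ^ d) * (\<integral>\<^sup>+x. g (\<lambda>i. t i + c * x i) \<partial>leb d)"
      by (subst A, subst nn_integral_density) (auto simp: nn_integral_distr nn_integral_cmult) }
  { assume P: "AE x in leb d. P x"
    then have "AE x in distr (leb d) borel (\<lambda>x i. t i + c * x i). P x"
      by (subst (asm) A, subst (asm) AE_density) (use c in auto)
    then show "AE x in leb d. P (\<lambda>i. t i + c * x i)"
      by (rule AE_distrD[rotated]) auto }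
qed

text \<open>The affine map with c = -1. It carries almost-everywhere statements about the first
  factor of a convolution over to the integration variable.\<close>

lemma AE_leb_reflect:
  assumes "\<xi> \<in> Rd d" "AE x in leb d. P x" shows "AE x in leb d. P (\<lambda>i. \<xi> i - x i)"
  using AE_leb_affine[OF assms(1), of "-1" P] assms(2) by simp

lemma nn_integral_leb_reflect:
  assumes "\<xi> \<in> Rd d" "g \<in> borel_measurable borel"
  shows "(\<integral>\<^sup>+x. g (\<lambda>i. \<xi> i - x i) \<partial>leb d) = (\<integral>\<^sup>+x. g x \<partial>leb d)"
  using nn_integral_leb_affine[OF assms(1), of "-1" g] assms(2) by simp

section \<open>Powers of the norm\<close>

lemma prod_mono_ennreal:
  fixes f g :: "'a \<Rightarrow> ennreal"
  assumes "\<And>i. i \<in> A \<Longrightarrow> f i \<le> g i"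
  shows "prod f A \<le> prod g A"
  using assms by (induction A rule: infinite_finite_induct) (auto intro!: mult_mono)

text \<open>The half-line on the right contains the origin, which is thus counted twice; an
  inequality spares any discussion of null sets.\<close>

lemma nn_integral_even_le:
  fixes f :: "real \<Rightarrow> ennreal"
  assumes [measurable]: "f \<in> borel_measurable borel"
  shows "(\<integral>\<^sup>+y. f \<bar>y\<bar> \<partial>lborel) \<le> 2 * (\<integral>\<^sup>+y. f y * indicator {0..} y \<partial>lborel)"
proof -
  let ?g = "\<lambda>y. f y * indicator {0..} y"
  have "(\<integral>\<^sup>+y. f \<bar>y\<bar> \<partial>lborel) \<le> (\<integral>\<^sup>+y. ?g y + ?g (- y) \<partial>lborel)"
    by (intro nn_integral_mono) (auto simp: indicator_def abs_if)
  also have "\<dots> = (\<integral>\<^sup>+y. ?g y \<partial>lborel) + (\<integral>\<^sup>+y. ?g (- y) \<partial>lborel)"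
    by (intro nn_integral_add) auto
  also have "(\<integral>\<^sup>+y. ?g (- y) \<partial>lborel) = (\<integral>\<^sup>+y. ?g y \<partial>lborel)"
  proof -
    have "(\<integral>\<^sup>+y. ?g y \<partial>lborel) = (\<integral>\<^sup>+y. ?g y \<partial>distr lborel borel uminus)"
      by (simp add: lborel_distr_uminus)
    also have "\<dots> = (\<integral>\<^sup>+y. ?g (- y) \<partial>lborel)" by (intro nn_integral_distr) auto
    finally show ?thesis by simp
  qed
  finally show ?thesis by (simp add: mult_2)
qed

lemma nn_integral_powr_near:
  assumes "s < 1" "R > 0"
  shows "(\<integral>\<^sup>+y. ennreal (\<bar>y\<bar> powr (-s)) * indicator {..R} \<bar>y\<bar> \<partial>lborel) \<le> ennreal (2 / (1 - s) * R powr (1 - s))"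
proof -
  have "((\<lambda>y. y powr (-s)) has_integral (R powr (-s+1) / (-s+1))) {0..R}"
    using assms by (intro has_integral_powr_from_0) auto
  then have "(\<integral>\<^sup>+y. ennreal (y powr (-s)) * indicator {0..R} y \<partial>lborel) = ennreal (R powr (-s+1) / (-s+1))"
    using nn_integral_has_integral_lebesgue[of "{0..R}" "\<lambda>y. y powr (-s)"]
    by (simp add: ennreal_mult' ennreal_indicator mult.commute)
  moreover have "(\<integral>\<^sup>+y. ennreal (\<bar>y\<bar> powr (-s)) * indicator {..R} \<bar>y\<bar> \<partial>lborel)
      \<le> 2 * (\<integral>\<^sup>+y. ennreal (y powr (-s)) * indicator {..R} y * indicator {0..} y \<partial>lborel)"
    by (rule nn_integral_even_le[of "\<lambda>y. ennreal (y powr (-s)) * indicator {..R} y"]) auto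
  moreover have "indicator {..R} y * indicator {0..} y = (indicator {0..R} y :: ennreal)" for y
    by (auto simp: indicator_def)
  ultimately have "(\<integral>\<^sup>+y. ennreal (\<bar>y\<bar> powr (-s)) * indicator {..R} \<bar>y\<bar> \<partial>lborel) \<le> 2 * ennreal (R powr (-s+1) / (-s+1))"
    by (simp add: mult.assoc)
  also have "\<dots> = ennreal (2 / (1 - s) * R powr (1 - s))"
    using assms by (simp add: ennreal_mult'[symmetric] ennreal_numeral[symmetric] del: ennreal_numeral)
  finally show ?thesis .
qed

text \<open>The cutoff removes the singularity at the origin. In the constant, 1 is the contribution
  of the interval up to R and 1/(s - 1) that of the tail.\<close>

lemma nn_integral_powr_far:
  assumes "s > 1" "R > 0"
  shows "(\<integral>\<^sup>+y. ennreal (max R \<bar>y\<bar> powr (-s)) \<partial>lborel) \<le> ennreal (2 * (1 + 1 / (s - 1)) * R powr (1 - s))"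
proof -
  have "((\<lambda>y. y powr (-s)) has_integral (-(R powr (-s+1)) / (-s+1))) {R..}"
    using assms by (intro has_integral_powr_to_inf) auto
  then have far: "(\<integral>\<^sup>+y. ennreal (y powr (-s)) * indicator {R..} y \<partial>lborel) = ennreal (-(R powr (-s+1)) / (-s+1))"
    using nn_integral_has_integral_lebesgue[of "{R..}" "\<lambda>y. y powr (-s)"]
    by (simp add: ennreal_mult' ennreal_indicator mult.commute)
  have "(\<integral>\<^sup>+y. ennreal (max R \<bar>y\<bar> powr (-s)) \<partial>lborel)
      \<le> 2 * (\<integral>\<^sup>+y. ennreal (max R y powr (-s)) * indicator {0..} y \<partial>lborel)"
    by (rule nn_integral_even_le[of "\<lambda>y. ennreal (max R y powr (-s))"]) auto
  also have "(\<integral>\<^sup>+y. ennreal (max R y powr (-s)) * indicator {0..} y \<partial>lborel)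
     \<le> (\<integral>\<^sup>+y. ennreal (R powr (-s)) * indicator {0..R} y + ennreal (y powr (-s)) * indicator {R..} y \<partial>lborel)"
    using assms by (intro nn_integral_mono) (auto simp: indicator_def max_def)
  also have "\<dots> = ennreal (R powr (-s)) * ennreal R + ennreal (-(R powr (-s+1)) / (-s+1))"
    using assms by (subst nn_integral_add) (auto simp: far nn_integral_cmult)
  also have "\<dots> = ennreal ((1 + 1 / (s - 1)) * R powr (1 - s))"
  proof -
    have "R powr (-s) * R + -(R powr (-s+1)) / (-s+1) = (1 + 1 / (s - 1)) * R powr (1 - s)"
    proof -
      have "R powr (1 - s) = R * R powr (-s)"
        using assms powr_add[of R 1 "-s"] by simp
      moreover have "-(R powr (-s+1)) / (-s+1) = R powr (1 - s) / (s - 1)"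
        using assms by (simp add: divide_simps add.commute) (simp add: algebra_simps)
      ultimately show ?thesis by (simp add: algebra_simps)
    qed
    moreover have "-(R powr (-s+1)) / (-s+1) \<ge> 0" using assms by (simp add: divide_nonneg_neg)
    ultimately show ?thesis using assms by (simp add: ennreal_mult[symmetric] ennreal_plus[symmetric] del: ennreal_plus)
  qed
  finally have "(\<integral>\<^sup>+y. ennreal (max R \<bar>y\<bar> powr (-s)) \<partial>lborel) \<le> 2 * ennreal ((1 + 1 / (s - 1)) * R powr (1 - s))"
    by (simp add: mult_left_mono)
  also have "\<dots> = ennreal (2 * (1 + 1 / (s - 1)) * R powr (1 - s))"
    by (simp only: ennreal_numeral[symmetric] ennreal_mult'[of 2, symmetric] zero_le_numeral mult.assoc)
  finally show ?thesis .
qed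

text \<open>Both bounds rest on \<open>\<bar>x\<^sub>i\<bar> \<le> |x|\<close>, which dominates a power of \<open>|x|\<close> by a tensor product.\<close>

lemma nn_integral_enorm_powr_near:
  assumes "d > 0" "0 \<le> a" "a < real d" "R > 0"
  shows "(\<integral>\<^sup>+x. ennreal (enorm d x powr (-a)) * indicator {..R} (enorm d x) \<partial>leb d)
           \<le> ennreal ((2 / (1 - a / d)) ^ d * R powr (d - a))"
proof -
  \<comment> \<open>The exponent is shared equally by the d coordinates, so that a < d becomes s < 1
    in each one-dimensional factor.\<close>
  define s where "s = a / d"
  have s: "0 \<le> s" "s < 1" using assms by (auto simp: s_def divide_simps)
  have "(\<integral>\<^sup>+x. ennreal (enorm d x powr (-a)) * indicator {..R} (enorm d x) \<partial>leb d)
     \<le> (\<integral>\<^sup>+x. (\<Prod>i<d. ennreal (\<bar>x i\<bar> powr (-s)) * indicator {..R} \<bar>x i\<bar>) \<partial>leb d)"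
  proof (rule nn_integral_mono_AE)
    show "AE x in leb d. ennreal (enorm d x powr (-a)) * indicator {..R} (enorm d x)
            \<le> (\<Prod>i<d. ennreal (\<bar>x i\<bar> powr (-s)) * indicator {..R} \<bar>x i\<bar>)"
      using AE_leb_coord_nonzero
    proof eventually_elim
      case (elim x)
      show ?case
      proof (cases "enorm d x \<le> R")
        case True
        have "0 < \<bar>x 0\<bar>" using elim assms by simp
        also have "\<dots> \<le> enorm d x" using assms by (intro abs_coord_le_enorm)
        finally have "enorm d x > 0" .
        then have "enorm d x powr (-a) = (\<Prod>i<d. enorm d x powr (-s))"
          using assms by (simp add: s_def powr_realpow[symmetric] powr_powr)
        also have "\<dots> \<le> (\<Prod>i<d. \<bar>x i\<bar> powr (-s))"
          using elim s abs_coord_le_enorm[of _ d x] by (intro prod_mono) (auto intro!: powr_mono2')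
        finally have "ennreal (enorm d x powr (-a)) \<le> (\<Prod>i<d. ennreal (\<bar>x i\<bar> powr (-s)))"
          by (subst prod_ennreal) (auto intro: ennreal_leI)
        moreover have "indicator {..R} \<bar>x i\<bar> = (1::ennreal)" if "i < d" for i
          using abs_coord_le_enorm[OF that, of x] True by auto
        ultimately show ?thesis using True by simp
      qed auto
    qed
  qed
  also have "\<dots> = (\<Prod>i<d. \<integral>\<^sup>+y. ennreal (\<bar>y\<bar> powr (-s)) * indicator {..R} \<bar>y\<bar> \<partial>lborel)"
    by (intro nn_integral_leb_prod) measurable
  also have "\<dots> \<le> (\<Prod>i<d. ennreal (2 / (1 - s) * R powr (1 - s)))"
    using s assms by (intro prod_mono_ennreal nn_integral_powr_near) auto
  also have "\<dots> = ennreal ((2 / (1 - s) * R powr (1 - s)) ^ d)"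
    using s by (subst prod_ennreal) auto
  also have "(2 / (1 - s) * R powr (1 - s)) ^ d = (2 / (1 - s)) ^ d * R powr (d - a)"
    using assms by (simp add: power_mult_distrib power_divide s_def powr_power right_diff_distrib)
  finally show ?thesis by (simp add: s_def)
qed

lemma nn_integral_enorm_powr_far:
  assumes "d > 0" "b > real d" "R > 0"
  shows "(\<integral>\<^sup>+x. ennreal (max R (enorm d x) powr (-b)) \<partial>leb d)
           \<le> ennreal ((2 * (1 + 1 / (b / d - 1))) ^ d * R powr (d - b))"
proof -
  \<comment> \<open>Likewise b > d becomes s > 1 in each coordinate, and the cutoff keeps every
    factor finite on the coordinate hyperplanes.\<close>
  define s where "s = b / d"
  have s: "s > 1" using assms by (auto simp: s_def divide_simps)
  have "(\<integral>\<^sup>+x. ennreal (max R (enorm d x) powr (-b)) \<partial>leb d)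
     \<le> (\<integral>\<^sup>+x. (\<Prod>i<d. ennreal (max R \<bar>x i\<bar> powr (-s))) \<partial>leb d)"
  proof (rule nn_integral_mono)
    fix x
    have "max R (enorm d x) powr (-b) = (\<Prod>i<d. max R (enorm d x) powr (-s))"
      using assms by (simp add: s_def powr_realpow[symmetric] powr_powr max_def)
    also have "\<dots> \<le> (\<Prod>i<d. max R \<bar>x i\<bar> powr (-s))"
      using assms s abs_coord_le_enorm[of _ d x]
      by (intro prod_mono) (auto intro!: powr_mono2' max.mono)
    finally show "ennreal (max R (enorm d x) powr (-b)) \<le> (\<Prod>i<d. ennreal (max R \<bar>x i\<bar> powr (-s)))"
      by (subst prod_ennreal) (auto intro: ennreal_leI)
  qed
  also have "\<dots> = (\<Prod>i<d. \<integral>\<^sup>+y. ennreal (max R \<bar>y\<bar> powr (-s)) \<partial>lborel)"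
    by (intro nn_integral_leb_prod) measurable
  also have "\<dots> \<le> (\<Prod>i<d. ennreal (2 * (1 + 1 / (s - 1)) * R powr (1 - s)))"
    using s assms by (intro prod_mono_ennreal nn_integral_powr_far) auto
  also have "\<dots> = ennreal ((2 * (1 + 1 / (s - 1)) * R powr (1 - s)) ^ d)"
    using s by (subst prod_ennreal) auto
  also have "(2 * (1 + 1 / (s - 1)) * R powr (1 - s)) ^ d = (2 * (1 + 1 / (s - 1))) ^ d * R powr (d - b)"
    using assms by (simp add: power_mult_distrib power_divide s_def powr_power right_diff_distrib)
  finally show ?thesis by (simp add: s_def)
qed

lemma enorm_triangle: "enorm d \<xi> \<le> enorm d (\<lambda>i. \<xi> i - \<eta> i) + enorm d \<eta>"
  using L2_set_triangle_ineq[of "\<lambda>i. \<xi> i - \<eta> i" \<eta> "{..<d}"] by simp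

text \<open>Since x + y \<ge> 2 r, the two numbers cannot both lie below r. If one of them is at
  most r, the other one contributes at most a power of r; if both exceed r, the smaller one bounds
  the product by its power -(a + b).\<close>

lemma riesz_pointwise:
  fixes x y r a b :: real
  assumes "x > 0" "y > 0" "r > 0" "x + y \<ge> 2 * r" "a \<ge> 0" "b \<ge> 0"
  shows "x powr (-a) * y powr (-b) \<le>
     r powr (-a) * (y powr (-b) * indicator {..r} y) + r powr (-b) * (x powr (-a) * indicator {..r} x)
     + max r x powr (-(a+b)) + max r y powr (-(a+b))"
proof -
  have nn: "0 \<le> r powr (-a) * (y powr (-b) * indicator {..r} y)" "0 \<le> r powr (-b) * (x powr (-a) * indicator {..r} x)"
    "0 \<le> max r x powr (-(a+b))" "0 \<le> max r y powr (-(a+b))"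
    by auto
  consider "y \<le> r" | "x \<le> r" | "x > r" "y > r" by linarith
  then show ?thesis
  proof cases
    case 1
    then have "x powr (-a) \<le> r powr (-a)" using assms by (intro powr_mono2') auto
    then have "x powr (-a) * y powr (-b) \<le> r powr (-a) * (y powr (-b) * indicator {..r} y)"
      using 1 by (simp add: mult_right_mono)
    then show ?thesis using nn by linarith
  next
    case 2
    then have "y powr (-b) \<le> r powr (-b)" using assms by (intro powr_mono2') auto
    then have "x powr (-a) * y powr (-b) \<le> x powr (-a) * r powr (-b)" by (intro mult_left_mono) auto
    also have "\<dots> = r powr (-b) * (x powr (-a) * indicator {..r} x)" using 2 by simp
    finally have "x powr (-a) * y powr (-b) \<le> r powr (-b) * (x powr (-a) * indicator {..r} x)" .
    then show ?thesis using nn by linarith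
  next
    case 3
    show ?thesis
    proof (cases "x \<le> y")
      case True
      then have "y powr (-b) \<le> x powr (-b)" using assms by (intro powr_mono2') auto
      then have "x powr (-a) * y powr (-b) \<le> x powr (-a) * x powr (-b)" by (simp add: mult_left_mono)
      also have "\<dots> = max r x powr (-(a+b))" using 3 by (simp add: powr_add[symmetric] max_def)
      finally show ?thesis using nn by linarith
    next
      case False
      then have "x powr (-a) \<le> y powr (-a)" using assms by (intro powr_mono2') auto
      then have "x powr (-a) * y powr (-b) \<le> y powr (-a) * y powr (-b)" by (simp add: mult_right_mono)
      also have "\<dots> = max r y powr (-(a+b))" using 3 by (simp add: powr_add[symmetric] max_def)
      finally show ?thesis using nn by linarith
    qed
  qed
qed

text \<open>The convolution of two Riesz kernels. With r = |\<xi>|/2, the conditions a, b < d make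
  the near parts integrable and a + b > d the far parts, and every term scales like r to the power d
  - a - b.\<close>

lemma nn_integral_riesz:
  assumes d: "d > 0" and a: "0 < a" "a < real d" and b: "0 < b" "b < real d" and ab: "a + b > real d"
  shows "\<exists>C>0. \<forall>\<xi>\<in>Rd d. enorm d \<xi> > 0 \<longrightarrow>
    (\<integral>\<^sup>+\<eta>. ennreal (enorm d (\<lambda>i. \<xi> i - \<eta> i) powr (-a) * enorm d \<eta> powr (-b)) \<partial>leb d)
      \<le> ennreal (C * enorm d \<xi> powr (-(a + b - d)))"
proof -
  define A where "A = (2 / (1 - a / d)) ^ d"
  define B where "B = (2 / (1 - b / d)) ^ d"
  define D where "D = (2 * (1 + 1 / ((a + b) / d - 1))) ^ d"
  have pos: "A > 0" "B > 0" "D > 0"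
    using assms by (auto simp: A_def B_def D_def divide_simps intro!: zero_less_power add_pos_pos)
  define C where "C = (A + B + 2 * D) * (1/2) powr (-(a + b - d))"
  have "(\<integral>\<^sup>+\<eta>. ennreal (enorm d (\<lambda>i. \<xi> i - \<eta> i) powr (-a) * enorm d \<eta> powr (-b)) \<partial>leb d)
      \<le> ennreal (C * enorm d \<xi> powr (-(a + b - d)))" if \<xi>: "\<xi> \<in> Rd d" and pos\<xi>: "enorm d \<xi> > 0" for \<xi>
  proof -
    define r where "r = enorm d \<xi> / 2"
    have r: "r > 0" using pos\<xi> by (simp add: r_def)
    let ?x = "\<lambda>\<eta>. enorm d (\<lambda>i. \<xi> i - \<eta> i)" and ?y = "\<lambda>\<eta>. enorm d \<eta>"
    let ?N = "\<lambda>c \<eta>. ennreal (enorm d \<eta> powr (-c)) * indicator {..r} (enorm d \<eta>)"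
    let ?F = "\<lambda>\<eta>. ennreal (max r (enorm d \<eta>) powr (-(a+b)))"
    let ?R = "\<lambda>\<eta>::point. \<lambda>i. \<xi> i - \<eta> i"
    have "(\<integral>\<^sup>+\<eta>. ennreal (?x \<eta> powr (-a) * ?y \<eta> powr (-b)) \<partial>leb d) \<le>
      (\<integral>\<^sup>+\<eta>. ennreal (r powr (-a)) * ?N b \<eta> + ennreal (r powr (-b)) * ?N a (?R \<eta>) + ?F (?R \<eta>) + ?F \<eta> \<partial>leb d)"
    proof (rule nn_integral_mono_AE)
      show "AE \<eta> in leb d. ennreal (?x \<eta> powr (-a) * ?y \<eta> powr (-b)) \<le>
        ennreal (r powr (-a)) * ?N b \<eta> + ennreal (r powr (-b)) * ?N a (?R \<eta>) + ?F (?R \<eta>) + ?F \<eta>"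
        using AE_leb_enorm_pos[OF d] AE_leb_reflect[OF \<xi> AE_leb_enorm_pos[OF d]]
      proof eventually_elim
        case (elim \<eta>)
        have "?x \<eta> + ?y \<eta> \<ge> 2 * r" using enorm_triangle[where d=d and \<xi>=\<xi> and \<eta>=\<eta>] by (simp add: r_def)
        from riesz_pointwise[OF elim(2,1) r this, of a b] a b
        have "ennreal (?x \<eta> powr (-a) * ?y \<eta> powr (-b)) \<le> ennreal (r powr (-a) * (?y \<eta> powr (-b) * indicator {..r} (?y \<eta>)) + r powr (-b) * (?x \<eta> powr (-a) * indicator {..r} (?x \<eta>))
     + max r (?x \<eta>) powr (-(a+b)) + max r (?y \<eta>) powr (-(a+b)))" by (intro ennreal_leI) simp
        also have "\<dots> = ennreal (r powr (-a)) * ?N b \<eta> + ennreal (r powr (-b)) * ?N a (?R \<eta>) + ?F (?R \<eta>) + ?F \<eta>"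
          by (simp add: ennreal_mult' ennreal_plus ennreal_indicator)
        finally show ?case .
      qed
    qed
    also have "\<dots> = ennreal (r powr (-a)) * (\<integral>\<^sup>+\<eta>. ?N b \<eta> \<partial>leb d) + ennreal (r powr (-b)) * (\<integral>\<^sup>+\<eta>. ?N a (?R \<eta>) \<partial>leb d)
        + (\<integral>\<^sup>+\<eta>. ?F (?R \<eta>) \<partial>leb d) + (\<integral>\<^sup>+\<eta>. ?F \<eta> \<partial>leb d)"
      by (simp add: nn_integral_add nn_integral_cmult)
    also have "(\<integral>\<^sup>+\<eta>. ?N a (?R \<eta>) \<partial>leb d) = (\<integral>\<^sup>+\<eta>. ?N a \<eta> \<partial>leb d)"
      by (rule nn_integral_leb_reflect[OF \<xi>, of "?N a"]) measurable
    also have "(\<integral>\<^sup>+\<eta>. ?F (?R \<eta>) \<partial>leb d) = (\<integral>\<^sup>+\<eta>. ?F \<eta> \<partial>leb d)"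
      by (rule nn_integral_leb_reflect[OF \<xi>, of ?F]) measurable
    also have "ennreal (r powr (-a)) * (\<integral>\<^sup>+\<eta>. ?N b \<eta> \<partial>leb d) + ennreal (r powr (-b)) * (\<integral>\<^sup>+\<eta>. ?N a \<eta> \<partial>leb d)
        + (\<integral>\<^sup>+\<eta>. ?F \<eta> \<partial>leb d) + (\<integral>\<^sup>+\<eta>. ?F \<eta> \<partial>leb d) \<le>
        ennreal (r powr (-a)) * ennreal (B * r powr (d - b)) + ennreal (r powr (-b)) * ennreal (A * r powr (d - a))
        + ennreal (D * r powr (d - (a + b))) + ennreal (D * r powr (d - (a + b)))"
      unfolding A_def B_def D_def using assms r
      by (intro add_mono mult_left_mono nn_integral_enorm_powr_near nn_integral_enorm_powr_far) auto
    also have "\<dots> = ennreal (r powr (-a) * (B * r powr (d - b)) + r powr (-b) * (A * r powr (d - a))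
        + D * r powr (d - (a + b)) + D * r powr (d - (a + b)))"
      using pos by (simp add: ennreal_mult'[symmetric] ennreal_plus[symmetric] del: ennreal_plus)
    also have "r powr (-a) * (B * r powr (d - b)) = B * r powr (-(a + b - d))"
      using powr_add[of r "-a" "d - b"] by (simp add: algebra_simps)
    also have "r powr (-b) * (A * r powr (d - a)) = A * r powr (-(a + b - d))"
      using powr_add[of r "-b" "d - a"] by (simp add: algebra_simps)
    also have "B * r powr (-(a + b - d)) + A * r powr (-(a + b - d)) + D * r powr (d - (a + b)) + D * r powr (d - (a + b))
       = (A + B + 2 * D) * r powr (-(a + b - d))" by (simp add: algebra_simps)
    also have "\<dots> = C * enorm d \<xi> powr (-(a + b - d))"
      unfolding C_def r_def using powr_mult[of "enorm d \<xi>" "1/2" "-(a + b - d)"] by (simp add: mult_ac)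
    finally show ?thesis .
  qed
  moreover have "C > 0" using pos by (auto simp: C_def intro!: mult_pos_pos add_pos_pos)
  ultimately show ?thesis by blast
qed

section \<open>Schwartz functions\<close>

lemma continuous_map_Rd_iff: "continuous_map (Euclidean_space d) euclidean f \<longleftrightarrow> continuous_on (Rd d) f"
proof -
  have "Euclidean_space d = top_of_set (Rd d)"
    unfolding Euclidean_space_def by (simp add: euclidean_product_topology)
  then show ?thesis by (metis continuous_map_iff_continuous)
qed

lemma pdiffs_simps [simp]: "pdiffs [] \<phi> = \<phi>" "pdiffs (i # is) \<phi> = pdiff i (pdiffs is \<phi>)"
  by (simp_all add: pdiffs_def)

lemma upd_in_Rd: "x \<in> Rd d \<Longrightarrow> i < d \<Longrightarrow> x(i := s) \<in> Rd d"
  by (auto simp: Rd_iff)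

lemma upd_notin_Rd: "x \<notin> Rd d \<Longrightarrow> i < d \<Longrightarrow> x(i := s) \<notin> Rd d"
  by (auto simp: Rd_iff)

text \<open>Membership follows from a family of functions that contains the given one and is stable
  under \<open>pdiff\<close>: the conditions on all iterated derivatives become conditions on the
  members, and no formula for the iterates is required.\<close>

lemma schwartz_coinduct:
  assumes "\<phi> \<in> S"
    and zero: "\<And>\<psi> x. \<psi> \<in> S \<Longrightarrow> x \<notin> Rd d \<Longrightarrow> \<psi> x = 0"
    and cont: "\<And>\<psi>. \<psi> \<in> S \<Longrightarrow> continuous_on (Rd d) \<psi>"
    and diff: "\<And>\<psi> x i. \<psi> \<in> S \<Longrightarrow> x \<in> Rd d \<Longrightarrow> i < d \<Longrightarrow> (\<lambda>s. \<psi> (x(i := s))) differentiable (at (x i))"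
    and decay: "\<And>\<psi> k. \<psi> \<in> S \<Longrightarrow> \<exists>C. \<forall>x\<in>Rd d. (1 + enorm d x) ^ k * cmod (\<psi> x) \<le> C"
    and closed: "\<And>\<psi> i. \<psi> \<in> S \<Longrightarrow> i < d \<Longrightarrow> pdiff i \<psi> \<in> S"
  shows "\<phi> \<in> schwartz d"
proof -
  have "pdiffs is \<phi> \<in> S" if "is \<in> lists {..<d}" for "is"
    using that assms(1) closed by (induction "is") auto
  then show ?thesis
    using assms by (auto simp: schwartz_def smooth_def continuous_map_Rd_iff)
qed

lemma schwartz_zero: "\<phi> \<in> schwartz d \<Longrightarrow> x \<notin> Rd d \<Longrightarrow> \<phi> x = 0"
  by (simp add: schwartz_def)

lemma schwartz_pdiffs_decay:
  "\<phi> \<in> schwartz d \<Longrightarrow> is \<in> lists {..<d} \<Longrightarrow> \<exists>C. \<forall>x\<in>Rd d. (1 + enorm d x) ^ k * cmod (pdiffs is \<phi> x) \<le> C"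
  by (simp add: schwartz_def)

lemma schwartz_decay:
  assumes "\<phi> \<in> schwartz d"
  obtains C where "C \<ge> 0" "\<And>x. (1 + enorm d x) ^ k * cmod (\<phi> x) \<le> C"
proof -
  obtain C where C: "\<forall>x\<in>Rd d. (1 + enorm d x) ^ k * cmod (\<phi> x) \<le> C"
    using schwartz_pdiffs_decay[OF assms, of "[]"] by auto
  have "(1 + enorm d x) ^ k * cmod (\<phi> x) \<le> max 0 C" for x
    using C schwartz_zero[OF assms, of x] by (cases "x \<in> Rd d") (auto simp: le_max_iff_disj)
  then show ?thesis by (intro that[of "max 0 C"]) auto
qed

lemma
  assumes "\<phi> \<in> schwartz d"
  shows schwartz_cont: "continuous_on (Rd d) \<phi>"
    and schwartz_differentiable:
      "x \<in> Rd d \<Longrightarrow> i < d \<Longrightarrow> (\<lambda>s. \<phi> (x(i := s))) differentiable (at (x i))"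
proof -
  have "\<forall>is\<in>lists {..<d}. continuous_map (Euclidean_space d) euclidean (pdiffs is \<phi>) \<and>
      (\<forall>x \<in> Rd d. \<forall>i<d. (\<lambda>s. pdiffs is \<phi> (x(i := s))) differentiable (at (x i)))"
    using assms unfolding schwartz_def smooth_def by simp
  from bspec[OF this, of "[]"]
  show "continuous_on (Rd d) \<phi>" "x \<in> Rd d \<Longrightarrow> i < d \<Longrightarrow> (\<lambda>s. \<phi> (x(i := s))) differentiable (at (x i))"
    by (simp_all add: continuous_map_Rd_iff)
qed

lemma continuous_on_coord: "continuous_on S (\<lambda>x::point. x i)"
  by (rule continuous_on_subset[OF continuous_on_product_coordinates]) auto

text \<open>The definition differentiates a slice at its own base point only. Moving coordinate i
  stays inside \<open>Rd d\<close>, so the derivative exists along the whole line.\<close>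

lemma schwartz_pdiff_deriv:
  assumes "\<phi> \<in> schwartz d" "x \<in> Rd d" "i < d"
  shows "((\<lambda>s. \<phi> (x(i := s))) has_vector_derivative pdiff i \<phi> (x(i := s))) (at s)"
  using schwartz_differentiable[OF assms(1) upd_in_Rd[OF assms(2,3)] assms(3), of s]
  by (simp add: pdiff_def vector_derivative_works)

lemma pdiff_eqI:
  "((\<lambda>s. \<phi> (x(i := s))) has_vector_derivative D) (at (x i)) \<Longrightarrow> pdiff i \<phi> x = D"
  by (simp add: pdiff_def vector_derivative_at)

lemma pdiff_zero_outside:
  assumes "\<And>x. x \<notin> Rd d \<Longrightarrow> \<phi> x = 0" "x \<notin> Rd d" "i < d"
  shows "pdiff i \<phi> x = 0"
proof (rule pdiff_eqI)
  have "(\<lambda>s. \<phi> (x(i := s))) = (\<lambda>_. 0)"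
    using assms upd_notin_Rd by (auto simp: fun_eq_iff)
  then show "((\<lambda>s. \<phi> (x(i := s))) has_vector_derivative 0) (at (x i))" by simp
qed

lemma schwartz_pdiff:
  assumes "\<phi> \<in> schwartz d" "i < d"
  shows "pdiff i \<phi> \<in> schwartz d"
proof -
  \<comment> \<open>\<open>pdiffs\<close> applies the head of the list last, so an inner derivative
    is appended at the end.\<close>
  have "pdiffs is (pdiff i \<phi>) = pdiffs (is @ [i]) \<phi>" for "is"
    by (simp add: pdiffs_def)
  moreover have "is @ [i] \<in> lists {..<d}" if "is \<in> lists {..<d}" for "is"
    using that assms by auto
  ultimately show ?thesis
    using assms pdiff_zero_outside[of d \<phi> _ i]
    unfolding schwartz_def smooth_def by (simp add: schwartz_zero)
qed

lemma schwartz_pdiffs: "\<phi> \<in> schwartz d \<Longrightarrow> is \<in> lists {..<d} \<Longrightarrow> pdiffs is \<phi> \<in> schwartz d"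
  by (induction "is") (auto intro: schwartz_pdiff)

lemma schwartz_measurable [measurable_dest]:
  assumes "\<phi> \<in> schwartz d" shows "\<phi> \<in> borel_measurable borel"
proof -
  have "(\<lambda>x. indicator (Rd d) x *\<^sub>R \<phi> x) \<in> borel_measurable borel"
    using schwartz_cont[OF assms] by (intro borel_measurable_continuous_on_indicator) auto
  moreover have "(\<lambda>x. indicator (Rd d) x *\<^sub>R \<phi> x) = \<phi>"
    using schwartz_zero[OF assms] by (auto simp: fun_eq_iff indicator_def)
  ultimately show ?thesis by simp
qed

lemma integrable_decay:
  assumes "d > 0" shows "integrable (leb d) (\<lambda>x. 1 / (1 + enorm d x) ^ (d + 1))"
proof (rule integrableI_bounded)
  have "(\<integral>\<^sup>+x. norm (1 / (1 + enorm d x) ^ (d + 1)) \<partial>leb d)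
     \<le> (\<integral>\<^sup>+x. ennreal (max 1 (enorm d x) powr (- real (d+1))) \<partial>leb d)"
  proof (intro nn_integral_mono ennreal_leI)
    fix x
    have "max 1 (enorm d x) ^ (d+1) \<le> (1 + enorm d x) ^ (d+1)"
      by (intro power_mono) auto
    then show "norm (1 / (1 + enorm d x) ^ (d + 1)) \<le> max 1 (enorm d x) powr (- real (d+1))"
      by (subst powr_minus, subst powr_realpow) (auto simp: divide_simps max_def add_pos_nonneg)
  qed
  also have "\<dots> < \<infinity>"
    using nn_integral_enorm_powr_far[of d "real (d+1)" 1] assms
    by (auto intro: le_less_trans)
  finally show "(\<integral>\<^sup>+x. norm (1 / (1 + enorm d x) ^ (d + 1)) \<partial>leb d) < \<infinity>" .
qed measurable

lemma integrable_decay_bound: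
  fixes f :: "point \<Rightarrow> 'b::{banach,second_countable_topology}"
  assumes "d > 0" "f \<in> borel_measurable borel" "\<And>x. x \<in> Rd d \<Longrightarrow> norm (f x) \<le> C / (1 + enorm d x) ^ (d+1)"
  shows "integrable (leb d) f"
proof (rule Bochner_Integration.integrable_bound)
  show "integrable (leb d) (\<lambda>x. C * (1 / (1 + enorm d x) ^ (d + 1)))"
    by (intro integrable_mult_right integrable_decay assms(1))
  show "AE x in leb d. norm (f x) \<le> norm (C * (1 / (1 + enorm d x) ^ (d + 1)))"
    using AE_leb_Rd
  proof eventually_elim
    case (elim x)
    have "norm (f x) \<le> C / (1 + enorm d x) ^ (d+1)" by (rule assms(3)[OF elim])
    also have "\<dots> \<le> \<bar>C / (1 + enorm d x) ^ (d+1)\<bar>" by (rule abs_ge_self)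
    finally show ?case by simp
  qed
qed (use assms in simp)

lemma schwartz_integrable:
  assumes "d > 0" "\<phi> \<in> schwartz d" shows "integrable (leb d) \<phi>"
proof -
  obtain C where C: "\<And>x. (1 + enorm d x) ^ (d+1) * cmod (\<phi> x) \<le> C" using schwartz_decay[OF assms(2)] by blast
  show ?thesis
  proof (rule integrable_decay_bound[OF assms(1)])
    fix x show "cmod (\<phi> x) \<le> C / (1 + enorm d x) ^ (d+1)"
      using C[of x] by (subst pos_le_divide_eq) (auto simp: mult.commute add_pos_nonneg)
  qed (use assms in measurable)
qed

lemma schwartz_L1_bound:
  assumes "d > 0" "\<phi> \<in> schwartz d" "\<And>x. x \<in> Rd d \<Longrightarrow> (1 + enorm d x) ^ (d+1) * cmod (\<phi> x) \<le> C"
  shows "(LINT x|leb d. cmod (\<phi> x)) \<le> C * (LINT x|leb d. 1 / (1 + enorm d x) ^ (d + 1))"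
proof -
  have "(LINT x|leb d. cmod (\<phi> x)) \<le> (LINT x|leb d. C * (1 / (1 + enorm d x) ^ (d + 1)))"
  proof (rule integral_mono_AE)
    show "AE x in leb d. cmod (\<phi> x) \<le> C * (1 / (1 + enorm d x) ^ (d + 1))"
      using AE_leb_Rd
    proof eventually_elim
      case (elim x)
      show ?case using assms(3)[OF elim]
        by (simp only: mult.right_neutral times_divide_eq_right, subst pos_le_divide_eq) (auto simp: mult.commute add_pos_nonneg)
    qed
  qed (intro integrable_mult_right integrable_decay integrable_norm schwartz_integrable assms)+
  then show ?thesis by (simp only: integral_mult_right_zero)
qed

section \<open>Operations that preserve Schwartz functions\<close>

lemma pdiff_mult:
  assumes \<phi>: "\<phi> \<in> schwartz d" "x \<in> Rd d" "i < d"
    and m: "((\<lambda>s. m (x(i := s))) has_vector_derivative D) (at (x i))"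
  shows "pdiff i (\<lambda>x. m x * \<phi> x) x = D * \<phi> x + m x * pdiff i \<phi> x"
    and "(\<lambda>s. m (x(i := s)) * \<phi> (x(i := s))) differentiable (at (x i))"
proof -
  have D: "((\<lambda>s. m (x(i := s)) * \<phi> (x(i := s))) has_vector_derivative (D * \<phi> x + m x * pdiff i \<phi> x)) (at (x i))"
    using has_vector_derivative_mult[OF m schwartz_pdiff_deriv[OF \<phi>, of "x i"]] by (simp add: algebra_simps)
  then show "pdiff i (\<lambda>x. m x * \<phi> x) x = D * \<phi> x + m x * pdiff i \<phi> x" by (rule pdiff_eqI)
  from D show "(\<lambda>s. m (x(i := s)) * \<phi> (x(i := s))) differentiable (at (x i))" by (rule differentiableI_vector)
qed

lemma pdiff_add:
  assumes "\<phi> \<in> schwartz d" "\<psi> \<in> schwartz d" "i < d"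
  shows "pdiff i (\<lambda>x. \<phi> x + \<psi> x) = (\<lambda>x. pdiff i \<phi> x + pdiff i \<psi> x)"
proof
  fix x show "pdiff i (\<lambda>x. \<phi> x + \<psi> x) x = pdiff i \<phi> x + pdiff i \<psi> x"
  proof (cases "x \<in> Rd d")
    case True
    then show ?thesis
      using has_vector_derivative_add[OF schwartz_pdiff_deriv[of \<phi> d x i "x i"] schwartz_pdiff_deriv[of \<psi> d x i "x i"]] assms
      by (intro pdiff_eqI) simp
  next
    case False
    then show ?thesis
      using assms by (simp add: pdiff_zero_outside[of d] schwartz_zero)
  qed
qed

lemma schwartz_add:
  assumes "\<phi> \<in> schwartz d" "\<psi> \<in> schwartz d"
  shows "(\<lambda>x. \<phi> x + \<psi> x) \<in> schwartz d"
proof (rule schwartz_coinduct[where S="{\<lambda>x. \<phi> x + \<psi> x | \<phi> \<psi>. \<phi> \<in> schwartz d \<and> \<psi> \<in> schwartz d}"]; clarsimp?)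
  fix \<phi> \<psi> k assume "\<phi> \<in> schwartz d" "\<psi> \<in> schwartz d"
  then obtain A B where "\<And>x. (1 + enorm d x) ^ k * cmod (\<phi> x) \<le> A" "\<And>x. (1 + enorm d x) ^ k * cmod (\<psi> x) \<le> B"
    by (metis schwartz_decay)
  then have AB: "(1 + enorm d x) ^ k * cmod (\<phi> x) + (1 + enorm d x) ^ k * cmod (\<psi> x) \<le> A + B" for x
    by (meson add_mono)
  have "(1 + enorm d x) ^ k * cmod (\<phi> x + \<psi> x) \<le> A + B" for x
  proof -
    have "(1 + enorm d x) ^ k * cmod (\<phi> x + \<psi> x) \<le> (1 + enorm d x) ^ k * (cmod (\<phi> x) + cmod (\<psi> x))"
      by (intro mult_left_mono norm_triangle_ineq) auto
    then show ?thesis using AB[of x] by (simp add: distrib_left)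
  qed
  then show "\<exists>C. \<forall>x\<in>Rd d. (1 + enorm d x) ^ k * cmod (\<phi> x + \<psi> x) \<le> C" by blast
next
  show "\<exists>\<phi>' \<psi>'. (\<lambda>x. \<phi> x + \<psi> x) = (\<lambda>x. \<phi>' x + \<psi>' x) \<and> \<phi>' \<in> schwartz d \<and> \<psi>' \<in> schwartz d"
    using assms by blast
next
  fix \<phi> \<psi> i assume "\<phi> \<in> schwartz d" "\<psi> \<in> schwartz d" "i < d"
  then show "\<exists>\<phi>' \<psi>'. pdiff i (\<lambda>x. \<phi> x + \<psi> x) = (\<lambda>x. \<phi>' x + \<psi>' x) \<and> \<phi>' \<in> schwartz d \<and> \<psi>' \<in> schwartz d"
    by (intro exI[of _ "pdiff i \<phi>"] exI[of _ "pdiff i \<psi>"]) (simp add: pdiff_add schwartz_pdiff)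
qed (auto simp: schwartz_zero intro: continuous_on_add[OF schwartz_cont schwartz_cont] differentiable_add[OF schwartz_differentiable schwartz_differentiable])

lemma schwartz_scale:
  assumes "\<phi> \<in> schwartz d" shows "(\<lambda>x. c * \<phi> x) \<in> schwartz d"
    and "i < d \<Longrightarrow> pdiff i (\<lambda>x. c * \<phi> x) = (\<lambda>x. c * pdiff i \<phi> x)"
proof -
  have *: "pdiff i (\<lambda>x. c * \<phi> x) = (\<lambda>x. c * pdiff i \<phi> x)" if "\<phi> \<in> schwartz d" "i < d" for \<phi> i
  proof
    fix x show "pdiff i (\<lambda>x. c * \<phi> x) x = c * pdiff i \<phi> x"
      using that pdiff_mult(1)[of \<phi> d x i "\<lambda>_. c" 0]
      by (cases "x \<in> Rd d") (auto simp: pdiff_zero_outside[of d] schwartz_zero)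
  qed
  show "i < d \<Longrightarrow> pdiff i (\<lambda>x. c * \<phi> x) = (\<lambda>x. c * pdiff i \<phi> x)" using *[OF assms] .
  show "(\<lambda>x. c * \<phi> x) \<in> schwartz d"
  proof (rule schwartz_coinduct[where S="{\<lambda>x. c * \<phi> x | \<phi>. \<phi> \<in> schwartz d}"])
    show "(\<lambda>x. c * \<phi> x) \<in> {\<lambda>x. c * \<phi> x | \<phi>. \<phi> \<in> schwartz d}" using assms by blast
    fix f assume "f \<in> {\<lambda>x. c * \<phi> x | \<phi>. \<phi> \<in> schwartz d}"
    then obtain \<phi> where f: "f = (\<lambda>x. c * \<phi> x)" and s: "\<phi> \<in> schwartz d" by auto
    show "f x = 0" if "x \<notin> Rd d" for x using s that by (simp add: f schwartz_zero)
    show "continuous_on (Rd d) f" unfolding f by (intro continuous_on_mult_left schwartz_cont s)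
    show "\<exists>C. \<forall>x\<in>Rd d. (1 + enorm d x) ^ k * cmod (f x) \<le> C" for k
    proof -
      obtain A where "\<And>x. (1 + enorm d x) ^ k * cmod (\<phi> x) \<le> A" using s by (metis schwartz_decay)
      then have "cmod c * ((1 + enorm d x) ^ k * cmod (\<phi> x)) \<le> cmod c * A" for x by (intro mult_left_mono) auto
      then show ?thesis
        by (intro exI[of _ "cmod c * A"]) (auto simp: f norm_mult mult_ac)
    qed
    show "(\<lambda>s. f (x(i := s))) differentiable at (x i)" if "x \<in> Rd d" "i < d" for x i
      unfolding f using pdiff_mult(2)[OF s that, of "\<lambda>_. c" 0] by simp
    show "pdiff i f \<in> {\<lambda>x. c * \<phi> x | \<phi>. \<phi> \<in> schwartz d}" if "i < d" for i
      unfolding f *[OF s that] using schwartz_pdiff[OF s that] by blast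
  qed
qed

text \<open>The product rule leaves the undifferentiated function behind when i = j. The stable
  family therefore carries a free Schwartz summand.\<close>

lemma schwartz_coord_mult:
  assumes "\<phi> \<in> schwartz d" "j < d"
  shows "(\<lambda>x. complex_of_real (x j) * \<phi> x) \<in> schwartz d"
proof (rule schwartz_coinduct[where S="{\<lambda>x. complex_of_real (x j) * \<phi> x + \<psi> x | \<phi> \<psi>. \<phi> \<in> schwartz d \<and> \<psi> \<in> schwartz d}"])
  have m: "((\<lambda>s. complex_of_real ((x(i := s)) j)) has_vector_derivative (if i = j then 1 else 0)) (at (x i))" for x :: point and i
    by (auto intro!: derivative_eq_intros)
  have z: "(\<lambda>x. 0) \<in> schwartz d" using schwartz_scale(1)[OF assms(1), of 0] by simp
  show "(\<lambda>x. complex_of_real (x j) * \<phi> x) \<in> {\<lambda>x. complex_of_real (x j) * \<phi> x + \<psi> x | \<phi> \<psi>. \<phi> \<in> schwartz d \<and> \<psi> \<in> schwartz d}"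
    using assms(1) z by (intro CollectI exI[of _ \<phi>] exI[of _ "\<lambda>x. 0"]) auto
  fix f assume "f \<in> {\<lambda>x. complex_of_real (x j) * \<phi> x + \<psi> x | \<phi> \<psi>. \<phi> \<in> schwartz d \<and> \<psi> \<in> schwartz d}"
  then obtain \<phi> \<psi> where f: "f = (\<lambda>x. complex_of_real (x j) * \<phi> x + \<psi> x)" and s: "\<phi> \<in> schwartz d" "\<psi> \<in> schwartz d" by auto
  show "f x = 0" if "x \<notin> Rd d" for x using s that by (simp add: f schwartz_zero)
  show "continuous_on (Rd d) f"
    unfolding f by (intro continuous_intros schwartz_cont s continuous_on_coord)
  show dif: "(\<lambda>s. f (x(i := s))) differentiable (at (x i))" if "x \<in> Rd d" "i < d" for x i
    unfolding f by (intro differentiable_add pdiff_mult(2)[OF s(1) that m] schwartz_differentiable[OF s(2) that])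
  show "\<exists>C. \<forall>x\<in>Rd d. (1 + enorm d x) ^ k * cmod (f x) \<le> C" for k
  proof -
    obtain A B where A: "\<And>x. (1 + enorm d x) ^ (Suc k) * cmod (\<phi> x) \<le> A" and B: "\<And>x. (1 + enorm d x) ^ k * cmod (\<psi> x) \<le> B"
      using s by (metis schwartz_decay)
    have "(1 + enorm d x) ^ k * cmod (f x) \<le> A + B" for x
    proof -
      have "cmod (f x) \<le> \<bar>x j\<bar> * cmod (\<phi> x) + cmod (\<psi> x)"
        unfolding f using norm_triangle_ineq[of "complex_of_real (x j) * \<phi> x" "\<psi> x"] by (simp add: norm_mult)
      also have "\<dots> \<le> (1 + enorm d x) * cmod (\<phi> x) + cmod (\<psi> x)"
        using abs_coord_le_enorm[OF assms(2), of x] by (intro add_mono mult_right_mono) auto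
      finally have "(1 + enorm d x) ^ k * cmod (f x) \<le> (1 + enorm d x) ^ k * ((1 + enorm d x) * cmod (\<phi> x) + cmod (\<psi> x))"
        by (intro mult_left_mono) auto
      also have "\<dots> = (1 + enorm d x) ^ (Suc k) * cmod (\<phi> x) + (1 + enorm d x) ^ k * cmod (\<psi> x)"
        by (simp add: algebra_simps)
      also have "\<dots> \<le> A + B" by (intro add_mono A B)
      finally show ?thesis .
    qed
    then show ?thesis by blast
  qed
  show "pdiff i f \<in> {\<lambda>x. complex_of_real (x j) * \<phi> x + \<psi> x | \<phi> \<psi>. \<phi> \<in> schwartz d \<and> \<psi> \<in> schwartz d}" if i: "i < d" for i
  proof -
    have "pdiff i f = (\<lambda>x. complex_of_real (x j) * pdiff i \<phi> x + ((if i = j then 1 else 0) * \<phi> x + pdiff i \<psi> x))"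
    proof
      fix x
      show "pdiff i f x = complex_of_real (x j) * pdiff i \<phi> x + ((if i = j then 1 else 0) * \<phi> x + pdiff i \<psi> x)"
      proof (cases "x \<in> Rd d")
        case True
        have "((\<lambda>s. f (x(i := s))) has_vector_derivative
            (if i = j then 1 else 0) * \<phi> x + complex_of_real (x j) * pdiff i \<phi> x + pdiff i \<psi> x) (at (x i))"
          unfolding f
          using has_vector_derivative_add[OF has_vector_derivative_mult[OF m[of x i] schwartz_pdiff_deriv[OF s(1) True i, of "x i"]] schwartz_pdiff_deriv[OF s(2) True i, of "x i"]]
          by (simp add: algebra_simps)
        then have "pdiff i f x = (if i = j then 1 else 0) * \<phi> x + complex_of_real (x j) * pdiff i \<phi> x + pdiff i \<psi> x" by (rule pdiff_eqI)
        then show ?thesis by (simp add: algebra_simps)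
      next
        case False
        then show ?thesis
          using i s by (simp add: f pdiff_zero_outside[of d] schwartz_zero)
      qed
    qed
    moreover have "pdiff i \<phi> \<in> schwartz d" "(\<lambda>x. (if i = j then 1 else 0) * \<phi> x + pdiff i \<psi> x) \<in> schwartz d"
      using s i by (auto intro!: schwartz_pdiff schwartz_add schwartz_scale)
    ultimately show ?thesis by (intro CollectI exI conjI)
  qed
qed

lemma has_vector_derivative_cis_affine:
  "((\<lambda>s. cis (a + b * s)) has_vector_derivative \<i> * of_real b * cis (a + b * s)) (at s)"
proof -
  have "((\<lambda>z. exp (\<i> * (of_real a + of_real b * z))) has_field_derivative \<i> * of_real b * exp (\<i> * (of_real a + of_real b * of_real s))) (at (of_real s))"
    by (auto intro!: derivative_eq_intros)
  from has_vector_derivative_real_field[OF this] show ?thesis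
    by (simp add: cis_conv_exp)
qed

lemma sum_upd:
  fixes x y :: point
  assumes "i < d"
  shows "(\<Sum>k<d. (x(i := s)) k * y k) = (\<Sum>k<d. x k * y k) + y i * (s - x i)"
proof -
  have "(\<Sum>k<d. (x(i := s)) k * y k) = s * y i + (\<Sum>k\<in>{..<d}-{i}. x k * y k)"
    "(\<Sum>k<d. x k * y k) = x i * y i + (\<Sum>k\<in>{..<d}-{i}. x k * y k)"
    using assms by (subst sum.remove[of _ i]; auto intro!: sum.cong)+
  then show ?thesis by (simp add: algebra_simps)
qed

lemma has_vector_derivative_character:
  fixes x y :: point
  assumes "i < d"
  shows "((\<lambda>s. cis (c * (\<Sum>k<d. (x(i := s)) k * y k))) has_vector_derivative
     \<i> * of_real (c * y i) * cis (c * (\<Sum>k<d. (x(i := s)) k * y k))) (at s)"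
proof -
  have "c * (\<Sum>k<d. (x(i := s)) k * y k) = (c * (\<Sum>k<d. x k * y k) - c * y i * x i) + (c * y i) * s" for s
    by (subst sum_upd[OF assms]) (simp add: algebra_simps)
  then show ?thesis
    using has_vector_derivative_cis_affine[of "c * (\<Sum>k<d. x k * y k) - c * y i * x i" "c * y i" s]
    by simp
qed

lemma has_vector_derivative_character_neg:
  fixes x y :: point
  assumes "i < d"
  shows "((\<lambda>s. cis (- (\<Sum>k<d. (x(i := s)) k * y k))) has_vector_derivative
     - \<i> * of_real (y i) * cis (- (\<Sum>k<d. x k * y k))) (at (x i))"
  using has_vector_derivative_character[OF assms, of "-1" x y "x i"]
  by (simp add: fun_upd_idem del: fun_upd_apply)

lemma pdiff_character_mult:
  assumes "\<phi> \<in> schwartz d" "i < d"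
  shows "pdiff i (\<lambda>x. cis (- (\<Sum>k<d. x k * \<xi> k)) * \<phi> x)
    = (\<lambda>x. cis (- (\<Sum>k<d. x k * \<xi> k)) * (pdiff i \<phi> x - \<i> * of_real (\<xi> i) * \<phi> x))"
proof
  fix x
  show "pdiff i (\<lambda>x. cis (- (\<Sum>k<d. x k * \<xi> k)) * \<phi> x) x
    = cis (- (\<Sum>k<d. x k * \<xi> k)) * (pdiff i \<phi> x - \<i> * of_real (\<xi> i) * \<phi> x)"
  proof (cases "x \<in> Rd d")
    case True
    from pdiff_mult(1)[OF assms(1) True assms(2) has_vector_derivative_character_neg[OF assms(2), of x \<xi>]]
    show ?thesis by (simp add: algebra_simps)
  next
    case False
    then show ?thesis
      using assms by (simp add: pdiff_zero_outside[of d] schwartz_zero)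
  qed
qed

text \<open>A character reproduces itself under differentiation: the derivative of the product is
  the same character times another Schwartz function.\<close>

lemma schwartz_character_mult:
  assumes "\<phi> \<in> schwartz d"
  shows "(\<lambda>x. cis (- (\<Sum>k<d. x k * \<xi> k)) * \<phi> x) \<in> schwartz d"
proof (rule schwartz_coinduct[where S="{\<lambda>x. cis (- (\<Sum>k<d. x k * \<xi> k)) * \<phi> x | \<phi>. \<phi> \<in> schwartz d}"])
  show "(\<lambda>x. cis (- (\<Sum>k<d. x k * \<xi> k)) * \<phi> x) \<in> {\<lambda>x. cis (- (\<Sum>k<d. x k * \<xi> k)) * \<phi> x | \<phi>. \<phi> \<in> schwartz d}"
    using assms by blast
  fix f assume "f \<in> {\<lambda>x. cis (- (\<Sum>k<d. x k * \<xi> k)) * \<phi> x | \<phi>. \<phi> \<in> schwartz d}"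
  then obtain \<phi> where f: "f = (\<lambda>x. cis (- (\<Sum>k<d. x k * \<xi> k)) * \<phi> x)" and s: "\<phi> \<in> schwartz d" by auto
  show "f x = 0" if "x \<notin> Rd d" for x using s that by (simp add: f schwartz_zero)
  show "continuous_on (Rd d) f"
    unfolding f by (intro continuous_intros schwartz_cont s continuous_on_coord continuous_on_cis)
  show "\<exists>C. \<forall>x\<in>Rd d. (1 + enorm d x) ^ k * cmod (f x) \<le> C" for k
  proof -
    obtain A where "\<And>x. (1 + enorm d x) ^ k * cmod (\<phi> x) \<le> A" using s by (metis schwartz_decay)
    then show ?thesis by (auto simp: f norm_mult)
  qed
  show "(\<lambda>s. f (x(i := s))) differentiable at (x i)" if "x \<in> Rd d" "i < d" for x i
    unfolding f using pdiff_mult(2)[OF s that has_vector_derivative_character_neg[OF that(2), of x \<xi>]] .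
  show "pdiff i f \<in> {\<lambda>x. cis (- (\<Sum>k<d. x k * \<xi> k)) * \<phi> x | \<phi>. \<phi> \<in> schwartz d}" if i: "i < d" for i
  proof -
    have "(\<lambda>x. pdiff i \<phi> x - \<i> * of_real (\<xi> i) * \<phi> x) \<in> schwartz d"
      using schwartz_add[OF schwartz_pdiff[OF s i] schwartz_scale(1)[OF s, of "- \<i> * of_real (\<xi> i)"]] by simp
    then show ?thesis unfolding f pdiff_character_mult[OF s i] by (intro CollectI exI[of _ "\<lambda>x. pdiff i \<phi> x - \<i> * of_real (\<xi> i) * \<phi> x"]) simp
  qed
qed

lemma enorm_uminus [simp]: "enorm d (\<lambda>i. - x i) = enorm d x"
  by (simp add: L2_set_def)

lemma uminus_in_Rd_iff [simp]: "(\<lambda>i. - x i) \<in> Rd d \<longleftrightarrow> x \<in> Rd d"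
  by (simp add: Rd_iff)

lemma pdiff_reflect:
  assumes "\<phi> \<in> schwartz d" "i < d"
  shows "pdiff i (\<lambda>x. \<phi> (\<lambda>k. - x k)) = (\<lambda>x. - pdiff i \<phi> (\<lambda>k. - x k))"
    and "x \<in> Rd d \<Longrightarrow> (\<lambda>s. \<phi> (\<lambda>k. - (x(i := s)) k)) differentiable (at (x i))"
proof -
  have D: "((\<lambda>s. \<phi> (\<lambda>k. - (x(i := s)) k)) has_vector_derivative - pdiff i \<phi> (\<lambda>k. - x k)) (at (x i))" if "x \<in> Rd d" for x
  proof -
    have "(\<lambda>k. - x k) \<in> Rd d" using that by simp
    note A = schwartz_pdiff_deriv[OF assms(1) this assms(2)]
    have eq: "(\<lambda>k. - (x(i := s)) k) = (\<lambda>k. - x k)(i := - s)" for s by auto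
    have "((\<lambda>s. - s) has_vector_derivative - 1) (at (x i))" by (auto intro!: derivative_eq_intros)
    from vector_diff_chain_at[OF this A]
    have "((\<lambda>s. \<phi> ((\<lambda>k. - x k)(i := - s))) has_vector_derivative - pdiff i \<phi> (\<lambda>k. - x k)) (at (x i))"
      by (simp add: o_def fun_upd_idem)
    then show ?thesis by (simp only: eq)
  qed
  show "x \<in> Rd d \<Longrightarrow> (\<lambda>s. \<phi> (\<lambda>k. - (x(i := s)) k)) differentiable (at (x i))"
    using D differentiableI_vector by blast
  show "pdiff i (\<lambda>x. \<phi> (\<lambda>k. - x k)) = (\<lambda>x. - pdiff i \<phi> (\<lambda>k. - x k))"
  proof
    fix x show "pdiff i (\<lambda>x. \<phi> (\<lambda>k. - x k)) x = - pdiff i \<phi> (\<lambda>k. - x k)"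
      using assms pdiff_eqI[OF D, of x] by (cases "x \<in> Rd d") (auto simp: pdiff_zero_outside[of d] schwartz_zero)
  qed
qed

lemma schwartz_reflect:
  assumes "\<phi> \<in> schwartz d"
  shows "(\<lambda>x. \<phi> (\<lambda>k. - x k)) \<in> schwartz d"
proof (rule schwartz_coinduct[where S="{\<lambda>x. \<phi> (\<lambda>k. - x k) | \<phi>. \<phi> \<in> schwartz d}"])
  show "(\<lambda>x. \<phi> (\<lambda>k. - x k)) \<in> {\<lambda>x. \<phi> (\<lambda>k. - x k) | \<phi>. \<phi> \<in> schwartz d}" using assms by auto
  fix f assume "f \<in> {\<lambda>x. \<phi> (\<lambda>k. - x k) | \<phi>. \<phi> \<in> schwartz d}"
  then obtain \<phi> where f: "f = (\<lambda>x. \<phi> (\<lambda>k. - x k))" and s: "\<phi> \<in> schwartz d" by auto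
  show "f x = 0" if "x \<notin> Rd d" for x using s that by (simp add: f schwartz_zero)
  show "continuous_on (Rd d) f" unfolding f
    by (rule continuous_on_compose2[OF schwartz_cont[OF s]])
       (auto intro!: continuous_on_coordinatewise_then_product continuous_on_minus continuous_on_coord)
  show "(\<lambda>s. f (x(i := s))) differentiable (at (x i))" if "x \<in> Rd d" "i < d" for x i
    unfolding f using pdiff_reflect(2)[OF s that(2,1)] .
  show "\<exists>C. \<forall>x\<in>Rd d. (1 + enorm d x) ^ k * cmod (f x) \<le> C" for k
  proof -
    obtain A where A: "\<And>x. (1 + enorm d x) ^ k * cmod (\<phi> x) \<le> A" using s by (metis schwartz_decay)
    have "(1 + enorm d x) ^ k * cmod (f x) \<le> A" for x
      using A[of "\<lambda>k. - x k"] by (simp add: f)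
    then show ?thesis by blast
  qed
  show "pdiff i f \<in> {\<lambda>x. \<phi> (\<lambda>k. - x k) | \<phi>. \<phi> \<in> schwartz d}" if i: "i < d" for i
    unfolding f pdiff_reflect(1)[OF s i]
    using schwartz_scale(1)[OF schwartz_pdiff[OF s i], of "-1"]
    by (intro CollectI exI[of _ "\<lambda>x. - pdiff i \<phi> x"]) auto
qed


section \<open>The Fourier transform on Schwartz functions\<close>

lemma norm_diff_le_of_derivative:
  fixes f :: "real \<Rightarrow> complex"
  assumes "a \<le> b" and d: "\<And>s. (f has_vector_derivative f' s) (at s)" and B: "\<And>s. a \<le> s \<Longrightarrow> s \<le> b \<Longrightarrow> cmod (f' s) \<le> B"
  shows "cmod (f b - f a) \<le> B * (b - a)"
proof (cases "a = b")
  case False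
  have "cmod (f b - f a) \<le> B * b - B * a"
  proof (rule differentiable_bound_general)
    show "a < b" using False assms by simp
    show "continuous_on {a..b} f"
      by (intro continuous_at_imp_continuous_on ballI has_vector_derivative_continuous[OF d])
    show "(f has_vector_derivative f' s) (at s)" for s by (rule d)
    show "((\<lambda>s. B * s) has_vector_derivative B) (at s)" for s
      by (auto intro!: derivative_eq_intros)
  qed (auto intro!: continuous_intros B)
  then show ?thesis by (simp add: algebra_simps)
qed simp

lemma has_vector_derivative_slope:
  fixes f :: "real \<Rightarrow> complex"
  assumes "(f has_vector_derivative D) (at a)"
  shows "((\<lambda>s. (f s - f a) /\<^sub>R (s - a)) \<longlongrightarrow> D) (at a)"
proof -
  have "((\<lambda>s. (1 / \<bar>s - a\<bar>) *\<^sub>R (f s - (f a + (s - a) *\<^sub>R D))) \<longlongrightarrow> 0) (at a)"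
    using assms unfolding has_vector_derivative_def has_derivative_within by simp
  then have "((\<lambda>s. norm ((f s - f a) /\<^sub>R (s - a) - D)) \<longlongrightarrow> 0) (at a)"
  proof (rule tendsto_norm_zero[THEN Lim_transform_eventually])
    show "\<forall>\<^sub>F s in at a. norm ((1 / \<bar>s - a\<bar>) *\<^sub>R (f s - (f a + (s - a) *\<^sub>R D))) = norm ((f s - f a) /\<^sub>R (s - a) - D)"
      unfolding eventually_at_filter
    proof (intro always_eventually allI impI)
      fix s assume "s \<noteq> a"
      then have "(f s - f a) /\<^sub>R (s - a) - D = (f s - (f a + (s - a) *\<^sub>R D)) /\<^sub>R (s - a)"
        by (simp add: scaleR_diff_right scaleR_add_right)
      then show "norm ((1 / \<bar>s - a\<bar>) *\<^sub>R (f s - (f a + (s - a) *\<^sub>R D))) = norm ((f s - f a) /\<^sub>R (s - a) - D)"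
        by (simp add: inverse_eq_divide)
    qed
  qed
  then show ?thesis by (simp only: tendsto_norm_zero_iff LIM_zero_iff)
qed

lemma enorm_axis: "i < d \<Longrightarrow> enorm d (\<lambda>k. if k = i then h else 0) = \<bar>h\<bar>"
  unfolding L2_set_def by (subst sum.remove[of _ i]) auto

text \<open>The integral of a difference quotient vanishes by translation invariance.\<close>

lemma integral_pdiff_eq_0:
  assumes d: "d > 0" and \<phi>: "\<phi> \<in> schwartz d" and i: "i < d"
  shows "(LINT x|leb d. pdiff i \<phi> x) = 0"
proof -
  obtain C where C: "C \<ge> 0" "\<And>x. (1 + enorm d x) ^ (d+1) * cmod (pdiff i \<phi> x) \<le> C"
    using schwartz_decay[OF schwartz_pdiff[OF \<phi> i]] by blast
  define t where "t n = (\<lambda>k. if k = i then 1 / real (Suc n) else 0)" for n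
  define q where "q n x = of_nat (Suc n) * (\<phi> (\<lambda>k. t n k + 1 * x k) - \<phi> x)" for n x
  have t: "t n \<in> Rd d" for n using i by (auto simp: t_def Rd_iff)
  have [measurable]: "\<phi> \<in> borel_measurable borel" using schwartz_measurable[OF \<phi>] .
  have t_upd: "(\<lambda>k. t n k + 1 * x k) = x(i := x i + 1 / real (Suc n))" for n x
    by (auto simp: t_def fun_eq_iff)
  have q0: "(LINT x|leb d. q n x) = 0" for n
  proof -
    have "integrable (leb d) (\<lambda>x. \<phi> (\<lambda>k. t n k + 1 * x k))"
      using integrable_leb_affine_iff[OF t, of 1 \<phi>] schwartz_integrable[OF d \<phi>] by simp
    moreover have "(LINT x|leb d. \<phi> (\<lambda>k. t n k + 1 * x k)) = (LINT x|leb d. \<phi> x)"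
      using integral_leb_affine[OF t, of 1 \<phi>] by simp
    ultimately show ?thesis
      unfolding q_def integral_mult_right_zero using schwartz_integrable[OF d \<phi>] by simp
  qed
  have "(\<lambda>n. LINT x|leb d. q n x) \<longlonglongrightarrow> (LINT x|leb d. pdiff i \<phi> x)"
  proof (rule integral_dominated_convergence[where w="\<lambda>x. C * 2 ^ (d+1) * (1 / (1 + enorm d x) ^ (d+1))"])
    show "pdiff i \<phi> \<in> borel_measurable (leb d)"
      using schwartz_measurable[OF schwartz_pdiff[OF \<phi> i]] by simp
    show "q n \<in> borel_measurable (leb d)" for n unfolding q_def by measurable
    show "integrable (leb d) (\<lambda>x. C * 2 ^ (d+1) * (1 / (1 + enorm d x) ^ (d+1)))"
      by (intro integrable_mult_right integrable_decay d)
    show "AE x in leb d. (\<lambda>n. q n x) \<longlonglongrightarrow> pdiff i \<phi> x"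
      using AE_leb_Rd
    proof eventually_elim
      case (elim x)
      have "((\<lambda>s. \<phi> (x(i := s))) has_vector_derivative pdiff i \<phi> x) (at (x i))"
        using schwartz_pdiff_deriv[OF \<phi> elim i, of "x i"] by simp
      then have "((\<lambda>s. (\<phi> (x(i := s)) - \<phi> (x(i := x i))) /\<^sub>R (s - x i)) \<longlongrightarrow> pdiff i \<phi> x) (at (x i))"
        by (rule has_vector_derivative_slope)
      then have "((\<lambda>s. (\<phi> (x(i := s)) - \<phi> (x(i := x i))) /\<^sub>R (s - x i)) \<circ> (\<lambda>n. x i + 1 / real (Suc n))) \<longlonglongrightarrow> pdiff i \<phi> x"
        unfolding tendsto_at_iff_sequentially
        using tendsto_add[OF tendsto_const[of "x i"] LIMSEQ_inverse_real_of_nat]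
        by (auto simp: inverse_eq_divide)
      then show ?case
        unfolding q_def t_upd o_def by (simp add: scaleR_conv_of_real)
    qed
    show "AE x in leb d. cmod (q n x) \<le> C * 2 ^ (d+1) * (1 / (1 + enorm d x) ^ (d+1))" for n
      using AE_leb_Rd
    proof eventually_elim
      case (elim x)
      \<comment> \<open>The step is at most 1, so a shifted point y satisfies 1 + |x| \<le> 2 (1 +
        |y|); hence the factor 2^(d+1) in the dominating function.\<close>
      have B: "cmod (pdiff i \<phi> (x(i := s))) \<le> C * 2 ^ (d+1) * (1 / (1 + enorm d x) ^ (d+1))"
        if "x i \<le> s" "s \<le> x i + 1 / real (Suc n)" for s
      proof -
        let ?y = "x(i := s)"
        have "1 / real (Suc n) \<le> 1" by simp
        have "enorm d (\<lambda>k. x k - ?y k) = enorm d (\<lambda>k. if k = i then x i - s else 0)"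
          by (intro L2_set_cong) auto
        also have "\<dots> = \<bar>x i - s\<bar>" by (rule enorm_axis[OF i])
        also have "\<dots> \<le> 1" using that \<open>1 / real (Suc n) \<le> 1\<close> by linarith
        finally have "enorm d x \<le> 1 + enorm d ?y"
          using enorm_triangle[where d=d and \<xi>=x and \<eta>="?y"] by linarith
        moreover have "1 + a \<le> 2 * (1 + e)" if "a \<le> 1 + e" "0 \<le> e" for a e :: real
          using that by simp
        ultimately have "1 + enorm d x \<le> 2 * (1 + enorm d ?y)" using L2_set_nonneg by blast
        then have "(1 + enorm d x) ^ (d+1) \<le> (2 * (1 + enorm d ?y)) ^ (d+1)"
          by (intro power_mono) auto
        then have "(1 + enorm d x) ^ (d+1) * cmod (pdiff i \<phi> ?y) \<le> 2 ^ (d+1) * ((1 + enorm d ?y) ^ (d+1) * cmod (pdiff i \<phi> ?y))"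
          unfolding power_mult_distrib mult.assoc[symmetric] by (intro mult_right_mono) auto
        also have "\<dots> \<le> 2 ^ (d+1) * C" by (intro mult_left_mono C(2)) auto
        finally show ?thesis
          by (simp only: times_divide_eq_right mult.right_neutral, subst pos_le_divide_eq) (auto simp: mult_ac add_pos_nonneg)
      qed
      have "cmod (\<phi> (x(i := x i + 1 / real (Suc n))) - \<phi> (x(i := x i)))
         \<le> C * 2 ^ (d+1) * (1 / (1 + enorm d x) ^ (d+1)) * ((x i + 1 / real (Suc n)) - x i)"
        by (rule norm_diff_le_of_derivative[where f="\<lambda>s. \<phi> (x(i := s))", OF _ schwartz_pdiff_deriv[OF \<phi> elim i]])
           (use B in auto)
      then have "cmod (\<phi> (x(i := x i + 1 / real (Suc n))) - \<phi> x) * real (Suc n)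
         \<le> C * 2 ^ (d+1) * (1 / (1 + enorm d x) ^ (d+1)) * (1 / real (Suc n)) * real (Suc n)"
        by (intro mult_right_mono) (auto simp: algebra_simps)
      then show ?case
        unfolding q_def t_upd norm_mult by (simp add: mult.commute del: of_nat_Suc)
    qed
  qed
  then show ?thesis by (simp add: q0 LIMSEQ_const_iff)
qed

lemma fourier_eq:
  "\<xi> \<in> Rd d \<Longrightarrow> fourier d \<phi> \<xi> = (LINT x|leb d. cis (- (\<Sum>i<d. x i * \<xi> i)) * \<phi> x)"
  by (simp add: fourier_def)

lemma borel_measurable_ip [measurable (raw)]:
  fixes f g :: "'a \<Rightarrow> point"
  assumes "f \<in> borel_measurable M" "g \<in> borel_measurable M"
  shows "(\<lambda>x. \<Sum>i<d. f x i * g x i) \<in> borel_measurable M"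
  by (intro borel_measurable_sum borel_measurable_times borel_measurable_coord assms)

lemma borel_measurable_cis [measurable (raw)]:
  "f \<in> borel_measurable M \<Longrightarrow> (\<lambda>x. cis (f x)) \<in> borel_measurable M"
  by (rule borel_measurable_continuous_on[OF continuous_on_cis[OF continuous_on_id]])

lemma integrable_cis_mult:
  fixes \<phi> :: "'a \<Rightarrow> complex"
  assumes "integrable M \<phi>" "f \<in> borel_measurable M"
  shows "integrable M (\<lambda>x. cis (f x) * \<phi> x)"
proof (rule Bochner_Integration.integrable_bound[OF assms(1)])
  have [measurable]: "\<phi> \<in> borel_measurable M" "f \<in> borel_measurable M" using assms by auto
  show "(\<lambda>x. cis (f x) * \<phi> x) \<in> borel_measurable M" by measurable
qed (simp add: norm_mult)

lemma cmod_fourier_le: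
  assumes "integrable (leb d) \<phi>"
  shows "cmod (fourier d \<phi> \<xi>) \<le> (LINT x|leb d. cmod (\<phi> x))"
proof (cases "\<xi> \<in> Rd d")
  case True
  have "cmod (LINT x|leb d. cis (- (\<Sum>i<d. x i * \<xi> i)) * \<phi> x) \<le> (LINT x|leb d. cmod (cis (- (\<Sum>i<d. x i * \<xi> i)) * \<phi> x))"
    by (rule integral_norm_bound)
  then show ?thesis using True by (simp add: fourier_eq norm_mult)
qed (simp add: fourier_def)

text \<open>Integration by parts: the derivative of the character times \<open>\<phi>\<close> has
  integral zero, and the product rule splits it into the two sides of the identity.\<close>

lemma fourier_pdiff:
  assumes d: "d > 0" and \<phi>: "\<phi> \<in> schwartz d" and i: "i < d"
  shows "fourier d (pdiff i \<phi>) \<xi> = \<i> * of_real (\<xi> i) * fourier d \<phi> \<xi>"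
proof (cases "\<xi> \<in> Rd d")
  case True
  have int: "integrable (leb d) (\<lambda>x. cis (- (\<Sum>k<d. x k * \<xi> k)) * \<psi> x)" if "\<psi> \<in> schwartz d" for \<psi>
    by (intro integrable_cis_mult schwartz_integrable[OF d that]) measurable
  have "0 = (LINT x|leb d. cis (- (\<Sum>k<d. x k * \<xi> k)) * (pdiff i \<phi> x - \<i> * of_real (\<xi> i) * \<phi> x))"
    using integral_pdiff_eq_0[OF d schwartz_character_mult[OF \<phi>, of \<xi>] i]
    unfolding pdiff_character_mult[OF \<phi> i] by simp
  also have "\<dots> = (LINT x|leb d. cis (- (\<Sum>k<d. x k * \<xi> k)) * pdiff i \<phi> x - \<i> * of_real (\<xi> i) * (cis (- (\<Sum>k<d. x k * \<xi> k)) * \<phi> x))"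
    by (intro Bochner_Integration.integral_cong refl) (simp add: algebra_simps)
  also have "\<dots> = fourier d (pdiff i \<phi>) \<xi> - \<i> * of_real (\<xi> i) * fourier d \<phi> \<xi>"
    unfolding fourier_eq[OF True]
    by (subst Bochner_Integration.integral_diff) (auto intro!: int integrable_mult_right schwartz_pdiff \<phi> i)
  finally show ?thesis by simp
qed (simp add: fourier_def)

lemma has_vector_derivative_integral:
  fixes f :: "real \<Rightarrow> 'a \<Rightarrow> complex"
  assumes int: "\<And>s. integrable M (f s)"
    and der: "\<And>s x. ((\<lambda>s. f s x) has_vector_derivative f' s x) (at s)"
    and meas: "f' s0 \<in> borel_measurable M"
    and bnd: "\<And>s x. cmod (f' s x) \<le> g x" and g: "integrable M g"
  shows "((\<lambda>s. LINT x|M. f s x) has_vector_derivative (LINT x|M. f' s0 x)) (at s0)"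
proof -
  have int': "integrable M (f' s0)"
    by (rule Bochner_Integration.integrable_bound[OF g meas]) (use bnd in \<open>auto intro: order_trans[OF _ abs_ge_self]\<close>)
  have E: "cmod (f s x - f s0 x) \<le> g x * \<bar>s - s0\<bar>" for s x
  proof (cases "s0 \<le> s")
    case True
    then show ?thesis using norm_diff_le_of_derivative[of s0 s "\<lambda>s. f s x" "\<lambda>s. f' s x" "g x", OF True der bnd] by simp
  next
    case False
    then show ?thesis using norm_diff_le_of_derivative[of s s0 "\<lambda>s. f s x" "\<lambda>s. f' s x" "g x", OF _ der bnd]
      by (simp add: norm_minus_commute)
  qed
  let ?Q = "\<lambda>s x. (1 / \<bar>s - s0\<bar>) *\<^sub>R (f s x - (f s0 x + (s - s0) *\<^sub>R f' s0 x))"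
  have "((\<lambda>s. LINT x|M. ?Q s x) \<longlongrightarrow> (LINT x|M. 0)) (at s0)"
    unfolding tendsto_at_iff_sequentially
  proof (intro allI impI)
    fix S :: "nat \<Rightarrow> real" assume S: "\<forall>n. S n \<in> UNIV - {s0}" "S \<longlonglongrightarrow> s0"
    show "((\<lambda>s. LINT x|M. ?Q s x) \<circ> S) \<longlonglongrightarrow> (LINT x|M. 0)"
      unfolding o_def
    \<comment> \<open>One \<open>g\<close> bounds the difference quotient by the mean value
      inequality, the other one bounds the derivative that is subtracted.\<close>
    proof (rule integral_dominated_convergence[where w="\<lambda>x. 2 * g x"])
      show "(\<lambda>x. ?Q (S n) x) \<in> borel_measurable M" for n
        using borel_measurable_integrable[OF int] meas by measurable
      show "AE x in M. (\<lambda>n. ?Q (S n) x) \<longlonglongrightarrow> 0"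
      proof (rule AE_I2)
        fix x
        have "((\<lambda>s. ?Q s x) \<longlongrightarrow> 0) (at s0)"
          using der[where s=s0 and x=x] unfolding has_vector_derivative_def has_derivative_within by simp
        then show "(\<lambda>n. ?Q (S n) x) \<longlonglongrightarrow> 0"
          using S unfolding tendsto_at_iff_sequentially by (auto simp: o_def)
      qed
      show "AE x in M. cmod (?Q (S n) x) \<le> 2 * g x" for n
      proof (rule AE_I2)
        fix x
        have ne: "\<bar>S n - s0\<bar> > 0" using S by auto
        have "cmod (f (S n) x - (f s0 x + (S n - s0) *\<^sub>R f' s0 x)) \<le> cmod (f (S n) x - f s0 x) + cmod ((S n - s0) *\<^sub>R f' s0 x)"
          using norm_triangle_ineq4[of "f (S n) x - f s0 x" "(S n - s0) *\<^sub>R f' s0 x"] by (simp add: algebra_simps)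
        also have "\<dots> \<le> g x * \<bar>S n - s0\<bar> + \<bar>S n - s0\<bar> * g x"
          by (intro add_mono E) (auto intro!: mult_left_mono bnd)
        finally show "cmod (?Q (S n) x) \<le> 2 * g x"
          using ne by (simp add: divide_simps mult_ac)
      qed
    qed (use g in auto)
  qed
  moreover have "(LINT x|M. ?Q s x) = (1 / \<bar>s - s0\<bar>) *\<^sub>R ((LINT x|M. f s x) - ((LINT x|M. f s0 x) + (s - s0) *\<^sub>R (LINT x|M. f' s0 x)))" for s
    using int int' by simp
  ultimately have "((\<lambda>s. (1 / \<bar>s - s0\<bar>) *\<^sub>R ((LINT x|M. f s x) - ((LINT x|M. f s0 x) + (s - s0) *\<^sub>R (LINT x|M. f' s0 x)))) \<longlongrightarrow> 0) (at s0)"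
    by (simp only: Bochner_Integration.integral_zero)
  then show ?thesis
    unfolding has_vector_derivative_def has_derivative_within by (simp add: bounded_linear_scaleR_left)
qed

lemma fourier_deriv:
  assumes d: "d > 0" and \<phi>: "\<phi> \<in> schwartz d" and i: "i < d" and \<xi>: "\<xi> \<in> Rd d"
  shows "((\<lambda>s. fourier d \<phi> (\<xi>(i := s))) has_vector_derivative fourier d (\<lambda>x. - \<i> * (of_real (x i) * \<phi> x)) \<xi>) (at (\<xi> i))"
proof -
  let ?f = "\<lambda>s x. cis (- (\<Sum>k<d. x k * (\<xi>(i := s)) k)) * \<phi> x"
  let ?f' = "\<lambda>s x. (- \<i> * of_real (x i) * cis (- (\<Sum>k<d. x k * (\<xi>(i := s)) k))) * \<phi> x"
  have x\<phi>: "(\<lambda>x. of_real (x i) * \<phi> x) \<in> schwartz d" by (rule schwartz_coord_mult[OF \<phi> i])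
  have "((\<lambda>s. LINT x|leb d. ?f s x) has_vector_derivative (LINT x|leb d. ?f' (\<xi> i) x)) (at (\<xi> i))"
  proof (rule has_vector_derivative_integral[where g="\<lambda>x. cmod (of_real (x i) * \<phi> x)"])
    show "integrable (leb d) (?f s)" for s
      by (intro integrable_cis_mult schwartz_integrable d \<phi>) measurable
    have [measurable]: "\<phi> \<in> borel_measurable borel" using schwartz_measurable[OF \<phi>] .
    show "?f' (\<xi> i) \<in> borel_measurable (leb d)" by measurable
    show "((\<lambda>s. ?f s x) has_vector_derivative ?f' s x) (at s)" for s x
    proof -
      have "((\<lambda>s'. cis (- (\<Sum>k<d. ((\<xi>(i := s))(i := s')) k * x k))) has_vector_derivative
         - \<i> * of_real (x i) * cis (- (\<Sum>k<d. (\<xi>(i := s)) k * x k))) (at ((\<xi>(i := s)) i))"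
        by (rule has_vector_derivative_character_neg[OF i])
      then have "((\<lambda>s'. cis (- (\<Sum>k<d. x k * (\<xi>(i := s')) k))) has_vector_derivative
         - \<i> * of_real (x i) * cis (- (\<Sum>k<d. x k * (\<xi>(i := s)) k))) (at s)"
        by (simp only: fun_upd_upd fun_upd_same mult.commute[of "x _"])
      then show ?thesis by (rule has_vector_derivative_mult_left)
    qed
    show "cmod (?f' s x) \<le> cmod (of_real (x i) * \<phi> x)" for s x by (simp add: norm_mult)
    show "integrable (leb d) (\<lambda>x. cmod (of_real (x i) * \<phi> x))"
      by (intro integrable_norm schwartz_integrable d x\<phi>)
  qed
  moreover have "fourier d \<phi> (\<xi>(i := s)) = (LINT x|leb d. ?f s x)" for s
    by (rule fourier_eq[OF upd_in_Rd[OF \<xi> i]])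
  moreover have "(LINT x|leb d. ?f' (\<xi> i) x) = fourier d (\<lambda>x. - \<i> * (of_real (x i) * \<phi> x)) \<xi>"
    unfolding fourier_eq[OF \<xi>] by (simp add: mult_ac)
  ultimately show ?thesis by simp
qed

lemma pdiff_fourier:
  assumes "d > 0" "\<phi> \<in> schwartz d" "i < d"
  shows "pdiff i (fourier d \<phi>) = fourier d (\<lambda>x. - \<i> * (of_real (x i) * \<phi> x))"
proof
  fix \<xi> show "pdiff i (fourier d \<phi>) \<xi> = fourier d (\<lambda>x. - \<i> * (of_real (x i) * \<phi> x)) \<xi>"
  proof (cases "\<xi> \<in> Rd d")
    case True
    show ?thesis by (rule pdiff_eqI[OF fourier_deriv[OF assms True]])
  next
    case False
    then show ?thesis
      using pdiff_zero_outside[of d "fourier d \<phi>" \<xi> i] assms by (simp add: fourier_def)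
  qed
qed

lemma fourier_continuous:
  assumes int: "integrable (leb d) \<phi>"
  shows "continuous_on (Rd d) (fourier d \<phi>)"
  unfolding continuous_on_sequentially
proof (intro allI ballI impI)
  fix S :: "nat \<Rightarrow> point" and \<xi> assume \<xi>: "\<xi> \<in> Rd d" and S: "(\<forall>n. S n \<in> Rd d) \<and> S \<longlonglongrightarrow> \<xi>"
  have [measurable]: "\<phi> \<in> borel_measurable borel" using int by auto
  have "(\<lambda>n. LINT x|leb d. cis (- (\<Sum>i<d. x i * S n i)) * \<phi> x) \<longlonglongrightarrow> (LINT x|leb d. cis (- (\<Sum>i<d. x i * \<xi> i)) * \<phi> x)"
  proof (rule integral_dominated_convergence[where w="\<lambda>x. cmod (\<phi> x)"])
    have "(\<lambda>n. S n i) \<longlonglongrightarrow> \<xi> i" for i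
      using continuous_on_tendsto_compose[OF continuous_on_coord[of UNIV i], of S \<xi> sequentially] S by simp
    then show "AE x in leb d. (\<lambda>n. cis (- (\<Sum>i<d. x i * S n i)) * \<phi> x) \<longlonglongrightarrow> cis (- (\<Sum>i<d. x i * \<xi> i)) * \<phi> x"
      by (intro AE_I2 tendsto_intros isCont_tendsto_compose[of _ cis]) (auto intro!: continuous_intros)
  qed (use int in \<open>auto simp: norm_mult\<close>)
  then show "(fourier d \<phi> \<circ> S) \<longlonglongrightarrow> fourier d \<phi> \<xi>"
    using S \<xi> by (simp add: o_def fourier_eq)
qed

text \<open>Reduces the radial weight to powers of single coordinates, which the transform turns
  into repeated derivatives in one direction. Both sides are compared with the maximum of 1 and the
  |\<xi>_i|.\<close>

lemma power_enorm_le: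
  "(1 + enorm d \<xi>) ^ k \<le> (1 + real d) ^ k * (1 + (\<Sum>i<d. \<bar>\<xi> i\<bar> ^ k))"
proof -
  obtain m where m: "\<And>i. i < d \<Longrightarrow> \<bar>\<xi> i\<bar> \<le> m" "m \<ge> 1" "m ^ k \<le> 1 + (\<Sum>i<d. \<bar>\<xi> i\<bar> ^ k)"
  proof -
    define m where "m = Max (insert 1 ((\<lambda>i. \<bar>\<xi> i\<bar>) ` {..<d}))"
    have "m \<in> insert 1 ((\<lambda>i. \<bar>\<xi> i\<bar>) ` {..<d})" unfolding m_def by (rule Max_in) auto
    then have "m ^ k \<le> 1 + (\<Sum>i<d. \<bar>\<xi> i\<bar> ^ k)"
    proof
      assume "m \<in> (\<lambda>i. \<bar>\<xi> i\<bar>) ` {..<d}"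
      then obtain i where "i < d" "m = \<bar>\<xi> i\<bar>" by auto
      then have "m ^ k \<le> (\<Sum>i<d. \<bar>\<xi> i\<bar> ^ k)" using member_le_sum[of i "{..<d}" "\<lambda>i. \<bar>\<xi> i\<bar> ^ k"] by simp
      then show ?thesis by simp
    qed (simp add: sum_nonneg)
    then show ?thesis by (intro that[of m]) (auto simp: m_def intro!: Max_ge)
  qed
  have "enorm d \<xi> \<le> (\<Sum>i<d. \<bar>\<xi> i\<bar>)" by (rule L2_set_le_sum_abs)
  also have "\<dots> \<le> (\<Sum>i<d. m)" using m by (intro sum_mono) auto
  finally have "1 + enorm d \<xi> \<le> (1 + real d) * m" using m(2) by (simp add: algebra_simps)
  then have "(1 + enorm d \<xi>) ^ k \<le> ((1 + real d) * m) ^ k" by (intro power_mono) auto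
  also have "\<dots> \<le> (1 + real d) ^ k * (1 + (\<Sum>i<d. \<bar>\<xi> i\<bar> ^ k))"
    unfolding power_mult_distrib by (intro mult_left_mono m) auto
  finally show ?thesis .
qed

text \<open>A supremum of reals is an upper bound only for bounded families, which the Schwartz
  decay guarantees here. The other summands of the norm are nonnegative because the members of their
  families are.\<close>

lemma schwartz_norm_ge:
  assumes \<phi>: "\<phi> \<in> schwartz d" and "is": "is \<in> lists {..<d}" "length is \<le> N" and x: "x \<in> Rd d"
  shows "(1 + enorm d x) ^ N * cmod (pdiffs is \<phi> x) \<le> schwartz_norm d N \<phi>"
proof -
  let ?f = "\<lambda>is x. (1 + enorm d x) ^ N * cmod (pdiffs is \<phi> x)"
  have fin: "finite {is \<in> lists {..<d}. length is \<le> N}"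
    using finite_lists_length_le[of "{..<d}" N] by (simp add: lists_eq_set conj_commute)
  have bdd: "bdd_above (?f is ` Rd d)" if "is \<in> lists {..<d}" for "is"
    using schwartz_pdiffs_decay[OF \<phi> that, of N] by (auto simp: bdd_above_def)
  have "?f is x \<le> (SUP x\<in>Rd d. ?f is x)"
    by (rule cSUP_upper[OF x bdd[OF "is"(1)]])
  also have "\<dots> \<le> schwartz_norm d N \<phi>"
    unfolding schwartz_norm_def
  proof (rule member_le_sum)
    show "is \<in> {is \<in> lists {..<d}. length is \<le> N}" using "is" by simp
    fix js assume "js \<in> {is \<in> lists {..<d}. length is \<le> N} - {is}"
    then have "?f js x \<le> (SUP x\<in>Rd d. ?f js x)" by (intro cSUP_upper[OF x] bdd) auto
    then show "0 \<le> (SUP x\<in>Rd d. ?f js x)" by (rule order_trans[rotated]) simp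
  qed (rule fin)
  finally show ?thesis .
qed

text \<open>Derivatives up to order k supply the weight in \<xi>, and d + 1 further powers of the
  spatial weight make each of them integrable, whence the order k + d + 1. That C is independent of
  \<open>\<phi>\<close> is what \<open>synth_tempered\<close> relies on.\<close>

lemma fourier_decay:
  assumes d: "d > 0"
  shows "\<exists>C\<ge>0. \<forall>\<phi>\<in>schwartz d. \<forall>\<xi>. (1 + enorm d \<xi>) ^ k * cmod (fourier d \<phi> \<xi>) \<le> C * schwartz_norm d (k + d + 1) \<phi>"
proof -
  let ?I = "LINT x|leb d. 1 / (1 + enorm d x) ^ (d + 1)"
  have I0: "?I \<ge> 0" by (intro integral_nonneg_AE AE_I2) simp
  have A: "cmod (fourier d (pdiffs is \<phi>) \<xi>) \<le> schwartz_norm d (k + d + 1) \<phi> * ?I"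
    if \<phi>: "\<phi> \<in> schwartz d" and "is": "is \<in> lists {..<d}" "length is \<le> k" for \<phi> "is" \<xi>
  proof -
    have "(LINT x|leb d. cmod (pdiffs is \<phi> x)) \<le> schwartz_norm d (k + d + 1) \<phi> * ?I"
    proof (rule schwartz_L1_bound[OF d schwartz_pdiffs[OF \<phi> "is"(1)]])
      fix x assume x: "x \<in> Rd d"
      have "(1 + enorm d x) ^ (d + 1) * cmod (pdiffs is \<phi> x) \<le> (1 + enorm d x) ^ (k + d + 1) * cmod (pdiffs is \<phi> x)"
        by (intro mult_right_mono power_increasing) auto
      also have "\<dots> \<le> schwartz_norm d (k + d + 1) \<phi>"
        by (rule schwartz_norm_ge[OF \<phi> "is"(1) _ x]) (use "is" in auto)
      finally show "(1 + enorm d x) ^ (d + 1) * cmod (pdiffs is \<phi> x) \<le> schwartz_norm d (k + d + 1) \<phi>" .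
    qed
    then show ?thesis
      using cmod_fourier_le[OF schwartz_integrable[OF d schwartz_pdiffs[OF \<phi> "is"(1)]], of \<xi>] by linarith
  qed
  have B: "fourier d (pdiffs (replicate j i) \<phi>) \<xi> = (\<i> * of_real (\<xi> i)) ^ j * fourier d \<phi> \<xi>"
    if \<phi>: "\<phi> \<in> schwartz d" and i: "i < d" for \<phi> i j \<xi>
  proof (induction j)
    case (Suc j)
    have "pdiffs (replicate j i) \<phi> \<in> schwartz d" by (rule schwartz_pdiffs[OF \<phi>]) (use i in auto)
    then show ?case using fourier_pdiff[OF d _ i, of "pdiffs (replicate j i) \<phi>" \<xi>] Suc by simp
  qed simp
  let ?C = "(1 + real d) ^ k * ((1 + real d) * ?I)"
  have "(1 + enorm d \<xi>) ^ k * cmod (fourier d \<phi> \<xi>) \<le> ?C * schwartz_norm d (k + d + 1) \<phi>"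
    if \<phi>: "\<phi> \<in> schwartz d" for \<phi> \<xi>
  proof -
    let ?S = "schwartz_norm d (k + d + 1) \<phi> * ?I"
    have "(1 + enorm d \<xi>) ^ k * cmod (fourier d \<phi> \<xi>)
       \<le> (1 + real d) ^ k * (1 + (\<Sum>i<d. \<bar>\<xi> i\<bar> ^ k)) * cmod (fourier d \<phi> \<xi>)"
      by (intro mult_right_mono power_enorm_le) auto
    also have "\<dots> = (1 + real d) ^ k * (cmod (fourier d \<phi> \<xi>) + (\<Sum>i<d. cmod (fourier d (pdiffs (replicate k i) \<phi>) \<xi>)))"
      by (simp add: B[OF \<phi>] norm_mult norm_power distrib_left distrib_right sum_distrib_right)
    also have "\<dots> \<le> (1 + real d) ^ k * (?S + (\<Sum>i<d. ?S))"
      using A[OF \<phi>, of "[]" \<xi>]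
      by (intro mult_left_mono add_mono sum_mono A[OF \<phi>]) auto
    also have "\<dots> = ?C * schwartz_norm d (k + d + 1) \<phi>" by (simp add: algebra_simps)
    finally show ?thesis .
  qed
  then show ?thesis using I0 by (intro exI[of _ ?C]) auto
qed

lemma fourier_schwartz:
  assumes d: "d > 0" and "\<phi> \<in> schwartz d"
  shows "fourier d \<phi> \<in> schwartz d"
proof (rule schwartz_coinduct[where S="fourier d ` schwartz d"])
  show "fourier d \<phi> \<in> fourier d ` schwartz d" using assms by blast
  fix f assume "f \<in> fourier d ` schwartz d"
  then obtain \<phi> where f: "f = fourier d \<phi>" and s: "\<phi> \<in> schwartz d" by auto
  show "f x = 0" if "x \<notin> Rd d" for x using that by (simp add: f fourier_def)
  show "continuous_on (Rd d) f" unfolding f by (intro fourier_continuous schwartz_integrable d s)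
  show "\<exists>C. \<forall>x\<in>Rd d. (1 + enorm d x) ^ k * cmod (f x) \<le> C" for k
    using fourier_decay[OF d, of k] s unfolding f by blast
  show "(\<lambda>s. f (x(i := s))) differentiable at (x i)" if "x \<in> Rd d" "i < d" for x i
    unfolding f using fourier_deriv[OF d s that(2,1)] by (rule differentiableI_vector)
  show "pdiff i f \<in> fourier d ` schwartz d" if "i < d" for i
    unfolding f pdiff_fourier[OF d s that]
    using schwartz_scale(1)[OF schwartz_coord_mult[OF s that], of "- \<i>"] by blast
qed

section \<open>Fourier inversion\<close>

text \<open>The characteristic function of the standard normal law, freed of the normalising
  factor.\<close>

lemma integral_cis_gaussian:
  "(LINT x|lborel. cis (t * x) * of_real (exp (- x\<^sup>2 / 2))) = complex_of_real (sqrt (2 * pi) * exp (- t\<^sup>2 / 2))"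
proof -
  have "complex_of_real (exp (- t\<^sup>2 / 2)) = char std_normal_distribution t"
    by (simp add: char_std_normal_distribution)
  also have "\<dots> = (LINT x|lborel. std_normal_density x *\<^sub>R iexp (t * x))"
    unfolding char_def by (subst integral_density) (auto intro!: AE_I2)
  also have "\<dots> = (LINT x|lborel. of_real (1 / sqrt (2 * pi)) * (cis (t * x) * of_real (exp (- x\<^sup>2 / 2))))"
    by (intro Bochner_Integration.integral_cong refl) (simp add: std_normal_density_def scaleR_conv_of_real cis_conv_exp)
  also have "\<dots> = of_real (1 / sqrt (2 * pi)) * (LINT x|lborel. cis (t * x) * of_real (exp (- x\<^sup>2 / 2)))"
    by (rule integral_mult_right_zero)
  finally show ?thesis by (simp add: field_simps)
qed

lemma integrable_gaussian: "integrable lborel (\<lambda>x::real. exp (- x\<^sup>2 / 2))"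
proof -
  have "integrable lborel (\<lambda>x. sqrt (2 * pi) * std_normal_density x)"
    by (intro integrable_mult_right) (simp add: integrable_normal_density)
  then show ?thesis by (simp add: std_normal_density_def)
qed

lemma integrable_gaussian_scaled:
  assumes "n > 0" shows "integrable lborel (\<lambda>x::real. exp (- (x / n)\<^sup>2 / 2))"
  using lborel_integrable_real_affine[OF integrable_gaussian, of "1 / n" 0] assms by simp

lemma integral_cis_gaussian_scaled:
  assumes "n > 0"
  shows "(LINT x|lborel. cis (t * x) * of_real (exp (- (x / n)\<^sup>2 / 2))) = complex_of_real (n * sqrt (2 * pi) * exp (- (n * t)\<^sup>2 / 2))"
proof -
  have "(LINT x|lborel. cis (t * x) * of_real (exp (- (x / n)\<^sup>2 / 2)))
    = \<bar>n\<bar> *\<^sub>R (LINT x|lborel. cis (t * (0 + n * x)) * of_real (exp (- ((0 + n * x) / n)\<^sup>2 / 2)))"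
    using assms by (intro lborel_integral_real_affine) auto
  also have "(LINT x|lborel. cis (t * (0 + n * x)) * of_real (exp (- ((0 + n * x) / n)\<^sup>2 / 2)))
    = (LINT x|lborel. cis ((n * t) * x) * of_real (exp (- x\<^sup>2 / 2)))"
    using assms by (simp add: mult_ac)
  finally show ?thesis
    using assms unfolding integral_cis_gaussian by (simp add: scaleR_conv_of_real)
qed

lemma integrable_leb_prod:
  fixes f :: "nat \<Rightarrow> real \<Rightarrow> 'b::{real_normed_field,banach,second_countable_topology}"
  assumes "\<And>i. i < d \<Longrightarrow> integrable lborel (f i)"
  shows "integrable (leb d) (\<lambda>x. \<Prod>i<d. f i (x i))"
proof -
  have [measurable]: "f i \<in> borel_measurable borel" if "i < d" for i
    using assms[OF that] by auto
  have m: "(\<lambda>x::point. \<Prod>i<d. f i (x i)) \<in> borel_measurable borel"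
  proof (rule borel_measurable_prod)
    fix i assume "i \<in> {..<d}"
    then show "(\<lambda>x::point. f i (x i)) \<in> borel_measurable borel"
      by (intro measurable_compose[OF measurable_product_coordinates, of "f i"]) simp
  qed
  have "integrable (Pi\<^sub>M {..<d} (\<lambda>_. lborel)) (\<lambda>x. \<Prod>i<d. f i (x i))"
    by (rule lborel_prod.product_integrable_prod) (use assms in auto)
  then have "integrable (Pi\<^sub>M {..<d} (\<lambda>_. lborel)) (\<lambda>x. \<Prod>i<d. f i (extend0 d x i))"
    by simp
  then show ?thesis
    unfolding leb_def by (subst integrable_distr_eq) (auto intro: m)
qed

lemma integrable_pair_product:
  fixes f g :: "point \<Rightarrow> complex" and k :: "point \<times> point \<Rightarrow> complex"
  assumes f: "integrable (leb d) f" and g: "integrable (leb d) g"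
    and [measurable]: "k \<in> borel_measurable (leb d \<Otimes>\<^sub>M leb d)" and k: "\<And>z. cmod (k z) \<le> 1"
  shows "integrable (leb d \<Otimes>\<^sub>M leb d) (\<lambda>(x, y). k (x, y) * f x * g y)"
proof (rule Bochner_Integration.integrable_bound)
  have [measurable]: "f \<in> borel_measurable borel" "g \<in> borel_measurable borel" using f g by auto
  show "integrable (leb d \<Otimes>\<^sub>M leb d) (\<lambda>(x, y). cmod (f x) * cmod (g y))"
  proof (rule leb_pair.Fubini_integrable)
    show "integrable (leb d) (\<lambda>x. LINT y|leb d. norm (case (x, y) of (x, y) \<Rightarrow> cmod (f x) * cmod (g y)))"
      using f by (simp add: abs_mult)
    show "AE x in leb d. integrable (leb d) (\<lambda>y. case (x, y) of (x, y) \<Rightarrow> cmod (f x) * cmod (g y))"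
      using g by simp
  qed measurable
  show "(\<lambda>(x, y). k (x, y) * f x * g y) \<in> borel_measurable (leb d \<Otimes>\<^sub>M leb d)" by measurable
  show "AE z in leb d \<Otimes>\<^sub>M leb d. norm (case z of (x, y) \<Rightarrow> k (x, y) * f x * g y) \<le> norm (case z of (x, y) \<Rightarrow> cmod (f x) * cmod (g y))"
  proof (rule AE_I2, clarify)
    fix x y
    have "cmod (k (x, y)) * (cmod (f x) * cmod (g y)) \<le> 1 * (cmod (f x) * cmod (g y))"
      by (intro mult_right_mono k) auto
    then show "norm (k (x, y) * f x * g y) \<le> norm (cmod (f x) * cmod (g y))"
      by (simp add: norm_mult mult.assoc)
  qed
qed

lemma tendsto_point:
  fixes f :: "'a \<Rightarrow> point"
  assumes "\<And>i. ((\<lambda>n. f n i) \<longlongrightarrow> l i) F"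
  shows "(f \<longlongrightarrow> l) F"
proof -
  have "limitin (product_topology (\<lambda>_. euclidean) UNIV) f l F"
    using assms by (simp add: limitin_componentwise)
  then show ?thesis by (simp add: euclidean_product_topology)
qed

text \<open>The integral is regularised by the factor \<open>exp (- |\<xi>|\<^sup>2 / (2 n\<^sup>2))\<close>; after Fubini and a
  rescaling it is the average of \<open>\<phi>\<close> against a Gaussian concentrating at \<open>x\<close>.\<close>

lemma fourier_inversion:
  fixes \<phi> :: "point \<Rightarrow> complex"
  assumes d: "d > 0" and \<phi>: "\<phi> \<in> schwartz d" and x: "x \<in> Rd d"
  shows "(LINT \<xi>|leb d. cis (\<Sum>i<d. x i * \<xi> i) * fourier d \<phi> \<xi>) = of_real ((2 * pi) ^ d) * \<phi> x"
proof -
  \<comment> \<open>A product of one-dimensional Gaussians, so that the inner integral after Fubini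
    factorises over the coordinates.\<close>
  define G where "G n \<xi> = (\<Prod>i<d. complex_of_real (exp (- (\<xi> i / real (Suc n))\<^sup>2 / 2)))" for n :: nat and \<xi> :: point
  have [measurable]: "\<phi> \<in> borel_measurable borel" "fourier d \<phi> \<in> borel_measurable borel"
    using schwartz_measurable[OF \<phi>] schwartz_measurable[OF fourier_schwartz[OF d \<phi>]] by auto
  have Gint: "integrable (leb d) (G n)" for n
    unfolding G_def by (intro integrable_leb_prod integrable_of_real integrable_gaussian_scaled) auto
  have [measurable]: "G n \<in> borel_measurable borel" for n using Gint[of n] by auto
  have G1: "cmod (G n \<xi>) \<le> 1" for n \<xi>
    unfolding G_def prod_norm[symmetric] by (intro prod_le_1) auto
  have Fint: "integrable (leb d) (fourier d \<phi>)" by (intro schwartz_integrable fourier_schwartz d \<phi>)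
  have L1: "(\<lambda>n. LINT \<xi>|leb d. cis (\<Sum>i<d. x i * \<xi> i) * fourier d \<phi> \<xi> * G n \<xi>)
      \<longlonglongrightarrow> (LINT \<xi>|leb d. cis (\<Sum>i<d. x i * \<xi> i) * fourier d \<phi> \<xi>)"
  proof (rule integral_dominated_convergence[where w="\<lambda>\<xi>. cmod (fourier d \<phi> \<xi>)"])
    show "AE \<xi> in leb d. (\<lambda>n. cis (\<Sum>i<d. x i * \<xi> i) * fourier d \<phi> \<xi> * G n \<xi>) \<longlonglongrightarrow> cis (\<Sum>i<d. x i * \<xi> i) * fourier d \<phi> \<xi>"
    proof (rule AE_I2)
      fix \<xi> :: point
      have "(\<lambda>n. \<xi> i / real (Suc n)) \<longlonglongrightarrow> 0" for i
        using tendsto_mult_right_zero[OF LIMSEQ_inverse_real_of_nat, of "\<xi> i"] by (simp add: divide_inverse)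
      then have "(\<lambda>n. complex_of_real (exp (- (\<xi> i / real (Suc n))\<^sup>2 / 2))) \<longlonglongrightarrow> complex_of_real (exp (- 0\<^sup>2 / 2))" for i
        by (intro tendsto_intros) auto
      then have "(\<lambda>n. G n \<xi>) \<longlonglongrightarrow> (\<Prod>i<d. complex_of_real (exp (- 0\<^sup>2 / 2)))"
        unfolding G_def by (intro tendsto_prod)
      from tendsto_mult_left[OF this, of "cis (\<Sum>i<d. x i * \<xi> i) * fourier d \<phi> \<xi>"]
      show "(\<lambda>n. cis (\<Sum>i<d. x i * \<xi> i) * fourier d \<phi> \<xi> * G n \<xi>) \<longlonglongrightarrow> cis (\<Sum>i<d. x i * \<xi> i) * fourier d \<phi> \<xi>"
        by simp
    qed
    show "AE \<xi> in leb d. cmod (cis (\<Sum>i<d. x i * \<xi> i) * fourier d \<phi> \<xi> * G n \<xi>) \<le> cmod (fourier d \<phi> \<xi>)" for n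
      using mult_left_mono[OF G1, of "cmod (fourier d \<phi> _)" n] by (intro AE_I2) (simp add: norm_mult)
  qed (use Fint in \<open>auto intro!: borel_measurable_times borel_measurable_cis borel_measurable_ip\<close>)
  define \<gamma> where "\<gamma> z = (\<Prod>i<d. complex_of_real (exp (- (z i)\<^sup>2 / 2)))" for z :: point
  have \<gamma>int: "integrable (leb d) \<gamma>"
    unfolding \<gamma>_def by (intro integrable_leb_prod integrable_of_real integrable_gaussian)
  have [measurable]: "\<gamma> \<in> borel_measurable borel" using \<gamma>int by auto
  have \<gamma>I: "(LINT z|leb d. \<gamma> z) = of_real (sqrt (2 * pi)) ^ d"
    unfolding \<gamma>_def using integral_cis_gaussian[of 0]
    by (subst integral_leb_prod[OF integrable_of_real[OF integrable_gaussian]]) auto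
  define t where "t n z = (\<lambda>i. x i + 1 / real (Suc n) * z i)" for n :: nat and z :: point
  have E: "(LINT \<xi>|leb d. cis (\<Sum>i<d. x i * \<xi> i) * fourier d \<phi> \<xi> * G n \<xi>)
     = of_real (sqrt (2 * pi)) ^ d * (LINT z|leb d. \<phi> (t n z) * \<gamma> z)" for n
  proof -
    let ?k = "\<lambda>(\<xi>, y). cis (\<Sum>i<d. (x i - y i) * \<xi> i)"
    have "(LINT \<xi>|leb d. cis (\<Sum>i<d. x i * \<xi> i) * fourier d \<phi> \<xi> * G n \<xi>)
       = (LINT \<xi>|leb d. (LINT y|leb d. ?k (\<xi>, y) * G n \<xi> * \<phi> y))"
    proof (rule integral_cong_AE)
      show "AE \<xi> in leb d. cis (\<Sum>i<d. x i * \<xi> i) * fourier d \<phi> \<xi> * G n \<xi> = (LINT y|leb d. ?k (\<xi>, y) * G n \<xi> * \<phi> y)"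
        using AE_leb_Rd
      proof eventually_elim
        case (elim \<xi>)
        have "cis (\<Sum>i<d. x i * \<xi> i) * fourier d \<phi> \<xi> * G n \<xi>
          = (LINT y|leb d. (cis (\<Sum>i<d. x i * \<xi> i) * G n \<xi>) * (cis (- (\<Sum>i<d. y i * \<xi> i)) * \<phi> y))"
          unfolding fourier_eq[OF elim] integral_mult_right_zero by simp
        also have "\<dots> = (LINT y|leb d. ?k (\<xi>, y) * G n \<xi> * \<phi> y)"
        proof (intro Bochner_Integration.integral_cong refl)
          fix y
          have "cis (\<Sum>i<d. (x i - y i) * \<xi> i) = cis (\<Sum>i<d. x i * \<xi> i) * cis (- (\<Sum>i<d. y i * \<xi> i))"
            by (simp add: cis_mult left_diff_distrib sum_subtractf)
          then show "(cis (\<Sum>i<d. x i * \<xi> i) * G n \<xi>) * (cis (- (\<Sum>i<d. y i * \<xi> i)) * \<phi> y) = ?k (\<xi>, y) * G n \<xi> * \<phi> y"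
            by simp
        qed
        finally show ?case .
      qed
    qed measurable
    also have "\<dots> = (LINT y|leb d. (LINT \<xi>|leb d. ?k (\<xi>, y) * G n \<xi> * \<phi> y))"
    proof (rule leb_pair.Fubini_integral[symmetric])
      have "(\<lambda>(\<xi>, y). \<lambda>i. x i - y i) \<in> borel_measurable (leb d \<Otimes>\<^sub>M leb d)"
        by measurable
      then have km: "?k \<in> borel_measurable (leb d \<Otimes>\<^sub>M leb d)"
        using borel_measurable_ip[of "\<lambda>(\<xi>, y). \<lambda>i. x i - y i" "leb d \<Otimes>\<^sub>M leb d" fst d]
        by (auto simp: case_prod_unfold intro!: borel_measurable_cis)
      show "integrable (leb d \<Otimes>\<^sub>M leb d) (\<lambda>(\<xi>, y). ?k (\<xi>, y) * G n \<xi> * \<phi> y)"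
        by (rule integrable_pair_product[OF Gint schwartz_integrable[OF d \<phi>] km]) auto
    qed
    also have "\<dots> = (LINT y|leb d. \<phi> y * (\<Prod>i<d. complex_of_real (real (Suc n) * sqrt (2 * pi) * exp (- (real (Suc n) * (x i - y i))\<^sup>2 / 2))))"
    proof (intro Bochner_Integration.integral_cong refl)
      fix y
      have "(LINT \<xi>|leb d. ?k (\<xi>, y) * G n \<xi>) = (LINT \<xi>|leb d. (\<Prod>i<d. cis ((x i - y i) * \<xi> i) * of_real (exp (- (\<xi> i / real (Suc n))\<^sup>2 / 2))))"
        unfolding G_def prod.distrib by (simp add: cis_conv_exp sum_distrib_left exp_sum)
      also have "\<dots> = (\<Prod>i<d. LINT s|lborel. cis ((x i - y i) * s) * of_real (exp (- (s / real (Suc n))\<^sup>2 / 2)))"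
        by (rule integral_leb_prod) (intro integrable_cis_mult integrable_of_real integrable_gaussian_scaled; simp)
      also have "\<dots> = (\<Prod>i<d. complex_of_real (real (Suc n) * sqrt (2 * pi) * exp (- (real (Suc n) * (x i - y i))\<^sup>2 / 2)))"
        by (intro prod.cong refl integral_cis_gaussian_scaled) simp
      finally show "(LINT \<xi>|leb d. ?k (\<xi>, y) * G n \<xi> * \<phi> y) = \<phi> y * (\<Prod>i<d. complex_of_real (real (Suc n) * sqrt (2 * pi) * exp (- (real (Suc n) * (x i - y i))\<^sup>2 / 2)))"
        by (simp add: mult.commute)
    qed
    also have "\<dots> = \<bar>1 / real (Suc n)\<bar> ^ d *\<^sub>R (LINT z|leb d. \<phi> (t n z) * (\<Prod>i<d. complex_of_real (real (Suc n) * sqrt (2 * pi) * exp (- (real (Suc n) * (x i - t n z i))\<^sup>2 / 2))))"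
      unfolding t_def by (rule integral_leb_affine[OF x]) (simp, measurable)
    also have "(LINT z|leb d. \<phi> (t n z) * (\<Prod>i<d. complex_of_real (real (Suc n) * sqrt (2 * pi) * exp (- (real (Suc n) * (x i - t n z i))\<^sup>2 / 2))))
      = (LINT z|leb d. of_real ((real (Suc n) * sqrt (2 * pi)) ^ d) * (\<phi> (t n z) * \<gamma> z))"
    proof (intro Bochner_Integration.integral_cong refl)
      fix z
      have "real (Suc n) * (x i - t n z i) = - z i" for i by (simp add: t_def field_simps)
      then show "\<phi> (t n z) * (\<Prod>i<d. complex_of_real (real (Suc n) * sqrt (2 * pi) * exp (- (real (Suc n) * (x i - t n z i))\<^sup>2 / 2)))
        = of_real ((real (Suc n) * sqrt (2 * pi)) ^ d) * (\<phi> (t n z) * \<gamma> z)"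
        unfolding \<gamma>_def by (simp add: prod.distrib power_mult_distrib del: of_nat_Suc)
    qed
    also have "\<dots> = of_real ((real (Suc n) * sqrt (2 * pi)) ^ d) * (LINT z|leb d. \<phi> (t n z) * \<gamma> z)"
      by (rule integral_mult_right_zero)
    finally show ?thesis
      by (simp add: scaleR_conv_of_real power_mult_distrib power_divide del: of_nat_Suc)
  qed
  have "(\<lambda>n. LINT z|leb d. \<phi> (t n z) * \<gamma> z) \<longlonglongrightarrow> (LINT z|leb d. \<phi> x * \<gamma> z)"
  proof -
    obtain C where C: "\<And>x. cmod (\<phi> x) \<le> C" using schwartz_decay[OF \<phi>, of 0] by auto
    show ?thesis
    proof (rule integral_dominated_convergence[where w="\<lambda>z. C * cmod (\<gamma> z)"])
      show "AE z in leb d. (\<lambda>n. \<phi> (t n z) * \<gamma> z) \<longlonglongrightarrow> \<phi> x * \<gamma> z"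
        using AE_leb_Rd
      proof eventually_elim
        case (elim z)
        have "(\<lambda>n. x i + 1 / real (Suc n) * z i) \<longlonglongrightarrow> x i + 0 * z i" for i
          using LIMSEQ_inverse_real_of_nat by (intro tendsto_intros) (simp add: divide_inverse)
        then have "((\<lambda>n. t n z) \<longlongrightarrow> x) sequentially"
          unfolding t_def by (intro tendsto_point) simp
        moreover have "t n z \<in> Rd d" for n using x elim by (simp add: t_def Rd_iff)
        ultimately have "(\<lambda>n. \<phi> (t n z)) \<longlonglongrightarrow> \<phi> x"
          by (intro continuous_on_tendsto_compose[OF schwartz_cont[OF \<phi>]] x always_eventually allI) auto
        then show ?case by (rule tendsto_mult_right)
      qed
      show "AE z in leb d. norm (\<phi> (t n z) * \<gamma> z) \<le> C * cmod (\<gamma> z)" for n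
        using C by (intro AE_I2) (auto simp: norm_mult intro!: mult_right_mono)
      have [measurable]: "t n \<in> borel_measurable borel" for n unfolding t_def by measurable
      show "(\<lambda>z. \<phi> (t n z) * \<gamma> z) \<in> borel_measurable (leb d)" for n by measurable
    qed (use \<gamma>int in auto)
  qed
  then have "(\<lambda>n. of_real (sqrt (2 * pi)) ^ d * (LINT z|leb d. \<phi> (t n z) * \<gamma> z)) \<longlonglongrightarrow> of_real (sqrt (2 * pi)) ^ d * (\<phi> x * of_real (sqrt (2 * pi)) ^ d)"
    unfolding integral_mult_right_zero \<gamma>I by (rule tendsto_mult_left)
  \<comment> \<open>One factor (2 pi)^(d/2) comes from transforming \<open>G n\<close>, the other
    one is the total mass of \<open>\<gamma>\<close>.\<close>
  moreover have "of_real (sqrt (2 * pi)) ^ d * (\<phi> x * of_real (sqrt (2 * pi)) ^ d) = of_real ((2 * pi) ^ d) * \<phi> x"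
  proof -
    have "complex_of_real ((2 * pi) ^ d) = of_real ((sqrt (2 * pi) * sqrt (2 * pi)) ^ d)" by simp
    also have "\<dots> = of_real (sqrt (2 * pi)) ^ d * of_real (sqrt (2 * pi)) ^ d"
      by (simp only: power_mult_distrib of_real_mult of_real_power)
    finally show ?thesis by (simp only: mult_ac)
  qed
  ultimately show ?thesis
    using L1 unfolding E by (simp add: LIMSEQ_unique)
qed

definition inv_fourier :: "nat \<Rightarrow> (point \<Rightarrow> complex) \<Rightarrow> point \<Rightarrow> complex" where
  "inv_fourier d \<psi> \<xi> = fourier d \<psi> (\<lambda>k. - \<xi> k) / of_real ((2 * pi) ^ d)"

lemma fourier_fourier:
  fixes \<phi> :: "point \<Rightarrow> complex"
  assumes d: "d > 0" and \<phi>: "\<phi> \<in> schwartz d"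
  shows "fourier d (fourier d \<phi>) x = of_real ((2 * pi) ^ d) * \<phi> (\<lambda>k. - x k)"
proof (cases "x \<in> Rd d")
  case True
  then show ?thesis
    using fourier_inversion[OF d \<phi>, of "\<lambda>k. - x k"] by (simp add: fourier_eq sum_negf mult.commute)
next
  case False
  then show ?thesis using schwartz_zero[OF \<phi>, of "\<lambda>k. - x k"] by (simp add: fourier_def)
qed

lemma fourier_reflect:
  assumes "\<phi> \<in> borel_measurable borel"
  shows "fourier d (\<lambda>x. \<phi> (\<lambda>k. - x k)) \<xi> = fourier d \<phi> (\<lambda>k. - \<xi> k)"
proof (cases "\<xi> \<in> Rd d")
  case True
  note [measurable] = assms
  have z: "(\<lambda>_. 0) \<in> Rd d" by (simp add: Rd_iff)
  have "(LINT x|leb d. cis (- (\<Sum>i<d. x i * - \<xi> i)) * \<phi> x) = \<bar>-1\<bar> ^ d *\<^sub>R (LINT x|leb d. cis (- (\<Sum>i<d. (0 + (-1) * x i) * - \<xi> i)) * \<phi> (\<lambda>i. 0 + (-1) * x i))"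
    by (rule integral_leb_affine[OF z]) (simp, measurable)
  then show ?thesis using True by (simp add: fourier_eq)
qed (simp add: fourier_def)

lemma inv_fourier_schwartz:
  assumes "d > 0" "\<psi> \<in> schwartz d" shows "inv_fourier d \<psi> \<in> schwartz d"
  using schwartz_scale(1)[OF schwartz_reflect[OF fourier_schwartz[OF assms]], of "1 / of_real ((2 * pi) ^ d)"]
  by (simp add: inv_fourier_def[abs_def])

lemma fourier_inv_fourier:
  assumes "d > 0" "\<psi> \<in> schwartz d" shows "fourier d (inv_fourier d \<psi>) = \<psi>"
proof
  fix x
  have m: "fourier d \<psi> \<in> borel_measurable borel" by (intro schwartz_measurable[of _ d] fourier_schwartz assms)
  have "fourier d (inv_fourier d \<psi>) x = fourier d (\<lambda>\<xi>. fourier d \<psi> (\<lambda>k. - \<xi> k)) x / of_real ((2 * pi) ^ d)"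
    unfolding inv_fourier_def fourier_def by simp
  also have "\<dots> = \<psi> x"
    unfolding fourier_reflect[OF m] fourier_fourier[OF assms] by simp
  finally show "fourier d (inv_fourier d \<psi>) x = \<psi> x" .
qed

lemma inv_fourier_fourier:
  assumes "d > 0" "\<phi> \<in> schwartz d" shows "inv_fourier d (fourier d \<phi>) = \<phi>"
  by (rule ext) (simp add: inv_fourier_def fourier_fourier[OF assms])

section \<open>Uniqueness of densities\<close>

text \<open>A family that can be made stable under \<open>pdiff\<close> by keeping \<open>Q\<close>
  fixed, and that contains smooth approximations of box indicators. It takes the place of compactly
  supported bump functions as a supply of test functions.\<close>

definition tensor :: "nat \<Rightarrow> (nat \<Rightarrow> real poly) \<Rightarrow> (nat \<Rightarrow> real poly) \<Rightarrow> point \<Rightarrow> complex" where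
  "tensor d P Q x = (if x \<in> Rd d then \<Prod>i<d. of_real (poly (P i) (x i) * exp (- poly (Q i) (x i))) else 0)"

lemma poly_growth:
  fixes P :: "real poly"
  shows "\<exists>C m. C \<ge> 0 \<and> (\<forall>y. \<bar>poly P y\<bar> \<le> C * (1 + \<bar>y\<bar>) ^ m)"
proof (induction P)
  case 0
  show ?case by (intro exI[of _ 0]) auto
next
  case (pCons a P)
  then obtain C m where C: "C \<ge> 0" "\<And>y. \<bar>poly P y\<bar> \<le> C * (1 + \<bar>y\<bar>) ^ m" by auto
  have "\<bar>poly (pCons a P) y\<bar> \<le> (\<bar>a\<bar> + C) * (1 + \<bar>y\<bar>) ^ (m + 1)" for y
  proof -
    have "\<bar>poly (pCons a P) y\<bar> \<le> \<bar>a\<bar> + \<bar>y\<bar> * \<bar>poly P y\<bar>"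
      using abs_triangle_ineq[of a "y * poly P y"] by (simp add: abs_mult)
    also have "\<dots> \<le> \<bar>a\<bar> * (1 + \<bar>y\<bar>) ^ (m + 1) + (1 + \<bar>y\<bar>) * (C * (1 + \<bar>y\<bar>) ^ m)"
      using C mult_left_mono[OF one_le_power[of "1 + \<bar>y\<bar>" "m + 1"], of "\<bar>a\<bar>"]
      by (intro add_mono mult_mono) auto
    finally show ?thesis by (simp add: algebra_simps)
  qed
  then show ?case using C by (intro exI[of _ "\<bar>a\<bar> + C"] exI[of _ "m + 1"]) auto
qed

lemma power_le_fact_exp:
  assumes "x \<ge> (0::real)" shows "x ^ n \<le> fact n * exp x"
proof -
  have "(\<Sum>k\<in>{n}. x ^ k /\<^sub>R fact k) \<le> (\<Sum>k. x ^ k /\<^sub>R fact k)"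
    using assms by (intro sum_le_suminf summable_exp_generic) auto
  then show ?thesis by (simp add: exp_def field_simps)
qed

lemma poly_exp_bounded:
  fixes P :: "real poly"
  assumes R: "R > 0" and n: "n > 0"
  shows "\<exists>B\<ge>0. \<forall>y. (1 + \<bar>y\<bar>) ^ k * \<bar>poly P y * exp (- (((y - c) / R) ^ (2 * n)))\<bar> \<le> B"
proof -
  obtain C m where C: "C \<ge> 0" "\<And>y. \<bar>poly P y\<bar> \<le> C * (1 + \<bar>y\<bar>) ^ m" using poly_growth by blast
  define D where "D = 1 + \<bar>c\<bar> + R"
  have D: "D \<ge> 0" using R by (simp add: D_def)
  define B where "B = C * D ^ (k + m) * (fact (k + m) * exp (9 / 4))"
  have "(1 + \<bar>y\<bar>) ^ k * \<bar>poly P y * exp (- (((y - c) / R) ^ (2 * n)))\<bar> \<le> B" for y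
  proof -
    define z where "z = (y - c) / R"
    have "y = R * z + c" using R by (simp add: z_def)
    then have "\<bar>y\<bar> \<le> R * \<bar>z\<bar> + \<bar>c\<bar>" using abs_triangle_ineq[of "R * z" c] R by (simp add: abs_mult)
    then have y: "1 + \<bar>y\<bar> \<le> D * (1 + \<bar>z\<bar>)"
      using R by (simp add: D_def algebra_simps) (smt (verit) mult_nonneg_nonneg abs_ge_zero)
    \<comment> \<open>An even power beats |z| up to a bounded error; any constant from 1 on would
      do. Exponential decay in |z| then absorbs every power of 1 + |z|, and the 9/4 in
      \<open>B\<close> is 1 + 5/4.\<close>
    have "\<bar>z\<bar> - 5 / 4 \<le> z ^ (2 * n)"
    proof (cases "\<bar>z\<bar> \<le> 1")
      case False
      have "\<bar>z\<bar> \<le> \<bar>z\<bar> ^ (2 * n)" using False n by (intro self_le_power) auto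
      then show ?thesis by (simp add: power_even_abs)
    next
      case True
      moreover have "0 \<le> z ^ (2 * n)" by simp
      ultimately show ?thesis by linarith
    qed
    then have e: "exp (- (z ^ (2 * n))) \<le> exp (5 / 4 - \<bar>z\<bar>)" by simp
    have "(1 + \<bar>y\<bar>) ^ k * \<bar>poly P y * exp (- (z ^ (2 * n)))\<bar> \<le> (1 + \<bar>y\<bar>) ^ k * (C * (1 + \<bar>y\<bar>) ^ m * exp (5 / 4 - \<bar>z\<bar>))"
      unfolding abs_mult using C e by (intro mult_left_mono mult_mono) auto
    also have "\<dots> = C * (1 + \<bar>y\<bar>) ^ (k + m) * exp (5 / 4 - \<bar>z\<bar>)" by (simp add: power_add)
    also have "\<dots> \<le> C * (D * (1 + \<bar>z\<bar>)) ^ (k + m) * exp (5 / 4 - \<bar>z\<bar>)"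
      using C y by (intro mult_right_mono mult_left_mono power_mono) auto
    also have "\<dots> = C * D ^ (k + m) * ((1 + \<bar>z\<bar>) ^ (k + m) * exp (5 / 4 - \<bar>z\<bar>))"
      by (simp add: power_mult_distrib)
    also have "\<dots> \<le> C * D ^ (k + m) * (fact (k + m) * exp (1 + \<bar>z\<bar>) * exp (5 / 4 - \<bar>z\<bar>))"
      using C D by (intro mult_left_mono mult_right_mono power_le_fact_exp) auto
    also have "fact (k + m) * exp (1 + \<bar>z\<bar>) * exp (5 / 4 - \<bar>z\<bar>) = fact (k + m) * exp (9 / 4)"
      by (simp add: mult.assoc exp_add[symmetric])
    finally show ?thesis by (simp add: z_def B_def)
  qed
  moreover have "B \<ge> 0" using C D by (simp add: B_def)
  ultimately show ?thesis by blast
qed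

lemma one_plus_enorm_le_prod: "1 + enorm d x \<le> (\<Prod>i<d. 1 + \<bar>x i\<bar>)"
proof -
  have "1 + (\<Sum>i<d. \<bar>x i\<bar>) \<le> (\<Prod>i<d. 1 + \<bar>x i\<bar>)"
  proof (induction d)
    case (Suc d)
    have "1 \<le> (\<Prod>i<d. 1 + \<bar>x i\<bar>)" by (intro prod_ge_1) auto
    then have "\<bar>x d\<bar> \<le> (\<Prod>i<d. 1 + \<bar>x i\<bar>) * \<bar>x d\<bar>" using mult_right_mono[of 1 _ "\<bar>x d\<bar>"] by fastforce
    then show ?case using Suc by (simp add: algebra_simps)
  qed simp
  then show ?thesis using L2_set_le_sum_abs[of x "{..<d}"] by linarith
qed

text \<open>With \<open>Q\<close> fixed, differentiation in coordinate j replaces P_j by P_j' - P_j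
  Q_j', so the family indexed by all \<open>P\<close> is stable. The even powers in \<open>Q\<close>
  provide the decay.\<close>

lemma tensor_schwartz:
  assumes Q: "\<And>i y. i < d \<Longrightarrow> poly (Q i) y = ((y - c i) / R i) ^ (2 * n i)"
    and R: "\<And>i. i < d \<Longrightarrow> R i > 0" and n: "\<And>i. i < d \<Longrightarrow> n i > 0"
  shows "tensor d P Q \<in> schwartz d"
proof (rule schwartz_coinduct[where S="range (\<lambda>P. tensor d P Q)"])
  fix f assume "f \<in> range (\<lambda>P. tensor d P Q)"
  then obtain P where f: "f = tensor d P Q" by auto
  show "f x = 0" if "x \<notin> Rd d" for x using that by (simp add: f tensor_def)
  show "continuous_on (Rd d) f"
  proof -
    have "continuous_on (Rd d) (\<lambda>x. \<Prod>i<d. complex_of_real (poly (P i) (x i) * exp (- poly (Q i) (x i))))"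
      by (intro continuous_intros continuous_on_coord)
    then show ?thesis by (subst continuous_on_cong[OF refl, of _ _ "\<lambda>x. \<Prod>i<d. complex_of_real (poly (P i) (x i) * exp (- poly (Q i) (x i)))"]) (auto simp: f tensor_def)
  qed
  have D: "((\<lambda>s. f (x(j := s))) has_vector_derivative tensor d (P(j := pderiv (P j) - P j * pderiv (Q j))) Q x) (at (x j))"
    if x: "x \<in> Rd d" and j: "j < d" for x j
  proof -
    let ?r = "\<Prod>i\<in>{..<d} - {j}. complex_of_real (poly (P i) (x i) * exp (- poly (Q i) (x i)))"
    have eq: "f (x(j := s)) = of_real (poly (P j) s * exp (- poly (Q j) s)) * ?r" for s
      using upd_in_Rd[OF x j] j unfolding f tensor_def
      by (subst prod.remove[of _ j]) (auto intro!: prod.cong)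
    have "((\<lambda>s. poly (P j) s * exp (- poly (Q j) s)) has_real_derivative
        (poly (pderiv (P j) - P j * pderiv (Q j)) (x j) * exp (- poly (Q j) (x j)))) (at (x j))"
      by (auto intro!: derivative_eq_intros poly_DERIV simp: algebra_simps)
    then have "((\<lambda>s. complex_of_real (poly (P j) s * exp (- poly (Q j) s)) * ?r) has_vector_derivative
        of_real (poly (pderiv (P j) - P j * pderiv (Q j)) (x j) * exp (- poly (Q j) (x j))) * ?r) (at (x j))"
      by (intro has_vector_derivative_mult_left has_vector_derivative_of_real)
         (simp add: has_real_derivative_iff_has_vector_derivative)
    moreover have "tensor d (P(j := pderiv (P j) - P j * pderiv (Q j))) Q x
       = of_real (poly (pderiv (P j) - P j * pderiv (Q j)) (x j) * exp (- poly (Q j) (x j))) * ?r"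
      using x j unfolding tensor_def by (subst prod.remove[of _ j]) (auto intro!: prod.cong)
    ultimately show ?thesis unfolding eq by simp
  qed
  show "(\<lambda>s. f (x(i := s))) differentiable at (x i)" if "x \<in> Rd d" "i < d" for x i
    using D[OF that] by (rule differentiableI_vector)
  show "pdiff i f \<in> range (\<lambda>P. tensor d P Q)" if i: "i < d" for i
  proof -
    have "pdiff i f = tensor d (P(i := pderiv (P i) - P i * pderiv (Q i))) Q"
    proof
      fix x show "pdiff i f x = tensor d (P(i := pderiv (P i) - P i * pderiv (Q i))) Q x"
      proof (cases "x \<in> Rd d")
        case True
        show ?thesis by (rule pdiff_eqI[OF D[OF True i]])
      next
        case False
        then show ?thesis using i pdiff_zero_outside[of d f x i] by (simp add: f tensor_def)
      qed
    qed
    then show ?thesis by blast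
  qed
  show "\<exists>C. \<forall>x\<in>Rd d. (1 + enorm d x) ^ k * cmod (f x) \<le> C" for k
  proof -
    have "\<forall>i\<in>{..<d}. \<exists>B\<ge>0. \<forall>y. (1 + \<bar>y\<bar>) ^ k * \<bar>poly (P i) y * exp (- poly (Q i) y)\<bar> \<le> B"
      using poly_exp_bounded[OF R n, of _ _ k] Q by auto
    then obtain B where B: "\<And>i y. i < d \<Longrightarrow> (1 + \<bar>y\<bar>) ^ k * \<bar>poly (P i) y * exp (- poly (Q i) y)\<bar> \<le> B i"
      by (metis lessThan_iff)
    have "(1 + enorm d x) ^ k * cmod (f x) \<le> (\<Prod>i<d. B i)" if x: "x \<in> Rd d" for x
    proof -
      have "(1 + enorm d x) ^ k * cmod (f x) \<le> (\<Prod>i<d. 1 + \<bar>x i\<bar>) ^ k * cmod (f x)"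
        by (intro mult_right_mono power_mono one_plus_enorm_le_prod) auto
      also have "\<dots> = (\<Prod>i<d. (1 + \<bar>x i\<bar>) ^ k * \<bar>poly (P i) (x i) * exp (- poly (Q i) (x i))\<bar>)"
        using x by (simp add: f tensor_def prod_power_distrib prod.distrib prod_norm[symmetric] norm_mult abs_mult)
      also have "\<dots> \<le> (\<Prod>i<d. B i)" using B by (intro prod_mono) auto
      finally show ?thesis .
    qed
    then show ?thesis by blast
  qed
qed simp

lemma AE_leb_coord_neq: "AE x in leb d. \<forall>i<d. x i \<noteq> a i"
proof -
  have "AE x in leb d. \<forall>i<d. extend0 d (\<lambda>i. - a i) i + 1 * x i \<noteq> 0"
    by (rule AE_leb_affine[OF extend0_in_Rd _ AE_leb_coord_nonzero]) simp
  then show ?thesis by eventually_elim auto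
qed

text \<open>Domination uniform in the exponent: all these functions lie below one multiple of a
  Gaussian.\<close>

lemma exp_even_power_le:
  fixes z :: real
  assumes "n > 0"
  shows "exp (- (z ^ (2 * n))) \<le> exp 1 * exp (- z\<^sup>2)"
proof -
  have "z\<^sup>2 - 1 \<le> z ^ (2 * n)"
  proof (cases "\<bar>z\<bar> \<le> 1")
    case True
    then have "z\<^sup>2 \<le> 1" by (simp add: abs_square_le_1)
    moreover have "0 \<le> z ^ (2 * n)" by simp
    ultimately show ?thesis by linarith
  next
    case False
    then have "\<bar>z\<bar> ^ 2 \<le> \<bar>z\<bar> ^ (2 * n)" using assms by (intro power_increasing) auto
    then show ?thesis by (simp add: power_even_abs)
  qed
  then show ?thesis by (simp add: exp_add[symmetric])
qed

text \<open>The products of exp(-((x_i - c_i)/R_i)^(2n)) tend to the indicator of the box off its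
  boundary, which is a null set. They are dominated by a multiple of the Gaussian among them, whose
  product with \<open>h\<close> is integrable by \<open>z\<close>; the same passage to the limit
  yields integrability of \<open>h\<close> on the box.\<close>

lemma integral_cube_eq_0:
  assumes d: "d > 0" and h: "h \<in> borel_measurable borel"
    and z: "\<And>\<phi>. \<phi> \<in> schwartz d \<Longrightarrow> integrable (leb d) (\<lambda>x. h x * \<phi> x) \<and> (LINT x|leb d. h x * \<phi> x) = 0"
    and R: "\<And>i. i < d \<Longrightarrow> R i > 0"
  shows "set_integrable (leb d) {x. \<forall>i<d. \<bar>x i - c i\<bar> < R i} h"
    and "(LINT x:{x. \<forall>i<d. \<bar>x i - c i\<bar> < R i}|leb d. h x) = 0"
proof -
  let ?B = "{x::point. \<forall>i<d. \<bar>x i - c i\<bar> < R i}"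
  have "?B = {x. \<forall>i<d. x i \<in> {c i - R i<..<c i + R i}}" by (auto simp: abs_less_iff)
  moreover have "{x::point. \<forall>i<d. x i \<in> {c i - R i<..<c i + R i}} \<in> sets borel" by (intro sets_box) auto
  ultimately have [measurable]: "?B \<in> sets borel" by simp
  note [measurable] = h
  define Q where "Q n i = [: - c i / R i, 1 / R i :] ^ (2 * Suc n)" for n :: nat and i
  have Q: "poly (Q n i) y = ((y - c i) / R i) ^ (2 * Suc n)" for n i y
    by (simp add: Q_def diff_divide_distrib del: mult_Suc_right power_Suc)
  define f where "f n = tensor d (\<lambda>_. 1) (Q n)" for n
  have fS: "f n \<in> schwartz d" for n unfolding f_def
    by (rule tensor_schwartz[where c=c and R=R and n="\<lambda>_. Suc n"]) (use Q R in auto)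
  have feq: "f n x = of_real (\<Prod>i<d. exp (- (((x i - c i) / R i) ^ (2 * Suc n))))" if "x \<in> Rd d" for n x
    using that by (simp add: f_def tensor_def Q del: mult_Suc_right power_Suc)
  have dom: "cmod (f n x) \<le> exp 1 ^ d * cmod (f 0 x)" for n x
  proof (cases "x \<in> Rd d")
    case True
    have "cmod (f n x) = (\<Prod>i<d. exp (- (((x i - c i) / R i) ^ (2 * Suc n))))"
      unfolding feq[OF True] norm_of_real by (intro abs_of_nonneg prod_nonneg) auto
    also have "\<dots> \<le> (\<Prod>i<d. exp 1 * exp (- (((x i - c i) / R i) ^ (2 * Suc 0))))"
    proof (intro prod_mono conjI)
      fix i
      have "2 * Suc 0 = 2" by simp
      then show "exp (- (((x i - c i) / R i) ^ (2 * Suc n))) \<le> exp 1 * exp (- (((x i - c i) / R i) ^ (2 * Suc 0)))"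
        using exp_even_power_le[of "Suc n" "(x i - c i) / R i"] by (simp only:)
    qed simp
    also have "\<dots> = exp 1 ^ d * cmod (f 0 x)"
      unfolding feq[OF True] norm_of_real prod.distrib by (subst abs_of_nonneg) (auto intro!: prod_nonneg)
    finally show ?thesis .
  qed (simp add: f_def tensor_def)
  have int0: "integrable (leb d) (\<lambda>x. exp 1 ^ d * cmod (h x * f 0 x))"
    using z[OF fS, of 0] by (intro integrable_mult_right integrable_norm) auto
  have lim: "AE x in leb d. (\<lambda>n. h x * f n x) \<longlonglongrightarrow> indicator ?B x *\<^sub>R h x"
    using AE_leb_coord_neq[of d "\<lambda>i. c i + R i"] AE_leb_coord_neq[of d "\<lambda>i. c i - R i"] AE_leb_Rd
  proof eventually_elim
    case (elim x)
    have one: "(\<lambda>n. exp (- (((x i - c i) / R i) ^ (2 * Suc n)))) \<longlonglongrightarrow> (if \<bar>x i - c i\<bar> < R i then 1 else 0)" if i: "i < d" for i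
    proof -
      define w where "w = ((x i - c i) / R i)\<^sup>2"
      have w: "((x i - c i) / R i) ^ (2 * Suc n) = w ^ Suc n" for n by (simp only: w_def power_mult)
      have ne: "\<bar>x i - c i\<bar> \<noteq> R i" using elim(1,2) i by (auto simp: abs_if split: if_splits)
      show ?thesis
      proof (cases "\<bar>x i - c i\<bar> < R i")
        case True
        then have "\<bar>(x i - c i) / R i\<bar> < 1" using R[OF i] by (simp add: abs_divide)
        then have "w < 1" "w \<ge> 0" by (auto simp: w_def abs_square_less_1)
        then have "(\<lambda>n. w ^ Suc n) \<longlonglongrightarrow> 0" by (intro LIMSEQ_Suc LIMSEQ_power_zero) auto
        then have "(\<lambda>n. exp (- (w ^ Suc n))) \<longlonglongrightarrow> exp (- 0)" by (intro tendsto_intros)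
        then show ?thesis unfolding w using True by (simp del: power_Suc)
      next
        case False
        then have "\<bar>(x i - c i) / R i\<bar> > 1" using R[OF i] ne by (simp add: abs_divide)
        then have "1\<^sup>2 < \<bar>(x i - c i) / R i\<bar>\<^sup>2" by (intro power_strict_mono) auto
        then have "w > 1" unfolding w_def by (simp only: power2_abs one_power2)
        then have "filterlim (\<lambda>n. w ^ Suc n) at_top sequentially"
          using filterlim_compose[OF filterlim_realpow_sequentially_gt1[of w, THEN filterlim_at_infinity_imp_filterlim_at_top] filterlim_Suc]
          by (auto simp: eventually_sequentially)
        then have "((\<lambda>n. exp (- (w ^ Suc n))) \<longlongrightarrow> 0) sequentially"
          by (intro filterlim_compose[OF exp_at_bot] filterlim_compose[OF filterlim_uminus_at_bot_at_top])
        then show ?thesis unfolding w using False by (simp del: power_Suc)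
      qed
    qed
    have "(\<lambda>n. f n x) \<longlonglongrightarrow> of_real (\<Prod>i<d. if \<bar>x i - c i\<bar> < R i then 1 else 0)"
      unfolding feq[OF elim(3)] by (intro tendsto_of_real tendsto_prod one) auto
    also have "(\<Prod>i<d. if \<bar>x i - c i\<bar> < R i then 1 else 0) = (indicator ?B x :: real)"
      by (auto simp: indicator_def prod_zero_iff)
    finally have "(\<lambda>n. h x * f n x) \<longlonglongrightarrow> h x * of_real (indicator ?B x)" by (rule tendsto_mult_left)
    then show ?case by (simp add: scaleR_conv_of_real mult.commute)
  qed
  have bnd: "AE x in leb d. cmod (h x * f n x) \<le> exp 1 ^ d * cmod (h x * f 0 x)" for n
    using mult_left_mono[OF dom, of "cmod (h _)" n] by (intro AE_I2) (simp add: norm_mult mult_ac)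
  have m1: "(\<lambda>x. indicator ?B x *\<^sub>R h x) \<in> borel_measurable (leb d)" by measurable
  have m2: "(\<lambda>x. h x * f n x) \<in> borel_measurable (leb d)" for n
    using z[OF fS, of n] borel_measurable_integrable by blast
  show "set_integrable (leb d) ?B h"
    unfolding set_integrable_def
    by (rule integrable_dominated_convergence[OF m1 m2 int0 lim bnd])
  have "(\<lambda>n. LINT x|leb d. h x * f n x) \<longlonglongrightarrow> (LINT x:?B|leb d. h x)"
    unfolding set_lebesgue_integral_def
    by (rule integral_dominated_convergence[OF m1 m2 int0 lim bnd])
  then show "(LINT x:?B|leb d. h x) = 0"
    using z[OF fS] by (simp add: LIMSEQ_const_iff)
qed


section \<open>From integrals over boxes to almost every point\<close>

lemma sets_PiM_lborel_boxes:
  fixes d :: nat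
  shows
  "sets (Pi\<^sub>M {..<d} (\<lambda>_. lborel :: real measure))
     = sigma_sets (Pi\<^sub>E {..<d} (\<lambda>_. UNIV)) {Pi\<^sub>E {..<d} (\<lambda>i. {l i<..<u i}) | l u. True}"
proof -
  let ?E = "range (\<lambda>(a, b). {a<..<b::real})"
  have b: "(borel :: real measure) = sigma UNIV ?E"
    using borel_eq_box[where 'a=real] by (simp add: box_real)
  have cover: "\<exists>S\<subseteq>?E. countable S \<and> UNIV = \<Union>S"
  proof (intro exI[of _ "range (\<lambda>n::nat. {- real n<..<real n})"] conjI)
    show "UNIV = (\<Union>n::nat. {- real n<..<real n})"
    proof (intro equalityI subsetI)
      fix x :: real
      obtain n :: nat where "\<bar>x\<bar> < real n" using reals_Archimedean2 by blast
      then show "x \<in> (\<Union>n::nat. {- real n<..<real n})" by (auto simp: abs_less_iff intro!: exI[of _ n])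
    qed simp
  qed auto
  have "sets (Pi\<^sub>M {..<d} (\<lambda>_. lborel :: real measure)) = sets (Pi\<^sub>M {..<d} (\<lambda>_. sigma UNIV ?E))"
    by (intro sets_PiM_cong refl) (simp add: b[symmetric])
  also have "\<dots> = sets (sigma (Pi\<^sub>E {..<d} (\<lambda>_. UNIV)) {{f\<in>Pi\<^sub>E {..<d} (\<lambda>_. UNIV). \<forall>i\<in>j. f i \<in> A i} | A j. j \<in> {{..<d}} \<and> A \<in> Pi j (\<lambda>_. ?E)})"
    by (rule sets_PiM_sigma) (rule cover, auto)
  also have "{{f\<in>Pi\<^sub>E {..<d} (\<lambda>_. UNIV). \<forall>i\<in>j. f i \<in> A i} | A j. j \<in> {{..<d}} \<and> A \<in> Pi j (\<lambda>_. ?E)}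
      = {Pi\<^sub>E {..<d} (\<lambda>i. {l i<..<u i}) | l u. True}" (is "?L = ?R")
  proof -
    have E: "{f\<in>Pi\<^sub>E {..<d} (\<lambda>_. UNIV). \<forall>i\<in>{..<d}. f i \<in> A i} = Pi\<^sub>E {..<d} A" for A :: "nat \<Rightarrow> real set"
      by (auto simp: PiE_def Pi_iff)
    show ?thesis
    proof (intro equalityI subsetI)
      fix S assume "S \<in> ?L"
      then obtain A where S: "S = Pi\<^sub>E {..<d} A" and A: "A \<in> Pi {..<d} (\<lambda>_. ?E)"
        using E by auto
      have "\<forall>i\<in>{..<d}. \<exists>l u. A i = {l<..<u}" using A by (fastforce simp: Pi_iff)
      then obtain l u where "\<And>i. i < d \<Longrightarrow> A i = {l i<..<u i}" by (metis lessThan_iff)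
      then have "S = Pi\<^sub>E {..<d} (\<lambda>i. {l i<..<u i})" unfolding S by (intro PiE_cong) auto
      then show "S \<in> ?R" by blast
    next
      fix S assume "S \<in> ?R"
      then obtain l u where S: "S = Pi\<^sub>E {..<d} (\<lambda>i. {l i<..<u i})" by auto
      have "(\<lambda>i. {l i<..<u i}) \<in> Pi {..<d} (\<lambda>_. ?E)"
      proof (rule Pi_I)
        fix i show "{l i<..<u i} \<in> ?E" by (rule range_eqI[of _ _ "(l i, u i)"]) simp
      qed
      then show "S \<in> ?L"
        by (intro CollectI exI[of _ "\<lambda>i. {l i<..<u i}"] exI[of _ "{..<d}"] conjI)
           (simp_all only: S E singletonI)
    qed
  qed
  also have "sets (sigma (Pi\<^sub>E {..<d} (\<lambda>_. UNIV)) {Pi\<^sub>E {..<d} (\<lambda>i. {l i<..<u i}) | l u. True})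
     = sigma_sets (Pi\<^sub>E {..<d} (\<lambda>_. UNIV)) {Pi\<^sub>E {..<d} (\<lambda>i. {l i<..<u i}) | l u. True}"
    by (rule sets_measure_of) (auto simp: PiE_iff)
  finally show ?thesis .
qed

lemma enn2real_inj:
  "enn2real a = enn2real b \<Longrightarrow> a \<noteq> \<infinity> \<Longrightarrow> b \<noteq> \<infinity> \<Longrightarrow> a = b"
  by (cases a; cases b) auto

text \<open>\<open>ennreal\<close> truncates negative values, so \<open>ennreal (v x)\<close> and
  \<open>ennreal (- v x)\<close> are the positive and the negative part of v. As densities they give
  the same mass to all open boxes, a generator stable under intersection. Hence they agree almost
  everywhere, and since one of them always vanishes, both do.\<close>

lemma AE_eq_0_of_boxes:
  fixes v :: "point \<Rightarrow> real"
  assumes [measurable]: "v \<in> borel_measurable borel"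
    and int: "integrable (leb d) v"
    and box: "\<And>l u. (LINT x:{x. \<forall>i<d. x i \<in> {l i<..<u i}}|leb d. v x) = 0"
  shows "AE x in leb d. v x = 0"
proof -
  let ?L = "Pi\<^sub>M {..<d} (\<lambda>_. lborel :: real measure)"
  interpret L: sigma_finite_measure ?L by (rule lborel_prod.sigma_finite) simp
  let ?k = "\<lambda>y. v (extend0 d y)"
  let ?P = "density ?L (\<lambda>y. ennreal (?k y))" and ?Q = "density ?L (\<lambda>y. ennreal (- ?k y))"
  let ?E = "{Pi\<^sub>E {..<d} (\<lambda>i. {l i<..<u i}) | l u. True} :: point set set"
  have kint: "integrable ?L ?k"
    using int unfolding leb_def by (subst (asm) integrable_distr_eq) auto
  have fin: "(\<integral>\<^sup>+y. ennreal (?k y) \<partial>?L) < \<infinity>"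
    using kint by (simp add: real_integrable_def less_top)
  have "?P = ?Q"
  proof (rule measure_eqI_generator_eq[where E="?E" and \<Omega>="Pi\<^sub>E {..<d} (\<lambda>_. UNIV)" and A="\<lambda>n. Pi\<^sub>E {..<d} (\<lambda>i. {- real n<..<real n})"])
    show "Int_stable ?E"
    proof (rule Int_stableI)
      fix S T assume "S \<in> ?E" "T \<in> ?E"
      then obtain l u l' u' where "S = Pi\<^sub>E {..<d} (\<lambda>i. {l i<..<u i})" "T = Pi\<^sub>E {..<d} (\<lambda>i. {l' i<..<u' i})" by auto
      then have "S \<inter> T = Pi\<^sub>E {..<d} (\<lambda>i. {max (l i) (l' i)<..<min (u i) (u' i)})"
        by (simp only: PiE_Int Int_greaterThanLessThan)
      then show "S \<inter> T \<in> ?E"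
        by (intro CollectI exI[of _ "\<lambda>i. max (l i) (l' i)"] exI[of _ "\<lambda>i. min (u i) (u' i)"] conjI TrueI)
    qed
    show "?E \<subseteq> Pow (Pi\<^sub>E {..<d} (\<lambda>_. UNIV))" by (auto simp: PiE_iff)
    show "sets ?P = sigma_sets (Pi\<^sub>E {..<d} (\<lambda>_. UNIV)) ?E" "sets ?Q = sigma_sets (Pi\<^sub>E {..<d} (\<lambda>_. UNIV)) ?E"
      by (simp_all only: sets_density sets_PiM_lborel_boxes)
    show "range (\<lambda>n. Pi\<^sub>E {..<d} (\<lambda>i. {- real n<..<real n})) \<subseteq> ?E"
    proof (rule image_subsetI)
      fix n show "Pi\<^sub>E {..<d} (\<lambda>i. {- real n<..<real n}) \<in> ?E"
        by (intro CollectI exI[of _ "\<lambda>i. - real n"] exI[of _ "\<lambda>i. real n"] conjI TrueI refl)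
    qed
    show "(\<Union>n. Pi\<^sub>E {..<d} (\<lambda>i. {- real n<..<real n})) = Pi\<^sub>E {..<d} (\<lambda>_. UNIV)"
    proof (intro equalityI subsetI)
      fix y :: point assume y: "y \<in> Pi\<^sub>E {..<d} (\<lambda>_. UNIV)"
      obtain n :: nat where "enorm d y < real n" using reals_Archimedean2 by blast
      then have "- real n < y i \<and> y i < real n" if "i < d" for i
        using abs_coord_le_enorm[OF that, of y] by linarith
      then show "y \<in> (\<Union>n. Pi\<^sub>E {..<d} (\<lambda>i. {- real n<..<real n}))" using y by (auto simp: PiE_iff)
    qed (auto simp: PiE_iff)
    show "emeasure ?P (Pi\<^sub>E {..<d} (\<lambda>i. {- real n<..<real n})) \<noteq> \<infinity>" for n
    proof -
      have "emeasure ?P (Pi\<^sub>E {..<d} (\<lambda>i. {- real n<..<real n})) \<le> (\<integral>\<^sup>+y. ennreal (?k y) \<partial>?L)"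
        by (subst emeasure_density) (auto intro!: nn_integral_mono simp: indicator_def)
      then show ?thesis using fin by auto
    qed
    fix S assume "S \<in> ?E"
    then obtain l u where S: "S = Pi\<^sub>E {..<d} (\<lambda>i. {l i<..<u i})" by auto
    have Sm [measurable]: "S \<in> sets ?L" unfolding S by (intro sets_PiM_I_finite) auto
    let ?B = "{x::point. \<forall>i<d. x i \<in> {l i<..<u i}}"
    have [measurable]: "?B \<in> sets borel" by (intro sets_box) auto
    have ind: "indicator S y *\<^sub>R ?k y = indicator ?B (extend0 d y) *\<^sub>R v (extend0 d y)" if "y \<in> space ?L" for y
      using that unfolding S by (auto simp: indicator_def space_PiM PiE_iff)
    have Sint: "integrable ?L (\<lambda>y. indicator S y *\<^sub>R ?k y)"
      using integrable_real_mult_indicator[OF Sm kint] by (simp add: mult.commute)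
    have "(LINT y|?L. indicator S y *\<^sub>R ?k y) = (LINT y|?L. indicator ?B (extend0 d y) *\<^sub>R v (extend0 d y))"
      by (rule Bochner_Integration.integral_cong[OF refl ind])
    also have "\<dots> = (LINT x|leb d. indicator ?B x *\<^sub>R v x)"
      unfolding leb_def by (rule integral_distr[symmetric]) measurable
    also have "\<dots> = 0" using box[of l u] by (simp add: set_lebesgue_integral_def)
    finally have "enn2real (\<integral>\<^sup>+y. ennreal (indicator S y *\<^sub>R ?k y) \<partial>?L) = enn2real (\<integral>\<^sup>+y. ennreal (- (indicator S y *\<^sub>R ?k y)) \<partial>?L)"
      using real_lebesgue_integral_def[OF Sint] by simp
    moreover have "(\<integral>\<^sup>+y. ennreal (indicator S y *\<^sub>R ?k y) \<partial>?L) \<noteq> \<infinity>" "(\<integral>\<^sup>+y. ennreal (- (indicator S y *\<^sub>R ?k y)) \<partial>?L) \<noteq> \<infinity>"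
      using Sint unfolding real_integrable_def by auto
    ultimately have "(\<integral>\<^sup>+y. ennreal (indicator S y *\<^sub>R ?k y) \<partial>?L) = (\<integral>\<^sup>+y. ennreal (- (indicator S y *\<^sub>R ?k y)) \<partial>?L)"
      by (rule enn2real_inj)
    moreover have "ennreal (indicator S y *\<^sub>R ?k y) = ennreal (?k y) * indicator S y"
      "ennreal (- (indicator S y *\<^sub>R ?k y)) = ennreal (- ?k y) * indicator S y" for y
      by (auto simp: indicator_def)
    ultimately show "emeasure ?P S = emeasure ?Q S"
      by (subst (1 2) emeasure_density) auto
  qed
  then have "AE y in ?L. ennreal (?k y) = ennreal (- ?k y)"
    by (intro L.density_unique) auto
  then have "AE y in ?L. ?k y = 0"
  proof eventually_elim
    case (elim y)
    show ?case
    proof (cases "?k y \<ge> 0")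
      case True
      then have "ennreal (?k y) = 0" using elim by (simp add: ennreal_neg)
      then show ?thesis using True by (simp add: ennreal_eq_0_iff)
    next
      case False
      then have "ennreal (- ?k y) = 0" using elim by (simp add: ennreal_neg)
      then show ?thesis using False by (simp add: ennreal_eq_0_iff)
    qed
  qed
  then show ?thesis
    unfolding leb_def by (subst AE_distr_iff) auto
qed

text \<open>Cutting \<open>h\<close> off to a cube makes it integrable. A box meets a cube in a box
  or not at all, so the cut-off function still has zero integral over every box, and the cubes
  exhaust the space.\<close>

lemma AE_eq_0_of_schwartz:
  assumes d: "d > 0" and h: "h \<in> borel_measurable borel"
    and z: "\<And>\<phi>. \<phi> \<in> schwartz d \<Longrightarrow> integrable (leb d) (\<lambda>x. h x * \<phi> x) \<and> (LINT x|leb d. h x * \<phi> x) = 0"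
  shows "AE x in leb d. h x = 0"
proof -
  note [measurable] = h
  let ?C = "\<lambda>N. {x::point. \<forall>i<d. x i \<in> {- real (Suc N)<..<real (Suc N)}}"
  have Cm [measurable]: "?C N \<in> sets borel" for N by (intro sets_box) auto
  have A: "AE x in leb d. indicator (?C N) x *\<^sub>R h x = 0" for N
  proof -
    let ?w = "\<lambda>x. indicator (?C N) x *\<^sub>R h x"
    have eqC: "?C N = {x. \<forall>i<d. \<bar>x i - 0\<bar> < real (Suc N)}" by (auto simp: abs_less_iff)
    have "set_integrable (leb d) (?C N) h"
      unfolding eqC by (rule integral_cube_eq_0[OF d h z]) auto
    then have int: "integrable (leb d) ?w" by (simp add: set_integrable_def)
    have box: "(LINT x:{x. \<forall>i<d. x i \<in> {l i<..<u i}}|leb d. ?w x) = 0" for l u :: point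
    proof -
      define l' where "l' i = max (l i) (- real (Suc N))" for i
      define u' where "u' i = min (u i) (real (Suc N))" for i
      have eq: "indicator {x. \<forall>i<d. x i \<in> {l i<..<u i}} x *\<^sub>R ?w x = indicator {x. \<forall>i<d. l' i < x i \<and> x i < u' i} x *\<^sub>R h x" for x :: point
        by (auto simp: indicator_def l'_def u'_def)
      show ?thesis
      proof (cases "\<forall>i<d. l' i < u' i")
        case True
        have "{x. \<forall>i<d. l' i < x i \<and> x i < u' i} = {x. \<forall>i<d. \<bar>x i - (l' i + u' i) / 2\<bar> < (u' i - l' i) / 2}"
          by (rule Collect_cong) (auto simp: abs_less_iff field_simps)
        moreover have "(LINT x:{x. \<forall>i<d. \<bar>x i - (l' i + u' i) / 2\<bar> < (u' i - l' i) / 2}|leb d. h x) = 0"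
          by (rule integral_cube_eq_0(2)[OF d h z]) (use True in auto)
        ultimately show ?thesis unfolding set_lebesgue_integral_def eq by simp
      next
        case False
        then have "{x::point. \<forall>i<d. l' i < x i \<and> x i < u' i} = {}" by (auto dest: less_trans)
        then show ?thesis unfolding set_lebesgue_integral_def eq by simp
      qed
    qed
    have sint: "integrable (leb d) (\<lambda>x. indicator {x. \<forall>i<d. x i \<in> {l i<..<u i}} x *\<^sub>R ?w x)" for l u :: point
      by (rule integrable_mult_indicator[OF _ int]) (simp only: sets_leb, intro sets_box, auto)
    have "AE x in leb d. Re (?w x) = 0"
    proof (rule AE_eq_0_of_boxes)
      show "(LINT x:{x. \<forall>i<d. x i \<in> {l i<..<u i}}|leb d. Re (?w x)) = 0" for l u
      proof -
        let ?X = "{x::point. \<forall>i<d. x i \<in> {l i<..<u i}}"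
        have "(LINT x:?X|leb d. Re (?w x)) = (LINT x|leb d. Re (indicator ?X x *\<^sub>R ?w x))"
          unfolding set_lebesgue_integral_def by (intro Bochner_Integration.integral_cong refl) simp
        also have "\<dots> = Re (LINT x|leb d. indicator ?X x *\<^sub>R ?w x)" by (rule integral_Re[OF sint])
        also have "\<dots> = 0" using box[of l u] by (simp only: set_lebesgue_integral_def zero_complex.sel)
        finally show ?thesis .
      qed
      show "integrable (leb d) (\<lambda>x. Re (?w x))" by (rule integrable_Re[OF int])
      show "(\<lambda>x. Re (?w x)) \<in> borel_measurable borel" by measurable
    qed
    moreover have "AE x in leb d. Im (?w x) = 0"
    proof (rule AE_eq_0_of_boxes)
      show "(LINT x:{x. \<forall>i<d. x i \<in> {l i<..<u i}}|leb d. Im (?w x)) = 0" for l u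
      proof -
        let ?X = "{x::point. \<forall>i<d. x i \<in> {l i<..<u i}}"
        have "(LINT x:?X|leb d. Im (?w x)) = (LINT x|leb d. Im (indicator ?X x *\<^sub>R ?w x))"
          unfolding set_lebesgue_integral_def by (intro Bochner_Integration.integral_cong refl) simp
        also have "\<dots> = Im (LINT x|leb d. indicator ?X x *\<^sub>R ?w x)" by (rule integral_Im[OF sint])
        also have "\<dots> = 0" using box[of l u] by (simp only: set_lebesgue_integral_def zero_complex.sel)
        finally show ?thesis .
      qed
      show "integrable (leb d) (\<lambda>x. Im (?w x))" by (rule integrable_Im[OF int])
      show "(\<lambda>x. Im (?w x)) \<in> borel_measurable borel" by measurable
    qed
    ultimately show ?thesis by eventually_elim (simp add: complex_eq_iff)
  qed
  have "AE x in leb d. \<forall>N. indicator (?C N) x *\<^sub>R h x = 0" unfolding AE_all_countable using A by blast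
  then show ?thesis
  proof eventually_elim
    case (elim x)
    obtain n :: nat where n: "enorm d x < real n" using reals_Archimedean2 by blast
    have "- real (Suc n) < x i \<and> x i < real (Suc n)" if "i < d" for i
      using abs_coord_le_enorm[OF that, of x] n by (simp; linarith)
    then have "x \<in> ?C n" by simp
    then show ?case using elim[rule_format, of n] by simp
  qed
qed

section \<open>Distributions with a regular Fourier transform\<close>

text \<open>A sufficient condition for \<open>h\<close> to be the transform of a tempered
  distribution. It admits an integrable singularity at the origin and polynomial growth, and it can
  be checked by a bound on |h|.\<close>

definition tame :: "nat \<Rightarrow> (point \<Rightarrow> complex) \<Rightarrow> bool" where
  "tame d h \<longleftrightarrow> h \<in> borel_measurable borel \<and>
     (\<exists>k. integrable (leb d) (\<lambda>\<xi>. cmod (h \<xi>) / (1 + enorm d \<xi>) ^ k))"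

lemma tame_measurable: "tame d h \<Longrightarrow> h \<in> borel_measurable borel"
  by (simp add: tame_def)

lemma integrable_cong_AE':
  fixes f g :: "'a \<Rightarrow> 'b::{banach,second_countable_topology}"
  assumes "integrable M g" "f \<in> borel_measurable M" "AE x in M. f x = g x"
  shows "integrable M f"
  using integrable_cong_AE_imp[OF assms(1,2)] assms(3) by (auto simp: eq_commute)

lemma tame_cong_AE:
  assumes "tame d h" "h' \<in> borel_measurable borel" "AE \<xi> in leb d. h' \<xi> = h \<xi>"
  shows "tame d h'"
proof -
  note [measurable] = tame_measurable[OF assms(1)] assms(2)
  obtain k where k: "integrable (leb d) (\<lambda>\<xi>. cmod (h \<xi>) / (1 + enorm d \<xi>) ^ k)" using assms(1) by (auto simp: tame_def)
  have "integrable (leb d) (\<lambda>\<xi>. cmod (h' \<xi>) / (1 + enorm d \<xi>) ^ k)"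
  proof (rule integrable_cong_AE'[OF k])
    show "AE \<xi> in leb d. cmod (h' \<xi>) / (1 + enorm d \<xi>) ^ k = cmod (h \<xi>) / (1 + enorm d \<xi>) ^ k"
      using assms(3) by eventually_elim simp
  qed measurable
  then show ?thesis using assms(2) by (auto simp: tame_def)
qed

text \<open>On the unit ball the power is integrable because a < d; outside it is at most 1 because
  a \<ge> 0, so the weight of order d + 1 suffices.\<close>

lemma tame_powr:
  assumes d: "d > 0" and h: "h \<in> borel_measurable borel" and a: "0 \<le> a" "a < real d"
    and bnd: "AE \<xi> in leb d. cmod (h \<xi>) \<le> C * enorm d \<xi> powr (-a)"
  shows "tame d h"
proof -
  note [measurable] = h
  have 1: "integrable (leb d) (\<lambda>\<xi>. indicator {..1} (enorm d \<xi>) * enorm d \<xi> powr (-a))"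
  proof (rule integrableI_bounded)
    have "(\<integral>\<^sup>+\<xi>. norm (indicator {..1} (enorm d \<xi>) * enorm d \<xi> powr (-a)) \<partial>leb d)
      = (\<integral>\<^sup>+x. ennreal (enorm d x powr (-a)) * indicator {..1} (enorm d x) \<partial>leb d)"
      by (intro nn_integral_cong) (auto simp: indicator_def)
    also have "\<dots> < \<infinity>"
      using nn_integral_enorm_powr_near[OF d a zero_less_one] by (rule le_less_trans) simp
    finally show "(\<integral>\<^sup>+\<xi>. norm (indicator {..1} (enorm d \<xi>) * enorm d \<xi> powr (-a)) \<partial>leb d) < \<infinity>" .
  qed measurable
  have "integrable (leb d) (\<lambda>\<xi>. cmod (h \<xi>) / (1 + enorm d \<xi>) ^ (d + 1))"
  proof (rule Bochner_Integration.integrable_bound)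
    show "integrable (leb d) (\<lambda>\<xi>. \<bar>C\<bar> * (indicator {..1} (enorm d \<xi>) * enorm d \<xi> powr (-a)) + \<bar>C\<bar> * (1 / (1 + enorm d \<xi>) ^ (d + 1)))"
      by (intro Bochner_Integration.integrable_add integrable_mult_right 1 integrable_decay d)
    show "AE \<xi> in leb d. norm (cmod (h \<xi>) / (1 + enorm d \<xi>) ^ (d + 1)) \<le>
       norm (\<bar>C\<bar> * (indicator {..1} (enorm d \<xi>) * enorm d \<xi> powr (-a)) + \<bar>C\<bar> * (1 / (1 + enorm d \<xi>) ^ (d + 1)))"
      using bnd AE_leb_enorm_pos[OF d]
    proof eventually_elim
      case (elim \<xi>)
      define r where "r = enorm d \<xi>"
      have r: "r > 0" using elim by (simp add: r_def)
      have h: "cmod (h \<xi>) \<le> \<bar>C\<bar> * r powr (-a)"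
        using elim(1) by (rule order_trans) (simp add: r_def mult_right_mono)
      have p: "1 \<le> (1 + r) ^ (d + 1)" using r by (intro one_le_power) simp
      have "cmod (h \<xi>) / (1 + r) ^ (d + 1) \<le> \<bar>C\<bar> * (indicator {..1} r * r powr (-a)) + \<bar>C\<bar> * (1 / (1 + r) ^ (d + 1))"
      proof (cases "r \<le> 1")
        case True
        have "cmod (h \<xi>) / (1 + r) ^ (d + 1) \<le> cmod (h \<xi>) / 1"
          using p by (intro divide_left_mono) auto
        also have "\<dots> \<le> \<bar>C\<bar> * (indicator {..1} r * r powr (-a))" using h True by simp
        finally show ?thesis using p by (simp add: add_increasing2)
      next
        case False
        then have "r powr (-a) \<le> 1" using a powr_mono[of "-a" 0 r] by simp
        then have "cmod (h \<xi>) \<le> \<bar>C\<bar>" using h by (smt (verit) abs_ge_zero mult_left_le)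
        then have "cmod (h \<xi>) / (1 + r) ^ (d + 1) \<le> \<bar>C\<bar> / (1 + r) ^ (d + 1)"
          using p by (intro divide_right_mono) auto
        then show ?thesis using False by simp
      qed
      then show ?case unfolding r_def[symmetric] real_norm_def using r by (smt (verit) abs_ge_self abs_of_nonneg divide_nonneg_nonneg norm_ge_zero zero_le_power)
    qed
  qed measurable
  then show ?thesis unfolding tame_def using h by blast
qed

lemma divide_mult_cancel: "p \<noteq> 0 \<Longrightarrow> a / p * (p * b) = a * b" for a b p :: real
  by simp

lemma tame_schwartz:
  assumes "tame d h" "\<phi> \<in> schwartz d"
  shows "integrable (leb d) (\<lambda>x. h x * \<phi> x)"
proof -
  obtain k where k: "integrable (leb d) (\<lambda>\<xi>. cmod (h \<xi>) / (1 + enorm d \<xi>) ^ k)" using assms(1) by (auto simp: tame_def)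
  obtain C where C: "C \<ge> 0" "\<And>x. (1 + enorm d x) ^ k * cmod (\<phi> x) \<le> C" using schwartz_decay[OF assms(2)] by blast
  note [measurable] = tame_measurable[OF assms(1)] schwartz_measurable[OF assms(2)]
  show ?thesis
  proof (rule Bochner_Integration.integrable_bound)
    show "integrable (leb d) (\<lambda>\<xi>. cmod (h \<xi>) / (1 + enorm d \<xi>) ^ k * C)" by (intro integrable_mult_left k)
    show "AE x in leb d. norm (h x * \<phi> x) \<le> norm (cmod (h x) / (1 + enorm d x) ^ k * C)"
    proof (rule AE_I2)
      fix x
      have p: "(1 + enorm d x) ^ k > 0" by (simp add: add_pos_nonneg)
      have "cmod (h x) / (1 + enorm d x) ^ k * ((1 + enorm d x) ^ k * cmod (\<phi> x)) \<le> cmod (h x) / (1 + enorm d x) ^ k * C"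
        using p by (intro mult_left_mono C) auto
      then have "cmod (h x) * cmod (\<phi> x) \<le> cmod (h x) / (1 + enorm d x) ^ k * C"
        unfolding divide_mult_cancel[OF p[THEN less_imp_neq, THEN not_sym]] .
      also have "\<dots> \<le> norm (cmod (h x) / (1 + enorm d x) ^ k * C)" by (simp only: real_norm_def abs_ge_self)
      finally show "norm (h x * \<phi> x) \<le> norm (cmod (h x) / (1 + enorm d x) ^ k * C)"
        by (simp only: norm_mult)
    qed
  qed measurable
qed

lemma tame_set_integrable:
  assumes "tame d h" shows "set_integrable (leb d) {x. enorm d x \<le> R} h"
proof -
  obtain k where k: "integrable (leb d) (\<lambda>\<xi>. cmod (h \<xi>) / (1 + enorm d \<xi>) ^ k)" using assms(1) by (auto simp: tame_def)
  note [measurable] = tame_measurable[OF assms(1)]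
  show ?thesis
    unfolding set_integrable_def
  proof (rule Bochner_Integration.integrable_bound)
    show "integrable (leb d) (\<lambda>\<xi>. (1 + \<bar>R\<bar>) ^ k * (cmod (h \<xi>) / (1 + enorm d \<xi>) ^ k))" by (intro integrable_mult_right k)
    show "AE x in leb d. norm (indicator {x. enorm d x \<le> R} x *\<^sub>R h x) \<le> norm ((1 + \<bar>R\<bar>) ^ k * (cmod (h x) / (1 + enorm d x) ^ k))"
    proof (rule AE_I2)
      fix x
      have p: "(1 + enorm d x) ^ k > 0" by (simp add: add_pos_nonneg)
      show "norm (indicator {x. enorm d x \<le> R} x *\<^sub>R h x) \<le> norm ((1 + \<bar>R\<bar>) ^ k * (cmod (h x) / (1 + enorm d x) ^ k))"
      proof (cases "enorm d x \<le> R")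
        case True
        then have "(1 + enorm d x) ^ k \<le> (1 + \<bar>R\<bar>) ^ k" by (intro power_mono) auto
        then have "cmod (h x) * (1 + enorm d x) ^ k \<le> cmod (h x) * (1 + \<bar>R\<bar>) ^ k" by (intro mult_left_mono) auto
        then have "cmod (h x) \<le> (1 + \<bar>R\<bar>) ^ k * (cmod (h x) / (1 + enorm d x) ^ k)"
          using p by (simp add: field_simps)
        then show ?thesis using True by (simp add: abs_mult)
      qed simp
    qed
  qed measurable
qed

lemma has_hatI:
  assumes "tame d h" "\<And>\<phi>. \<phi> \<in> schwartz d \<Longrightarrow> g (fourier d \<phi>) = (LINT x|leb d. h x * \<phi> x)"
  shows "has_hat d g h"
  using assms tame_measurable[OF assms(1)] tame_set_integrable[OF assms(1)] tame_schwartz[OF assms(1)]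
  by (simp add: has_hat_def is_regular_def dist_fourier_def)

lemma
  assumes "has_hat d g h"
  shows has_hat_measurable: "h \<in> borel_measurable borel"
    and has_hat_set_integrable: "set_integrable (leb d) {x. enorm d x \<le> R} h"
    and has_hat_integrable: "\<phi> \<in> schwartz d \<Longrightarrow> integrable (leb d) (\<lambda>x. h x * \<phi> x)"
    and has_hat_fourier: "\<phi> \<in> schwartz d \<Longrightarrow> g (fourier d \<phi>) = (LINT x|leb d. h x * \<phi> x)"
  using assms by (auto simp: has_hat_def is_regular_def dist_fourier_def)

text \<open>\<open>has_hat\<close> tests \<open>g\<close> on transforms only; every Schwartz
  function is a transform, so this determines \<open>g\<close> on all of them.\<close>

lemma has_hat_apply:
  assumes "d > 0" "has_hat d g h" "\<psi> \<in> schwartz d"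
  shows "g \<psi> = (LINT x|leb d. h x * inv_fourier d \<psi> x)"
  using has_hat_fourier[OF assms(2) inv_fourier_schwartz[OF assms(1,3)]] fourier_inv_fourier[OF assms(1,3)] by simp

lemma has_hat_unique:
  assumes d: "d > 0" and h: "has_hat d g h" "has_hat d g h'"
  shows "AE x in leb d. h x = h' x"
proof -
  note [measurable] = has_hat_measurable[OF h(1)] has_hat_measurable[OF h(2)]
  have "AE x in leb d. h x - h' x = 0"
  proof (rule AE_eq_0_of_schwartz[OF d])
    fix \<phi> assume \<phi>: "\<phi> \<in> schwartz d"
    note i = has_hat_integrable[OF h(1) \<phi>] has_hat_integrable[OF h(2) \<phi>]
    have "(LINT x|leb d. h x * \<phi> x) = (LINT x|leb d. h' x * \<phi> x)"
      using has_hat_fourier[OF h(1) \<phi>] has_hat_fourier[OF h(2) \<phi>] by simp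
    then show "integrable (leb d) (\<lambda>x. (h x - h' x) * \<phi> x) \<and> (LINT x|leb d. (h x - h' x) * \<phi> x) = 0"
      using i by (simp add: left_diff_distrib)
  qed measurable
  then show ?thesis by eventually_elim simp
qed

lemma has_hat_hat: "has_hat d g h \<Longrightarrow> has_hat d g (hat d g)"
  unfolding hat_def by (rule someI[of "has_hat d g"])

lemma AE_hat_eq: "d > 0 \<Longrightarrow> has_hat d g h \<Longrightarrow> AE x in leb d. hat d g x = h x"
  by (rule has_hat_unique[OF _ has_hat_hat])

lemma hat_measurable: "has_hat d g h \<Longrightarrow> hat d g \<in> borel_measurable borel"
  by (rule has_hat_measurable[OF has_hat_hat])

lemma fourier_add:
  assumes "integrable (leb d) \<phi>" "integrable (leb d) \<psi>"
  shows "fourier d (\<lambda>x. \<phi> x + \<psi> x) \<xi> = fourier d \<phi> \<xi> + fourier d \<psi> \<xi>"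
proof -
  have "integrable (leb d) (\<lambda>x. cis (- (\<Sum>i<d. x i * \<xi> i)) * \<phi> x)" if "integrable (leb d) \<phi>" for \<phi>
    by (intro integrable_cis_mult that) measurable
  then show ?thesis using assms by (simp add: fourier_def distrib_left)
qed

lemma fourier_scale: "fourier d (\<lambda>x. c * \<phi> x) \<xi> = c * fourier d \<phi> \<xi>"
proof -
  have "(LINT x|leb d. cis (- (\<Sum>i<d. x i * \<xi> i)) * (c * \<phi> x)) = (LINT x|leb d. c * (cis (- (\<Sum>i<d. x i * \<xi> i)) * \<phi> x))"
    by (intro Bochner_Integration.integral_cong refl) simp
  then show ?thesis by (simp only: fourier_def integral_mult_right_zero) simp
qed

text \<open>Parseval's formula taken as a definition. It is the witness behind the choice in
  \<open>inv_hat\<close>.\<close>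

definition synth :: "nat \<Rightarrow> (point \<Rightarrow> complex) \<Rightarrow> distn" where
  "synth d h \<psi> = (LINT \<xi>|leb d. h \<xi> * inv_fourier d \<psi> \<xi>)"

lemma has_hat_synth:
  assumes "d > 0" "tame d h" shows "has_hat d (synth d h) h"
  by (intro has_hatI assms) (simp add: synth_def inv_fourier_fourier[OF assms(1)])

text \<open>The transform of a Schwartz function carries any power of 1 + |\<xi>| at the cost of a
  higher Schwartz norm, so it compensates the weight under which \<open>h\<close> is
  integrable.\<close>

lemma synth_tempered:
  assumes d: "d > 0" and h: "tame d h" shows "synth d h \<in> tempered d"
proof -
  have inv_add: "inv_fourier d (\<lambda>x. \<phi> x + \<psi> x) = (\<lambda>x. inv_fourier d \<phi> x + inv_fourier d \<psi> x)"
    if "\<phi> \<in> schwartz d" "\<psi> \<in> schwartz d" for \<phi> \<psi>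
    using that by (simp add: fun_eq_iff inv_fourier_def fourier_add schwartz_integrable[OF d] add_divide_distrib)
  have inv_scale: "inv_fourier d (\<lambda>x. c * \<phi> x) = (\<lambda>x. c * inv_fourier d \<phi> x)" for c \<phi>
    by (simp add: fun_eq_iff inv_fourier_def fourier_scale)
  have int: "integrable (leb d) (\<lambda>\<xi>. h \<xi> * inv_fourier d \<phi> \<xi>)" if "\<phi> \<in> schwartz d" for \<phi>
    by (intro tame_schwartz h inv_fourier_schwartz d that)
  have add: "synth d h (\<lambda>x. \<phi> x + \<psi> x) = synth d h \<phi> + synth d h \<psi>"
    if "\<phi> \<in> schwartz d" "\<psi> \<in> schwartz d" for \<phi> \<psi>
    using int that by (simp add: synth_def inv_add distrib_left)
  have scale: "synth d h (\<lambda>x. c * \<phi> x) = c * synth d h \<phi>" for c \<phi>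
  proof -
    have "synth d h (\<lambda>x. c * \<phi> x) = (LINT \<xi>|leb d. c * (h \<xi> * inv_fourier d \<phi> \<xi>))"
      unfolding synth_def inv_scale by (intro Bochner_Integration.integral_cong refl) simp
    then show ?thesis by (simp only: synth_def integral_mult_right_zero)
  qed
  obtain k where k: "integrable (leb d) (\<lambda>\<xi>. cmod (h \<xi>) / (1 + enorm d \<xi>) ^ k)" using h by (auto simp: tame_def)
  obtain C where C: "C \<ge> 0" "\<And>\<phi> \<xi>. \<phi> \<in> schwartz d \<Longrightarrow> (1 + enorm d \<xi>) ^ k * cmod (fourier d \<phi> \<xi>) \<le> C * schwartz_norm d (k + d + 1) \<phi>"
    using fourier_decay[OF d, of k] by blast
  let ?I = "LINT \<xi>|leb d. cmod (h \<xi>) / (1 + enorm d \<xi>) ^ k"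
  define D where "D = C / (2 * pi) ^ d"
  have "cmod (synth d h \<phi>) \<le> (?I * D) * schwartz_norm d (k + d + 1) \<phi>" if \<phi>: "\<phi> \<in> schwartz d" for \<phi>
  proof -
    let ?S = "D * schwartz_norm d (k + d + 1) \<phi>"
    have b: "(1 + enorm d \<xi>) ^ k * cmod (inv_fourier d \<phi> \<xi>) \<le> ?S" for \<xi>
    proof -
      have "(1 + enorm d \<xi>) ^ k * cmod (fourier d \<phi> (\<lambda>i. - \<xi> i)) / (2 * pi) ^ d \<le> C * schwartz_norm d (k + d + 1) \<phi> / (2 * pi) ^ d"
        using C(2)[OF \<phi>, of "\<lambda>i. - \<xi> i"] by (intro divide_right_mono) auto
      then show ?thesis by (simp add: inv_fourier_def norm_divide norm_mult norm_power D_def)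
    qed
    have "cmod (synth d h \<phi>) \<le> (LINT \<xi>|leb d. cmod (h \<xi> * inv_fourier d \<phi> \<xi>))"
      unfolding synth_def by (rule integral_norm_bound)
    also have "\<dots> \<le> (LINT \<xi>|leb d. cmod (h \<xi>) / (1 + enorm d \<xi>) ^ k * ?S)"
    proof (rule integral_mono)
      show "integrable (leb d) (\<lambda>\<xi>. cmod (h \<xi>) / (1 + enorm d \<xi>) ^ k * ?S)" by (intro integrable_mult_left k)
      show "cmod (h \<xi> * inv_fourier d \<phi> \<xi>) \<le> cmod (h \<xi>) / (1 + enorm d \<xi>) ^ k * ?S" for \<xi>
      proof -
        have p: "(1 + enorm d \<xi>) ^ k > 0" by (simp add: add_pos_nonneg)
        have "cmod (h \<xi>) / (1 + enorm d \<xi>) ^ k * ((1 + enorm d \<xi>) ^ k * cmod (inv_fourier d \<phi> \<xi>)) \<le> cmod (h \<xi>) / (1 + enorm d \<xi>) ^ k * ?S"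
          using p by (intro mult_left_mono b) auto
        then show ?thesis unfolding divide_mult_cancel[OF p[THEN less_imp_neq, THEN not_sym]] norm_mult .
      qed
    qed (intro integrable_norm int \<phi>)
    also have "\<dots> = ?I * ?S" by (rule integral_mult_left_zero)
    finally show ?thesis by (simp add: mult.assoc)
  qed
  then show ?thesis using add scale unfolding tempered_def by blast
qed

lemma
  assumes "d > 0" "tame d h"
  shows tame_has_inv_hat: "has_inv_hat d h"
    and inv_hat_tempered: "inv_hat d h \<in> tempered d"
    and has_hat_inv_hat: "has_hat d (inv_hat d h) h"
proof -
  have e: "\<exists>g. g \<in> tempered d \<and> has_hat d g h"
    using synth_tempered[OF assms] has_hat_synth[OF assms] by blast
  then show "has_inv_hat d h" by (auto simp: has_inv_hat_def)
  show "inv_hat d h \<in> tempered d" "has_hat d (inv_hat d h) h"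
    using someI_ex[OF e] by (simp_all add: inv_hat_def)
qed

lemma has_hat_cong_AE:
  assumes "has_hat d g h" "h' \<in> borel_measurable borel" "AE x in leb d. h' x = h x"
  shows "has_hat d g h'"
proof -
  note [measurable] = has_hat_measurable[OF assms(1)] assms(2)
  have 1: "set_integrable (leb d) {x. enorm d x \<le> R} h'" for R
    unfolding set_integrable_def
    by (rule integrable_cong_AE'[OF has_hat_set_integrable[OF assms(1), of R, unfolded set_integrable_def]])
       (measurable, use assms(3) in eventually_elim, simp)
  have 2: "integrable (leb d) (\<lambda>x. h' x * \<phi> x) \<and> (LINT x|leb d. h' x * \<phi> x) = (LINT x|leb d. h x * \<phi> x)" if "\<phi> \<in> schwartz d" for \<phi>
  proof -
    note [measurable] = schwartz_measurable[OF that]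
    have e: "AE x in leb d. h' x * \<phi> x = h x * \<phi> x" using assms(3) by eventually_elim simp
    show ?thesis
      using integrable_cong_AE'[OF has_hat_integrable[OF assms(1) that] _ e] integral_cong_AE[OF _ _ e] by simp
  qed
  show ?thesis
    using 1 2 has_hat_fourier[OF assms(1)] assms(2) by (simp add: has_hat_def is_regular_def dist_fourier_def)
qed

lemma has_hat_add:
  assumes "has_hat d g h" "has_hat d g' h'"
  shows "has_hat d (\<lambda>\<phi>. g \<phi> + g' \<phi>) (\<lambda>\<xi>. h \<xi> + h' \<xi>)"
proof -
  note [measurable] = has_hat_measurable[OF assms(1)] has_hat_measurable[OF assms(2)]
  have "(\<lambda>\<xi>. h \<xi> + h' \<xi>) \<in> borel_measurable borel" by measurable
  then show ?thesis
    using assms by (auto simp: has_hat_def is_regular_def dist_fourier_def distrib_right set_integral_add)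
qed

lemma has_hat_scale:
  assumes "has_hat d g h"
  shows "has_hat d (\<lambda>\<phi>. c * g \<phi>) (\<lambda>\<xi>. c * h \<xi>)"
proof -
  note [measurable] = has_hat_measurable[OF assms(1)]
  have "(\<lambda>\<xi>. c * h \<xi>) \<in> borel_measurable borel" by measurable
  then show ?thesis
    using assms by (auto simp: has_hat_def is_regular_def dist_fourier_def mult.assoc)
qed

lemma has_hat_minus: "has_hat d g h \<Longrightarrow> has_hat d (\<lambda>\<phi>. - g \<phi>) (\<lambda>\<xi>. - h \<xi>)"
  using has_hat_scale[of d g h "-1"] by simp

lemma has_hat_diff:
  "has_hat d g h \<Longrightarrow> has_hat d g' h' \<Longrightarrow> has_hat d (\<lambda>\<phi>. g \<phi> - g' \<phi>) (\<lambda>\<xi>. h \<xi> - h' \<xi>)"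
  using has_hat_add[OF _ has_hat_minus] by fastforce

lemma has_hat_zero: "has_hat d (\<lambda>_. 0) (\<lambda>_. 0)"
  by (simp add: has_hat_def is_regular_def dist_fourier_def set_integrable_def)

lemma has_hat_sum:
  fixes n :: nat
  assumes "\<And>i. i < n \<Longrightarrow> has_hat d (g i) (h i)"
  shows "has_hat d (\<lambda>\<phi>. \<Sum>i<n. g i \<phi>) (\<lambda>\<xi>. \<Sum>i<n. h i \<xi>)"
  using assms
proof (induction n)
  case (Suc n)
  then show ?case using has_hat_add[of d "\<lambda>\<phi>. \<Sum>i<n. g i \<phi>" "\<lambda>\<xi>. \<Sum>i<n. h i \<xi>" "g n" "h n"] by simp
qed (simp add: has_hat_zero)

text \<open>The transpose of \<open>pdiff_fourier\<close>. On a ball the multiplier is bounded by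
  the radius, so local integrability persists.\<close>

lemma has_hat_dist_pdiff:
  assumes d: "d > 0" and h: "has_hat d g h" and i: "i < d"
  shows "has_hat d (dist_pdiff i g) (\<lambda>\<xi>. \<i> * of_real (\<xi> i) * h \<xi>)"
proof -
  note [measurable] = has_hat_measurable[OF h]
  have 1: "set_integrable (leb d) {x. enorm d x \<le> R} (\<lambda>\<xi>. \<i> * of_real (\<xi> i) * h \<xi>)" for R
    unfolding set_integrable_def
  proof (rule Bochner_Integration.integrable_bound)
    show "integrable (leb d) (\<lambda>\<xi>. \<bar>R\<bar> * norm (indicator {x. enorm d x \<le> R} \<xi> *\<^sub>R h \<xi>))"
      using has_hat_set_integrable[OF h, of R] unfolding set_integrable_def
      by (intro integrable_mult_right integrable_norm)
    show "AE \<xi> in leb d. norm (indicator {x. enorm d x \<le> R} \<xi> *\<^sub>R (\<i> * of_real (\<xi> i) * h \<xi>))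
       \<le> norm (\<bar>R\<bar> * norm (indicator {x. enorm d x \<le> R} \<xi> *\<^sub>R h \<xi>))"
    proof (rule AE_I2)
      fix \<xi>
      have "\<bar>\<xi> i\<bar> \<le> \<bar>R\<bar>" if "enorm d \<xi> \<le> R" using abs_coord_le_enorm[OF i, of \<xi>] that by linarith
      then show "norm (indicator {x. enorm d x \<le> R} \<xi> *\<^sub>R (\<i> * of_real (\<xi> i) * h \<xi>)) \<le> norm (\<bar>R\<bar> * norm (indicator {x. enorm d x \<le> R} \<xi> *\<^sub>R h \<xi>))"
        by (auto simp: indicator_def norm_mult abs_mult intro!: mult_right_mono)
    qed
  qed measurable
  have 2: "integrable (leb d) (\<lambda>\<xi>. \<i> * of_real (\<xi> i) * h \<xi> * \<phi> \<xi>) \<and>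
      dist_pdiff i g (fourier d \<phi>) = (LINT \<xi>|leb d. \<i> * of_real (\<xi> i) * h \<xi> * \<phi> \<xi>)" if \<phi>: "\<phi> \<in> schwartz d" for \<phi>
  proof -
    let ?\<chi> = "\<lambda>x. - \<i> * (of_real (x i) * \<phi> x)"
    have \<chi>: "?\<chi> \<in> schwartz d" by (intro schwartz_scale(1) schwartz_coord_mult \<phi> i)
    have eq: "\<i> * of_real (\<xi> i) * h \<xi> * \<phi> \<xi> = - (h \<xi> * ?\<chi> \<xi>)" for \<xi> by simp
    have "dist_pdiff i g (fourier d \<phi>) = - (LINT \<xi>|leb d. h \<xi> * ?\<chi> \<xi>)"
      unfolding dist_pdiff_def pdiff_fourier[OF d \<phi> i] has_hat_fourier[OF h \<chi>] ..
    then show ?thesis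
      unfolding eq using has_hat_integrable[OF h \<chi>] by simp
  qed
  have "(\<lambda>\<xi>. \<i> * of_real (\<xi> i) * h \<xi>) \<in> borel_measurable borel" by measurable
  then show ?thesis
    using 1 2 by (simp add: has_hat_def is_regular_def dist_fourier_def)
qed

text \<open>The formula of \<open>prod_hat\<close> for explicit representatives, which can be
  estimated pointwise, in place of the chosen ones.\<close>

definition conv :: "nat \<Rightarrow> (point \<Rightarrow> complex) \<Rightarrow> (point \<Rightarrow> complex) \<Rightarrow> point \<Rightarrow> complex" where
  "conv d V W \<xi> = (LINT \<eta>|leb d. V (\<lambda>i. \<xi> i - \<eta> i) * W \<eta>) / (2 * pi) ^ d"

lemma measurable_conv_integrand:
  fixes V W :: "point \<Rightarrow> complex"
  assumes [measurable]: "V \<in> borel_measurable borel" "W \<in> borel_measurable borel"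
  shows "(\<lambda>(\<xi>, \<eta>). V (\<lambda>i. \<xi> i - \<eta> i) * W \<eta>) \<in> borel_measurable (borel \<Otimes>\<^sub>M leb d)"
proof -
  have "(\<lambda>z::point \<times> point. \<lambda>i. fst z i - snd z i) \<in> borel_measurable (borel \<Otimes>\<^sub>M leb d)"
    by (rule measurable_point_diff) measurable
  note V = measurable_compose[OF this assms(1)]
  have W: "(\<lambda>z::point \<times> point. W (snd z)) \<in> borel_measurable (borel \<Otimes>\<^sub>M leb d)" by measurable
  show ?thesis unfolding case_prod_unfold by (rule borel_measurable_times[OF V W])
qed

lemma measurable_conv:
  assumes "V \<in> borel_measurable borel" "W \<in> borel_measurable borel"
  shows "conv d V W \<in> borel_measurable borel"
  unfolding conv_def[abs_def]
  using leb.borel_measurable_lebesgue_integral[OF measurable_conv_integrand[OF assms, of d]] by simp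

lemma prod_hat_eq_conv: "prod_hat d v w = conv d (hat d v) (hat d w)"
  by (simp add: prod_hat_def conv_def fun_eq_iff)

text \<open>For fixed \<xi> in \<open>Rd d\<close> the reflection preserves null sets, so passing
  from \<open>V\<close> and \<open>W\<close> to the chosen transforms changes the convolution
  integrand on a null set only. Integrability and tameness of the explicit convolution thus carry
  over to \<open>prod_hat\<close>.\<close>

lemma
  assumes d: "d > 0" and v: "has_hat d v V" and w: "has_hat d w W"
    and int: "\<And>\<xi>. \<xi> \<in> Rd d \<Longrightarrow> enorm d \<xi> > 0 \<Longrightarrow> integrable (leb d) (\<lambda>\<eta>. V (\<lambda>i. \<xi> i - \<eta> i) * W \<eta>)"
    and tame: "tame d (conv d V W)"
  shows prod_definedI: "prod_defined d v w"
    and has_hat_dist_prod: "has_hat d (dist_prod d v w) (conv d V W)"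
proof -
  note [measurable] = has_hat_measurable[OF v] has_hat_measurable[OF w] hat_measurable[OF v] hat_measurable[OF w]
  have ae: "AE \<eta> in leb d. hat d v (\<lambda>i. \<xi> i - \<eta> i) * hat d w \<eta> = V (\<lambda>i. \<xi> i - \<eta> i) * W \<eta>" if "\<xi> \<in> Rd d" for \<xi>
    using AE_hat_eq[OF d w] AE_leb_reflect[OF that AE_hat_eq[OF d v]] by eventually_elim simp
  have "AE \<xi> in leb d. integrable (leb d) (\<lambda>\<eta>. hat d v (\<lambda>i. \<xi> i - \<eta> i) * hat d w \<eta>)"
    using AE_leb_Rd AE_leb_enorm_pos[OF d]
  proof eventually_elim
    case (elim \<xi>)
    show ?case
      by (rule integrable_cong_AE'[OF int[OF elim] _ ae[OF elim(1)]]) measurable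
  qed
  moreover have eq: "AE \<xi> in leb d. prod_hat d v w \<xi> = conv d V W \<xi>"
    using AE_leb_Rd
  proof eventually_elim
    case (elim \<xi>)
    have "(LINT \<eta>|leb d. hat d v (\<lambda>i. \<xi> i - \<eta> i) * hat d w \<eta>) = (LINT \<eta>|leb d. V (\<lambda>i. \<xi> i - \<eta> i) * W \<eta>)"
      by (rule integral_cong_AE[OF _ _ ae[OF elim]]) measurable
    then show ?case by (simp add: prod_hat_def conv_def)
  qed
  moreover have t: "tame d (prod_hat d v w)"
    by (rule tame_cong_AE[OF tame _ eq]) (unfold prod_hat_eq_conv, rule measurable_conv[OF hat_measurable[OF v] hat_measurable[OF w]])
  ultimately show "prod_defined d v w"
    using v w tame_has_inv_hat[OF d t] unfolding prod_defined_def by blast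
  show "has_hat d (dist_prod d v w) (conv d V W)"
    unfolding dist_prod_def
    by (rule has_hat_cong_AE[OF has_hat_inv_hat[OF d t] tame_measurable[OF tame]])
       (use eq in eventually_elim, simp)
qed

section \<open>Pseudomeasure norms\<close>

lemma measurable_L2_set [measurable (raw)]:
  assumes "\<And>j. j < m \<Longrightarrow> f j \<in> borel_measurable M"
  shows "(\<lambda>x. L2_set (\<lambda>j. f j x) {..<m}) \<in> borel_measurable M"
proof -
  have "(\<lambda>x. \<Sum>j<m. (f j x)\<^sup>2) \<in> borel_measurable M"
    by (rule borel_measurable_sum) (use assms in \<open>auto intro: borel_measurable_power\<close>)
  then show ?thesis unfolding L2_set_def by measurable
qed

lemma PM_norm_measurable:
  assumes "\<And>j. j < m \<Longrightarrow> has_hat d (v j) (V j)"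
  shows "(\<lambda>\<xi>. ereal (enorm d \<xi> powr r * L2_set (\<lambda>j. cmod (hat d (v j) \<xi>)) {..<m})) \<in> borel_measurable (leb d)"
proof -
  have "(\<lambda>\<xi>. L2_set (\<lambda>j. cmod (hat d (v j) \<xi>)) {..<m}) \<in> borel_measurable borel"
  proof (rule measurable_L2_set)
    fix j assume "j < m"
    note [measurable] = hat_measurable[OF assms[OF this]]
    show "(\<lambda>\<xi>. cmod (hat d (v j) \<xi>)) \<in> borel_measurable borel" by measurable
  qed
  note [measurable] = this
  show ?thesis by measurable
qed

lemma PM_norm_le:
  assumes d: "d > 0" and v: "\<And>j. j < m \<Longrightarrow> has_hat d (v j) (V j)"
    and bnd: "AE \<xi> in leb d. enorm d \<xi> powr r * L2_set (\<lambda>j. cmod (V j \<xi>)) {..<m} \<le> M"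
  shows "PM_norm d m r v \<le> ereal M"
  unfolding PM_norm_def
proof (rule esssup_I[OF PM_norm_measurable[OF v]])
  have "AE \<xi> in leb d. \<forall>j\<in>{..<m}. hat d (v j) \<xi> = V j \<xi>"
    by (intro AE_finite_allI AE_hat_eq d v) auto
  then show "AE \<xi> in leb d. ereal (enorm d \<xi> powr r * L2_set (\<lambda>j. cmod (hat d (v j) \<xi>)) {..<m}) \<le> ereal M"
    using bnd
  proof eventually_elim
    case (elim \<xi>)
    have "L2_set (\<lambda>j. cmod (hat d (v j) \<xi>)) {..<m} = L2_set (\<lambda>j. cmod (V j \<xi>)) {..<m}"
      by (intro L2_set_cong refl) (use elim(1) in auto)
    then show ?case using elim(2) by simp
  qed
qed

lemma PM_norm_ge_0:
  assumes "\<And>j. j < m \<Longrightarrow> has_hat d (v j) (V j)"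
  shows "0 \<le> PM_norm d m r v"
proof -
  have "0 = esssup (leb d) (\<lambda>\<xi>. 0 :: ereal)" using esssup_const[of "leb d" "0::ereal"] emeasure_leb_UNIV[of d] by simp
  also have "\<dots> \<le> PM_norm d m r v"
    unfolding PM_norm_def by (rule esssup_mono) (auto intro: mult_nonneg_nonneg)
  finally show ?thesis .
qed

lemma L2_set_le_card:
  assumes "\<And>j. j < m \<Longrightarrow> 0 \<le> f j" "\<And>j. j < m \<Longrightarrow> f j \<le> B"
  shows "L2_set f {..<m} \<le> real m * B"
proof -
  have "L2_set f {..<m} \<le> sum f {..<m}" by (rule L2_set_le_sum) (use assms in auto)
  also have "\<dots> \<le> (\<Sum>j<m. B)" by (intro sum_mono) (use assms in auto)
  finally show ?thesis by simp
qed

text \<open>The Euclidean norm is at most the sum of the components. The factor m is harmless, and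
  bounds at single nonzero frequencies become sufficient.\<close>

lemma PM_norm_le_componentwise:
  assumes d: "d > 0" and v: "\<And>j. j < m \<Longrightarrow> has_hat d (v j) (V j)"
    and bnd: "\<And>\<xi> j. \<xi> \<in> Rd d \<Longrightarrow> enorm d \<xi> > 0 \<Longrightarrow> j < m \<Longrightarrow> enorm d \<xi> powr r * cmod (V j \<xi>) \<le> M"
  shows "PM_norm d m r v \<le> ereal (real m * M)"
proof (rule PM_norm_le[OF d v])
  show "AE \<xi> in leb d. enorm d \<xi> powr r * L2_set (\<lambda>j. cmod (V j \<xi>)) {..<m} \<le> real m * M"
    using AE_leb_Rd AE_leb_enorm_pos[OF d]
  proof eventually_elim
    case (elim \<xi>)
    have "enorm d \<xi> powr r * L2_set (\<lambda>j. cmod (V j \<xi>)) {..<m} = L2_set (\<lambda>j. enorm d \<xi> powr r * cmod (V j \<xi>)) {..<m}"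
      by (rule L2_set_right_distrib) simp
    also have "\<dots> \<le> real m * M" by (rule L2_set_le_card) (use bnd[OF elim] in auto)
    finally show ?case .
  qed
qed

section \<open>The linear propagator\<close>

text \<open>Each component of \<open>W_symbol\<close> has this form, with \<open>s n\<close> a
  component of A^n x. Scalar series replace a norm on matrices.\<close>

definition expseries :: "real \<Rightarrow> (nat \<Rightarrow> complex) \<Rightarrow> complex" where
  "expseries t s = (\<Sum>n. complex_of_real ((- t) ^ n / fact n) * s n)"

text \<open>Geometric growth of the coefficients makes the exponential series entire in t.\<close>

definition geom_bounded :: "(nat \<Rightarrow> complex) \<Rightarrow> bool" where
  "geom_bounded s \<longleftrightarrow> (\<exists>N K. \<forall>n. cmod (s n) \<le> N * K ^ n)"

lemma geom_bounded_summable: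
  assumes "geom_bounded s"
  shows "summable (\<lambda>n. complex_of_real ((- t) ^ n / fact n) * s n)"
proof -
  obtain N K where s: "\<And>n. cmod (s n) \<le> N * K ^ n" using assms by (auto simp: geom_bounded_def)
  have "summable (\<lambda>n. N * ((\<bar>t\<bar> * K) ^ n /\<^sub>R fact n))"
    by (intro summable_mult summable_exp_generic)
  then show ?thesis
  proof (rule summable_comparison_test'[where N=0])
    fix n :: nat
    have "cmod (complex_of_real ((- t) ^ n / fact n) * s n) = \<bar>t\<bar> ^ n / fact n * cmod (s n)"
      by (simp add: norm_mult norm_divide norm_power)
    also have "\<dots> \<le> \<bar>t\<bar> ^ n / fact n * (N * K ^ n)" by (intro mult_left_mono s) auto
    finally show "cmod (complex_of_real ((- t) ^ n / fact n) * s n) \<le> N * ((\<bar>t\<bar> * K) ^ n /\<^sub>R fact n)"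
      by (simp add: power_mult_distrib field_simps)
  qed
qed

lemma expseries_0 [simp]: "expseries 0 s = s 0"
proof -
  have "(\<lambda>n. complex_of_real ((- 0) ^ n / fact n) * s n) sums (\<Sum>n\<in>{0}. complex_of_real ((- 0) ^ n / fact n) * s n)"
    by (rule sums_finite) (auto simp: power_0_left)
  then show ?thesis by (simp add: expseries_def sums_iff)
qed

lemma expseries_cmult:
  assumes "geom_bounded s"
  shows "expseries t (\<lambda>n. c * s n) = c * expseries t s"
  unfolding expseries_def suminf_mult[OF geom_bounded_summable[OF assms], symmetric]
  by (simp only: mult.left_commute)

lemma expseries_add:
  assumes "geom_bounded s" "geom_bounded s'"
  shows "expseries t (\<lambda>n. s n + s' n) = expseries t s + expseries t s'"
  unfolding expseries_def suminf_add[OF geom_bounded_summable[OF assms(1)] geom_bounded_summable[OF assms(2)]]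
  by (simp only: distrib_left)

lemma expseries_diff:
  assumes "geom_bounded s" "geom_bounded s'"
  shows "expseries t (\<lambda>n. s n - s' n) = expseries t s - expseries t s'"
  unfolding expseries_def suminf_diff[OF geom_bounded_summable[OF assms(1)] geom_bounded_summable[OF assms(2)]]
  by (simp only: right_diff_distrib)

lemma expseries_sum:
  assumes "\<And>i. i \<in> I \<Longrightarrow> geom_bounded (s i)"
  shows "expseries t (\<lambda>n. \<Sum>i\<in>I. s i n) = (\<Sum>i\<in>I. expseries t (s i))"
  unfolding expseries_def sum_distrib_left
  by (rule suminf_sum) (rule geom_bounded_summable[OF assms])

text \<open>Termwise differentiation shifts the sequence by one. For \<open>s n\<close> a component
  of A^n x this becomes the equation W' = - A W, once \<open>expseries_A\<close> has moved A out of
  the series.\<close>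

lemma expseries_deriv:
  assumes s: "geom_bounded s"
  shows "((\<lambda>t. expseries t s) has_vector_derivative - expseries t (\<lambda>n. s (Suc n))) (at t)"
proof -
  define c where "c n = complex_of_real ((- 1) ^ n / fact n) * s n" for n
  have eq: "c n * of_real t ^ n = complex_of_real ((- t) ^ n / fact n) * s n" for n t
    unfolding c_def by (simp add: power_minus[of t] mult_ac)
  have "summable (\<lambda>n. c n * z ^ n)" for z
  proof -
    have "summable (\<lambda>n. norm (c n * of_real (norm z) ^ n))"
    proof -
      obtain N K where s: "\<And>n. cmod (s n) \<le> N * K ^ n" using assms by (auto simp: geom_bounded_def)
      have "geom_bounded (\<lambda>n. of_real (cmod (s n)))" using s by (auto simp: geom_bounded_def)
      from geom_bounded_summable[OF this, of "- norm z"]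
      have "summable (\<lambda>n. complex_of_real (cmod z ^ n / fact n * cmod (s n)))" by simp
      then have "summable (\<lambda>n. cmod z ^ n / fact n * cmod (s n))" by (simp only: summable_of_real_iff)
      then show ?thesis unfolding c_def by (simp add: norm_mult norm_divide norm_power mult_ac)
    qed
    then have "summable (\<lambda>n. norm (c n * z ^ n))" by (simp add: norm_mult norm_power)
    then show ?thesis by (rule summable_norm_cancel)
  qed
  then have "((\<lambda>z. \<Sum>n. c n * z ^ n) has_field_derivative (\<Sum>n. diffs c n * of_real t ^ n)) (at (of_real t))"
    by (rule termdiffs_strong_converges_everywhere)
  from has_vector_derivative_real_field[OF this]
  have "((\<lambda>t. expseries t s) has_vector_derivative (\<Sum>n. diffs c n * of_real t ^ n)) (at t)"
    unfolding eq expseries_def .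
  also have "(\<Sum>n. diffs c n * of_real t ^ n) = (\<Sum>n. - (complex_of_real ((- t) ^ n / fact n) * s (Suc n)))"
  proof (rule suminf_cong)
    fix n
    have f: "complex_of_real (fact (Suc n)) = of_nat (Suc n) * complex_of_real (fact n)" by simp
    have "diffs c n = complex_of_real ((- 1) ^ Suc n / fact n) * s (Suc n)"
      unfolding diffs_def c_def of_real_divide f by (simp del: of_nat_Suc fact_Suc)
    then show "diffs c n * of_real t ^ n = - (complex_of_real ((- t) ^ n / fact n) * s (Suc n))"
      by (simp add: power_minus[of t] mult_ac)
  qed
  also have "\<dots> = - expseries t (\<lambda>n. s (Suc n))"
  proof -
    obtain N K where s: "\<And>n. cmod (s n) \<le> N * K ^ n" using assms by (auto simp: geom_bounded_def)
    have "geom_bounded (\<lambda>n. s (Suc n))"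
      unfolding geom_bounded_def using s by (intro exI[of _ "N * K"] exI[of _ K] allI) (simp add: mult.assoc flip: power_Suc)
    then show ?thesis unfolding expseries_def by (intro suminf_minus geom_bounded_summable)
  qed
  finally show ?thesis .
qed

text \<open>The weights 1 and |\<xi>| on the scalar part match the two spaces that contain the
  density. Up to constants this is the square root of \<open>energy\<close>, uniformly in \<xi>,
  hence it is adapted to the semigroup.\<close>

definition nrm :: "nat \<Rightarrow> point \<Rightarrow> complex \<times> (nat \<Rightarrow> complex) \<Rightarrow> real" where
  "nrm d \<xi> x = (1 + enorm d \<xi>) * cmod (fst x) + (\<Sum>j<d. cmod (snd x j))"

lemma nrm_nonneg [simp]: "0 \<le> nrm d \<xi> x"
  by (simp add: nrm_def sum_nonneg)

lemma nrm_fst: "(1 + enorm d \<xi>) * cmod (fst x) \<le> nrm d \<xi> x"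
  by (simp add: nrm_def sum_nonneg)

lemma nrm_snd: "j < d \<Longrightarrow> cmod (snd x j) \<le> nrm d \<xi> x"
  using member_le_sum[of j "{..<d}" "\<lambda>j. cmod (snd x j)"] by (simp add: nrm_def add_increasing)

lemma nrm_fst_le: "cmod (fst x) \<le> nrm d \<xi> x" "enorm d \<xi> * cmod (fst x) \<le> nrm d \<xi> x"
proof -
  have "cmod (fst x) + enorm d \<xi> * cmod (fst x) \<le> nrm d \<xi> x"
    using nrm_fst[where d=d and \<xi>=\<xi> and x=x] by (simp add: distrib_right)
  moreover have "0 \<le> enorm d \<xi> * cmod (fst x)" by simp
  ultimately show "cmod (fst x) \<le> nrm d \<xi> x" "enorm d \<xi> * cmod (fst x) \<le> nrm d \<xi> x"
    using norm_ge_zero[of "fst x"] by linarith+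
qed

lemma cmod_ip_le:
  "(cmod (\<Sum>i<d. complex_of_real (\<xi> i) * w i))\<^sup>2 \<le> (enorm d \<xi>)\<^sup>2 * (\<Sum>j<d. (cmod (w j))\<^sup>2)"
proof -
  have "cmod (\<Sum>i<d. complex_of_real (\<xi> i) * w i) \<le> (\<Sum>i<d. \<bar>\<xi> i\<bar> * \<bar>cmod (w i)\<bar>)"
    by (rule order_trans[OF norm_sum]) (simp add: norm_mult)
  also have "\<dots> \<le> L2_set \<xi> {..<d} * L2_set (\<lambda>i. cmod (w i)) {..<d}" by (rule L2_set_mult_ineq)
  finally have "(cmod (\<Sum>i<d. complex_of_real (\<xi> i) * w i))\<^sup>2 \<le> (L2_set \<xi> {..<d} * L2_set (\<lambda>i. cmod (w i)) {..<d})\<^sup>2"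
    by (intro power_mono) auto
  also have "\<dots> = (enorm d \<xi>)\<^sup>2 * (\<Sum>j<d. (cmod (w j))\<^sup>2)"
    by (simp add: power_mult_distrib L2_set_def sum_nonneg)
  finally show ?thesis .
qed

lemma cmod_ip_le_sum:
  "cmod (\<Sum>i<d. complex_of_real (\<xi> i) * w i) \<le> enorm d \<xi> * (\<Sum>j<d. cmod (w j))"
proof -
  have "cmod (\<Sum>i<d. complex_of_real (\<xi> i) * w i) \<le> (\<Sum>i<d. \<bar>\<xi> i\<bar> * cmod (w i))"
    by (rule order_trans[OF norm_sum]) (simp add: norm_mult)
  also have "\<dots> \<le> (\<Sum>i<d. enorm d \<xi> * cmod (w i))"
    by (intro sum_mono mult_right_mono abs_coord_le_enorm) auto
  finally show ?thesis by (simp add: sum_distrib_left)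
qed

section \<open>The symbol of the linearised system and its exponential\<close>

locale nsk =
  fixes \<mu> \<nu> \<kappa> \<alpha> :: real
  assumes \<mu>: "\<mu> > 0" and \<mu>\<nu>: "\<mu> + \<nu> > 0" and \<kappa>: "\<kappa> > 0" and \<alpha>: "\<alpha> > 0"
begin

abbreviation A where "A d \<xi> \<equiv> A_symbol d \<mu> \<nu> \<kappa> \<alpha> \<xi>"
abbreviation W where "W d t \<xi> \<equiv> W_symbol d \<mu> \<nu> \<kappa> \<alpha> t \<xi>"

lemma fst_A: "fst (A d \<xi> x) = \<i> * (\<Sum>i<d. complex_of_real (\<xi> i) * snd x i)"
  by (cases x) (simp add: A_symbol_def Let_def)

lemma snd_A: "snd (A d \<xi> x) j = \<i> * complex_of_real (\<alpha> + \<kappa> * (enorm d \<xi>)\<^sup>2) * fst x * complex_of_real (\<xi> j)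
          + complex_of_real (\<mu> * (enorm d \<xi>)\<^sup>2) * snd x j
          + complex_of_real (\<mu> + \<nu>) * (\<Sum>i<d. complex_of_real (\<xi> i) * snd x i) * complex_of_real (\<xi> j)"
  by (cases x) (simp add: A_symbol_def Let_def)

lemma fst_W: "fst (W d t \<xi> x) = expseries t (\<lambda>n. fst ((A d \<xi> ^^ n) x))"
  by (simp add: W_symbol_def expseries_def)

lemma snd_W: "snd (W d t \<xi> x) j = expseries t (\<lambda>n. snd ((A d \<xi> ^^ n) x) j)"
  by (simp add: W_symbol_def expseries_def)

text \<open>A crude operator bound for A(\<xi>), cubic in the frequency. It serves at a single
  frequency, for convergence of the series, and on bounded frequencies, for the dependence on time;
  its size does not enter the decay.\<close>

definition A_bound :: "nat \<Rightarrow> real \<Rightarrow> real" where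
  "A_bound d r = (1 + r) * r + real d * ((\<alpha> + \<kappa> * r\<^sup>2) * r + \<mu> * r\<^sup>2 + (\<mu> + \<nu>) * r\<^sup>2)"

lemma A_bound_nonneg: "r \<ge> 0 \<Longrightarrow> A_bound d r \<ge> 0"
  using \<mu> \<mu>\<nu> \<kappa> \<alpha> by (simp add: A_bound_def)

lemma A_bound_mono: "0 \<le> r \<Longrightarrow> r \<le> R \<Longrightarrow> A_bound d r \<le> A_bound d R"
proof -
  assume r: "0 \<le> r" "r \<le> R"
  then have r2: "r\<^sup>2 \<le> R\<^sup>2" by (intro power_mono) auto
  have "(1 + r) * r \<le> (1 + R) * R" using r by (intro mult_mono) auto
  moreover have "(\<alpha> + \<kappa> * r\<^sup>2) * r \<le> (\<alpha> + \<kappa> * R\<^sup>2) * R"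
    using r r2 \<alpha> \<kappa> by (intro mult_mono add_mono mult_left_mono) auto
  moreover have "\<mu> * r\<^sup>2 \<le> \<mu> * R\<^sup>2" "(\<mu> + \<nu>) * r\<^sup>2 \<le> (\<mu> + \<nu>) * R\<^sup>2"
    using r2 \<mu> \<mu>\<nu> by (auto intro!: mult_left_mono)
  ultimately show ?thesis
    unfolding A_bound_def by (intro add_mono mult_left_mono[of _ _ "real d"]) auto
qed

lemma nrm_A_le: "nrm d \<xi> (A d \<xi> x) \<le> A_bound d (enorm d \<xi>) * nrm d \<xi> x"
proof -
  define r where "r = enorm d \<xi>"
  have r: "r \<ge> 0" by (simp add: r_def)
  let ?z = "\<Sum>i<d. complex_of_real (\<xi> i) * snd x i"
  let ?n = "nrm d \<xi> x"
  have z: "cmod ?z \<le> r * ?n"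
  proof -
    have "cmod ?z \<le> r * (\<Sum>j<d. cmod (snd x j))" unfolding r_def by (rule cmod_ip_le_sum)
    also have "\<dots> \<le> r * ?n" using r by (intro mult_left_mono) (auto simp: nrm_def)
    finally show ?thesis .
  qed
  have s: "cmod (snd (A d \<xi> x) j) \<le> ((\<alpha> + \<kappa> * r\<^sup>2) * r + \<mu> * r\<^sup>2 + (\<mu> + \<nu>) * r\<^sup>2) * ?n" if j: "j < d" for j
  proof -
    have \<xi>j: "\<bar>\<xi> j\<bar> \<le> r" unfolding r_def by (rule abs_coord_le_enorm[OF j])
    have a: "0 \<le> \<alpha> + \<kappa> * r\<^sup>2" using \<alpha> \<kappa> by simp
    have "cmod (snd (A d \<xi> x) j) \<le> cmod (\<i> * complex_of_real (\<alpha> + \<kappa> * r\<^sup>2) * fst x * complex_of_real (\<xi> j))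
       + cmod (complex_of_real (\<mu> * r\<^sup>2) * snd x j) + cmod (complex_of_real (\<mu> + \<nu>) * ?z * complex_of_real (\<xi> j))"
      unfolding snd_A r_def[symmetric] by (intro order_trans[OF norm_triangle_ineq] add_mono norm_triangle_ineq order_refl)
    also have "\<dots> = (\<alpha> + \<kappa> * r\<^sup>2) * cmod (fst x) * \<bar>\<xi> j\<bar> + \<mu> * r\<^sup>2 * cmod (snd x j) + (\<mu> + \<nu>) * cmod ?z * \<bar>\<xi> j\<bar>"
      using a \<mu> \<mu>\<nu> by (simp only: norm_mult norm_of_real norm_ii) (simp add: abs_mult)
    also have "\<dots> \<le> (\<alpha> + \<kappa> * r\<^sup>2) * ?n * r + \<mu> * r\<^sup>2 * ?n + (\<mu> + \<nu>) * (r * ?n) * r"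
      using a \<mu> \<mu>\<nu> r z \<xi>j nrm_fst_le(1)[of x d \<xi>] nrm_snd[OF j, of x \<xi>]
      by (intro add_mono mult_mono mult_left_mono mult_nonneg_nonneg) auto
    finally show ?thesis by (simp add: algebra_simps power2_eq_square)
  qed
  have "nrm d \<xi> (A d \<xi> x) \<le> (1 + r) * (r * ?n) + (\<Sum>j<d. ((\<alpha> + \<kappa> * r\<^sup>2) * r + \<mu> * r\<^sup>2 + (\<mu> + \<nu>) * r\<^sup>2) * ?n)"
    unfolding nrm_def[of d \<xi> "A d \<xi> x"] r_def[symmetric] using z r
    by (intro add_mono sum_mono s mult_left_mono) (auto simp: fst_A norm_mult)
  then show ?thesis by (simp add: A_bound_def r_def[symmetric] algebra_simps)
qed

lemma nrm_A_pow_le: "nrm d \<xi> ((A d \<xi> ^^ n) x) \<le> nrm d \<xi> x * A_bound d (enorm d \<xi>) ^ n"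
proof (induction n)
  case (Suc n)
  have "nrm d \<xi> ((A d \<xi> ^^ Suc n) x) \<le> A_bound d (enorm d \<xi>) * nrm d \<xi> ((A d \<xi> ^^ n) x)"
    using nrm_A_le by simp
  also have "\<dots> \<le> A_bound d (enorm d \<xi>) * (nrm d \<xi> x * A_bound d (enorm d \<xi>) ^ n)"
    by (intro mult_left_mono Suc A_bound_nonneg) auto
  finally show ?case by (simp add: mult_ac)
qed simp

lemma geom_bounded_fst: "geom_bounded (\<lambda>n. fst ((A d \<xi> ^^ n) x))"
  unfolding geom_bounded_def using order_trans[OF nrm_fst_le(1) nrm_A_pow_le] by blast

lemma geom_bounded_snd: "j < d \<Longrightarrow> geom_bounded (\<lambda>n. snd ((A d \<xi> ^^ n) x) j)"
  unfolding geom_bounded_def using order_trans[OF nrm_snd nrm_A_pow_le] by blast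

lemma geom_bounded_cmult: "geom_bounded s \<Longrightarrow> geom_bounded (\<lambda>n. c * s n)"
proof -
  assume "geom_bounded s"
  then obtain N K where "\<And>n. cmod (s n) \<le> N * K ^ n" by (auto simp: geom_bounded_def)
  then have "cmod (c * s n) \<le> (cmod c * N) * K ^ n" for n
    by (simp add: norm_mult mult.assoc mult_left_mono)
  then show ?thesis unfolding geom_bounded_def by blast
qed

text \<open>A(\<xi>) is linear with finitely many coefficients and so commutes with the series; all
  sequences involved grow geometrically, which justifies splitting the sums.\<close>

lemma expseries_A:
  shows "expseries t (\<lambda>n. fst ((A d \<xi> ^^ Suc n) x)) = fst (A d \<xi> (W d t \<xi> x))"
    and "j < d \<Longrightarrow> expseries t (\<lambda>n. snd ((A d \<xi> ^^ Suc n) x) j) = snd (A d \<xi> (W d t \<xi> x)) j"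
proof -
  let ?z = "\<lambda>n. \<Sum>i<d. complex_of_real (\<xi> i) * snd ((A d \<xi> ^^ n) x) i"
  have gz: "geom_bounded ?z"
  proof -
    have "cmod (?z n) \<le> (enorm d \<xi> * nrm d \<xi> x) * A_bound d (enorm d \<xi>) ^ n" for n
    proof -
      have "cmod (?z n) \<le> enorm d \<xi> * (\<Sum>j<d. cmod (snd ((A d \<xi> ^^ n) x) j))" by (rule cmod_ip_le_sum)
      also have "\<dots> \<le> enorm d \<xi> * nrm d \<xi> ((A d \<xi> ^^ n) x)" by (intro mult_left_mono) (auto simp: nrm_def)
      also have "\<dots> \<le> enorm d \<xi> * (nrm d \<xi> x * A_bound d (enorm d \<xi>) ^ n)" by (intro mult_left_mono nrm_A_pow_le) auto
      finally show ?thesis by (simp add: mult.assoc)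
    qed
    then show ?thesis unfolding geom_bounded_def by blast
  qed
  have z: "expseries t ?z = (\<Sum>i<d. complex_of_real (\<xi> i) * snd (W d t \<xi> x) i)"
    by (subst expseries_sum) (auto simp: snd_W expseries_cmult geom_bounded_snd intro!: geom_bounded_cmult geom_bounded_snd)
  show "expseries t (\<lambda>n. fst ((A d \<xi> ^^ Suc n) x)) = fst (A d \<xi> (W d t \<xi> x))"
    by (simp add: fst_A z expseries_cmult[OF gz])
  assume j: "j < d"
  have g: "geom_bounded (\<lambda>n. snd ((A d \<xi> ^^ n) x) j)" by (rule geom_bounded_snd[OF j])
  let ?c1 = "\<i> * complex_of_real (\<alpha> + \<kappa> * (enorm d \<xi>)\<^sup>2) * complex_of_real (\<xi> j)"
  let ?c2 = "complex_of_real (\<mu> * (enorm d \<xi>)\<^sup>2)"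
  let ?c3 = "complex_of_real (\<mu> + \<nu>) * complex_of_real (\<xi> j)"
  have eq: "snd ((A d \<xi> ^^ Suc n) x) j = (?c1 * fst ((A d \<xi> ^^ n) x) + ?c2 * snd ((A d \<xi> ^^ n) x) j) + ?c3 * ?z n" for n
    by (simp add: snd_A mult_ac)
  have "geom_bounded (\<lambda>n. snd ((A d \<xi> ^^ Suc n) x) j)"
    unfolding funpow_Suc_right o_apply by (rule geom_bounded_snd[OF j])
  then have g2: "geom_bounded (\<lambda>n. ?c1 * fst ((A d \<xi> ^^ n) x) + ?c2 * snd ((A d \<xi> ^^ n) x) j)"
  proof -
    obtain N K where 1: "\<And>n. cmod (?c1 * fst ((A d \<xi> ^^ n) x) + ?c2 * snd ((A d \<xi> ^^ n) x) j) \<le> N * K ^ n"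
    proof -
      have "cmod (?c1 * fst ((A d \<xi> ^^ n) x) + ?c2 * snd ((A d \<xi> ^^ n) x) j) \<le> ((cmod ?c1 + cmod ?c2) * nrm d \<xi> x) * A_bound d (enorm d \<xi>) ^ n" for n
      proof -
        have "cmod (?c1 * fst ((A d \<xi> ^^ n) x) + ?c2 * snd ((A d \<xi> ^^ n) x) j) \<le> cmod ?c1 * cmod (fst ((A d \<xi> ^^ n) x)) + cmod ?c2 * cmod (snd ((A d \<xi> ^^ n) x) j)"
          unfolding norm_mult[symmetric] by (rule norm_triangle_ineq)
        also have "\<dots> \<le> cmod ?c1 * (nrm d \<xi> x * A_bound d (enorm d \<xi>) ^ n) + cmod ?c2 * (nrm d \<xi> x * A_bound d (enorm d \<xi>) ^ n)"
          using order_trans[OF nrm_fst_le(1) nrm_A_pow_le] order_trans[OF nrm_snd[OF j] nrm_A_pow_le]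
          by (intro add_mono mult_left_mono) auto
        finally show ?thesis by (simp only: distrib_right mult.assoc)
      qed
      then show ?thesis by (rule that)
    qed
    then show ?thesis unfolding geom_bounded_def by blast
  qed
  show "expseries t (\<lambda>n. snd ((A d \<xi> ^^ Suc n) x) j) = snd (A d \<xi> (W d t \<xi> x)) j"
    unfolding eq expseries_add[OF g2 geom_bounded_cmult[OF gz]]
      expseries_add[OF geom_bounded_cmult[OF geom_bounded_fst] geom_bounded_cmult[OF g]]
      expseries_cmult[OF gz] expseries_cmult[OF g] expseries_cmult[OF geom_bounded_fst] z snd_A
      fst_W[symmetric] snd_W[symmetric]
    by (simp only: mult_ac)
qed

lemma W_0: "W d 0 \<xi> x = x"
  by (intro prod_eqI ext) (simp_all add: fst_W snd_W)

lemma W_deriv: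
  shows "((\<lambda>t. fst (W d t \<xi> x)) has_vector_derivative - fst (A d \<xi> (W d t \<xi> x))) (at t)"
    and "j < d \<Longrightarrow> ((\<lambda>t. snd (W d t \<xi> x) j) has_vector_derivative - snd (A d \<xi> (W d t \<xi> x)) j) (at t)"
  using expseries_deriv[OF geom_bounded_fst, of d \<xi> x t] expseries_deriv[OF geom_bounded_snd, of j d \<xi> x t]
  by (simp_all only: fst_W[symmetric] snd_W[symmetric] expseries_A)

text \<open>Lyapunov functional: the physical energy, perturbed by a small multiple of
  \<open>Im (cnj b * z)\<close> with \<open>z = \<xi> \<cdot> w\<close> so that its derivative also controls \<open>|b|\<^sup>2\<close>.\<close>

definition \<epsilon> :: real where "\<epsilon> = min (sqrt \<kappa> / 2) (\<mu> / (2 + (2 * \<mu> + \<nu>)\<^sup>2 / \<kappa>))"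

text \<open>The dissipation is at least 3 \<open>lam\<close> |\<xi>|^2 times the energy, and the
  functional is at most 3/2 of the energy. This gives the rate 2 \<open>lam\<close> |\<xi>|^2 for
  the quadratic functional, that is \<open>lam\<close> |\<xi>|^2 for the norm.\<close>

definition lam :: real where "lam = min \<mu> \<epsilon> / 3"

lemma \<epsilon>_pos: "\<epsilon> > 0"
  using \<mu> \<kappa> by (auto simp: \<epsilon>_def intro!: divide_pos_pos add_pos_nonneg)

lemma lam_pos: "lam > 0"
  using \<mu> \<epsilon>_pos by (simp add: lam_def)

text \<open>The first bound keeps the perturbation below half of the energy. The second one lets the
  viscosity absorb what the perturbation produces in w: the term 2 \<epsilon> |z|^2 and, after
  AM-GM, a share of the mixed viscous term.\<close>

lemma \<epsilon>_bounds: "4 * \<epsilon>\<^sup>2 \<le> \<kappa>" "2 * \<epsilon> + \<epsilon> * (2 * \<mu> + \<nu>)\<^sup>2 / \<kappa> \<le> \<mu>"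
proof -
  have "\<epsilon> \<le> sqrt \<kappa> / 2" unfolding \<epsilon>_def by (rule min.cobounded1)
  then have "\<epsilon>\<^sup>2 \<le> (sqrt \<kappa> / 2)\<^sup>2" using \<epsilon>_pos by (intro power_mono) auto
  then show "4 * \<epsilon>\<^sup>2 \<le> \<kappa>" using \<kappa> by (simp add: power_divide)
  have "\<epsilon> * (2 + (2 * \<mu> + \<nu>)\<^sup>2 / \<kappa>) \<le> \<mu> / (2 + (2 * \<mu> + \<nu>)\<^sup>2 / \<kappa>) * (2 + (2 * \<mu> + \<nu>)\<^sup>2 / \<kappa>)"
    using \<kappa> by (intro mult_right_mono) (auto simp: \<epsilon>_def)
  also have "\<dots> = \<mu>" using \<kappa> by (simp add: add_pos_nonneg less_imp_neq[THEN not_sym])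
  finally show "2 * \<epsilon> + \<epsilon> * (2 * \<mu> + \<nu>)\<^sup>2 / \<kappa> \<le> \<mu>" by (simp add: algebra_simps)
qed

text \<open>AM-GM, in the form in which mixed terms are absorbed.\<close>

lemma abs_le_of_square_le_4:
  fixes X P Q :: real
  assumes "X\<^sup>2 \<le> 4 * (P * Q)" "P \<ge> 0" "Q \<ge> 0"
  shows "\<bar>X\<bar> \<le> P + Q"
proof -
  have "X\<^sup>2 \<le> (P + Q)\<^sup>2"
    using assms sum_squares_ge_zero[of "P - Q" 0] by (simp add: power2_eq_square algebra_simps)
  then show ?thesis using assms abs_le_square_iff[of X "P + Q"] by simp
qed

text \<open>To be read with B = |b|^2, S = |w|^2, X = Im (cnj b z), r = |\<xi>|, and Cauchy-Schwarz
  as the assumption on X; in the next lemma also Z = |z|^2. The real inequalities are kept apart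
  from the complex computations.\<close>

lemma energy_comparison:
  fixes B S X r :: real
  assumes B: "B \<ge> 0" and S: "S \<ge> 0" and X: "X\<^sup>2 \<le> B * (r\<^sup>2 * S)"
  shows "\<bar>2 * \<epsilon> * X\<bar> \<le> ((\<alpha> + \<kappa> * r\<^sup>2) * B + S) / 2"
proof -
  have "\<bar>2 * \<epsilon> * X\<bar> \<le> \<kappa> * r\<^sup>2 * B / 2 + S / 2"
  proof (rule abs_le_of_square_le_4)
    have "(2 * \<epsilon> * X)\<^sup>2 = 4 * \<epsilon>\<^sup>2 * X\<^sup>2" by (simp add: power_mult_distrib)
    also have "\<dots> \<le> \<kappa> * (B * (r\<^sup>2 * S))" using \<epsilon>_bounds(1) X \<kappa> by (intro mult_mono) auto
    finally show "(2 * \<epsilon> * X)\<^sup>2 \<le> 4 * (\<kappa> * r\<^sup>2 * B / 2 * (S / 2))" by (simp add: algebra_simps)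
  qed (use \<kappa> B S in auto)
  also have "\<dots> \<le> ((\<alpha> + \<kappa> * r\<^sup>2) * B + S) / 2" using \<alpha> B by (simp add: algebra_simps)
  finally show ?thesis .
qed

text \<open>The left side is the time derivative of the functional. The term with
  \<open>\<mu> + \<nu>\<close> has a good sign and is dropped; \<epsilon> Z is absorbed by the
  viscosity. The perturbation creates the gain - 2 \<epsilon> a r^2 B with a = \<alpha> + \<kappa>
  r^2; half of it pays for the B part of the mixed term because \<kappa> r^2 \<le> a, and the other
  half remains.\<close>

lemma energy_dissipation:
  fixes B S X Z r :: real
  assumes B: "B \<ge> 0" and S: "S \<ge> 0" and X: "X\<^sup>2 \<le> B * (r\<^sup>2 * S)" and Z: "0 \<le> Z" "Z \<le> r\<^sup>2 * S"
  shows "- 2 * \<mu> * r\<^sup>2 * S - 2 * (\<mu> + \<nu>) * Z + 2 * \<epsilon> * (Z - (\<alpha> + \<kappa> * r\<^sup>2) * r\<^sup>2 * B - (2 * \<mu> + \<nu>) * r\<^sup>2 * X)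
     \<le> - (2 * lam * r\<^sup>2) * ((\<alpha> + \<kappa> * r\<^sup>2) * B + S + 2 * \<epsilon> * X)"
proof -
  define a where "a = \<alpha> + \<kappa> * r\<^sup>2"
  define \<beta> where "\<beta> = 2 * \<mu> + \<nu>"
  have a: "a \<ge> 0" "\<kappa> * r\<^sup>2 \<le> a" using \<alpha> \<kappa> by (auto simp: a_def)
  have x: "\<bar>2 * \<epsilon> * \<beta> * X\<bar> \<le> \<epsilon> * \<kappa> * r\<^sup>2 * B + \<epsilon> * \<beta>\<^sup>2 / \<kappa> * S"
  proof (rule abs_le_of_square_le_4)
    have "(2 * \<epsilon> * \<beta> * X)\<^sup>2 = 4 * \<epsilon>\<^sup>2 * \<beta>\<^sup>2 * X\<^sup>2" by (simp add: power_mult_distrib)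
    also have "\<dots> \<le> 4 * \<epsilon>\<^sup>2 * \<beta>\<^sup>2 * (B * (r\<^sup>2 * S))" using X by (intro mult_left_mono) auto
    finally show "(2 * \<epsilon> * \<beta> * X)\<^sup>2 \<le> 4 * (\<epsilon> * \<kappa> * r\<^sup>2 * B * (\<epsilon> * \<beta>\<^sup>2 / \<kappa> * S))"
      using \<kappa> by (simp add: field_simps power2_eq_square)
  qed (use \<kappa> \<epsilon>_pos B S in auto)
  have x': "- (2 * \<epsilon> * \<beta> * r\<^sup>2 * X) \<le> r\<^sup>2 * (\<epsilon> * \<kappa> * r\<^sup>2 * B + \<epsilon> * \<beta>\<^sup>2 / \<kappa> * S)"
  proof -
    have "r\<^sup>2 * (- (2 * \<epsilon> * \<beta> * X)) \<le> r\<^sup>2 * (\<epsilon> * \<kappa> * r\<^sup>2 * B + \<epsilon> * \<beta>\<^sup>2 / \<kappa> * S)"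
      using x by (intro mult_left_mono) auto
    then show ?thesis by (simp add: mult_ac)
  qed
  have "- 2 * \<mu> * r\<^sup>2 * S - 2 * (\<mu> + \<nu>) * Z + 2 * \<epsilon> * (Z - a * r\<^sup>2 * B - \<beta> * r\<^sup>2 * X)
      \<le> - 2 * \<mu> * r\<^sup>2 * S + 2 * \<epsilon> * (r\<^sup>2 * S) - 2 * \<epsilon> * a * r\<^sup>2 * B + r\<^sup>2 * (\<epsilon> * \<kappa> * r\<^sup>2 * B + \<epsilon> * \<beta>\<^sup>2 / \<kappa> * S)"
  proof -
    have "0 \<le> (\<mu> + \<nu>) * Z" using \<mu>\<nu> Z by simp
    moreover have "\<epsilon> * Z \<le> \<epsilon> * (r\<^sup>2 * S)" using \<epsilon>_pos Z by (intro mult_left_mono) auto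
    ultimately show ?thesis using x' by (simp add: algebra_simps)
  qed
  also have "\<dots> = - (2 * \<mu> - (2 * \<epsilon> + \<epsilon> * \<beta>\<^sup>2 / \<kappa>)) * (r\<^sup>2 * S) - \<epsilon> * (r\<^sup>2 * B) * (2 * a - \<kappa> * r\<^sup>2)"
    by (simp add: algebra_simps)
  also have "\<dots> \<le> - \<mu> * (r\<^sup>2 * S) - \<epsilon> * (r\<^sup>2 * B) * a"
  proof (intro diff_mono mult_left_mono mult_right_mono)
    show "- (2 * \<mu> - (2 * \<epsilon> + \<epsilon> * \<beta>\<^sup>2 / \<kappa>)) \<le> - \<mu>" using \<epsilon>_bounds(2) by (simp add: \<beta>_def)
  qed (use a B S \<epsilon>_pos in auto)
  also have "\<dots> \<le> - (3 * lam) * (r\<^sup>2 * S) - (3 * lam) * (r\<^sup>2 * B) * a"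
    using a B S by (intro diff_mono mult_right_mono) (auto simp: lam_def)
  also have "\<dots> = - (2 * lam * r\<^sup>2) * (3 / 2 * (a * B + S))" by (simp add: algebra_simps)
  also have "\<dots> \<le> - (2 * lam * r\<^sup>2) * (a * B + S + 2 * \<epsilon> * X)"
  proof (rule mult_left_mono_neg)
    have "2 * \<epsilon> * X \<le> (a * B + S) / 2"
      using abs_le_D1[OF energy_comparison[OF B S X]] by (simp only: a_def)
    moreover have "s + e \<le> 3 / 2 * s" if "e \<le> s / 2" for s e :: real using that by simp
    ultimately show "a * B + S + 2 * \<epsilon> * X \<le> 3 / 2 * (a * B + S)" by blast
    show "- (2 * lam * r\<^sup>2) \<le> 0" using lam_pos by simp
  qed
  finally show ?thesis by (simp add: a_def \<beta>_def)
qed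

text \<open>The factor \<alpha> + \<kappa> |\<xi>|^2 unites pressure and capillarity. With this
  weight the exchange terms between b and w cancel in the time derivative.\<close>

definition energy :: "nat \<Rightarrow> point \<Rightarrow> complex \<times> (nat \<Rightarrow> complex) \<Rightarrow> real" where
  "energy d \<xi> x = (\<alpha> + \<kappa> * (enorm d \<xi>)\<^sup>2) * (cmod (fst x))\<^sup>2 + (\<Sum>j<d. (cmod (snd x j))\<^sup>2)"

definition lyapunov :: "nat \<Rightarrow> point \<Rightarrow> complex \<times> (nat \<Rightarrow> complex) \<Rightarrow> real" where
  "lyapunov d \<xi> x = energy d \<xi> x + 2 * \<epsilon> * Im (cnj (fst x) * (\<Sum>i<d. complex_of_real (\<xi> i) * snd x i))"

lemma cross_term_le:
  "(Im (cnj (fst x) * (\<Sum>i<d. complex_of_real (\<xi> i) * snd x i)))\<^sup>2 \<le> (cmod (fst x))\<^sup>2 * ((enorm d \<xi>)\<^sup>2 * (\<Sum>j<d. (cmod (snd x j))\<^sup>2))"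
proof -
  have "(Im (cnj (fst x) * (\<Sum>i<d. complex_of_real (\<xi> i) * snd x i)))\<^sup>2 \<le> (cmod (cnj (fst x) * (\<Sum>i<d. complex_of_real (\<xi> i) * snd x i)))\<^sup>2"
    using abs_Im_le_cmod by (rule abs_le_square_iff[THEN iffD1, OF order_trans]) simp
  also have "\<dots> = (cmod (fst x))\<^sup>2 * (cmod (\<Sum>i<d. complex_of_real (\<xi> i) * snd x i))\<^sup>2"
    by (simp add: norm_mult power_mult_distrib)
  also have "\<dots> \<le> (cmod (fst x))\<^sup>2 * ((enorm d \<xi>)\<^sup>2 * (\<Sum>j<d. (cmod (snd x j))\<^sup>2))"
    by (intro mult_left_mono cmod_ip_le) auto
  finally show ?thesis .
qed

lemma lyapunov_energy: "energy d \<xi> x / 2 \<le> lyapunov d \<xi> x" "lyapunov d \<xi> x \<le> 3 / 2 * energy d \<xi> x"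
proof -
  have "\<bar>2 * \<epsilon> * Im (cnj (fst x) * (\<Sum>i<d. complex_of_real (\<xi> i) * snd x i))\<bar> \<le> energy d \<xi> x / 2"
    unfolding energy_def by (rule energy_comparison[OF _ _ cross_term_le]) (auto simp: sum_nonneg)
  moreover have "E / 2 \<le> E + X \<and> E + X \<le> 3 / 2 * E" if "\<bar>X\<bar> \<le> E / 2" for E X :: real
    using abs_le_D1[OF that] abs_le_D2[OF that] by simp
  ultimately show "energy d \<xi> x / 2 \<le> lyapunov d \<xi> x" "lyapunov d \<xi> x \<le> 3 / 2 * energy d \<xi> x"
    unfolding lyapunov_def by blast+
qed

lemma has_derivative_cmod_sq:
  assumes "(f has_vector_derivative f') (at t)"
  shows "((\<lambda>t. (cmod (f t))\<^sup>2) has_real_derivative 2 * Re (cnj (f t) * f')) (at t)"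
proof -
  have c: "((\<lambda>t. cnj (f t)) has_vector_derivative cnj f') (at t)"
    by (rule bounded_linear.has_vector_derivative[OF bounded_linear_cnj assms])
  have "((\<lambda>t. Re (cnj (f t) * f t)) has_vector_derivative Re (cnj (f t) * f' + cnj f' * f t)) (at t)"
    by (rule bounded_linear.has_vector_derivative[OF bounded_linear_Re has_vector_derivative_mult[OF c assms]])
  moreover have "Re (cnj z * z) = (cmod z)\<^sup>2" for z unfolding cmod_power2 by (simp add: power2_eq_square)
  moreover have "Re (cnj (f t) * f' + cnj f' * f t) = 2 * Re (cnj (f t) * f')" by simp
  ultimately show ?thesis by (simp only: has_real_derivative_iff_has_vector_derivative)
qed

text \<open>The derivative is computed exactly; after cancellation of the exchange terms it is the
  expression estimated in \<open>energy_dissipation\<close>.\<close>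

lemma lyapunov_deriv_le:
  "\<exists>D. ((\<lambda>t. lyapunov d \<xi> (W d t \<xi> x)) has_real_derivative D) (at t) \<and> D \<le> - (2 * lam * (enorm d \<xi>)\<^sup>2) * lyapunov d \<xi> (W d t \<xi> x)"
proof -
  define r where "r = enorm d \<xi>"
  define a where "a = \<alpha> + \<kappa> * r\<^sup>2"
  define b where "b t = fst (W d t \<xi> x)" for t
  define w where "w t j = snd (W d t \<xi> x) j" for t j
  define z where "z t = (\<Sum>i<d. complex_of_real (\<xi> i) * w t i)" for t
  define b' where "b' = - (\<i> * z t)"
  define w' where "w' j = - (\<i> * of_real a * b t * of_real (\<xi> j) + of_real (\<mu> * r\<^sup>2) * w t j + of_real (\<mu> + \<nu>) * z t * of_real (\<xi> j))" for j
  have r2: "(\<Sum>i<d. complex_of_real (\<xi> i) * complex_of_real (\<xi> i)) = of_real (r\<^sup>2)"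
    by (simp add: r_def L2_set_def sum_nonneg power2_eq_square)
  have db: "(b has_vector_derivative b') (at t)"
    using W_deriv(1)[of d \<xi> x t] unfolding b'_def z_def w_def b_def[abs_def] fst_A by simp
  have dw: "((\<lambda>t. w t j) has_vector_derivative w' j) (at t)" if "j < d" for j
    using W_deriv(2)[OF that, of \<xi> x t] unfolding w'_def z_def w_def b_def snd_A a_def r_def by simp
  have dz: "(z has_vector_derivative (\<Sum>i<d. of_real (\<xi> i) * w' i)) (at t)"
    unfolding z_def[abs_def] by (intro has_vector_derivative_sum has_vector_derivative_mult_right dw) auto
  \<comment> \<open>The product with \<xi> closes the system in (b, z): the viscosities add up to
    \<mu> + (\<mu> + \<nu>) = 2 \<mu> + \<nu>.\<close>
  have z': "(\<Sum>i<d. of_real (\<xi> i) * w' i) = - (\<i> * of_real (a * r\<^sup>2) * b t + of_real ((2 * \<mu> + \<nu>) * r\<^sup>2) * z t)"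
  proof -
    have "(\<Sum>i<d. of_real (\<xi> i) * w' i) = (\<Sum>i<d. - (\<i> * of_real a * b t * (of_real (\<xi> i) * of_real (\<xi> i)) + of_real (\<mu> * r\<^sup>2) * (of_real (\<xi> i) * w t i) + of_real (\<mu> + \<nu>) * z t * (of_real (\<xi> i) * of_real (\<xi> i))))"
      by (intro sum.cong refl) (simp add: w'_def algebra_simps)
    also have "\<dots> = - (\<i> * of_real a * b t * of_real (r\<^sup>2) + of_real (\<mu> * r\<^sup>2) * z t + of_real (\<mu> + \<nu>) * z t * of_real (r\<^sup>2))"
      unfolding sum_negf sum.distrib sum_distrib_left[symmetric] r2 z_def ..
    finally show ?thesis by (simp add: algebra_simps)
  qed
  have dcz: "((\<lambda>t. Im (cnj (b t) * z t)) has_real_derivative Im (cnj (b t) * (\<Sum>i<d. of_real (\<xi> i) * w' i) + cnj b' * z t)) (at t)"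
    unfolding has_real_derivative_iff_has_vector_derivative
    by (intro bounded_linear.has_vector_derivative[OF bounded_linear_Im] has_vector_derivative_mult
          bounded_linear.has_vector_derivative[OF bounded_linear_cnj] db dz)
  define S where "S = (\<Sum>j<d. (cmod (w t j))\<^sup>2)"
  define X where "X = Im (cnj (b t) * z t)"
  define D where "D = a * (2 * Re (cnj (b t) * b')) + (\<Sum>j<d. 2 * Re (cnj (w t j) * w' j)) + 2 * \<epsilon> * Im (cnj (b t) * (\<Sum>i<d. of_real (\<xi> i) * w' i) + cnj b' * z t)"
  have eq: "lyapunov d \<xi> (W d t \<xi> x) = a * (cmod (b t))\<^sup>2 + (\<Sum>j<d. (cmod (w t j))\<^sup>2) + 2 * \<epsilon> * Im (cnj (b t) * z t)" for t
    by (simp only: lyapunov_def energy_def a_def r_def b_def w_def z_def)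
  have der: "((\<lambda>t. lyapunov d \<xi> (W d t \<xi> x)) has_real_derivative D) (at t)"
    unfolding eq D_def
    by (intro DERIV_add DERIV_cmult DERIV_sum has_derivative_cmod_sq db dw dcz) auto
  have Sw: "(\<Sum>j<d. cnj (w t j) * w t j) = of_real S"
    by (simp only: S_def of_real_sum complex_norm_square mult.commute)
  have zc: "(\<Sum>j<d. cnj (w t j) * of_real (\<xi> j)) = cnj (z t)"
    by (simp add: z_def mult.commute)
  have "(\<Sum>j<d. cnj (w t j) * w' j) = (\<Sum>j<d. - (\<i> * of_real a * b t * (cnj (w t j) * of_real (\<xi> j)) + of_real (\<mu> * r\<^sup>2) * (cnj (w t j) * w t j) + of_real (\<mu> + \<nu>) * z t * (cnj (w t j) * of_real (\<xi> j))))"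
    by (intro sum.cong refl) (simp add: w'_def algebra_simps)
  also have "\<dots> = - (\<i> * of_real a * b t * cnj (z t) + of_real (\<mu> * r\<^sup>2) * of_real S + of_real (\<mu> + \<nu>) * z t * cnj (z t))"
    unfolding sum_negf sum.distrib sum_distrib_left[symmetric] Sw zc ..
  finally have Rw: "(\<Sum>j<d. 2 * Re (cnj (w t j) * w' j)) = 2 * Re (- (\<i> * of_real a * b t * cnj (z t) + of_real (\<mu> * r\<^sup>2) * of_real S + of_real (\<mu> + \<nu>) * z t * cnj (z t)))"
    by (metis Re_sum sum_distrib_left)
  have "D = - 2 * \<mu> * r\<^sup>2 * S - 2 * (\<mu> + \<nu>) * (cmod (z t))\<^sup>2 + 2 * \<epsilon> * ((cmod (z t))\<^sup>2 - a * r\<^sup>2 * (cmod (b t))\<^sup>2 - (2 * \<mu> + \<nu>) * r\<^sup>2 * X)"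
    unfolding D_def Rw z' b'_def X_def cmod_power2 by (simp add: power2_eq_square algebra_simps)
  also have "\<dots> \<le> - (2 * lam * r\<^sup>2) * (a * (cmod (b t))\<^sup>2 + S + 2 * \<epsilon> * X)"
    unfolding a_def
  proof (rule energy_dissipation)
    show "X\<^sup>2 \<le> (cmod (b t))\<^sup>2 * (r\<^sup>2 * S)"
      unfolding X_def S_def b_def z_def w_def r_def by (rule cross_term_le)
    show "(cmod (z t))\<^sup>2 \<le> r\<^sup>2 * S" unfolding z_def r_def S_def by (rule cmod_ip_le)
  qed (auto simp: S_def sum_nonneg)
  also have "\<dots> = - (2 * lam * (enorm d \<xi>)\<^sup>2) * lyapunov d \<xi> (W d t \<xi> x)"
    unfolding eq S_def X_def r_def ..
  finally show ?thesis using der by blast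
qed

lemma lyapunov_decay:
  assumes "t \<ge> 0"
  shows "lyapunov d \<xi> (W d t \<xi> x) \<le> exp (- (2 * lam * (enorm d \<xi>)\<^sup>2 * t)) * lyapunov d \<xi> x"
proof -
  let ?c = "2 * lam * (enorm d \<xi>)\<^sup>2"
  \<comment> \<open>Gronwall's inequality by means of the integrating factor.\<close>
  let ?g = "\<lambda>t. exp (?c * t) * lyapunov d \<xi> (W d t \<xi> x)"
  have "?g t \<le> ?g 0"
  proof (rule DERIV_nonpos_imp_nonincreasing[OF assms])
    fix s
    obtain D where D: "((\<lambda>t. lyapunov d \<xi> (W d t \<xi> x)) has_real_derivative D) (at s)" "D \<le> - ?c * lyapunov d \<xi> (W d s \<xi> x)"
      using lyapunov_deriv_le by blast
    have "(?g has_real_derivative exp (?c * s) * D + ?c * exp (?c * s) * lyapunov d \<xi> (W d s \<xi> x)) (at s)"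
      by (auto intro!: derivative_eq_intros D(1))
    moreover have "exp (?c * s) * D + ?c * exp (?c * s) * lyapunov d \<xi> (W d s \<xi> x) \<le> 0"
    proof -
      have "exp (?c * s) * (D + ?c * lyapunov d \<xi> (W d s \<xi> x)) \<le> 0"
        using D(2) by (intro mult_nonneg_nonpos) auto
      then show ?thesis by (simp only: distrib_left mult_ac)
    qed
    ultimately show "\<exists>y. (?g has_real_derivative y) (at s) \<and> y \<le> 0" by blast
  qed
  then have "exp (- (?c * t)) * ?g t \<le> exp (- (?c * t)) * lyapunov d \<xi> x"
    by (intro mult_left_mono) (auto simp: W_0)
  moreover have "exp (- (?c * t)) * ?g t = lyapunov d \<xi> (W d t \<xi> x)"
    by (simp add: mult.assoc[symmetric] exp_add[symmetric])
  ultimately show ?thesis by simp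
qed

text \<open>The outer factors compare \<open>nrm\<close> with the square root of
  \<open>energy\<close> in both directions; sqrt 3 stems from the bounds 1/2 and 3/2 of the
  functional in terms of the energy.\<close>

definition W_const :: "nat \<Rightarrow> real" where
  "W_const d = (sqrt (2 * (1 / \<alpha> + 1 / \<kappa>)) + real d) * sqrt 3 * (1 + sqrt \<alpha> + sqrt \<kappa>)"

lemma W_const_pos: "d > 0 \<Longrightarrow> W_const d > 0"
  using \<alpha> \<kappa> by (auto simp: W_const_def intro!: mult_pos_pos add_pos_pos add_nonneg_pos)

lemma nrm_le_energy: "nrm d \<xi> x \<le> (sqrt (2 * (1 / \<alpha> + 1 / \<kappa>)) + real d) * sqrt (energy d \<xi> x)"
proof -
  define r where "r = enorm d \<xi>"
  have r: "r \<ge> 0" by (simp add: r_def)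
  define c where "c = 1 / \<alpha> + 1 / \<kappa>"
  let ?E = "energy d \<xi> x"
  have c: "1 \<le> c * \<alpha>" "1 \<le> c * \<kappa>" "c > 0" using \<alpha> \<kappa> by (auto simp: c_def field_simps)
  have "(1 + r)\<^sup>2 \<le> 2 * (1 + r\<^sup>2)" using sum_squares_ge_zero[of "1 - r" 0] by (simp add: power2_eq_square algebra_simps)
  also have "\<dots> \<le> 2 * (c * \<alpha> + c * \<kappa> * r\<^sup>2)"
    using c mult_right_mono[OF c(2), of "r\<^sup>2"] by (intro mult_left_mono add_mono) auto
  finally have "(1 + r)\<^sup>2 * (cmod (fst x))\<^sup>2 \<le> 2 * c * ((\<alpha> + \<kappa> * r\<^sup>2) * (cmod (fst x))\<^sup>2)"
    using mult_right_mono[of "(1 + r)\<^sup>2" "2 * (c * \<alpha> + c * \<kappa> * r\<^sup>2)" "(cmod (fst x))\<^sup>2"] by (simp add: algebra_simps)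
  also have "\<dots> \<le> 2 * c * ?E" using c by (intro mult_left_mono) (auto simp: energy_def r_def sum_nonneg)
  finally have 1: "(1 + r) * cmod (fst x) \<le> sqrt (2 * c) * sqrt ?E"
    unfolding real_sqrt_mult[symmetric] by (intro real_le_rsqrt) (simp only: power_mult_distrib)
  have 2: "cmod (snd x j) \<le> sqrt ?E" if "j < d" for j
  proof (rule real_le_rsqrt)
    have "(cmod (snd x j))\<^sup>2 \<le> (\<Sum>j<d. (cmod (snd x j))\<^sup>2)" using that by (intro member_le_sum) auto
    also have "\<dots> \<le> ?E" using \<alpha> \<kappa> by (simp add: energy_def)
    finally show "(cmod (snd x j))\<^sup>2 \<le> ?E" .
  qed
  have "nrm d \<xi> x \<le> sqrt (2 * c) * sqrt ?E + (\<Sum>j<d. sqrt ?E)"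
    unfolding nrm_def r_def[symmetric] by (intro add_mono 1 sum_mono 2) auto
  then show ?thesis by (simp add: c_def algebra_simps)
qed

lemma energy_le_nrm: "sqrt (energy d \<xi> x) \<le> (1 + sqrt \<alpha> + sqrt \<kappa>) * nrm d \<xi> x"
proof (rule real_le_lsqrt)
  define r where "r = enorm d \<xi>"
  have r: "r \<ge> 0" by (simp add: r_def)
  let ?k = "1 + sqrt \<alpha> + sqrt \<kappa>"
  define P where "P = (1 + r) * cmod (fst x)"
  define Q where "Q = (\<Sum>j<d. cmod (snd x j))"
  have PQ: "P \<ge> 0" "Q \<ge> 0" using r by (auto simp: P_def Q_def sum_nonneg)
  have k: "?k \<ge> 1" using \<alpha> \<kappa> by simp
  have "\<alpha> + \<kappa> * r\<^sup>2 \<le> (?k * (1 + r))\<^sup>2"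
  proof -
    have "\<alpha> + \<kappa> * r\<^sup>2 = (sqrt \<alpha>)\<^sup>2 + (sqrt \<kappa> * r)\<^sup>2" using \<alpha> \<kappa> by (simp add: power_mult_distrib)
    also have "\<dots> \<le> (sqrt \<alpha> + sqrt \<kappa> * r)\<^sup>2" using \<alpha> \<kappa> r by (simp add: power2_sum)
    also have "\<dots> \<le> (?k * (1 + r))\<^sup>2"
      using \<alpha> \<kappa> r by (intro power_mono) (auto simp: algebra_simps)
    finally show ?thesis .
  qed
  then have "(\<alpha> + \<kappa> * r\<^sup>2) * (cmod (fst x))\<^sup>2 \<le> (?k * (1 + r))\<^sup>2 * (cmod (fst x))\<^sup>2"
    by (intro mult_right_mono) auto
  then have "(\<alpha> + \<kappa> * r\<^sup>2) * (cmod (fst x))\<^sup>2 \<le> (?k * P)\<^sup>2"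
    by (simp only: P_def power_mult_distrib mult.assoc)
  moreover have "(\<Sum>j<d. (cmod (snd x j))\<^sup>2) \<le> (?k * Q)\<^sup>2"
  proof -
    have "sqrt (\<Sum>j<d. (cmod (snd x j))\<^sup>2) \<le> Q"
      using L2_set_le_sum[of "{..<d}" "\<lambda>j. cmod (snd x j)"] by (simp add: L2_set_def Q_def)
    then have "(\<Sum>j<d. (cmod (snd x j))\<^sup>2) \<le> Q\<^sup>2"
      by (rule sqrt_le_D)
    also have "\<dots> \<le> (?k * Q)\<^sup>2" using k PQ mult_right_mono[OF k, of Q] by (intro power_mono) auto
    finally show ?thesis .
  qed
  ultimately have "energy d \<xi> x \<le> (?k * P)\<^sup>2 + (?k * Q)\<^sup>2" by (simp add: energy_def r_def)
  also have "\<dots> \<le> (?k * P + ?k * Q)\<^sup>2" using k PQ by (simp add: power2_sum)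
  also have "?k * P + ?k * Q = ?k * nrm d \<xi> x" by (simp add: nrm_def P_def Q_def r_def distrib_left)
  finally show "energy d \<xi> x \<le> (?k * nrm d \<xi> x)\<^sup>2" .
  show "0 \<le> ?k * nrm d \<xi> x" using k by (intro mult_nonneg_nonneg) auto
qed

lemma nrm_W_le:
  assumes "t \<ge> 0"
  shows "nrm d \<xi> (W d t \<xi> x) \<le> W_const d * exp (- (lam * (enorm d \<xi>)\<^sup>2 * t)) * nrm d \<xi> x"
proof -
  let ?e = "exp (- (lam * (enorm d \<xi>)\<^sup>2 * t))"
  have "energy d \<xi> (W d t \<xi> x) \<le> 2 * lyapunov d \<xi> (W d t \<xi> x)" using lyapunov_energy(1)[of d \<xi> "W d t \<xi> x"] by simp
  also have "\<dots> \<le> 2 * (exp (- (2 * lam * (enorm d \<xi>)\<^sup>2 * t)) * lyapunov d \<xi> x)"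
    by (intro mult_left_mono lyapunov_decay assms) auto
  also have "\<dots> \<le> 2 * (exp (- (2 * lam * (enorm d \<xi>)\<^sup>2 * t)) * (3 / 2 * energy d \<xi> x))"
    by (intro mult_left_mono lyapunov_energy(2)) auto
  also have "exp (- (2 * lam * (enorm d \<xi>)\<^sup>2 * t)) = ?e\<^sup>2"
    by (simp add: power2_eq_square exp_add[symmetric])
  finally have "energy d \<xi> (W d t \<xi> x) \<le> 3 * (?e\<^sup>2 * energy d \<xi> x)" by (simp add: mult_ac)
  then have "sqrt (energy d \<xi> (W d t \<xi> x)) \<le> sqrt (3 * (?e\<^sup>2 * energy d \<xi> x))" by (rule real_sqrt_le_mono)
  also have "\<dots> = sqrt 3 * (?e * sqrt (energy d \<xi> x))" by (simp add: real_sqrt_mult)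
  also have "\<dots> \<le> sqrt 3 * (?e * ((1 + sqrt \<alpha> + sqrt \<kappa>) * nrm d \<xi> x))"
    by (intro mult_left_mono energy_le_nrm) auto
  finally have s: "sqrt (energy d \<xi> (W d t \<xi> x)) \<le> sqrt 3 * (?e * ((1 + sqrt \<alpha> + sqrt \<kappa>) * nrm d \<xi> x))" .
  have "nrm d \<xi> (W d t \<xi> x) \<le> (sqrt (2 * (1 / \<alpha> + 1 / \<kappa>)) + real d) * sqrt (energy d \<xi> (W d t \<xi> x))"
    by (rule nrm_le_energy)
  also have "\<dots> \<le> (sqrt (2 * (1 / \<alpha> + 1 / \<kappa>)) + real d) * (sqrt 3 * (?e * ((1 + sqrt \<alpha> + sqrt \<kappa>) * nrm d \<xi> x)))"
    using s \<alpha> \<kappa> by (intro mult_left_mono) auto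
  finally show ?thesis by (simp add: W_const_def mult_ac)
qed

lemma nrm_W_le':
  assumes "t \<ge> 0"
  shows "nrm d \<xi> (W d t \<xi> x) \<le> W_const d * nrm d \<xi> x"
proof -
  have "W_const d \<ge> 0" using \<alpha> \<kappa> by (simp add: W_const_def)
  moreover have "exp (- (lam * (enorm d \<xi>)\<^sup>2 * t)) \<le> 1" using assms lam_pos by simp
  ultimately have "W_const d * exp (- (lam * (enorm d \<xi>)\<^sup>2 * t)) * nrm d \<xi> x \<le> W_const d * 1 * nrm d \<xi> x"
    by (intro mult_right_mono mult_left_mono) auto
  then show ?thesis using nrm_W_le[OF assms, of d \<xi> x] by simp
qed

lemma W_lipschitz:
  assumes t: "0 \<le> s" "s \<le> t"
  shows "(1 + enorm d \<xi>) * cmod (fst (W d t \<xi> x) - fst (W d s \<xi> x)) \<le> A_bound d (enorm d \<xi>) * W_const d * nrm d \<xi> x * (t - s)"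
    and "j < d \<Longrightarrow> cmod (snd (W d t \<xi> x) j - snd (W d s \<xi> x) j) \<le> A_bound d (enorm d \<xi>) * W_const d * nrm d \<xi> x * (t - s)"
proof -
  have n: "nrm d \<xi> (A d \<xi> (W d q \<xi> x)) \<le> A_bound d (enorm d \<xi>) * W_const d * nrm d \<xi> x" if "q \<ge> 0" for q
  proof -
    have "nrm d \<xi> (A d \<xi> (W d q \<xi> x)) \<le> A_bound d (enorm d \<xi>) * nrm d \<xi> (W d q \<xi> x)" by (rule nrm_A_le)
    also have "\<dots> \<le> A_bound d (enorm d \<xi>) * (W_const d * nrm d \<xi> x)"
      by (intro mult_left_mono nrm_W_le' A_bound_nonneg that) auto
    finally show ?thesis by (simp add: mult.assoc)
  qed
  have p: "1 + enorm d \<xi> > 0" by (simp add: add_pos_nonneg)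
  let ?B = "A_bound d (enorm d \<xi>) * W_const d * nrm d \<xi> x"
  have "cmod (fst (W d t \<xi> x) - fst (W d s \<xi> x)) \<le> ?B / (1 + enorm d \<xi>) * (t - s)"
  proof (rule norm_diff_le_of_derivative[OF t(2) W_deriv(1)])
    fix q assume "s \<le> q" "q \<le> t"
    then have "(1 + enorm d \<xi>) * cmod (fst (A d \<xi> (W d q \<xi> x))) \<le> ?B"
      using t order_trans[OF nrm_fst n[of q]] by simp
    then show "cmod (- fst (A d \<xi> (W d q \<xi> x))) \<le> ?B / (1 + enorm d \<xi>)" using p by (simp add: field_simps)
  qed
  then show "(1 + enorm d \<xi>) * cmod (fst (W d t \<xi> x) - fst (W d s \<xi> x)) \<le> ?B * (t - s)" using p by (simp add: field_simps)
  assume j: "j < d"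
  show "cmod (snd (W d t \<xi> x) j - snd (W d s \<xi> x) j) \<le> ?B * (t - s)"
  proof (rule norm_diff_le_of_derivative[OF t(2) W_deriv(2)[OF j]])
    fix q assume "s \<le> q" "q \<le> t"
    then show "cmod (- snd (A d \<xi> (W d q \<xi> x)) j) \<le> ?B"
      using t order_trans[OF nrm_snd[OF j] n[of q]] by simp
  qed
qed

lemma A_pow_diff:
  "(A d \<xi> ^^ n) (fst x - fst y, \<lambda>j. snd x j - snd y j)
     = (fst ((A d \<xi> ^^ n) x) - fst ((A d \<xi> ^^ n) y), \<lambda>j. snd ((A d \<xi> ^^ n) x) j - snd ((A d \<xi> ^^ n) y) j)"
proof (induction n)
  case (Suc n)
  have 1: "(\<Sum>i<d. complex_of_real (\<xi> i) * (u i - v i)) = (\<Sum>i<d. complex_of_real (\<xi> i) * u i) - (\<Sum>i<d. complex_of_real (\<xi> i) * v i)" for u v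
    by (simp add: right_diff_distrib sum_subtractf)
  show ?case
    by (intro prod_eqI ext; simp only: funpow.simps o_apply Suc fst_A snd_A fst_conv snd_conv 1)
       (simp_all add: algebra_simps)
qed simp

lemma W_diff:
  shows "fst (W d t \<xi> (fst x - fst y, \<lambda>j. snd x j - snd y j)) = fst (W d t \<xi> x) - fst (W d t \<xi> y)"
    and "j < d \<Longrightarrow> snd (W d t \<xi> (fst x - fst y, \<lambda>j. snd x j - snd y j)) j = snd (W d t \<xi> x) j - snd (W d t \<xi> y) j"
  by (simp_all add: fst_W snd_W A_pow_diff expseries_diff geom_bounded_fst geom_bounded_snd)

text \<open>The vector part is a function on all naturals. Its values from \<open>d\<close> on are
  arbitrary, in the application transforms of components that mean nothing, so agreement is asked
  below \<open>d\<close> only.\<close>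

lemma A_pow_cong:
  assumes "fst x = fst y" "\<And>j. j < d \<Longrightarrow> snd x j = snd y j"
  shows "fst ((A d \<xi> ^^ n) x) = fst ((A d \<xi> ^^ n) y) \<and> (\<forall>j<d. snd ((A d \<xi> ^^ n) x) j = snd ((A d \<xi> ^^ n) y) j)"
  using assms
proof (induction n)
  case (Suc n)
  then have IH: "fst ((A d \<xi> ^^ n) x) = fst ((A d \<xi> ^^ n) y)" "\<And>j. j < d \<Longrightarrow> snd ((A d \<xi> ^^ n) x) j = snd ((A d \<xi> ^^ n) y) j" by auto
  have "(\<Sum>i<d. complex_of_real (\<xi> i) * snd ((A d \<xi> ^^ n) x) i) = (\<Sum>i<d. complex_of_real (\<xi> i) * snd ((A d \<xi> ^^ n) y) i)"
    by (intro sum.cong refl) (simp add: IH)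
  then show ?case by (simp add: fst_A snd_A IH)
qed auto

lemma W_cong:
  assumes "fst x = fst y" "\<And>j. j < d \<Longrightarrow> snd x j = snd y j"
  shows "fst (W d t \<xi> x) = fst (W d t \<xi> y)" "j < d \<Longrightarrow> snd (W d t \<xi> x) j = snd (W d t \<xi> y) j"
  using A_pow_cong[OF assms] by (simp_all add: fst_W snd_W)

lemma measurable_W:
  fixes \<tau> :: "'a \<Rightarrow> real" and X :: "'a \<Rightarrow> point" and b :: "'a \<Rightarrow> complex"
  assumes \<tau> [measurable]: "\<tau> \<in> borel_measurable M" and X: "X \<in> borel_measurable M"
    and b [measurable]: "b \<in> borel_measurable M" and w: "\<And>j. j < d \<Longrightarrow> (\<lambda>q. w q j) \<in> borel_measurable M"
  shows "(\<lambda>q. fst (W d (\<tau> q) (X q) (b q, w q))) \<in> borel_measurable M"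
    and "j < d \<Longrightarrow> (\<lambda>q. snd (W d (\<tau> q) (X q) (b q, w q)) j) \<in> borel_measurable M"
proof -
  note [measurable] = measurable_compose[OF X borel_measurable_enorm] borel_measurable_coord[OF X]
  have pow: "(\<lambda>q. fst ((A d (X q) ^^ n) (b q, w q))) \<in> borel_measurable M \<and>
     (\<forall>j<d. (\<lambda>q. snd ((A d (X q) ^^ n) (b q, w q)) j) \<in> borel_measurable M)" for n
  proof (induction n)
    case (Suc n)
    then have IH [measurable]: "(\<lambda>q. fst ((A d (X q) ^^ n) (b q, w q))) \<in> borel_measurable M"
      and IHj: "\<And>j. j < d \<Longrightarrow> (\<lambda>q. snd ((A d (X q) ^^ n) (b q, w q)) j) \<in> borel_measurable M" by auto
    have z [measurable]: "(\<lambda>q. \<Sum>i<d. complex_of_real (X q i) * snd ((A d (X q) ^^ n) (b q, w q)) i) \<in> borel_measurable M"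
    proof (rule borel_measurable_sum)
      fix i assume "i \<in> {..<d}"
      then have [measurable]: "(\<lambda>q. snd ((A d (X q) ^^ n) (b q, w q)) i) \<in> borel_measurable M" using IHj by simp
      show "(\<lambda>q. complex_of_real (X q i) * snd ((A d (X q) ^^ n) (b q, w q)) i) \<in> borel_measurable M" by measurable
    qed
    show ?case
    proof (intro conjI allI impI)
      show "(\<lambda>q. fst ((A d (X q) ^^ Suc n) (b q, w q))) \<in> borel_measurable M"
        by (simp add: fst_A)
      fix j assume "j < d"
      then have [measurable]: "(\<lambda>q. snd ((A d (X q) ^^ n) (b q, w q)) j) \<in> borel_measurable M" by (rule IHj)
      show "(\<lambda>q. snd ((A d (X q) ^^ Suc n) (b q, w q)) j) \<in> borel_measurable M"
        unfolding funpow.simps o_apply snd_A by measurable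
    qed
  qed (use w in auto)
  have [measurable]: "(\<lambda>q. fst ((A d (X q) ^^ n) (b q, w q))) \<in> borel_measurable M" for n
    using pow by blast
  show "(\<lambda>q. fst (W d (\<tau> q) (X q) (b q, w q))) \<in> borel_measurable M"
    unfolding fst_W expseries_def by measurable
  assume "j < d"
  then have [measurable]: "(\<lambda>q. snd ((A d (X q) ^^ n) (b q, w q)) j) \<in> borel_measurable M" for n
    using pow by blast
  show "(\<lambda>q. snd (W d (\<tau> q) (X q) (b q, w q)) j) \<in> borel_measurable M"
    unfolding snd_W expseries_def by measurable
qed

end

section \<open>Time integrals and convolutions\<close>

text \<open>Split at t/2: on each half the factor that is not singular there is at most its value at
  t/2, and the singular one is integrated up to t.\<close>

lemma nn_integral_beta_le:
  assumes t: "t > 0" and q: "0 < q" "q < 1" and m: "0 < m" "m < 1"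
  shows "(\<integral>\<^sup>+s. ennreal (indicator {0<..<t} s * ((t - s) powr (-q) * s powr (-m))) \<partial>lborel)
     \<le> ennreal ((2 powr q * (2 / (1 - m)) + 2 powr m * (2 / (1 - q))) * t powr (1 - q - m))"
proof -
  let ?F = "\<lambda>c y. ennreal (\<bar>y\<bar> powr (-c)) * indicator {..t} \<bar>y\<bar>"
  have "(\<integral>\<^sup>+s. ennreal (indicator {0<..<t} s * ((t - s) powr (-q) * s powr (-m))) \<partial>lborel)
     \<le> (\<integral>\<^sup>+s. ennreal ((t / 2) powr (-q)) * ?F m s + ennreal ((t / 2) powr (-m)) * ?F q (t - s) \<partial>lborel)"
  proof (rule nn_integral_mono)
    fix s
    show "ennreal (indicator {0<..<t} s * ((t - s) powr (-q) * s powr (-m))) \<le> ennreal ((t / 2) powr (-q)) * ?F m s + ennreal ((t / 2) powr (-m)) * ?F q (t - s)"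
    proof (cases "0 < s \<and> s < t")
      case True
      have "(t - s) powr (-q) * s powr (-m) \<le> (t / 2) powr (-q) * s powr (-m) + (t / 2) powr (-m) * (t - s) powr (-q)"
      proof (cases "s \<le> t / 2")
        case le: True
        have "(t - s) powr (-q) \<le> (t / 2) powr (-q)" using le True q t by (intro powr_mono2') auto
        then have "(t - s) powr (-q) * s powr (-m) \<le> (t / 2) powr (-q) * s powr (-m)" by (intro mult_right_mono) auto
        then show ?thesis by (simp add: add_increasing2)
      next
        case False
        have "s powr (-m) \<le> (t / 2) powr (-m)" using False True m t by (intro powr_mono2') auto
        then have "s powr (-m) * (t - s) powr (-q) \<le> (t / 2) powr (-m) * (t - s) powr (-q)" by (intro mult_right_mono) auto
        then show ?thesis by (simp add: add_increasing mult.commute)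
      qed
      then have "ennreal ((t - s) powr (-q) * s powr (-m)) \<le> ennreal ((t / 2) powr (-q) * s powr (-m) + (t / 2) powr (-m) * (t - s) powr (-q))"
        by (rule ennreal_leI)
      then show ?thesis using True by (simp add: ennreal_plus ennreal_mult')
    qed simp
  qed
  also have "\<dots> = ennreal ((t / 2) powr (-q)) * (\<integral>\<^sup>+s. ?F m s \<partial>lborel) + ennreal ((t / 2) powr (-m)) * (\<integral>\<^sup>+s. ?F q (t - s) \<partial>lborel)"
    by (subst nn_integral_add) (auto simp: nn_integral_cmult)
  also have "(\<integral>\<^sup>+s. ?F q (t - s) \<partial>lborel) = (\<integral>\<^sup>+s. ?F q s \<partial>lborel)"
    by (subst nn_integral_real_affine[of "?F q" "-1" t]) auto
  also have "ennreal ((t / 2) powr (-q)) * (\<integral>\<^sup>+s. ?F m s \<partial>lborel) + ennreal ((t / 2) powr (-m)) * (\<integral>\<^sup>+s. ?F q s \<partial>lborel)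
     \<le> ennreal ((t / 2) powr (-q)) * ennreal (2 / (1 - m) * t powr (1 - m)) + ennreal ((t / 2) powr (-m)) * ennreal (2 / (1 - q) * t powr (1 - q))"
    using assms by (intro add_mono mult_left_mono nn_integral_powr_near) auto
  also have "\<dots> = ennreal ((t / 2) powr (-q) * (2 / (1 - m) * t powr (1 - m)) + (t / 2) powr (-m) * (2 / (1 - q) * t powr (1 - q)))"
    using q m by (simp add: ennreal_mult'[symmetric] ennreal_plus[symmetric] del: ennreal_plus)
  also have "(t / 2) powr (-q) * (2 / (1 - m) * t powr (1 - m)) = 2 powr q * (2 / (1 - m)) * t powr (1 - q - m)"
  proof -
    have "(t / 2) powr (-q) = t powr (-q) * 2 powr q" using t by (simp add: powr_divide powr_minus field_simps)
    moreover have "t powr (-q) * t powr (1 - m) = t powr (1 - q - m)" by (simp add: powr_add[symmetric] algebra_simps)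
    ultimately show ?thesis by (simp add: mult_ac)
  qed
  also have "(t / 2) powr (-m) * (2 / (1 - q) * t powr (1 - q)) = 2 powr m * (2 / (1 - q)) * t powr (1 - q - m)"
  proof -
    have "(t / 2) powr (-m) = t powr (-m) * 2 powr m" using t by (simp add: powr_divide powr_minus field_simps)
    moreover have "t powr (-m) * t powr (1 - q) = t powr (1 - q - m)" by (simp add: powr_add[symmetric] algebra_simps)
    ultimately show ?thesis by (simp add: mult_ac)
  qed
  finally show ?thesis by (simp add: distrib_right)
qed

lemma integral_bound_of_nn:
  fixes f :: "'a \<Rightarrow> complex"
  assumes "f \<in> borel_measurable M" "(\<integral>\<^sup>+x. ennreal (cmod (f x)) \<partial>M) \<le> ennreal K" "K \<ge> 0"
  shows "integrable M f" "cmod (LINT x|M. f x) \<le> K"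
proof -
  show i: "integrable M f"
    using assms by (intro integrableI_bounded) (auto intro: le_less_trans)
  have "ennreal (cmod (LINT x|M. f x)) \<le> ennreal K"
    using integral_norm_bound_ennreal[OF i] assms(2) by (rule order_trans)
  then show "cmod (LINT x|M. f x) \<le> K" using assms(3) by simp
qed

text \<open>Trades Gaussian decay for a power that is singular in time, with a free exponent up to
  1.\<close>

lemma powr_exp_le: "0 < x \<Longrightarrow> 0 \<le> q \<Longrightarrow> q \<le> 1 \<Longrightarrow> exp (- x) \<le> x powr (- q)" for x q :: real
proof -
  assume x: "0 < x" and q: "0 \<le> q" "q \<le> 1"
  have "x powr q \<le> exp x"
  proof (cases "x \<le> 1")
    case True
    then have "x powr q \<le> 1" using x q by (intro powr_le1) auto
    also have "\<dots> \<le> exp x" using x by simp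
    finally show ?thesis .
  next
    case False
    then have "x powr q \<le> x powr 1" using q by (intro powr_mono) auto
    also have "\<dots> = x" using x by simp
    also have "\<dots> \<le> exp x" using exp_ge_add_one_self[of x] by linarith
    finally show ?thesis .
  qed
  then show ?thesis using x by (simp add: exp_minus powr_minus)
qed

text \<open>Completing the square. In the application x = sqrt(t - s) |\<xi>|, and the cost exp(1/(2
  l)) depends neither on time nor on frequency.\<close>

lemma exp_shift_le:
  fixes l x :: real
  assumes "l > 0"
  shows "exp (x - l * x\<^sup>2) \<le> exp (1 / (2 * l)) * exp (- (l * x\<^sup>2 / 2))"
proof -
  have "0 \<le> (l * x - 1)\<^sup>2 / (2 * l)" using assms by simp
  also have "(l * x - 1)\<^sup>2 / (2 * l) = 1 / (2 * l) + l * x\<^sup>2 / 2 - x"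
    using assms by (simp add: power2_eq_square field_simps)
  finally show ?thesis by (simp add: exp_add[symmetric])
qed

text \<open>The exponent q stays free: 1 - 1/p serves in the Duhamel term and 1/p, with s = 0, in
  the linear one. The rate grows from sqrt s to sqrt t by subadditivity of the square root.\<close>

lemma exp_propagator_le:
  assumes l: "l > 0" and st: "0 \<le> s" "s < t" and r: "r > 0" and q: "0 \<le> q" "q \<le> 1"
  shows "exp (- (l * r\<^sup>2 * (t - s))) * exp (- (sqrt s * r))
     \<le> exp (1 / (2 * l)) * (l / 2) powr (-q) * ((t - s) powr (-q) * r powr (-(2 * q))) * exp (- (sqrt t * r))"
proof -
  let ?x = "sqrt (t - s) * r"
  have x2: "?x\<^sup>2 = r\<^sup>2 * (t - s)" using st by (simp add: power_mult_distrib)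
  have "sqrt t \<le> sqrt (t - s) + sqrt s"
    using sqrt_add_le_add_sqrt[of "t - s" s] st by simp
  then have "sqrt t * r \<le> (sqrt (t - s) + sqrt s) * r" using r by (intro mult_right_mono) auto
  then have "exp (- (l * r\<^sup>2 * (t - s))) * exp (- (sqrt s * r)) \<le> exp (?x - l * ?x\<^sup>2) * exp (- (sqrt t * r))"
    unfolding exp_add[symmetric] x2 by (simp add: algebra_simps)
  also have "\<dots> \<le> (exp (1 / (2 * l)) * exp (- (l * ?x\<^sup>2 / 2))) * exp (- (sqrt t * r))"
    by (intro mult_right_mono exp_shift_le l) auto
  also have "\<dots> \<le> (exp (1 / (2 * l)) * (l * ?x\<^sup>2 / 2) powr (-q)) * exp (- (sqrt t * r))"
    using l st r q by (intro mult_right_mono mult_left_mono powr_exp_le) (auto simp: x2)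
  also have "(l * ?x\<^sup>2 / 2) powr (-q) = (l / 2) powr (-q) * ((t - s) powr (-q) * r powr (-(2 * q)))"
  proof -
    have "l * ?x\<^sup>2 / 2 = (l / 2) * ((t - s) * r powr 2)" unfolding x2 using r by (simp add: mult_ac)
    then show ?thesis using l st r by (simp only: powr_mult powr_powr) simp
  qed
  finally show ?thesis by (simp add: mult.assoc)
qed

text \<open>The constant is chosen before the rate \<sigma> and both functions, because \<sigma> =
  sqrt t varies along the evolution. The triangle inequality takes the exponential factors out of
  the integral, and the Riesz integral remains.\<close>

lemma conv_bound:
  assumes d: "d > 0" and ab: "0 < a" "a < real d" "0 < b" "b < real d" "a + b > real d"
  shows "\<exists>C>0. \<forall>V W \<sigma> A B \<xi>. \<sigma> \<ge> 0 \<longrightarrow> A \<ge> 0 \<longrightarrow> B \<ge> 0 \<longrightarrow>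
    V \<in> borel_measurable borel \<longrightarrow> W \<in> borel_measurable borel \<longrightarrow>
    (\<forall>\<xi>\<in>Rd d. enorm d \<xi> > 0 \<longrightarrow> cmod (V \<xi>) \<le> A * (exp (- (\<sigma> * enorm d \<xi>)) * enorm d \<xi> powr (-a))) \<longrightarrow>
    (\<forall>\<xi>\<in>Rd d. enorm d \<xi> > 0 \<longrightarrow> cmod (W \<xi>) \<le> B * (exp (- (\<sigma> * enorm d \<xi>)) * enorm d \<xi> powr (-b))) \<longrightarrow>
    \<xi> \<in> Rd d \<longrightarrow> enorm d \<xi> > 0 \<longrightarrow>
    integrable (leb d) (\<lambda>\<eta>. V (\<lambda>i. \<xi> i - \<eta> i) * W \<eta>) \<and>
    cmod (conv d V W \<xi>) \<le> C * (A * B) * (exp (- (\<sigma> * enorm d \<xi>)) * enorm d \<xi> powr (-(a + b - d)))"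
proof -
  obtain C where C: "C > 0" "\<And>\<xi>. \<xi> \<in> Rd d \<Longrightarrow> enorm d \<xi> > 0 \<Longrightarrow>
    (\<integral>\<^sup>+\<eta>. ennreal (enorm d (\<lambda>i. \<xi> i - \<eta> i) powr (-a) * enorm d \<eta> powr (-b)) \<partial>leb d)
      \<le> ennreal (C * enorm d \<xi> powr (-(a + b - d)))"
    using nn_integral_riesz[OF d ab(1-5)] by blast
  show ?thesis
  proof (intro exI[of _ "C / (2 * pi) ^ d"] conjI allI impI)
    show "C / (2 * pi) ^ d > 0" using C(1) by simp
    fix V W :: "point \<Rightarrow> complex" and \<sigma> A B :: real and \<xi> :: point
    assume nn: "\<sigma> \<ge> 0" "A \<ge> 0" "B \<ge> 0" and [measurable]: "V \<in> borel_measurable borel" "W \<in> borel_measurable borel"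
      and V: "\<forall>\<xi>\<in>Rd d. enorm d \<xi> > 0 \<longrightarrow> cmod (V \<xi>) \<le> A * (exp (- (\<sigma> * enorm d \<xi>)) * enorm d \<xi> powr (-a))"
      and W: "\<forall>\<xi>\<in>Rd d. enorm d \<xi> > 0 \<longrightarrow> cmod (W \<xi>) \<le> B * (exp (- (\<sigma> * enorm d \<xi>)) * enorm d \<xi> powr (-b))"
      and \<xi>: "\<xi> \<in> Rd d" "enorm d \<xi> > 0"
    let ?f = "\<lambda>\<eta>. V (\<lambda>i. \<xi> i - \<eta> i) * W \<eta>"
    let ?K = "A * B * exp (- (\<sigma> * enorm d \<xi>))"
    have K: "?K \<ge> 0" using nn by simp
    have "(\<integral>\<^sup>+\<eta>. ennreal (cmod (?f \<eta>)) \<partial>leb d)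
      \<le> (\<integral>\<^sup>+\<eta>. ennreal ?K * ennreal (enorm d (\<lambda>i. \<xi> i - \<eta> i) powr (-a) * enorm d \<eta> powr (-b)) \<partial>leb d)"
    proof (rule nn_integral_mono_AE)
      show "AE \<eta> in leb d. ennreal (cmod (?f \<eta>)) \<le> ennreal ?K * ennreal (enorm d (\<lambda>i. \<xi> i - \<eta> i) powr (-a) * enorm d \<eta> powr (-b))"
        using AE_leb_Rd AE_leb_enorm_pos[OF d] AE_leb_reflect[OF \<xi>(1) AE_leb_Rd] AE_leb_reflect[OF \<xi>(1) AE_leb_enorm_pos[OF d]]
      proof eventually_elim
        case (elim \<eta>)
        let ?x = "enorm d (\<lambda>i. \<xi> i - \<eta> i)" and ?y = "enorm d \<eta>"
        have "cmod (?f \<eta>) \<le> (A * (exp (- (\<sigma> * ?x)) * ?x powr (-a))) * (B * (exp (- (\<sigma> * ?y)) * ?y powr (-b)))"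
          unfolding norm_mult using V W elim nn by (intro mult_mono) auto
        also have "\<dots> = A * B * exp (- (\<sigma> * (?x + ?y))) * (?x powr (-a) * ?y powr (-b))"
          by (simp add: exp_add[symmetric] distrib_left mult_ac exp_diff exp_minus field_simps)
        also have "\<dots> \<le> ?K * (?x powr (-a) * ?y powr (-b))"
        proof -
          have "\<sigma> * enorm d \<xi> \<le> \<sigma> * (?x + ?y)"
            using nn by (intro mult_left_mono enorm_triangle) auto
          then show ?thesis using nn by (intro mult_right_mono mult_left_mono) auto
        qed
        finally show ?case using K by (simp add: ennreal_mult'[symmetric] ennreal_leI)
      qed
    qed
    also have "\<dots> = ennreal ?K * (\<integral>\<^sup>+\<eta>. ennreal (enorm d (\<lambda>i. \<xi> i - \<eta> i) powr (-a) * enorm d \<eta> powr (-b)) \<partial>leb d)"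
      by (intro nn_integral_cmult) measurable
    also have "\<dots> \<le> ennreal ?K * ennreal (C * enorm d \<xi> powr (-(a + b - d)))"
      by (intro mult_left_mono C(2) \<xi>) auto
    also have "\<dots> = ennreal (?K * (C * enorm d \<xi> powr (-(a + b - d))))"
      using K by (simp add: ennreal_mult')
    finally have n: "(\<integral>\<^sup>+\<eta>. ennreal (cmod (?f \<eta>)) \<partial>leb d) \<le> ennreal (?K * (C * enorm d \<xi> powr (-(a + b - d))))" .
    have m: "?f \<in> borel_measurable (leb d)" by measurable
    have k: "0 \<le> ?K * (C * enorm d \<xi> powr (-(a + b - d)))" using K C(1) by simp
    note b = integral_bound_of_nn[OF m n k]
    show "integrable (leb d) ?f" by (rule b(1))
    have "cmod (conv d V W \<xi>) = cmod (LINT \<eta>|leb d. ?f \<eta>) / (2 * pi) ^ d"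
      by (simp add: conv_def norm_divide norm_power norm_mult)
    also have "\<dots> \<le> (?K * (C * enorm d \<xi> powr (-(a + b - d)))) / (2 * pi) ^ d"
      by (intro divide_right_mono b(2)) simp
    finally show "cmod (conv d V W \<xi>) \<le> C / (2 * pi) ^ d * (A * B) * (exp (- (\<sigma> * enorm d \<xi>)) * enorm d \<xi> powr (-(a + b - d)))"
      by (simp add: mult_ac)
  qed
qed

text \<open>Convolution acts at fixed time; the Duhamel integral then runs over the time parameter,
  hence the need for joint measurability.\<close>

lemma measurable_conv_param:
  fixes V W :: "real \<Rightarrow> point \<Rightarrow> complex"
  assumes V: "(\<lambda>z. V (fst z) (snd z)) \<in> borel_measurable (borel \<Otimes>\<^sub>M borel)"
    and W: "(\<lambda>z. W (fst z) (snd z)) \<in> borel_measurable (borel \<Otimes>\<^sub>M borel)"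
  shows "(\<lambda>z. conv d (V (fst z)) (W (fst z)) (snd z)) \<in> borel_measurable (borel \<Otimes>\<^sub>M borel)"
proof -
  let ?M = "(borel \<Otimes>\<^sub>M borel) \<Otimes>\<^sub>M leb d :: ((real \<times> point) \<times> point) measure"
  have diff: "(\<lambda>y. \<lambda>i. snd (fst y) i - snd y i) \<in> borel_measurable ?M"
    by (rule measurable_point_diff) measurable
  have "(\<lambda>y. (fst (fst y), \<lambda>i. snd (fst y) i - snd y i)) \<in> ?M \<rightarrow>\<^sub>M borel \<Otimes>\<^sub>M borel"
    by (rule measurable_Pair[OF _ diff]) measurable
  from measurable_compose[OF this V] have 1: "(\<lambda>y. V (fst (fst y)) (\<lambda>i. snd (fst y) i - snd y i)) \<in> borel_measurable ?M" by simp
  have "(\<lambda>y. (fst (fst y), snd y)) \<in> ?M \<rightarrow>\<^sub>M borel \<Otimes>\<^sub>M borel" by measurable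
  from measurable_compose[OF this W] have 2: "(\<lambda>y. W (fst (fst y)) (snd y)) \<in> borel_measurable ?M" by simp
  have "(\<lambda>(z, \<eta>). V (fst z) (\<lambda>i. snd z i - \<eta> i) * W (fst z) \<eta>) \<in> borel_measurable ?M"
    using borel_measurable_times[OF 1 2] by (simp add: case_prod_unfold)
  from leb.borel_measurable_lebesgue_integral[OF this]
  have [measurable]: "(\<lambda>z. LINT \<eta>|leb d. V (fst z) (\<lambda>i. snd z i - \<eta> i) * W (fst z) \<eta>) \<in> borel_measurable (borel \<Otimes>\<^sub>M borel)" .
  show ?thesis unfolding conv_def by measurable
qed

lemma conv_diff_left:
  assumes "integrable (leb d) (\<lambda>\<eta>. V (\<lambda>i. \<xi> i - \<eta> i) * W \<eta>)" "integrable (leb d) (\<lambda>\<eta>. V' (\<lambda>i. \<xi> i - \<eta> i) * W \<eta>)"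
  shows "conv d (\<lambda>\<eta>. V \<eta> - V' \<eta>) W \<xi> = conv d V W \<xi> - conv d V' W \<xi>"
  using Bochner_Integration.integral_diff[OF assms] by (simp add: conv_def left_diff_distrib diff_divide_distrib)

lemma conv_diff_right:
  assumes "integrable (leb d) (\<lambda>\<eta>. V (\<lambda>i. \<xi> i - \<eta> i) * W \<eta>)" "integrable (leb d) (\<lambda>\<eta>. V (\<lambda>i. \<xi> i - \<eta> i) * W' \<eta>)"
  shows "conv d V (\<lambda>\<eta>. W \<eta> - W' \<eta>) \<xi> = conv d V W \<xi> - conv d V W' \<xi>"
  using Bochner_Integration.integral_diff[OF assms] by (simp add: conv_def right_diff_distrib diff_divide_distrib)

section \<open>The nonlinearity on the Fourier side\<close>

type_synonym state = "complex \<times> (nat \<Rightarrow> complex)"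

locale nsk_dim = nsk +
  fixes d :: nat and p :: real
  assumes d2: "d \<ge> 2" and p2: "p > 2" and dp: "real d - 3 + 4 / p > 0"
begin

lemma d0: "d > 0" using d2 by simp

text \<open>e1 is the weight of the solution, e2 that of its gradient, and e3 = e1 + e2 - d that of
  their convolution.\<close>

definition e1 where "e1 = real d - 1 + 2 / p"
definition e2 where "e2 = real d - 2 + 2 / p"
definition e3 where "e3 = real d - 3 + 4 / p"

lemma p_bounds: "0 < 1 / p" "1 / p < 1 / 2" "2 / p < 1" "0 < 2 / p"
  using p2 by (auto simp: field_simps)

text \<open>\<open>p > 2\<close> gives e1 < d, and \<open>dp\<close> gives e3 > 0, that is e1 + e2 >
  d. The last identity says that the smoothing gain 2 (1 - 1/p) leads from the weight of the
  nonlinearity back to that of the solution.\<close>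

lemma e_bounds: "0 < e1" "e1 < real d" "0 < e2" "e2 < real d" "e1 + e2 > real d" "e1 + e1 > real d" "e3 > 0" "e3 < real d"
  "e1 + e2 - real d = e3" "e1 + e1 - real d = e3 + 1" "e2 + 1 = e1" "e3 + 2 - 2 / p = e1"
proof -
  have "real d \<ge> 2" "4 / p = 2 * (2 / p)" using d2 by simp_all
  then show "0 < e1" "e1 < real d" "0 < e2" "e2 < real d" "e1 + e2 > real d" "e1 + e1 > real d" "e3 > 0" "e3 < real d"
    "e1 + e2 - real d = e3" "e1 + e1 - real d = e3 + 1" "e2 + 1 = e1" "e3 + 2 - 2 / p = e1"
    using dp p_bounds unfolding e1_def e2_def e3_def by linarith+
qed

abbreviation profile :: "real \<Rightarrow> real \<Rightarrow> point \<Rightarrow> real" where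
  "profile e \<sigma> \<xi> \<equiv> exp (- (\<sigma> * enorm d \<xi>)) * enorm d \<xi> powr (-e)"

definition dmult :: "nat \<Rightarrow> (point \<Rightarrow> complex) \<Rightarrow> point \<Rightarrow> complex" where
  "dmult i V \<eta> = \<i> * of_real (\<eta> i) * V \<eta>"

text \<open>\<open>B_fst\<close> and \<open>B_snd\<close> polarise the quadratic terms: on the
  diagonal they are the transforms of f and g, and two separate slots are what difference estimates
  call for.\<close>

definition B_fst :: "(point \<Rightarrow> state) \<Rightarrow> (point \<Rightarrow> state) \<Rightarrow> point \<Rightarrow> complex" where
  "B_fst U V \<xi> = - (\<Sum>i<d. conv d (\<lambda>\<eta>. snd (U \<eta>) i) (dmult i (\<lambda>\<eta>. fst (V \<eta>))) \<xi>)"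

definition B_snd :: "(point \<Rightarrow> state) \<Rightarrow> (point \<Rightarrow> state) \<Rightarrow> point \<Rightarrow> nat \<Rightarrow> complex" where
  "B_snd U V \<xi> j =
     - (\<Sum>i<d. conv d (\<lambda>\<eta>. snd (U \<eta>) i) (dmult i (\<lambda>\<eta>. snd (V \<eta>) j)) \<xi>)
     + of_real \<mu> * (\<Sum>i<d. conv d (dmult i (\<lambda>\<eta>. fst (U \<eta>))) (dmult i (\<lambda>\<eta>. snd (V \<eta>) j)) \<xi>)
     + of_real (\<mu> + \<nu>) * (\<Sum>i<d. conv d (dmult i (\<lambda>\<eta>. fst (U \<eta>))) (dmult j (\<lambda>\<eta>. snd (V \<eta>) i)) \<xi>)
     + of_real (\<kappa> / 2) * (\<i> * of_real (\<xi> j) * (\<Sum>i<d. conv d (dmult i (\<lambda>\<eta>. fst (U \<eta>))) (dmult i (\<lambda>\<eta>. fst (V \<eta>))) \<xi>))"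

definition B :: "(point \<Rightarrow> state) \<Rightarrow> (point \<Rightarrow> state) \<Rightarrow> point \<Rightarrow> state" where
  "B U V \<xi> = (B_fst U V \<xi>, B_snd U V \<xi>)"

text \<open>At the origin \<open>0 powr (- e)\<close> is 0, so a pointwise bound by a negative power
  would demand vanishing there. The excluded points form a null set by
  \<open>AE_good\<close>.\<close>

definition good :: "point \<Rightarrow> bool" where "good \<xi> \<longleftrightarrow> \<xi> \<in> Rd d \<and> enorm d \<xi> > 0"

lemma AE_good: "AE \<xi> in leb d. good \<xi>"
  using AE_leb_Rd AE_leb_enorm_pos[OF d0] by eventually_elim (simp add: good_def)

definition state_meas :: "(point \<Rightarrow> state) \<Rightarrow> bool" where
  "state_meas U \<longleftrightarrow> (\<lambda>\<eta>. fst (U \<eta>)) \<in> borel_measurable borel \<and> (\<forall>j<d. (\<lambda>\<eta>. snd (U \<eta>) j) \<in> borel_measurable borel)"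

definition decays :: "real \<Rightarrow> real \<Rightarrow> (point \<Rightarrow> state) \<Rightarrow> bool" where
  "decays \<sigma> M U \<longleftrightarrow> state_meas U \<and> M \<ge> 0 \<and>
     (\<forall>\<xi>. good \<xi> \<longrightarrow> nrm d \<xi> (U \<xi>) \<le> M * profile e1 \<sigma> \<xi>)"

lemma dmult_measurable [measurable (raw)]:
  "V \<in> borel_measurable borel \<Longrightarrow> dmult i V \<in> borel_measurable borel"
  unfolding dmult_def[abs_def] by measurable

lemma decays_snd:
  assumes "decays \<sigma> M U" "good \<xi>" "j < d"
  shows "cmod (snd (U \<xi>) j) \<le> M * profile e1 \<sigma> \<xi>"
  using assms nrm_snd[OF assms(3), of "U \<xi>" \<xi>] by (auto simp: decays_def intro: order_trans)

lemma e1_e2_powr: "r > 0 \<Longrightarrow> r * r powr (-e1) = r powr (-e2)"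
proof -
  assume "r > 0"
  moreover have "- e2 = 1 + - e1" using e_bounds(11) by simp
  ultimately show ?thesis by (simp only: powr_add powr_one)
qed

lemma decays_dmult_snd:
  assumes "decays \<sigma> M U" "good \<xi>" "j < d" "i < d"
  shows "cmod (dmult i (\<lambda>\<eta>. snd (U \<eta>) j) \<xi>) \<le> M * profile e2 \<sigma> \<xi>"
proof -
  have r: "enorm d \<xi> > 0" using assms(2) by (simp add: good_def)
  have "cmod (dmult i (\<lambda>\<eta>. snd (U \<eta>) j) \<xi>) = \<bar>\<xi> i\<bar> * cmod (snd (U \<xi>) j)" by (simp add: dmult_def norm_mult)
  also have "\<dots> \<le> enorm d \<xi> * (M * profile e1 \<sigma> \<xi>)"
    by (intro mult_mono abs_coord_le_enorm decays_snd assms) auto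
  also have "\<dots> = M * (exp (- (\<sigma> * enorm d \<xi>)) * (enorm d \<xi> * enorm d \<xi> powr (-e1)))" by (simp only: mult_ac)
  finally show ?thesis using e1_e2_powr[OF r] by simp
qed

text \<open>|\<xi>| |b| itself is controlled by \<open>nrm\<close>, which gives e1; using |b| and
  keeping the factor |\<xi>| gives e2. So the gradient of the density can take the place of either
  factor in a product.\<close>

lemma decays_dmult_fst:
  assumes "decays \<sigma> M U" "good \<xi>" "i < d"
  shows "cmod (dmult i (\<lambda>\<eta>. fst (U \<eta>)) \<xi>) \<le> M * profile e1 \<sigma> \<xi>"
    and "cmod (dmult i (\<lambda>\<eta>. fst (U \<eta>)) \<xi>) \<le> M * profile e2 \<sigma> \<xi>"
proof -
  have r: "enorm d \<xi> > 0" using assms(2) by (simp add: good_def)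
  let ?w = "M * profile e1 \<sigma> \<xi>"
  have n: "nrm d \<xi> (U \<xi>) \<le> ?w" using assms by (simp add: decays_def)
  have "cmod (dmult i (\<lambda>\<eta>. fst (U \<eta>)) \<xi>) = \<bar>\<xi> i\<bar> * cmod (fst (U \<xi>))" by (simp add: dmult_def norm_mult)
  also have le: "\<dots> \<le> enorm d \<xi> * cmod (fst (U \<xi>))" by (intro mult_right_mono abs_coord_le_enorm assms) auto
  finally have 1: "cmod (dmult i (\<lambda>\<eta>. fst (U \<eta>)) \<xi>) \<le> enorm d \<xi> * cmod (fst (U \<xi>))" .
  from 1 show "cmod (dmult i (\<lambda>\<eta>. fst (U \<eta>)) \<xi>) \<le> ?w"
    using nrm_fst_le(2)[where d=d and \<xi>=\<xi> and x="U \<xi>"] n by linarith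
  have "enorm d \<xi> * cmod (fst (U \<xi>)) \<le> enorm d \<xi> * ?w"
    using nrm_fst_le(1)[where d=d and \<xi>=\<xi> and x="U \<xi>"] n by (intro mult_left_mono) auto
  also have "\<dots> = M * (exp (- (\<sigma> * enorm d \<xi>)) * (enorm d \<xi> * enorm d \<xi> powr (-e1)))" by (simp only: mult_ac)
  finally show "cmod (dmult i (\<lambda>\<eta>. fst (U \<eta>)) \<xi>) \<le> M * profile e2 \<sigma> \<xi>"
    using 1 e1_e2_powr[OF r] by simp
qed

definition conv_ok :: "real \<Rightarrow> real \<Rightarrow> real \<Rightarrow> (point \<Rightarrow> complex) \<Rightarrow> (point \<Rightarrow> complex) \<Rightarrow> bool" where
  "conv_ok K \<sigma> e f g \<longleftrightarrow> f \<in> borel_measurable borel \<and> g \<in> borel_measurable borel \<and> (\<forall>\<xi>. good \<xi> \<longrightarrow>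
     integrable (leb d) (\<lambda>\<eta>. f (\<lambda>i. \<xi> i - \<eta> i) * g \<eta>) \<and>
     cmod (conv d f g \<xi>) \<le> K * profile e \<sigma> \<xi>)"

lemma conv_ok_exists:
  obtains C where "C > 0"
    "\<And>\<sigma> A A' V W. \<lbrakk>\<sigma> \<ge> 0; A \<ge> 0; A' \<ge> 0; V \<in> borel_measurable borel; W \<in> borel_measurable borel;
      \<And>\<xi>. good \<xi> \<Longrightarrow> cmod (V \<xi>) \<le> A * profile e1 \<sigma> \<xi>;
      \<And>\<xi>. good \<xi> \<Longrightarrow> cmod (W \<xi>) \<le> A' * profile e2 \<sigma> \<xi>\<rbrakk>
      \<Longrightarrow> conv_ok (C * (A * A')) \<sigma> e3 V W"
    "\<And>\<sigma> A A' V W. \<lbrakk>\<sigma> \<ge> 0; A \<ge> 0; A' \<ge> 0; V \<in> borel_measurable borel; W \<in> borel_measurable borel;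
      \<And>\<xi>. good \<xi> \<Longrightarrow> cmod (V \<xi>) \<le> A * profile e1 \<sigma> \<xi>;
      \<And>\<xi>. good \<xi> \<Longrightarrow> cmod (W \<xi>) \<le> A' * profile e1 \<sigma> \<xi>\<rbrakk>
      \<Longrightarrow> conv_ok (C * (A * A')) \<sigma> (e3 + 1) V W"
proof -
  obtain C1 where C1: "C1 > 0" "\<And>V W \<sigma> A B \<xi>. \<lbrakk>\<sigma> \<ge> 0; A \<ge> 0; B \<ge> 0;
    V \<in> borel_measurable borel; W \<in> borel_measurable borel;
    \<forall>\<xi>\<in>Rd d. enorm d \<xi> > 0 \<longrightarrow> cmod (V \<xi>) \<le> A * profile e1 \<sigma> \<xi>;
    \<forall>\<xi>\<in>Rd d. enorm d \<xi> > 0 \<longrightarrow> cmod (W \<xi>) \<le> B * profile e2 \<sigma> \<xi>;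
    \<xi> \<in> Rd d; enorm d \<xi> > 0\<rbrakk> \<Longrightarrow>
    integrable (leb d) (\<lambda>\<eta>. V (\<lambda>i. \<xi> i - \<eta> i) * W \<eta>) \<and>
    cmod (conv d V W \<xi>) \<le> C1 * (A * B) * profile e3 \<sigma> \<xi>"
    using conv_bound[OF d0 e_bounds(1,2,3,4,5)] unfolding e_bounds(9) by blast
  obtain C2 where C2: "C2 > 0" "\<And>V W \<sigma> A B \<xi>. \<lbrakk>\<sigma> \<ge> 0; A \<ge> 0; B \<ge> 0;
    V \<in> borel_measurable borel; W \<in> borel_measurable borel;
    \<forall>\<xi>\<in>Rd d. enorm d \<xi> > 0 \<longrightarrow> cmod (V \<xi>) \<le> A * profile e1 \<sigma> \<xi>;
    \<forall>\<xi>\<in>Rd d. enorm d \<xi> > 0 \<longrightarrow> cmod (W \<xi>) \<le> B * profile e1 \<sigma> \<xi>;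
    \<xi> \<in> Rd d; enorm d \<xi> > 0\<rbrakk> \<Longrightarrow>
    integrable (leb d) (\<lambda>\<eta>. V (\<lambda>i. \<xi> i - \<eta> i) * W \<eta>) \<and>
    cmod (conv d V W \<xi>) \<le> C2 * (A * B) * profile (e3 + 1) \<sigma> \<xi>"
    using conv_bound[OF d0 e_bounds(1,2,1,2,6)] unfolding e_bounds(10) by blast
  define C where "C = max C1 C2"
  have C: "C1 \<le> C" "C2 \<le> C" by (auto simp: C_def)
  have up: "x \<le> C * y * z" if "x \<le> C' * y * z" "C' \<le> C" "0 \<le> y" "0 \<le> z" for x y z C'
    using that by (meson mult_right_mono order_trans)
  show ?thesis
  proof (rule that[of C])
    show "C > 0" using C1(1) C by linarith
    show "conv_ok (C * (A * A')) \<sigma> e3 V W" if a: "\<sigma> \<ge> 0" "A \<ge> 0" "A' \<ge> 0" "V \<in> borel_measurable borel" "W \<in> borel_measurable borel"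
      "\<And>\<xi>. good \<xi> \<Longrightarrow> cmod (V \<xi>) \<le> A * profile e1 \<sigma> \<xi>"
      "\<And>\<xi>. good \<xi> \<Longrightarrow> cmod (W \<xi>) \<le> A' * profile e2 \<sigma> \<xi>" for \<sigma> A A' V W
      unfolding conv_ok_def
    proof (intro conjI allI impI)
      fix \<xi> assume "good \<xi>"
      note c = C1(2)[OF a(1-5) _ _ conjunct1[OF this[unfolded good_def]] conjunct2[OF this[unfolded good_def]]]
      show "integrable (leb d) (\<lambda>\<eta>. V (\<lambda>i. \<xi> i - \<eta> i) * W \<eta>)"
        using c a(6,7) by (auto simp: good_def)
      show "cmod (conv d V W \<xi>) \<le> C * (A * A') * profile e3 \<sigma> \<xi>"
        by (rule up[OF _ C(1)]) (use c a in \<open>auto simp: good_def\<close>)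
    qed (use a in auto)
    show "conv_ok (C * (A * A')) \<sigma> (e3 + 1) V W" if a: "\<sigma> \<ge> 0" "A \<ge> 0" "A' \<ge> 0" "V \<in> borel_measurable borel" "W \<in> borel_measurable borel"
      "\<And>\<xi>. good \<xi> \<Longrightarrow> cmod (V \<xi>) \<le> A * profile e1 \<sigma> \<xi>"
      "\<And>\<xi>. good \<xi> \<Longrightarrow> cmod (W \<xi>) \<le> A' * profile e1 \<sigma> \<xi>" for \<sigma> A A' V W
      unfolding conv_ok_def
    proof (intro conjI allI impI)
      fix \<xi> assume "good \<xi>"
      note c = C2(2)[OF a(1-5) _ _ conjunct1[OF this[unfolded good_def]] conjunct2[OF this[unfolded good_def]]]
      show "integrable (leb d) (\<lambda>\<eta>. V (\<lambda>i. \<xi> i - \<eta> i) * W \<eta>)"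
        using c a(6,7) by (auto simp: good_def)
      show "cmod (conv d V W \<xi>) \<le> C * (A * A') * profile (e3 + 1) \<sigma> \<xi>"
        by (rule up[OF _ C(2)]) (use c a in \<open>auto simp: good_def\<close>)
    qed (use a in auto)
  qed
qed

text \<open>u . \<nabla>a is recorded at both exponents because the scalar component carries the
  weights 1 and |\<xi>|; \<nabla>a . \<nabla>a stands at e3 + 1 because a further derivative falls
  on it. The other products enter the vector component undifferentiated, at e3.\<close>

definition B_ok :: "real \<Rightarrow> real \<Rightarrow> (point \<Rightarrow> state) \<Rightarrow> (point \<Rightarrow> state) \<Rightarrow> bool" where
  "B_ok K \<sigma> U V \<longleftrightarrow> (\<forall>i<d.
      conv_ok K \<sigma> e3 (\<lambda>\<eta>. snd (U \<eta>) i) (dmult i (\<lambda>\<eta>. fst (V \<eta>))) \<and>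
      conv_ok K \<sigma> (e3 + 1) (\<lambda>\<eta>. snd (U \<eta>) i) (dmult i (\<lambda>\<eta>. fst (V \<eta>))) \<and>
      conv_ok K \<sigma> (e3 + 1) (dmult i (\<lambda>\<eta>. fst (U \<eta>))) (dmult i (\<lambda>\<eta>. fst (V \<eta>))) \<and>
      (\<forall>j<d. conv_ok K \<sigma> e3 (\<lambda>\<eta>. snd (U \<eta>) i) (dmult i (\<lambda>\<eta>. snd (V \<eta>) j)) \<and>
         conv_ok K \<sigma> e3 (dmult i (\<lambda>\<eta>. fst (U \<eta>))) (dmult i (\<lambda>\<eta>. snd (V \<eta>) j)) \<and>
         conv_ok K \<sigma> e3 (dmult i (\<lambda>\<eta>. fst (U \<eta>))) (dmult j (\<lambda>\<eta>. snd (V \<eta>) i))))"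

lemma B_ok_exists:
  obtains C where "C > 0"
    "\<And>\<sigma> M M' U V. \<sigma> \<ge> 0 \<Longrightarrow> decays \<sigma> M U \<Longrightarrow> decays \<sigma> M' V \<Longrightarrow> B_ok (C * (M * M')) \<sigma> U V"
proof -
  obtain C where C: "C > 0"
    "\<And>\<sigma> A A' V W. \<lbrakk>\<sigma> \<ge> 0; A \<ge> 0; A' \<ge> 0; V \<in> borel_measurable borel; W \<in> borel_measurable borel;
      \<And>\<xi>. good \<xi> \<Longrightarrow> cmod (V \<xi>) \<le> A * profile e1 \<sigma> \<xi>;
      \<And>\<xi>. good \<xi> \<Longrightarrow> cmod (W \<xi>) \<le> A' * profile e2 \<sigma> \<xi>\<rbrakk>
      \<Longrightarrow> conv_ok (C * (A * A')) \<sigma> e3 V W"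
    "\<And>\<sigma> A A' V W. \<lbrakk>\<sigma> \<ge> 0; A \<ge> 0; A' \<ge> 0; V \<in> borel_measurable borel; W \<in> borel_measurable borel;
      \<And>\<xi>. good \<xi> \<Longrightarrow> cmod (V \<xi>) \<le> A * profile e1 \<sigma> \<xi>;
      \<And>\<xi>. good \<xi> \<Longrightarrow> cmod (W \<xi>) \<le> A' * profile e1 \<sigma> \<xi>\<rbrakk>
      \<Longrightarrow> conv_ok (C * (A * A')) \<sigma> (e3 + 1) V W"
    by (rule conv_ok_exists) blast
  show ?thesis
  proof (rule that[OF C(1)])
    fix \<sigma> M M' U V assume \<sigma>: "\<sigma> \<ge> 0" and U: "decays \<sigma> M U" and V: "decays \<sigma> M' V"
    have mU: "(\<lambda>\<eta>. snd (U \<eta>) i) \<in> borel_measurable borel" "dmult i (\<lambda>\<eta>. fst (U \<eta>)) \<in> borel_measurable borel" if "i < d" for i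
      using U that by (auto simp: decays_def state_meas_def intro!: dmult_measurable)
    have mV: "dmult i (\<lambda>\<eta>. fst (V \<eta>)) \<in> borel_measurable borel" "j < d \<Longrightarrow> dmult i (\<lambda>\<eta>. snd (V \<eta>) j) \<in> borel_measurable borel" for i j
      using V by (auto simp: decays_def state_meas_def intro!: dmult_measurable)
    have M: "M \<ge> 0" "M' \<ge> 0" using U V by (auto simp: decays_def)
    show "B_ok (C * (M * M')) \<sigma> U V"
      unfolding B_ok_def
    proof (intro allI impI conjI)
      fix i assume i: "i < d"
      show "conv_ok (C * (M * M')) \<sigma> e3 (\<lambda>\<eta>. snd (U \<eta>) i) (dmult i (\<lambda>\<eta>. fst (V \<eta>)))"
        by (intro C(2) \<sigma> M mU mV i) (use decays_snd[OF U _ i] decays_dmult_fst(2)[OF V _ i] in auto)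
      show "conv_ok (C * (M * M')) \<sigma> (e3 + 1) (\<lambda>\<eta>. snd (U \<eta>) i) (dmult i (\<lambda>\<eta>. fst (V \<eta>)))"
        by (intro C(3) \<sigma> M mU mV i) (use decays_snd[OF U _ i] decays_dmult_fst(1)[OF V _ i] in auto)
      show "conv_ok (C * (M * M')) \<sigma> (e3 + 1) (dmult i (\<lambda>\<eta>. fst (U \<eta>))) (dmult i (\<lambda>\<eta>. fst (V \<eta>)))"
        by (intro C(3) \<sigma> M mU mV i) (use decays_dmult_fst(1)[OF U _ i] decays_dmult_fst(1)[OF V _ i] in auto)
      fix j assume j: "j < d"
      show "conv_ok (C * (M * M')) \<sigma> e3 (\<lambda>\<eta>. snd (U \<eta>) i) (dmult i (\<lambda>\<eta>. snd (V \<eta>) j))"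
        by (intro C(2) \<sigma> M mU mV i j) (use decays_snd[OF U _ i] decays_dmult_snd[OF V _ j i] in auto)
      show "conv_ok (C * (M * M')) \<sigma> e3 (dmult i (\<lambda>\<eta>. fst (U \<eta>))) (dmult i (\<lambda>\<eta>. snd (V \<eta>) j))"
        by (intro C(2) \<sigma> M mU mV i j) (use decays_dmult_fst(1)[OF U _ i] decays_dmult_snd[OF V _ j i] in auto)
      show "conv_ok (C * (M * M')) \<sigma> e3 (dmult i (\<lambda>\<eta>. fst (U \<eta>))) (dmult j (\<lambda>\<eta>. snd (V \<eta>) i))"
        by (intro C(2) \<sigma> M mU mV i j) (use decays_dmult_fst(1)[OF U _ i] decays_dmult_snd[OF V _ i j] in auto)
    qed
  qed
qed

lemma conv_ok_bound: "conv_ok K \<sigma> e f g \<Longrightarrow> good \<xi> \<Longrightarrow> cmod (conv d f g \<xi>) \<le> K * profile e \<sigma> \<xi>"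
  by (simp add: conv_ok_def)

lemma conv_ok_int: "conv_ok K \<sigma> e f g \<Longrightarrow> good \<xi> \<Longrightarrow> integrable (leb d) (\<lambda>\<eta>. f (\<lambda>i. \<xi> i - \<eta> i) * g \<eta>)"
  by (simp add: conv_ok_def)

text \<open>2 d counts the d products of \<open>B_fst\<close> under the weights 1 and |\<xi>|; each
  of the d components of \<open>B_snd\<close> consists of four sums of d products.\<close>

definition B_const :: real where
  "B_const = 2 * real d + real d * (real d * (1 + \<mu> + (\<mu> + \<nu>) + \<kappa> / 2))"

lemma B_const_nonneg: "B_const \<ge> 0"
  using \<mu> \<mu>\<nu> \<kappa> by (auto simp: B_const_def intro!: add_nonneg_nonneg mult_nonneg_nonneg)

lemma nrm_B_le:
  assumes ok: "B_ok K \<sigma> U V" and \<xi>: "good \<xi>"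
  shows "nrm d \<xi> (B U V \<xi>) \<le> B_const * K * profile e3 \<sigma> \<xi>"
proof -
  define r where "r = enorm d \<xi>"
  have r: "r > 0" using \<xi> by (simp add: good_def r_def)
  define w where "w = K * (exp (- (\<sigma> * r)) * r powr (-e3))"
  \<comment> \<open>One factor |\<xi>|, from the weight of the scalar part or from the outer
    derivative, turns the exponent e3 + 1 into e3.\<close>
  have rw: "r * (K * (exp (- (\<sigma> * r)) * r powr (-(e3 + 1)))) = w"
  proof -
    have "r * r powr (-(e3 + 1)) = r powr (-e3)" using r powr_add[of r 1 "-(e3 + 1)"] by simp
    then show ?thesis unfolding w_def by (metis mult.left_commute)
  qed
  have sum_le: "cmod (\<Sum>i<d. f i) \<le> real d * b" if "\<And>i. i < d \<Longrightarrow> cmod (f i) \<le> b" for f :: "nat \<Rightarrow> complex" and b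
  proof -
    have "cmod (\<Sum>i<d. f i) \<le> (\<Sum>i<d. b)" by (rule sum_norm_le) (use that in auto)
    then show ?thesis by simp
  qed
  have f: "cmod (B_fst U V \<xi>) \<le> real d * w"
    unfolding B_fst_def norm_minus_cancel w_def r_def
    by (rule sum_le, rule conv_ok_bound[OF _ \<xi>], use ok in \<open>simp add: B_ok_def\<close>)
  have "cmod (B_fst U V \<xi>) \<le> real d * (K * (exp (- (\<sigma> * r)) * r powr (-(e3 + 1))))"
    unfolding B_fst_def norm_minus_cancel r_def
    by (rule sum_le, rule conv_ok_bound[OF _ \<xi>], use ok in \<open>simp add: B_ok_def\<close>)
  then have "r * cmod (B_fst U V \<xi>) \<le> r * (real d * (K * (exp (- (\<sigma> * r)) * r powr (-(e3 + 1)))))"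
    using r by (intro mult_left_mono) auto
  also have "\<dots> = real d * w" using rw by (metis mult.left_commute)
  finally have f': "(1 + r) * cmod (B_fst U V \<xi>) \<le> 2 * real d * w" using f by (simp add: distrib_right)
  have g: "cmod (B_snd U V \<xi> j) \<le> real d * (1 + \<mu> + (\<mu> + \<nu>) + \<kappa> / 2) * w" if j: "j < d" for j
  proof -
    let ?s1 = "\<Sum>i<d. conv d (\<lambda>\<eta>. snd (U \<eta>) i) (dmult i (\<lambda>\<eta>. snd (V \<eta>) j)) \<xi>"
    let ?s2 = "\<Sum>i<d. conv d (dmult i (\<lambda>\<eta>. fst (U \<eta>))) (dmult i (\<lambda>\<eta>. snd (V \<eta>) j)) \<xi>"
    let ?s3 = "\<Sum>i<d. conv d (dmult i (\<lambda>\<eta>. fst (U \<eta>))) (dmult j (\<lambda>\<eta>. snd (V \<eta>) i)) \<xi>"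
    let ?s4 = "\<Sum>i<d. conv d (dmult i (\<lambda>\<eta>. fst (U \<eta>))) (dmult i (\<lambda>\<eta>. fst (V \<eta>))) \<xi>"
    have s: "cmod ?s1 \<le> real d * w" "cmod ?s2 \<le> real d * w" "cmod ?s3 \<le> real d * w"
      unfolding w_def r_def by ((rule sum_le, rule conv_ok_bound[OF _ \<xi>], use ok j in \<open>simp add: B_ok_def\<close>)+)
    have "cmod ?s4 \<le> real d * (K * (exp (- (\<sigma> * r)) * r powr (-(e3 + 1))))"
      unfolding r_def by (rule sum_le, rule conv_ok_bound[OF _ \<xi>], use ok j in \<open>simp add: B_ok_def\<close>)
    then have "cmod (\<i> * of_real (\<xi> j) * ?s4) \<le> r * (real d * (K * (exp (- (\<sigma> * r)) * r powr (-(e3 + 1)))))"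
      unfolding norm_mult using r abs_coord_le_enorm[OF j, of \<xi>] by (intro mult_mono) (auto simp: r_def)
    also have "\<dots> = real d * w" using rw by (metis mult.left_commute)
    finally have s4: "cmod (\<i> * of_real (\<xi> j) * ?s4) \<le> real d * w" .
    have "cmod (B_snd U V \<xi> j) \<le> cmod (- ?s1) + cmod (of_real \<mu> * ?s2) + cmod (of_real (\<mu> + \<nu>) * ?s3) + cmod (of_real (\<kappa> / 2) * (\<i> * of_real (\<xi> j) * ?s4))"
      unfolding B_snd_def by (intro order_trans[OF norm_triangle_ineq] add_mono norm_triangle_ineq order_refl)
    also have "\<dots> = cmod ?s1 + \<mu> * cmod ?s2 + (\<mu> + \<nu>) * cmod ?s3 + \<kappa> / 2 * cmod (\<i> * of_real (\<xi> j) * ?s4)"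
      using \<mu> \<mu>\<nu> \<kappa> by (simp only: norm_mult[of "of_real _"] norm_of_real norm_minus_cancel)
    also have "\<dots> \<le> real d * w + \<mu> * (real d * w) + (\<mu> + \<nu>) * (real d * w) + \<kappa> / 2 * (real d * w)"
      using \<mu> \<mu>\<nu> \<kappa> s s4 by (intro add_mono mult_left_mono) auto
    finally show ?thesis by (simp add: algebra_simps)
  qed
  have "nrm d \<xi> (B U V \<xi>) \<le> 2 * real d * w + (\<Sum>j<d. real d * (1 + \<mu> + (\<mu> + \<nu>) + \<kappa> / 2) * w)"
    unfolding nrm_def B_def fst_conv snd_conv r_def[symmetric] by (intro add_mono f' sum_mono g) auto
  then show ?thesis by (simp add: B_const_def w_def r_def algebra_simps)
qed

definition sdiff :: "(point \<Rightarrow> state) \<Rightarrow> (point \<Rightarrow> state) \<Rightarrow> point \<Rightarrow> state" where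
  "sdiff U V \<eta> = (fst (U \<eta>) - fst (V \<eta>), \<lambda>j. snd (U \<eta>) j - snd (V \<eta>) j)"

lemma dmult_diff: "dmult i (\<lambda>\<eta>. f \<eta> - g \<eta>) = (\<lambda>\<eta>. dmult i f \<eta> - dmult i g \<eta>)"
  by (simp add: dmult_def fun_eq_iff right_diff_distrib)

text \<open>Linearity in a slot holds where the two convolution integrals converge separately;
  \<open>B_ok\<close> for both arguments provides this at good frequencies.\<close>

lemma B_diff_left:
  assumes U: "B_ok K \<sigma> U X" and V: "B_ok K' \<sigma>' V X" and \<xi>: "good \<xi>"
  shows "B_fst (sdiff U V) X \<xi> = B_fst U X \<xi> - B_fst V X \<xi>"
    and "j < d \<Longrightarrow> B_snd (sdiff U V) X \<xi> j = B_snd U X \<xi> j - B_snd V X \<xi> j"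
proof -
  note U' = U[unfolded B_ok_def, rule_format] and V' = V[unfolded B_ok_def, rule_format]
  have 1: "conv d (\<lambda>\<eta>. snd (U \<eta>) i - snd (V \<eta>) i) (dmult i (\<lambda>\<eta>. fst (X \<eta>))) \<xi>
     = conv d (\<lambda>\<eta>. snd (U \<eta>) i) (dmult i (\<lambda>\<eta>. fst (X \<eta>))) \<xi> - conv d (\<lambda>\<eta>. snd (V \<eta>) i) (dmult i (\<lambda>\<eta>. fst (X \<eta>))) \<xi>" if "i < d" for i
    by (rule conv_diff_left) (use U'[OF that] V'[OF that] in \<open>auto intro: conv_ok_int[OF _ \<xi>]\<close>)
  show "B_fst (sdiff U V) X \<xi> = B_fst U X \<xi> - B_fst V X \<xi>"
    unfolding B_fst_def sdiff_def by (simp add: 1 sum_subtractf)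
  assume j: "j < d"
  have 2: "conv d (\<lambda>\<eta>. snd (U \<eta>) i - snd (V \<eta>) i) (dmult i (\<lambda>\<eta>. snd (X \<eta>) j)) \<xi>
     = conv d (\<lambda>\<eta>. snd (U \<eta>) i) (dmult i (\<lambda>\<eta>. snd (X \<eta>) j)) \<xi> - conv d (\<lambda>\<eta>. snd (V \<eta>) i) (dmult i (\<lambda>\<eta>. snd (X \<eta>) j)) \<xi>"
    "conv d (\<lambda>\<eta>. dmult i (\<lambda>\<eta>. fst (U \<eta>)) \<eta> - dmult i (\<lambda>\<eta>. fst (V \<eta>)) \<eta>) (dmult i (\<lambda>\<eta>. snd (X \<eta>) j)) \<xi>
     = conv d (dmult i (\<lambda>\<eta>. fst (U \<eta>))) (dmult i (\<lambda>\<eta>. snd (X \<eta>) j)) \<xi> - conv d (dmult i (\<lambda>\<eta>. fst (V \<eta>))) (dmult i (\<lambda>\<eta>. snd (X \<eta>) j)) \<xi>"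
    "conv d (\<lambda>\<eta>. dmult i (\<lambda>\<eta>. fst (U \<eta>)) \<eta> - dmult i (\<lambda>\<eta>. fst (V \<eta>)) \<eta>) (dmult j (\<lambda>\<eta>. snd (X \<eta>) i)) \<xi>
     = conv d (dmult i (\<lambda>\<eta>. fst (U \<eta>))) (dmult j (\<lambda>\<eta>. snd (X \<eta>) i)) \<xi> - conv d (dmult i (\<lambda>\<eta>. fst (V \<eta>))) (dmult j (\<lambda>\<eta>. snd (X \<eta>) i)) \<xi>"
    "conv d (\<lambda>\<eta>. dmult i (\<lambda>\<eta>. fst (U \<eta>)) \<eta> - dmult i (\<lambda>\<eta>. fst (V \<eta>)) \<eta>) (dmult i (\<lambda>\<eta>. fst (X \<eta>))) \<xi>
     = conv d (dmult i (\<lambda>\<eta>. fst (U \<eta>))) (dmult i (\<lambda>\<eta>. fst (X \<eta>))) \<xi> - conv d (dmult i (\<lambda>\<eta>. fst (V \<eta>))) (dmult i (\<lambda>\<eta>. fst (X \<eta>))) \<xi>"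
    if "i < d" for i
    by (rule conv_diff_left; use U'[OF that] V'[OF that] j in \<open>auto intro: conv_ok_int[OF _ \<xi>]\<close>)+
  show "B_snd (sdiff U V) X \<xi> j = B_snd U X \<xi> j - B_snd V X \<xi> j"
    unfolding B_snd_def sdiff_def fst_conv snd_conv dmult_diff
    by (simp add: 2 sum_subtractf algebra_simps)
qed

lemma B_diff_right:
  assumes U: "B_ok K \<sigma> X U" and V: "B_ok K' \<sigma>' X V" and \<xi>: "good \<xi>"
  shows "B_fst X (sdiff U V) \<xi> = B_fst X U \<xi> - B_fst X V \<xi>"
    and "j < d \<Longrightarrow> B_snd X (sdiff U V) \<xi> j = B_snd X U \<xi> j - B_snd X V \<xi> j"
proof -
  note U' = U[unfolded B_ok_def, rule_format] and V' = V[unfolded B_ok_def, rule_format]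
  have 1: "conv d (\<lambda>\<eta>. snd (X \<eta>) i) (\<lambda>\<eta>. dmult i (\<lambda>\<eta>. fst (U \<eta>)) \<eta> - dmult i (\<lambda>\<eta>. fst (V \<eta>)) \<eta>) \<xi>
     = conv d (\<lambda>\<eta>. snd (X \<eta>) i) (dmult i (\<lambda>\<eta>. fst (U \<eta>))) \<xi> - conv d (\<lambda>\<eta>. snd (X \<eta>) i) (dmult i (\<lambda>\<eta>. fst (V \<eta>))) \<xi>" if "i < d" for i
    by (rule conv_diff_right) (use U'[OF that] V'[OF that] in \<open>auto intro: conv_ok_int[OF _ \<xi>]\<close>)
  show "B_fst X (sdiff U V) \<xi> = B_fst X U \<xi> - B_fst X V \<xi>"
    unfolding B_fst_def sdiff_def fst_conv snd_conv dmult_diff by (simp add: 1 sum_subtractf)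
  assume j: "j < d"
  have 2: "conv d (\<lambda>\<eta>. snd (X \<eta>) i) (\<lambda>\<eta>. dmult i (\<lambda>\<eta>. snd (U \<eta>) j) \<eta> - dmult i (\<lambda>\<eta>. snd (V \<eta>) j) \<eta>) \<xi>
     = conv d (\<lambda>\<eta>. snd (X \<eta>) i) (dmult i (\<lambda>\<eta>. snd (U \<eta>) j)) \<xi> - conv d (\<lambda>\<eta>. snd (X \<eta>) i) (dmult i (\<lambda>\<eta>. snd (V \<eta>) j)) \<xi>"
    "conv d (dmult i (\<lambda>\<eta>. fst (X \<eta>))) (\<lambda>\<eta>. dmult i (\<lambda>\<eta>. snd (U \<eta>) j) \<eta> - dmult i (\<lambda>\<eta>. snd (V \<eta>) j) \<eta>) \<xi>
     = conv d (dmult i (\<lambda>\<eta>. fst (X \<eta>))) (dmult i (\<lambda>\<eta>. snd (U \<eta>) j)) \<xi> - conv d (dmult i (\<lambda>\<eta>. fst (X \<eta>))) (dmult i (\<lambda>\<eta>. snd (V \<eta>) j)) \<xi>"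
    "conv d (dmult i (\<lambda>\<eta>. fst (X \<eta>))) (\<lambda>\<eta>. dmult j (\<lambda>\<eta>. snd (U \<eta>) i) \<eta> - dmult j (\<lambda>\<eta>. snd (V \<eta>) i) \<eta>) \<xi>
     = conv d (dmult i (\<lambda>\<eta>. fst (X \<eta>))) (dmult j (\<lambda>\<eta>. snd (U \<eta>) i)) \<xi> - conv d (dmult i (\<lambda>\<eta>. fst (X \<eta>))) (dmult j (\<lambda>\<eta>. snd (V \<eta>) i)) \<xi>"
    "conv d (dmult i (\<lambda>\<eta>. fst (X \<eta>))) (\<lambda>\<eta>. dmult i (\<lambda>\<eta>. fst (U \<eta>)) \<eta> - dmult i (\<lambda>\<eta>. fst (V \<eta>)) \<eta>) \<xi>
     = conv d (dmult i (\<lambda>\<eta>. fst (X \<eta>))) (dmult i (\<lambda>\<eta>. fst (U \<eta>))) \<xi> - conv d (dmult i (\<lambda>\<eta>. fst (X \<eta>))) (dmult i (\<lambda>\<eta>. fst (V \<eta>))) \<xi>"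
    if "i < d" for i
    by (rule conv_diff_right; use U'[OF that] V'[OF that] j in \<open>auto intro: conv_ok_int[OF _ \<xi>]\<close>)+
  show "B_snd X (sdiff U V) \<xi> j = B_snd X U \<xi> j - B_snd X V \<xi> j"
    unfolding B_snd_def sdiff_def fst_conv snd_conv dmult_diff
    by (simp add: 2 sum_subtractf algebra_simps)
qed

lemma nrm_cong: "fst x = fst y \<Longrightarrow> (\<And>j. j < d \<Longrightarrow> snd x j = snd y j) \<Longrightarrow> nrm d \<xi> x = nrm d \<xi> y"
  unfolding nrm_def by (auto intro!: sum.cong arg_cong2[where f="(+)"])

lemma nrm_triangle:
  assumes "fst z = fst x + fst y" "\<And>j. j < d \<Longrightarrow> snd z j = snd x j + snd y j"
  shows "nrm d \<xi> z \<le> nrm d \<xi> x + nrm d \<xi> y"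
proof -
  have "(1 + enorm d \<xi>) * cmod (fst z) \<le> (1 + enorm d \<xi>) * (cmod (fst x) + cmod (fst y))"
    unfolding assms(1) by (intro mult_left_mono norm_triangle_ineq) auto
  moreover have "(\<Sum>j<d. cmod (snd z j)) \<le> (\<Sum>j<d. cmod (snd x j) + cmod (snd y j))"
    by (intro sum_mono) (simp add: assms(2) norm_triangle_ineq)
  ultimately show ?thesis by (simp add: nrm_def distrib_left sum.distrib)
qed

text \<open>B(U,U) - B(V,V) = B(U - V, U) + B(V, U - V).\<close>

lemma nrm_B_diff_le:
  assumes UU: "B_ok K1 \<sigma> U U" and VU: "B_ok K2 \<sigma> V U" and VV: "B_ok K3 \<sigma> V V"
    and D1: "B_ok K \<sigma> (sdiff U V) U" and D2: "B_ok K' \<sigma> V (sdiff U V)" and \<xi>: "good \<xi>"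
  shows "nrm d \<xi> (sdiff (B U U) (B V V) \<xi>) \<le> B_const * (K + K') * profile e3 \<sigma> \<xi>"
proof -
  have "nrm d \<xi> (sdiff (B U U) (B V V) \<xi>) \<le> nrm d \<xi> (B (sdiff U V) U \<xi>) + nrm d \<xi> (B V (sdiff U V) \<xi>)"
    by (rule nrm_triangle) (simp_all add: sdiff_def[of "B _ _"] B_def B_diff_left[OF UU VU \<xi>] B_diff_right[OF VU VV \<xi>])
  then show ?thesis
    using nrm_B_le[OF D1 \<xi>] nrm_B_le[OF D2 \<xi>] by (simp add: algebra_simps)
qed

end

section \<open>Duhamel integrals and the Picard iteration\<close>

text \<open>Completeness is used in the complex plane only, at fixed time and frequency; the
  explicit tail bound restores convergence in the weighted norm.\<close>

lemma geometric_limit: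
  fixes x :: "nat \<Rightarrow> complex"
  assumes "\<And>n. cmod (x (Suc n) - x n) \<le> c * (1 / 2) ^ n"
  shows "x \<longlonglongrightarrow> lim x" "cmod (x n - lim x) \<le> 2 * c * (1 / 2) ^ n"
proof -
  have c: "c \<ge> 0" using order_trans[OF norm_ge_zero assms[of 0]] by simp
  have A: "cmod (x (n + k) - x n) \<le> c * (1 / 2) ^ n * (2 - 2 * (1 / 2) ^ k)" for n k
  proof (induction k)
    case (Suc k)
    have "cmod (x (n + Suc k) - x n) \<le> cmod (x (Suc (n + k)) - x (n + k)) + cmod (x (n + k) - x n)"
      using norm_triangle_ineq[of "x (Suc (n + k)) - x (n + k)" "x (n + k) - x n"] by simp
    also have "\<dots> \<le> c * (1 / 2) ^ (n + k) + c * (1 / 2) ^ n * (2 - 2 * (1 / 2) ^ k)"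
      by (intro add_mono assms Suc)
    also have "\<dots> = c * (1 / 2) ^ n * (2 - 2 * (1 / 2) ^ Suc k)" by (simp add: power_add algebra_simps)
    finally show ?case .
  qed simp
  have B: "cmod (x (n + k) - x n) \<le> 2 * c * (1 / 2) ^ n" for n k
  proof -
    have "c * (1 / 2) ^ n * (2 - 2 * (1 / 2) ^ k) \<le> c * (1 / 2) ^ n * 2"
      using c by (intro mult_left_mono) auto
    then show ?thesis using A[of n k] by simp
  qed
  have "Cauchy x"
  proof (rule CauchyI)
    fix e :: real assume e: "e > 0"
    have "(\<lambda>n. 4 * c * (1 / 2) ^ n) \<longlonglongrightarrow> 4 * c * 0" by (intro tendsto_intros LIMSEQ_power_zero) simp
    then have "\<forall>\<^sub>F n in sequentially. 4 * c * (1 / 2) ^ n < e" using e by (intro order_tendstoD(2)) auto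
    then obtain N where N: "4 * c * (1 / 2) ^ N < e" by (auto simp: eventually_sequentially)
    show "\<exists>M. \<forall>m\<ge>M. \<forall>n\<ge>M. cmod (x m - x n) < e"
    proof (intro exI[of _ N] allI impI)
      fix m n assume "m \<ge> N" "n \<ge> N"
      then obtain k l where "m = N + k" "n = N + l" by (auto simp: le_iff_add)
      then have "cmod (x m - x n) \<le> 2 * c * (1 / 2) ^ N + 2 * c * (1 / 2) ^ N"
        using norm_triangle_ineq4[of "x m - x N" "x n - x N"] B[of N k] B[of N l] by simp
      then show "cmod (x m - x n) < e" using N by simp
    qed
  qed
  then show L: "x \<longlonglongrightarrow> lim x" by (simp add: Cauchy_convergent_iff convergent_LIMSEQ_iff)
  have "(\<lambda>k. cmod (x (n + k) - x n)) \<longlonglongrightarrow> cmod (lim x - x n)"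
    using LIMSEQ_ignore_initial_segment[OF L, of n] by (intro tendsto_intros) (simp add: add.commute)
  then have "cmod (lim x - x n) \<le> 2 * c * (1 / 2) ^ n"
    by (rule LIMSEQ_le_const2) (use B in auto)
  then show "cmod (x n - lim x) \<le> 2 * c * (1 / 2) ^ n" by (simp add: norm_minus_commute)
qed

context nsk_dim
begin

text \<open>The Duhamel integral and Fubini's theorem both ask for joint measurability in time and
  frequency, and it survives the pointwise limit of the iteration.\<close>

definition smeas :: "(real \<Rightarrow> point \<Rightarrow> state) \<Rightarrow> bool" where
  "smeas N \<longleftrightarrow> (\<lambda>z. fst (N (fst z) (snd z))) \<in> borel_measurable (borel \<Otimes>\<^sub>M borel) \<and>
     (\<forall>j<d. (\<lambda>z. snd (N (fst z) (snd z)) j) \<in> borel_measurable (borel \<Otimes>\<^sub>M borel))"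

text \<open>Envelopes of the solution and, in \<open>wtN\<close>, of the nonlinearity: the latter
  has the time power of a product of two solutions and the frequency power e3 of their
  convolution.\<close>

definition wt :: "real \<Rightarrow> real \<Rightarrow> real" where
  "wt t r = t powr (- (1 / p)) * (exp (- (sqrt t * r)) * r powr (- e1))"

definition wtN :: "real \<Rightarrow> real \<Rightarrow> real" where
  "wtN s r = s powr (- (2 / p)) * (exp (- (sqrt s * r)) * r powr (- e3))"

definition Dh :: "(real \<Rightarrow> point \<Rightarrow> state) \<Rightarrow> real \<Rightarrow> point \<Rightarrow> state" where
  "Dh N t \<xi> = (LINT s:{0<..<t}|lborel. fst (W d (t - s) \<xi> (N s \<xi>)),
     \<lambda>j. LINT s:{0<..<t}|lborel. snd (W d (t - s) \<xi> (N s \<xi>)) j)"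

lemma wt_nonneg [simp]: "0 \<le> wt t r" and wtN_nonneg [simp]: "0 \<le> wtN t r"
  by (simp_all add: wt_def wtN_def)

lemma smeas_slice:
  assumes "smeas N"
  shows "(\<lambda>s. fst (N s \<xi>)) \<in> borel_measurable borel" "j < d \<Longrightarrow> (\<lambda>s. snd (N s \<xi>) j) \<in> borel_measurable borel"
    and "state_meas (N t)"
proof -
  have 1: "(\<lambda>s::real. (s, \<xi>)) \<in> borel \<rightarrow>\<^sub>M borel \<Otimes>\<^sub>M borel" and 2: "(\<lambda>\<xi>::point. (t, \<xi>)) \<in> borel \<rightarrow>\<^sub>M borel \<Otimes>\<^sub>M borel"
    by measurable
  have f: "(\<lambda>z. fst (N (fst z) (snd z))) \<in> borel_measurable (borel \<Otimes>\<^sub>M borel)"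
    and s: "j < d \<Longrightarrow> (\<lambda>z. snd (N (fst z) (snd z)) j) \<in> borel_measurable (borel \<Otimes>\<^sub>M borel)" for j
    using assms by (auto simp: smeas_def)
  show "(\<lambda>s. fst (N s \<xi>)) \<in> borel_measurable borel" using measurable_compose[OF 1 f] by simp
  show "j < d \<Longrightarrow> (\<lambda>s. snd (N s \<xi>) j) \<in> borel_measurable borel" using measurable_compose[OF 1 s] by simp
  show "state_meas (N t)"
    unfolding state_meas_def using measurable_compose[OF 2 f] measurable_compose[OF 2 s] by simp
qed

lemma measurable_W_slice:
  assumes "smeas N"
  shows "(\<lambda>s. fst (W d (t - s) \<xi> (N s \<xi>))) \<in> borel_measurable borel"
    and "j < d \<Longrightarrow> (\<lambda>s. snd (W d (t - s) \<xi> (N s \<xi>)) j) \<in> borel_measurable borel"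
proof -
  have \<tau>: "(\<lambda>s. t - s) \<in> borel_measurable borel" and X: "(\<lambda>_. \<xi>) \<in> borel_measurable borel" by measurable
  note M = measurable_W[OF \<tau> X smeas_slice(1)[OF assms, of \<xi>], where w="\<lambda>s. snd (N s \<xi>)" and d=d]
  show "(\<lambda>s. fst (W d (t - s) \<xi> (N s \<xi>))) \<in> borel_measurable borel"
    using M(1) smeas_slice(2)[OF assms, of _ \<xi>] by simp
  show "j < d \<Longrightarrow> (\<lambda>s. snd (W d (t - s) \<xi> (N s \<xi>)) j) \<in> borel_measurable borel"
    using M(2) smeas_slice(2)[OF assms, of _ \<xi>] by simp
qed

lemma smeas_Dh:
  assumes "smeas N"
  shows "smeas (Dh N)"
proof -
  let ?M = "(borel \<Otimes>\<^sub>M borel) \<Otimes>\<^sub>M lborel :: ((real \<times> point) \<times> real) measure"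
  have pr: "(\<lambda>y. (snd y, snd (fst y))) \<in> ?M \<rightarrow>\<^sub>M borel \<Otimes>\<^sub>M borel" by measurable
  have f: "(\<lambda>z. fst (N (fst z) (snd z))) \<in> borel_measurable (borel \<Otimes>\<^sub>M borel)"
    and s: "j < d \<Longrightarrow> (\<lambda>z. snd (N (fst z) (snd z)) j) \<in> borel_measurable (borel \<Otimes>\<^sub>M borel)" for j
    using assms by (auto simp: smeas_def)
  have f': "(\<lambda>y. fst (N (snd y) (snd (fst y)))) \<in> borel_measurable ?M" using measurable_compose[OF pr f] by simp
  have s': "(\<lambda>y. snd (N (snd y) (snd (fst y))) j) \<in> borel_measurable ?M" if "j < d" for j
    using measurable_compose[OF pr s[OF that]] by simp
  have \<tau>: "(\<lambda>y. fst (fst y) - snd y) \<in> borel_measurable ?M" by measurable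
  have X: "(\<lambda>y. snd (fst y)) \<in> borel_measurable ?M" by measurable
  have w: "(\<lambda>y. fst (W d (fst (fst y) - snd y) (snd (fst y)) (N (snd y) (snd (fst y))))) \<in> borel_measurable ?M"
    "j < d \<Longrightarrow> (\<lambda>y. snd (W d (fst (fst y) - snd y) (snd (fst y)) (N (snd y) (snd (fst y)))) j) \<in> borel_measurable ?M" for j
    using measurable_W[OF \<tau> X f', where w="\<lambda>y. snd (N (snd y) (snd (fst y)))"] s' by simp_all
  have ind: "(\<lambda>y. indicat_real {0<..<fst (fst y)} (snd y)) \<in> borel_measurable ?M"
  proof -
    have "(\<lambda>y. if 0 < snd y \<and> snd y < fst (fst y) then 1 else 0 :: real) \<in> borel_measurable ?M" by measurable
    then show ?thesis by (rule measurable_cong[THEN iffD1, rotated]) (auto simp: indicator_def)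
  qed
  show ?thesis
    unfolding smeas_def
  proof (intro conjI allI impI)
    have "(\<lambda>(z, s). indicat_real {0<..<fst z} s *\<^sub>R fst (W d (fst z - s) (snd z) (N s (snd z)))) \<in> borel_measurable ?M"
      using borel_measurable_scaleR[OF ind w(1)] by (simp add: case_prod_unfold)
    from lborel.borel_measurable_lebesgue_integral[OF this]
    show "(\<lambda>z. fst (Dh N (fst z) (snd z))) \<in> borel_measurable (borel \<Otimes>\<^sub>M borel)"
      by (simp add: Dh_def set_lebesgue_integral_def)
    fix j assume j: "j < d"
    have "(\<lambda>(z, s). indicat_real {0<..<fst z} s *\<^sub>R snd (W d (fst z - s) (snd z) (N s (snd z))) j) \<in> borel_measurable ?M"
      using borel_measurable_scaleR[OF ind w(2)[OF j]] by (simp add: case_prod_unfold)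
    from lborel.borel_measurable_lebesgue_integral[OF this]
    show "(\<lambda>z. snd (Dh N (fst z) (snd z)) j) \<in> borel_measurable (borel \<Otimes>\<^sub>M borel)"
      by (simp add: Dh_def set_lebesgue_integral_def)
  qed
qed

section \<open>Weighted bounds for the Duhamel integral and the linear evolution\<close>

definition kernel_const :: real where
  "kernel_const = W_const d * (exp (1 / (2 * lam)) * (lam / 2) powr (- (1 - 1 / p)))"

lemma kernel_const_pos: "kernel_const > 0"
  using W_const_pos[OF d0] lam_pos by (simp add: kernel_const_def)

text \<open>The smoothing exponent q = 1 - 1/p is dictated by 2 q + e3 = e1, so that the frequency
  weight of the solution reappears.\<close>

lemma kernel_bound:
  assumes s: "0 < s" "s < t" and \<xi>: "good \<xi>" and K: "K \<ge> 0"
    and N: "nrm d \<xi> x \<le> K * wtN s (enorm d \<xi>)"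
  shows "nrm d \<xi> (W d (t - s) \<xi> x) \<le>
    (kernel_const * K * profile e1 (sqrt t) \<xi>) * ((t - s) powr (- (1 - 1 / p)) * s powr (- (2 / p)))"
proof -
  define r where "r = enorm d \<xi>"
  have r: "r > 0" using \<xi> by (simp add: good_def r_def)
  let ?q = "1 - 1 / p"
  have q: "0 \<le> ?q" "?q \<le> 1" using p_bounds by auto
  have "nrm d \<xi> (W d (t - s) \<xi> x) \<le> W_const d * exp (- (lam * r\<^sup>2 * (t - s))) * nrm d \<xi> x"
    unfolding r_def using s by (intro nrm_W_le) simp
  also have "\<dots> \<le> W_const d * exp (- (lam * r\<^sup>2 * (t - s))) * (K * wtN s r)"
    using N W_const_pos[OF d0] by (intro mult_left_mono) (auto simp: r_def)
  also have "\<dots> = W_const d * (exp (- (lam * r\<^sup>2 * (t - s))) * exp (- (sqrt s * r))) * (K * (s powr (- (2 / p)) * r powr (- e3)))"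
    by (simp add: wtN_def mult_ac)
  also have "\<dots> \<le> W_const d * (exp (1 / (2 * lam)) * (lam / 2) powr (-?q) * ((t - s) powr (-?q) * r powr (-(2 * ?q))) * exp (- (sqrt t * r))) * (K * (s powr (- (2 / p)) * r powr (- e3)))"
    using s W_const_pos[OF d0] K by (intro mult_right_mono mult_left_mono exp_propagator_le lam_pos r q) auto
  also have "\<dots> = (kernel_const * K * (exp (- (sqrt t * r)) * (r powr (-(2 * ?q)) * r powr (- e3)))) * ((t - s) powr (-?q) * s powr (- (2 / p)))"
    by (simp add: kernel_const_def mult_ac)
  also have "r powr (-(2 * ?q)) * r powr (- e3) = r powr (- e1)"
    using e_bounds(12) by (simp add: powr_add[symmetric] algebra_simps)
  finally show ?thesis by (simp add: r_def)
qed

definition beta_const :: real where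
  "beta_const = 2 powr (1 - 1 / p) * (2 / (1 - 2 / p)) + 2 powr (2 / p) * (2 / (1 - (1 - 1 / p)))"

lemma beta_const_pos: "beta_const > 0"
  using p_bounds by (auto simp: beta_const_def intro!: add_pos_pos mult_pos_pos)

text \<open>The singular exponents 1 - 1/p at s = t and 2/p at s = 0 are below 1 and add up to 1 +
  1/p. The integral therefore scales like t^(-1/p), again the time weight of the solution.\<close>

lemma time_integral_bound:
  fixes \<phi> :: "real \<Rightarrow> complex"
  assumes [measurable]: "\<phi> \<in> borel_measurable borel" and t: "t > 0" and c: "c \<ge> 0"
    and b: "\<And>s. 0 < s \<Longrightarrow> s < t \<Longrightarrow> cmod (\<phi> s) \<le> c * ((t - s) powr (- (1 - 1 / p)) * s powr (- (2 / p)))"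
  shows "set_integrable lborel {0<..<t} \<phi>"
    and "cmod (LINT s:{0<..<t}|lborel. \<phi> s) \<le> c * (beta_const * t powr (- (1 / p)))"
proof -
  let ?h = "\<lambda>s. indicator {0<..<t} s * ((t - s) powr (- (1 - 1 / p)) * s powr (- (2 / p)))"
  have "(\<integral>\<^sup>+s. ennreal (cmod (indicator {0<..<t} s *\<^sub>R \<phi> s)) \<partial>lborel) \<le> (\<integral>\<^sup>+s. ennreal c * ennreal (?h s) \<partial>lborel)"
  proof (rule nn_integral_mono)
    fix s
    show "ennreal (cmod (indicator {0<..<t} s *\<^sub>R \<phi> s)) \<le> ennreal c * ennreal (?h s)"
      using b[of s] c by (auto simp: indicator_def ennreal_mult'[symmetric] intro!: ennreal_leI)
  qed
  also have "\<dots> = ennreal c * (\<integral>\<^sup>+s. ennreal (?h s) \<partial>lborel)" by (intro nn_integral_cmult) measurable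
  also have "\<dots> \<le> ennreal c * ennreal (beta_const * t powr (1 - (1 - 1 / p) - 2 / p))"
    unfolding beta_const_def using p_bounds by (intro mult_left_mono nn_integral_beta_le t) auto
  also have "\<dots> = ennreal (c * (beta_const * t powr (- (1 / p))))"
    using c by (simp add: ennreal_mult' diff_divide_distrib[symmetric])
  finally have n: "(\<integral>\<^sup>+s. ennreal (cmod (indicator {0<..<t} s *\<^sub>R \<phi> s)) \<partial>lborel) \<le> ennreal (c * (beta_const * t powr (- (1 / p))))" .
  have k: "0 \<le> c * (beta_const * t powr (- (1 / p)))" using c beta_const_pos by simp
  have m: "(\<lambda>s. indicator {0<..<t} s *\<^sub>R \<phi> s) \<in> borel_measurable lborel" by measurable
  show "set_integrable lborel {0<..<t} \<phi>" "cmod (LINT s:{0<..<t}|lborel. \<phi> s) \<le> c * (beta_const * t powr (- (1 / p)))"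
    using integral_bound_of_nn[OF m n k] by (simp_all add: set_integrable_def set_lebesgue_integral_def)
qed

definition Dh_const :: real where "Dh_const = (1 + real d) * kernel_const * beta_const"

lemma Dh_const_pos: "Dh_const > 0"
  using kernel_const_pos beta_const_pos by (simp add: Dh_const_def)

lemma
  assumes N: "smeas N" and K: "K \<ge> 0" and t: "t > 0" and \<xi>: "good \<xi>"
    and b: "\<And>s. 0 < s \<Longrightarrow> s < t \<Longrightarrow> nrm d \<xi> (N s \<xi>) \<le> K * wtN s (enorm d \<xi>)"
  shows Dh_int_fst: "set_integrable lborel {0<..<t} (\<lambda>s. fst (W d (t - s) \<xi> (N s \<xi>)))"
    and Dh_int_snd: "j < d \<Longrightarrow> set_integrable lborel {0<..<t} (\<lambda>s. snd (W d (t - s) \<xi> (N s \<xi>)) j)"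
    and nrm_Dh_le: "nrm d \<xi> (Dh N t \<xi>) \<le> Dh_const * K * wt t (enorm d \<xi>)"
proof -
  define r where "r = enorm d \<xi>"
  define A where "A = kernel_const * K * (exp (- (sqrt t * r)) * r powr (-e1))"
  have A: "A \<ge> 0" using kernel_const_pos K by (simp add: A_def)
  have r: "1 + r > 0" by (simp add: r_def add_pos_nonneg)
  let ?h = "\<lambda>s. (t - s) powr (- (1 - 1 / p)) * s powr (- (2 / p))"
  have n: "nrm d \<xi> (W d (t - s) \<xi> (N s \<xi>)) \<le> A * ?h s" if "0 < s" "s < t" for s
    using kernel_bound[OF that \<xi> K b[OF that]] by (simp add: A_def r_def)
  \<comment> \<open>The scalar component is integrated with the factor 1/(1 + |\<xi>|), so that
    multiplying back by its weight in \<open>nrm\<close> costs nothing.\<close>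
  have f: "cmod (fst (W d (t - s) \<xi> (N s \<xi>))) \<le> A / (1 + r) * ?h s" if "0 < s" "s < t" for s
  proof -
    have "(1 + r) * cmod (fst (W d (t - s) \<xi> (N s \<xi>))) \<le> A * ?h s"
      using nrm_fst[where d=d and \<xi>=\<xi> and x="W d (t - s) \<xi> (N s \<xi>)"] n[OF that] by (simp add: r_def)
    then show ?thesis using r by (simp add: field_simps)
  qed
  have s: "cmod (snd (W d (t - s) \<xi> (N s \<xi>)) j) \<le> A * ?h s" if "j < d" "0 < s" "s < t" for s j
    using nrm_snd[OF that(1), of "W d (t - s) \<xi> (N s \<xi>)" \<xi>] n[OF that(2,3)] by simp
  have Ar: "A / (1 + r) \<ge> 0" using A r by simp
  note F = time_integral_bound[OF measurable_W_slice(1)[OF N] t Ar f]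
  note S = time_integral_bound[OF measurable_W_slice(2)[OF N] t A s]
  show "set_integrable lborel {0<..<t} (\<lambda>s. fst (W d (t - s) \<xi> (N s \<xi>)))" by (rule F(1))
  show "j < d \<Longrightarrow> set_integrable lborel {0<..<t} (\<lambda>s. snd (W d (t - s) \<xi> (N s \<xi>)) j)" by (rule S(1))
  have "nrm d \<xi> (Dh N t \<xi>) \<le> (1 + r) * (A / (1 + r) * (beta_const * t powr (- (1 / p)))) + (\<Sum>j<d. A * (beta_const * t powr (- (1 / p))))"
    unfolding nrm_def Dh_def fst_conv snd_conv r_def[symmetric]
    using r by (intro add_mono mult_left_mono sum_mono F(2) S(2)) auto
  also have "\<dots> = (1 + real d) * (A * (beta_const * t powr (- (1 / p))))" using r by (simp add: field_simps)
  finally show "nrm d \<xi> (Dh N t \<xi>) \<le> Dh_const * K * wt t (enorm d \<xi>)"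
    by (simp add: Dh_const_def wt_def A_def r_def mult_ac)
qed

lemma Dh_diff:
  assumes N: "smeas N" "K \<ge> 0" "\<And>s. 0 < s \<Longrightarrow> s < t \<Longrightarrow> nrm d \<xi> (N s \<xi>) \<le> K * wtN s (enorm d \<xi>)"
    and N': "smeas N'" "K' \<ge> 0" "\<And>s. 0 < s \<Longrightarrow> s < t \<Longrightarrow> nrm d \<xi> (N' s \<xi>) \<le> K' * wtN s (enorm d \<xi>)"
    and t: "t > 0" and \<xi>: "good \<xi>"
  shows "fst (Dh (\<lambda>s. sdiff (N s) (N' s)) t \<xi>) = fst (Dh N t \<xi>) - fst (Dh N' t \<xi>)"
    and "j < d \<Longrightarrow> snd (Dh (\<lambda>s. sdiff (N s) (N' s)) t \<xi>) j = snd (Dh N t \<xi>) j - snd (Dh N' t \<xi>) j"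
  using set_integral_diff(2)[OF Dh_int_fst[OF N(1,2) t \<xi> N(3)] Dh_int_fst[OF N'(1,2) t \<xi> N'(3)]]
    set_integral_diff(2)[OF Dh_int_snd[OF N(1,2) t \<xi> N(3), of j] Dh_int_snd[OF N'(1,2) t \<xi> N'(3), of j]]
  by (simp_all add: Dh_def sdiff_def W_diff)

definition lin_const :: real where
  "lin_const = W_const d * (exp (1 / (2 * lam)) * (lam / 2) powr (- (1 / p)))"

lemma lin_const_pos: "lin_const > 0"
  using W_const_pos[OF d0] lam_pos by (simp add: lin_const_def)

text \<open>Here q = 1/p: it leads from the data weight d - 1 to e1 and yields t^(-1/p) at the same
  time.\<close>

lemma nrm_lin_le:
  assumes t: "t > 0" and \<xi>: "good \<xi>" and x: "nrm d \<xi> x \<le> R * enorm d \<xi> powr (-(real d - 1))" and R: "R \<ge> 0"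
  shows "nrm d \<xi> (W d t \<xi> x) \<le> lin_const * R * wt t (enorm d \<xi>)"
proof -
  define r where "r = enorm d \<xi>"
  have r: "r > 0" using \<xi> by (simp add: good_def r_def)
  let ?q = "1 / p"
  have q: "0 \<le> ?q" "?q \<le> 1" using p_bounds by auto
  have "nrm d \<xi> (W d t \<xi> x) \<le> W_const d * exp (- (lam * r\<^sup>2 * t)) * nrm d \<xi> x"
    unfolding r_def using t by (intro nrm_W_le) simp
  also have "\<dots> \<le> W_const d * exp (- (lam * r\<^sup>2 * t)) * (R * r powr (-(real d - 1)))"
    using x W_const_pos[OF d0] by (intro mult_left_mono) (auto simp: r_def)
  also have "\<dots> \<le> W_const d * (exp (1 / (2 * lam)) * (lam / 2) powr (-?q) * (t powr (-?q) * r powr (-(2 * ?q))) * exp (- (sqrt t * r))) * (R * r powr (-(real d - 1)))"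
    using exp_propagator_le[OF lam_pos order_refl t r q] W_const_pos[OF d0] R
    by (intro mult_right_mono mult_left_mono) auto
  also have "\<dots> = lin_const * R * (t powr (-?q) * (exp (- (sqrt t * r)) * (r powr (-(2 * ?q)) * r powr (-(real d - 1)))))"
    by (simp add: lin_const_def mult_ac)
  also have "r powr (-(2 * ?q)) * r powr (-(real d - 1)) = r powr (- e1)"
    by (simp add: powr_add[symmetric] e1_def algebra_simps)
  finally show ?thesis by (simp add: r_def wt_def)
qed

section \<open>The nonlinear map and its contraction estimate\<close>

definition NL :: "(real \<Rightarrow> point \<Rightarrow> state) \<Rightarrow> real \<Rightarrow> point \<Rightarrow> state" where
  "NL U s = B (U s) (U s)"

lemma smeas_NL:
  assumes "smeas U" shows "smeas (NL U)"
proof -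
  have f: "(\<lambda>z. fst (U (fst z) (snd z))) \<in> borel_measurable (borel \<Otimes>\<^sub>M borel)"
    and s: "j < d \<Longrightarrow> (\<lambda>z. snd (U (fst z) (snd z)) j) \<in> borel_measurable (borel \<Otimes>\<^sub>M borel)" for j
    using assms by (auto simp: smeas_def)
  have coord: "(\<lambda>z::real \<times> point. snd z i) \<in> borel_measurable (borel \<Otimes>\<^sub>M borel)" for i
    by (rule borel_measurable_coord) measurable
  have dm: "(\<lambda>z. dmult i (V (fst z)) (snd z)) \<in> borel_measurable (borel \<Otimes>\<^sub>M borel)"
    if V: "(\<lambda>z. V (fst z) (snd z)) \<in> borel_measurable (borel \<Otimes>\<^sub>M borel)" for i and V :: "real \<Rightarrow> point \<Rightarrow> complex"
  proof -
    note [measurable] = V coord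
    show ?thesis unfolding dmult_def by measurable
  qed
  have c: "(\<lambda>z. conv d (V (fst z)) (X (fst z)) (snd z)) \<in> borel_measurable (borel \<Otimes>\<^sub>M borel)"
    if "(\<lambda>z. V (fst z) (snd z)) \<in> borel_measurable (borel \<Otimes>\<^sub>M borel)" "(\<lambda>z. X (fst z) (snd z)) \<in> borel_measurable (borel \<Otimes>\<^sub>M borel)"
    for V X :: "real \<Rightarrow> point \<Rightarrow> complex"
    by (rule measurable_conv_param[OF that])
  have F: "(\<lambda>z. (\<lambda>t \<eta>. fst (U t \<eta>)) (fst z) (snd z)) \<in> borel_measurable (borel \<Otimes>\<^sub>M borel)" using f by simp
  have S: "(\<lambda>z. (\<lambda>t \<eta>. snd (U t \<eta>) j) (fst z) (snd z)) \<in> borel_measurable (borel \<Otimes>\<^sub>M borel)" if "j < d" for j using s[OF that] by simp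
  have DF: "(\<lambda>z. (\<lambda>t. dmult i (\<lambda>\<eta>. fst (U t \<eta>))) (fst z) (snd z)) \<in> borel_measurable (borel \<Otimes>\<^sub>M borel)" for i
    using dm[OF F] by simp
  have DS: "(\<lambda>z. (\<lambda>t. dmult i (\<lambda>\<eta>. snd (U t \<eta>) j)) (fst z) (snd z)) \<in> borel_measurable (borel \<Otimes>\<^sub>M borel)" if "j < d" for i j
    using dm[OF S[OF that]] by simp
  show ?thesis
    unfolding smeas_def NL_def B_def fst_conv snd_conv
  proof (intro conjI allI impI)
    show "(\<lambda>z. B_fst (U (fst z)) (U (fst z)) (snd z)) \<in> borel_measurable (borel \<Otimes>\<^sub>M borel)"
      unfolding B_fst_def
      by (intro borel_measurable_uminus borel_measurable_sum) (use c[OF S DF] in simp)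
    fix j assume j: "j < d"
    have 1: "(\<lambda>z. \<Sum>i<d. conv d (\<lambda>\<eta>. snd (U (fst z) \<eta>) i) (dmult i (\<lambda>\<eta>. snd (U (fst z) \<eta>) j)) (snd z)) \<in> borel_measurable (borel \<Otimes>\<^sub>M borel)"
      by (intro borel_measurable_sum) (use c[OF S DS[OF j]] in simp)
    have 2: "(\<lambda>z. \<Sum>i<d. conv d (dmult i (\<lambda>\<eta>. fst (U (fst z) \<eta>))) (dmult i (\<lambda>\<eta>. snd (U (fst z) \<eta>) j)) (snd z)) \<in> borel_measurable (borel \<Otimes>\<^sub>M borel)"
      by (intro borel_measurable_sum) (use c[OF DF DS[OF j]] in simp)
    have 3: "(\<lambda>z. \<Sum>i<d. conv d (dmult i (\<lambda>\<eta>. fst (U (fst z) \<eta>))) (dmult j (\<lambda>\<eta>. snd (U (fst z) \<eta>) i)) (snd z)) \<in> borel_measurable (borel \<Otimes>\<^sub>M borel)"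
      by (intro borel_measurable_sum) (use c[OF DF DS] in simp)
    have 4: "(\<lambda>z. \<Sum>i<d. conv d (dmult i (\<lambda>\<eta>. fst (U (fst z) \<eta>))) (dmult i (\<lambda>\<eta>. fst (U (fst z) \<eta>))) (snd z)) \<in> borel_measurable (borel \<Otimes>\<^sub>M borel)"
      by (intro borel_measurable_sum) (use c[OF DF DF] in simp)
    note [measurable] = 1 2 3 4 coord
    show "(\<lambda>z. B_snd (U (fst z)) (U (fst z)) (snd z) j) \<in> borel_measurable (borel \<Otimes>\<^sub>M borel)"
      unfolding B_snd_def by measurable
  qed
qed

definition ball :: "real \<Rightarrow> (real \<Rightarrow> point \<Rightarrow> state) \<Rightarrow> bool" where
  "ball M U \<longleftrightarrow> smeas U \<and> M \<ge> 0 \<and> (\<forall>t>0. \<forall>\<xi>. good \<xi> \<longrightarrow> nrm d \<xi> (U t \<xi>) \<le> M * wt t (enorm d \<xi>))"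

lemma ball_decays: "ball M U \<Longrightarrow> t > 0 \<Longrightarrow> decays (sqrt t) (M * t powr (- (1 / p))) (U t)"
  unfolding decays_def ball_def using smeas_slice(3) by (auto simp: wt_def mult.assoc)

definition B_ok_const :: real where
  "B_ok_const = (SOME C. C > 0 \<and> (\<forall>\<sigma> M M' U V. \<sigma> \<ge> 0 \<longrightarrow> decays \<sigma> M U \<longrightarrow> decays \<sigma> M' V \<longrightarrow> B_ok (C * (M * M')) \<sigma> U V))"

lemma B_ok_const: "B_ok_const > 0" "\<sigma> \<ge> 0 \<Longrightarrow> decays \<sigma> M U \<Longrightarrow> decays \<sigma> M' V \<Longrightarrow> B_ok (B_ok_const * (M * M')) \<sigma> U V"
proof -
  have "\<exists>C. C > 0 \<and> (\<forall>\<sigma> M M' U V. \<sigma> \<ge> 0 \<longrightarrow> decays \<sigma> M U \<longrightarrow> decays \<sigma> M' V \<longrightarrow> B_ok (C * (M * M')) \<sigma> U V)"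
    by (rule B_ok_exists) blast
  from someI_ex[OF this] show "B_ok_const > 0" "\<sigma> \<ge> 0 \<Longrightarrow> decays \<sigma> M U \<Longrightarrow> decays \<sigma> M' V \<Longrightarrow> B_ok (B_ok_const * (M * M')) \<sigma> U V"
    unfolding B_ok_const_def by blast+
qed

definition NL_const :: real where "NL_const = B_const * B_ok_const"

lemma NL_const_nonneg: "NL_const \<ge> 0"
  using B_const_nonneg B_ok_const(1) by (simp add: NL_const_def)

lemma powr_split: "s > 0 \<Longrightarrow> s powr (- (1 / p)) * s powr (- (1 / p)) = s powr (- (2 / p))"
  by (simp add: powr_add[symmetric])

lemma nrm_NL_le:
  assumes U: "ball M U" and s: "s > 0" and \<xi>: "good \<xi>"
  shows "nrm d \<xi> (NL U s \<xi>) \<le> NL_const * M\<^sup>2 * wtN s (enorm d \<xi>)"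
proof -
  note D = ball_decays[OF U s]
  have "B_ok (B_ok_const * ((M * s powr (- (1 / p))) * (M * s powr (- (1 / p))))) (sqrt s) (U s) (U s)"
    by (rule B_ok_const(2)[OF _ D D]) (use s in simp)
  from nrm_B_le[OF this \<xi>] have "nrm d \<xi> (NL U s \<xi>) \<le> B_const * (B_ok_const * ((M * s powr (- (1 / p))) * (M * s powr (- (1 / p))))) * profile e3 (sqrt s) \<xi>"
    by (simp add: NL_def)
  also have "\<dots> = NL_const * M\<^sup>2 * ((s powr (- (1 / p)) * s powr (- (1 / p))) * profile e3 (sqrt s) \<xi>)"
    by (simp add: NL_const_def power2_eq_square mult_ac)
  finally show ?thesis unfolding powr_split[OF s] by (simp add: wtN_def)
qed

lemma smeas_sdiff: "smeas U \<Longrightarrow> smeas V \<Longrightarrow> smeas (\<lambda>t. sdiff (U t) (V t))"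
  by (auto simp: smeas_def sdiff_def intro!: borel_measurable_diff)

lemma nrm_NL_diff_le:
  assumes U: "ball M U" and V: "ball M V" and s: "s > 0" and \<xi>: "good \<xi>"
    and \<delta>: "ball \<delta> (\<lambda>t. sdiff (U t) (V t))"
  shows "nrm d \<xi> (sdiff (NL U s) (NL V s) \<xi>) \<le> NL_const * (2 * M * \<delta>) * wtN s (enorm d \<xi>)"
proof -
  let ?s = "s powr (- (1 / p))"
  note DU = ball_decays[OF U s] and DV = ball_decays[OF V s] and DD = ball_decays[OF \<delta> s]
  have s0: "sqrt s \<ge> 0" using s by simp
  note K = B_ok_const(2)[OF s0]
  have "nrm d \<xi> (sdiff (NL U s) (NL V s) \<xi>) \<le> B_const * (B_ok_const * (\<delta> * ?s * (M * ?s)) + B_ok_const * (M * ?s * (\<delta> * ?s))) * profile e3 (sqrt s) \<xi>"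
    unfolding NL_def by (rule nrm_B_diff_le[OF K[OF DU DU] K[OF DV DU] K[OF DV DV] K[OF DD DU] K[OF DV DD] \<xi>])
  also have "\<dots> = NL_const * (2 * M * \<delta>) * ((?s * ?s) * profile e3 (sqrt s) \<xi>)"
    by (simp add: NL_const_def algebra_simps)
  finally show ?thesis unfolding powr_split[OF s] by (simp add: wtN_def)
qed

text \<open>The value 0 at nonpositive times and bad frequencies makes the iterates converge at
  every (t, \<xi>), so that their limit is measurable on the whole product space.\<close>

definition \<Phi> :: "(point \<Rightarrow> state) \<Rightarrow> (real \<Rightarrow> point \<Rightarrow> state) \<Rightarrow> real \<Rightarrow> point \<Rightarrow> state" where
  "\<Phi> U0 U t \<xi> = (if t > 0 \<and> good \<xi>
     then (fst (W d t \<xi> (U0 \<xi>)) + fst (Dh (NL U) t \<xi>), \<lambda>j. snd (W d t \<xi> (U0 \<xi>)) j + snd (Dh (NL U) t \<xi>) j)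
     else (0, \<lambda>_. 0))"

lemma smeas_lin:
  assumes "state_meas U0"
  shows "smeas (\<lambda>t \<xi>. W d t \<xi> (U0 \<xi>))"
proof -
  let ?M = "borel \<Otimes>\<^sub>M borel :: (real \<times> point) measure"
  have f: "(\<lambda>z. fst (U0 (snd z))) \<in> borel_measurable ?M"
    using assms by (auto simp: state_meas_def intro: measurable_compose[OF measurable_snd])
  have \<tau>: "fst \<in> borel_measurable ?M" and X: "snd \<in> borel_measurable ?M" by measurable
  have s: "(\<lambda>z. snd (U0 (snd z)) j) \<in> borel_measurable ?M" if "j < d" for j
    using assms that by (auto simp: state_meas_def intro: measurable_compose[OF measurable_snd])
  show ?thesis
    unfolding smeas_def
    using measurable_W[OF \<tau> X f, where w="\<lambda>z. snd (U0 (snd z))" and d=d] s by simp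
qed

lemma smeas_\<Phi>:
  assumes "state_meas U0" "smeas U" shows "smeas (\<Phi> U0 U)"
proof -
  note L = smeas_lin[OF assms(1)] and D = smeas_Dh[OF smeas_NL[OF assms(2)]]
  have [measurable]: "Measurable.pred borel good"
    unfolding good_def by measurable
  have g: "Measurable.pred (borel \<Otimes>\<^sub>M borel) (\<lambda>z::real \<times> point. fst z > 0 \<and> good (snd z))" by measurable
  show ?thesis
    unfolding smeas_def
  proof (intro conjI allI impI)
    have [measurable]: "(\<lambda>z. fst (W d (fst z) (snd z) (U0 (snd z)))) \<in> borel_measurable (borel \<Otimes>\<^sub>M borel)"
      "(\<lambda>z. fst (Dh (NL U) (fst z) (snd z))) \<in> borel_measurable (borel \<Otimes>\<^sub>M borel)"
      using L D by (auto simp: smeas_def)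
    have "(\<lambda>z. if fst z > 0 \<and> good (snd z) then fst (W d (fst z) (snd z) (U0 (snd z))) + fst (Dh (NL U) (fst z) (snd z)) else 0) \<in> borel_measurable (borel \<Otimes>\<^sub>M borel)"
      using g by measurable
    then show "(\<lambda>z. fst (\<Phi> U0 U (fst z) (snd z))) \<in> borel_measurable (borel \<Otimes>\<^sub>M borel)"
      by (simp add: \<Phi>_def if_distrib[of fst] cong: if_cong)
    fix j assume "j < d"
    then have [measurable]: "(\<lambda>z. snd (W d (fst z) (snd z) (U0 (snd z))) j) \<in> borel_measurable (borel \<Otimes>\<^sub>M borel)"
      "(\<lambda>z. snd (Dh (NL U) (fst z) (snd z)) j) \<in> borel_measurable (borel \<Otimes>\<^sub>M borel)"
      using L D by (auto simp: smeas_def)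
    have "(\<lambda>z. if fst z > 0 \<and> good (snd z) then snd (W d (fst z) (snd z) (U0 (snd z))) j + snd (Dh (NL U) (fst z) (snd z)) j else 0) \<in> borel_measurable (borel \<Otimes>\<^sub>M borel)"
      using g by measurable
    then show "(\<lambda>z. snd (\<Phi> U0 U (fst z) (snd z)) j) \<in> borel_measurable (borel \<Otimes>\<^sub>M borel)"
      by (simp add: \<Phi>_def if_distrib[of snd] if_distribR cong: if_cong)
  qed
qed

lemma ball_\<Phi>:
  assumes U0: "state_meas U0" "\<And>\<xi>. good \<xi> \<Longrightarrow> nrm d \<xi> (U0 \<xi>) \<le> R * enorm d \<xi> powr (-(real d - 1))" "R \<ge> 0"
    and U: "ball M U"
  shows "ball (lin_const * R + Dh_const * (NL_const * M\<^sup>2)) (\<Phi> U0 U)"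
  unfolding ball_def
proof (intro conjI allI impI)
  show "smeas (\<Phi> U0 U)" using U0 U by (intro smeas_\<Phi>) (auto simp: ball_def)
  show "0 \<le> lin_const * R + Dh_const * (NL_const * M\<^sup>2)"
    using lin_const_pos Dh_const_pos NL_const_nonneg U0(3) by simp
  fix t \<xi> assume t: "0 < (t::real)" and \<xi>: "good \<xi>"
  have "nrm d \<xi> (\<Phi> U0 U t \<xi>) \<le> nrm d \<xi> (W d t \<xi> (U0 \<xi>)) + nrm d \<xi> (Dh (NL U) t \<xi>)"
    by (rule nrm_triangle) (use t \<xi> in \<open>simp_all add: \<Phi>_def\<close>)
  also have "\<dots> \<le> lin_const * R * wt t (enorm d \<xi>) + Dh_const * (NL_const * M\<^sup>2) * wt t (enorm d \<xi>)"
  proof (intro add_mono nrm_lin_le nrm_Dh_le t \<xi> U0)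
    show "smeas (NL U)" using U by (intro smeas_NL) (simp add: ball_def)
  qed (use NL_const_nonneg nrm_NL_le[OF U _ \<xi>] in auto)
  finally show "nrm d \<xi> (\<Phi> U0 U t \<xi>) \<le> (lin_const * R + Dh_const * (NL_const * M\<^sup>2)) * wt t (enorm d \<xi>)"
    by (simp add: distrib_right)
qed

lemma ball_\<Phi>_diff:
  assumes U0: "state_meas U0"
    and U: "ball M U" and V: "ball M V" and D: "ball \<delta> (\<lambda>t. sdiff (U t) (V t))"
  shows "ball (Dh_const * (NL_const * (2 * M * \<delta>))) (\<lambda>t. sdiff (\<Phi> U0 U t) (\<Phi> U0 V t))"
  unfolding ball_def
proof (intro conjI allI impI)
  have sU: "smeas U" "smeas V" using U V by (auto simp: ball_def)
  have nn: "M \<ge> 0" "\<delta> \<ge> 0" using U D by (auto simp: ball_def)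
  show "smeas (\<lambda>t. sdiff (\<Phi> U0 U t) (\<Phi> U0 V t))" by (intro smeas_sdiff smeas_\<Phi> U0 sU)
  show "0 \<le> Dh_const * (NL_const * (2 * M * \<delta>))"
    using Dh_const_pos NL_const_nonneg nn by simp
  fix t \<xi> assume t: "0 < (t::real)" and \<xi>: "good \<xi>"
  note dd = Dh_diff[OF smeas_NL[OF sU(1)] _ nrm_NL_le[OF U _ \<xi>] smeas_NL[OF sU(2)] _ nrm_NL_le[OF V _ \<xi>] t \<xi>]
  have c: "0 \<le> NL_const * M\<^sup>2" using NL_const_nonneg by simp
  have "nrm d \<xi> (sdiff (\<Phi> U0 U t) (\<Phi> U0 V t) \<xi>) = nrm d \<xi> (Dh (\<lambda>s. sdiff (NL U s) (NL V s)) t \<xi>)"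
    by (rule nrm_cong) (use t \<xi> dd c in \<open>simp_all add: sdiff_def[of "\<Phi> _ _ _"] \<Phi>_def\<close>)
  also have "\<dots> \<le> Dh_const * (NL_const * (2 * M * \<delta>)) * wt t (enorm d \<xi>)"
  proof (intro nrm_Dh_le t \<xi>)
    show "smeas (\<lambda>s. sdiff (NL U s) (NL V s))" by (intro smeas_sdiff smeas_NL sU)
    show "0 \<le> NL_const * (2 * M * \<delta>)" using NL_const_nonneg nn by simp
  qed (rule nrm_NL_diff_le[OF U V _ \<xi> D])
  finally show "nrm d \<xi> (sdiff (\<Phi> U0 U t) (\<Phi> U0 V t) \<xi>) \<le> Dh_const * (NL_const * (2 * M * \<delta>)) * wt t (enorm d \<xi>)" .
qed

lemma ball_mono: "ball M U \<Longrightarrow> M \<le> M' \<Longrightarrow> ball M' U"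
  unfolding ball_def by (meson mult_right_mono order_trans wt_nonneg)

definition zero_state :: "real \<Rightarrow> point \<Rightarrow> state" where "zero_state t \<xi> = (0, \<lambda>_. 0)"

lemma ball_zero: "ball 0 zero_state"
  by (simp add: ball_def smeas_def zero_state_def nrm_def)

lemma tendsto_of_geometric:
  fixes x :: "nat \<Rightarrow> complex"
  assumes "\<And>n. cmod (x n - l) \<le> c * (1 / 2) ^ n"
  shows "x \<longlonglongrightarrow> l"
proof -
  have "(\<lambda>n. c * (1 / 2) ^ n) \<longlonglongrightarrow> c * 0" by (intro tendsto_intros LIMSEQ_power_zero) simp
  then have "(\<lambda>n. c * (1 / 2) ^ n) \<longlonglongrightarrow> 0" by simp
  then have "(\<lambda>n. x n - l) \<longlonglongrightarrow> 0"
    by (rule Lim_null_comparison[rotated]) (intro always_eventually allI assms)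
  then show ?thesis by (simp only: LIM_zero_iff)
qed

definition mild_hat :: "(point \<Rightarrow> state) \<Rightarrow> (real \<Rightarrow> point \<Rightarrow> state) \<Rightarrow> bool" where
  "mild_hat U0 U \<longleftrightarrow> (\<forall>t>0. \<forall>\<xi>. good \<xi> \<longrightarrow>
      fst (U t \<xi>) = fst (W d t \<xi> (U0 \<xi>)) + fst (Dh (NL U) t \<xi>) \<and>
      (\<forall>j<d. snd (U t \<xi>) j = snd (W d t \<xi> (U0 \<xi>)) j + snd (Dh (NL U) t \<xi>) j))"

text \<open>Banach's fixed point argument carried out by hand: the iterates converge geometrically
  at each (t, \<xi>), the limit inherits measurability and the weighted bound, and the contraction
  estimate between the limit and the iterates gives the fixed point identity.\<close>

theorem mild_hat_exists:
  "\<exists>\<rho>>0. \<forall>U0. state_meas U0 \<longrightarrow> (\<forall>\<xi>. good \<xi> \<longrightarrow> nrm d \<xi> (U0 \<xi>) \<le> \<rho> * enorm d \<xi> powr (-(real d - 1))) \<longrightarrow>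
     (\<exists>M U. ball M U \<and> mild_hat U0 U)"
proof -
  define c1 where "c1 = lin_const"
  define c2 where "c2 = Dh_const * NL_const"
  have c: "c1 > 0" "c2 \<ge> 0" using lin_const_pos Dh_const_pos NL_const_nonneg by (auto simp: c1_def c2_def)
  \<comment> \<open>With M = 2 c1 \<rho> = 1/(4 (c2 + 1)) the nonlinear part has Lipschitz constant
    2 c2 M \<le> 1/2, and the ball of radius M is mapped into itself.\<close>
  define \<rho> where "\<rho> = 1 / (8 * c1 * (c2 + 1))"
  have \<rho>: "\<rho> > 0" using c by (simp add: \<rho>_def)
  define M where "M = 2 * c1 * \<rho>"
  have M: "M \<ge> 0" using c \<rho> by (simp add: M_def)
  have half: "c2 * (2 * M) \<le> 1 / 2"
    using c by (simp add: M_def \<rho>_def divide_simps)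
  have inv: "c1 * \<rho> + c2 * M\<^sup>2 \<le> M"
  proof -
    have "c2 * (2 * M) * M \<le> 1 / 2 * M" by (intro mult_right_mono half M)
    moreover have "c1 * \<rho> = M / 2" by (simp add: M_def)
    ultimately show ?thesis using M by (simp add: power2_eq_square)
  qed
  have "\<exists>M U. ball M U \<and> mild_hat U0 U"
    if U0: "state_meas U0" "\<And>\<xi>. good \<xi> \<Longrightarrow> nrm d \<xi> (U0 \<xi>) \<le> \<rho> * enorm d \<xi> powr (-(real d - 1))" for U0
  proof -
    define P where "P n = (\<Phi> U0 ^^ n) zero_state" for n
    have P0: "P 0 = zero_state" and PS: "P (Suc n) = \<Phi> U0 (P n)" for n by (simp_all add: P_def)
    have PM: "ball M (P n)" for n
    proof (induction n)
      case 0
      show ?case unfolding P0 by (rule ball_mono[OF ball_zero M])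
    next
      case (Suc n)
      have "ball (lin_const * \<rho> + Dh_const * (NL_const * M\<^sup>2)) (P (Suc n))"
        unfolding PS by (rule ball_\<Phi>) (use U0 \<rho> Suc in auto)
      then show ?case by (rule ball_mono) (use inv in \<open>simp add: c1_def c2_def mult.assoc\<close>)
    qed
    have PD: "ball (M * (1 / 2) ^ n) (\<lambda>t. sdiff (P (Suc n) t) (P n t))" for n
    proof (induction n)
      case 0
      have "nrm d \<xi> (sdiff (P (Suc 0) t) (P 0 t) \<xi>) = nrm d \<xi> (P (Suc 0) t \<xi>)" for t \<xi>
        by (rule nrm_cong) (simp_all add: sdiff_def P0 zero_state_def)
      moreover have "smeas (\<lambda>t. sdiff (P (Suc 0) t) (P 0 t))"
        using PM by (intro smeas_sdiff) (auto simp: ball_def)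
      ultimately show ?case using PM[of "Suc 0"] by (simp add: ball_def)
    next
      case (Suc n)
      have "ball (Dh_const * (NL_const * (2 * M * (M * (1 / 2) ^ n)))) (\<lambda>t. sdiff (P (Suc (Suc n)) t) (P (Suc n) t))"
        unfolding PS[of "Suc n"] PS[of n] by (rule ball_\<Phi>_diff[OF U0(1) PM[of "Suc n", unfolded PS] PM Suc[unfolded PS]])
      then show ?case
      proof (rule ball_mono)
        have "c2 * (2 * M) * (M * (1 / 2) ^ n) \<le> 1 / 2 * (M * (1 / 2) ^ n)"
          using M by (intro mult_right_mono half) auto
        then show "Dh_const * (NL_const * (2 * M * (M * (1 / 2) ^ n))) \<le> M * (1 / 2) ^ Suc n"
          by (simp add: c2_def mult_ac)
      qed
    qed
    have triv: "P n t \<xi> = (0, \<lambda>_. 0)" if "\<not> (t > 0 \<and> good \<xi>)" for n t \<xi>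
      using that by (cases n) (simp_all only: P0 PS zero_state_def \<Phi>_def if_False)
    define U where "U t \<xi> = (lim (\<lambda>n. fst (P n t \<xi>)), \<lambda>j. lim (\<lambda>n. snd (P n t \<xi>) j))" for t \<xi>
    have step: "nrm d \<xi> (sdiff (P (Suc n) t) (P n t) \<xi>) \<le> M * wt t (enorm d \<xi>) * (1 / 2) ^ n" if "t > 0" "good \<xi>" for n t \<xi>
      using PD[of n] that by (simp add: ball_def mult_ac)
    have pos: "1 + enorm d \<xi> > 0" for \<xi> by (simp add: add_pos_nonneg)
    have div1: "x \<le> y / c * h" if "c > 0" "c * x \<le> y * h" for c x y h :: real
      using that by (simp add: field_simps)
    have div2: "c * x \<le> 2 * y * h" if "c > 0" "x \<le> 2 * (y / c) * h" for c x y h :: real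
      using that by (simp add: field_simps)
    have stepf: "cmod (fst (P (Suc n) t \<xi>) - fst (P n t \<xi>)) \<le> M * wt t (enorm d \<xi>) / (1 + enorm d \<xi>) * (1 / 2) ^ n" if "t > 0" "good \<xi>" for n t \<xi>
    proof (rule div1[OF pos])
      show "(1 + enorm d \<xi>) * cmod (fst (P (Suc n) t \<xi>) - fst (P n t \<xi>)) \<le> M * wt t (enorm d \<xi>) * (1 / 2) ^ n"
        using order_trans[OF nrm_fst step[OF that, of n]] by (simp only: sdiff_def fst_conv)
    qed
    have steps: "cmod (snd (P (Suc n) t \<xi>) j - snd (P n t \<xi>) j) \<le> M * wt t (enorm d \<xi>) * (1 / 2) ^ n" if "t > 0" "good \<xi>" "j < d" for n t \<xi> j
      using nrm_snd[OF that(3), of "sdiff (P (Suc n) t) (P n t) \<xi>" \<xi>] step[OF that(1,2), of n] by (simp add: sdiff_def)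
    have limf: "(\<lambda>n. fst (P n t \<xi>)) \<longlonglongrightarrow> fst (U t \<xi>)" for t \<xi>
      using geometric_limit(1)[of "\<lambda>n. fst (P n t \<xi>)", OF stepf]
      by (cases "t > 0 \<and> good \<xi>") (auto simp: U_def triv)
    have lims: "(\<lambda>n. snd (P n t \<xi>) j) \<longlonglongrightarrow> snd (U t \<xi>) j" if "j < d" for t \<xi> j
      using geometric_limit(1)[of "\<lambda>n. snd (P n t \<xi>) j", OF steps] that
      by (cases "t > 0 \<and> good \<xi>") (auto simp: U_def triv)
    have Usm: "smeas U"
      unfolding smeas_def
    proof (intro conjI allI impI)
      show "(\<lambda>z. fst (U (fst z) (snd z))) \<in> borel_measurable (borel \<Otimes>\<^sub>M borel)"
        by (rule borel_measurable_LIMSEQ_metric[where f="\<lambda>n z. fst (P n (fst z) (snd z))"])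
           (use PM limf in \<open>auto simp: ball_def smeas_def\<close>)
      fix j assume "j < d"
      then show "(\<lambda>z. snd (U (fst z) (snd z)) j) \<in> borel_measurable (borel \<Otimes>\<^sub>M borel)"
        by (intro borel_measurable_LIMSEQ_metric[where f="\<lambda>n z. snd (P n (fst z) (snd z)) j" and g="\<lambda>z. snd (U (fst z) (snd z)) j"])
           (use PM lims in \<open>auto simp: ball_def smeas_def\<close>)
    qed
    have UM: "ball M U"
      unfolding ball_def
    proof (intro conjI allI impI Usm M)
      fix t \<xi> assume "0 < (t::real)" "good \<xi>"
      then have "nrm d \<xi> (P n t \<xi>) \<le> M * wt t (enorm d \<xi>)" for n using PM by (simp add: ball_def)
      moreover have "(\<lambda>n. nrm d \<xi> (P n t \<xi>)) \<longlonglongrightarrow> nrm d \<xi> (U t \<xi>)"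
        unfolding nrm_def by (intro tendsto_intros limf lims) auto
      ultimately show "nrm d \<xi> (U t \<xi>) \<le> M * wt t (enorm d \<xi>)" by (intro LIMSEQ_le_const2) auto
    qed
    \<comment> \<open>The factor 2 is the tail of the geometric series; 1 + d arises when
      \<open>nrm\<close> is rebuilt from the limits of the separate components.\<close>
    define \<delta> where "\<delta> n = (1 + real d) * (2 * M) * (1 / 2) ^ n" for n :: nat
    have UD: "ball (\<delta> n) (\<lambda>t. sdiff (U t) (P n t))" for n
      unfolding ball_def
    proof (intro conjI allI impI)
      show "smeas (\<lambda>t. sdiff (U t) (P n t))" using PM by (intro smeas_sdiff Usm) (simp add: ball_def)
      show "0 \<le> \<delta> n" using M by (simp add: \<delta>_def)
      fix t \<xi> assume t: "0 < (t::real)" "good \<xi>"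
      let ?w = "M * wt t (enorm d \<xi>)"
      have "cmod (fst (P n t \<xi>) - fst (U t \<xi>)) \<le> 2 * (?w / (1 + enorm d \<xi>)) * (1 / 2) ^ n"
        using geometric_limit(2)[of "\<lambda>n. fst (P n t \<xi>)", OF stepf[OF t]] by (simp add: U_def)
      then have 1: "(1 + enorm d \<xi>) * cmod (fst (U t \<xi>) - fst (P n t \<xi>)) \<le> 2 * ?w * (1 / 2) ^ n"
        unfolding norm_minus_commute[of "fst (U t \<xi>)"] by (rule div2[OF pos])
      have 2: "cmod (snd (U t \<xi>) j - snd (P n t \<xi>) j) \<le> 2 * ?w * (1 / 2) ^ n" if "j < d" for j
        using geometric_limit(2)[of "\<lambda>n. snd (P n t \<xi>) j", OF steps[OF t that]] by (simp add: U_def norm_minus_commute)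
      have "nrm d \<xi> (sdiff (U t) (P n t) \<xi>) \<le> 2 * ?w * (1 / 2) ^ n + (\<Sum>j<d. 2 * ?w * (1 / 2) ^ n)"
        unfolding nrm_def sdiff_def fst_conv snd_conv by (intro add_mono 1 sum_mono 2) auto
      then show "nrm d \<xi> (sdiff (U t) (P n t) \<xi>) \<le> \<delta> n * wt t (enorm d \<xi>)"
        by (simp add: \<delta>_def algebra_simps)
    qed
    \<comment> \<open>The shifted iterates converge to U, and being the images of the iterates they
      also converge to the image of U.\<close>
    have fixed: "fst (\<Phi> U0 U t \<xi>) = fst (U t \<xi>) \<and> (\<forall>j<d. snd (\<Phi> U0 U t \<xi>) j = snd (U t \<xi>) j)" if t: "t > 0" "good \<xi>" for t \<xi>
    proof -
      define c where "c = Dh_const * (NL_const * (2 * M * ((1 + real d) * (2 * M)))) * wt t (enorm d \<xi>)"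
      have b: "nrm d \<xi> (sdiff (\<Phi> U0 U t) (P (Suc n) t) \<xi>) \<le> c * (1 / 2) ^ n" for n
      proof -
        have "nrm d \<xi> (sdiff (\<Phi> U0 U t) (P (Suc n) t) \<xi>) \<le> Dh_const * (NL_const * (2 * M * \<delta> n)) * wt t (enorm d \<xi>)"
          using ball_\<Phi>_diff[OF U0(1) UM PM UD, of n] t unfolding PS by (simp add: ball_def)
        also have "\<dots> = c * (1 / 2) ^ n" by (simp add: c_def \<delta>_def algebra_simps)
        finally show ?thesis .
      qed
      have "(\<lambda>n. fst (P (Suc n) t \<xi>)) \<longlonglongrightarrow> fst (\<Phi> U0 U t \<xi>)"
      proof (rule tendsto_of_geometric)
        fix n show "cmod (fst (P (Suc n) t \<xi>) - fst (\<Phi> U0 U t \<xi>)) \<le> c * (1 / 2) ^ n"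
          using order_trans[OF nrm_fst_le(1) b[of n]] by (simp add: sdiff_def norm_minus_commute)
      qed
      moreover have "(\<lambda>n. snd (P (Suc n) t \<xi>) j) \<longlonglongrightarrow> snd (\<Phi> U0 U t \<xi>) j" if "j < d" for j
      proof (rule tendsto_of_geometric)
        fix n show "cmod (snd (P (Suc n) t \<xi>) j - snd (\<Phi> U0 U t \<xi>) j) \<le> c * (1 / 2) ^ n"
          using order_trans[OF nrm_snd[OF that] b[of n]] by (simp add: sdiff_def norm_minus_commute)
      qed
      ultimately show ?thesis
        using LIMSEQ_unique LIMSEQ_Suc[OF limf] LIMSEQ_Suc[OF lims] by blast
    qed
    have "mild_hat U0 U"
      unfolding mild_hat_def using fixed by (simp add: \<Phi>_def)
    then show ?thesis using UM by blast
  qed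
  then show ?thesis using \<rho> by blast
qed

end

section \<open>From the Fourier side back to distributions\<close>

context nsk_dim
begin

lemma tame_decay:
  assumes h: "h \<in> borel_measurable borel" and \<sigma>: "\<sigma> \<ge> 0" and C: "C \<ge> 0" and e: "0 \<le> e" "e < real d"
    and b: "\<And>\<xi>. good \<xi> \<Longrightarrow> cmod (h \<xi>) \<le> C * profile e \<sigma> \<xi>"
  shows "tame d h"
proof (rule tame_powr[OF d0 h e])
  show "AE \<xi> in leb d. cmod (h \<xi>) \<le> C * enorm d \<xi> powr (-e)"
    using AE_good
  proof eventually_elim
    case (elim \<xi>)
    have "exp (- (\<sigma> * enorm d \<xi>)) * enorm d \<xi> powr (-e) \<le> 1 * enorm d \<xi> powr (-e)"
      using \<sigma> by (intro mult_right_mono) auto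
    then have "C * profile e \<sigma> \<xi> \<le> C * enorm d \<xi> powr (-e)"
      using C by (intro mult_left_mono) auto
    then show ?case using b[OF elim] by simp
  qed
qed

lemma decays_fst:
  assumes "decays \<sigma> M U" "good \<xi>"
  shows "cmod (fst (U \<xi>)) \<le> M * profile e1 \<sigma> \<xi>"
  using assms nrm_fst_le(1)[of "U \<xi>" d \<xi>] by (auto simp: decays_def intro: order_trans)

lemma decays_tame:
  assumes U: "decays \<sigma> M U" and \<sigma>: "\<sigma> \<ge> 0"
  shows "tame d (\<lambda>\<xi>. fst (U \<xi>))" "j < d \<Longrightarrow> tame d (\<lambda>\<xi>. snd (U \<xi>) j)"
proof -
  note e = less_imp_le[OF e_bounds(1)] e_bounds(2)
  have m: "state_meas U" "M \<ge> 0" using U by (auto simp: decays_def)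
  show "tame d (\<lambda>\<xi>. fst (U \<xi>))"
    by (rule tame_decay[OF _ \<sigma> m(2) e decays_fst[OF U]]) (use m in \<open>auto simp: state_meas_def\<close>)
  show "j < d \<Longrightarrow> tame d (\<lambda>\<xi>. snd (U \<xi>) j)"
    by (rule tame_decay[OF _ \<sigma> m(2) e decays_snd[OF U]]) (use m in \<open>auto simp: state_meas_def\<close>)
qed

text \<open>All products fall under \<open>prod_definedI\<close>, since both exponents e3 and e3 + 1
  lie in [0, d) and make the convolutions tame. The linear rules for transforms then follow
  \<open>nsk_f\<close> and \<open>nsk_g\<close> term by term.\<close>

lemma
  assumes ok: "B_ok K \<sigma> S S" and K: "K \<ge> 0" and \<sigma>: "\<sigma> \<ge> 0"
    and a: "has_hat d a (\<lambda>\<xi>. fst (S \<xi>))" and u: "\<And>j. j < d \<Longrightarrow> has_hat d (u j) (\<lambda>\<xi>. snd (S \<xi>) j)"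
  shows nonlinearity_definedI: "nonlinearity_defined d u a"
    and has_hat_nsk_f: "has_hat d (nsk_f d u a) (\<lambda>\<xi>. fst (B S S \<xi>))"
    and has_hat_nsk_g: "j < d \<Longrightarrow> has_hat d (nsk_g d \<mu> \<nu> \<kappa> u a j) (\<lambda>\<xi>. snd (B S S \<xi>) j)"
proof -
  have da: "has_hat d (dist_pdiff i a) (dmult i (\<lambda>\<eta>. fst (S \<eta>)))" if "i < d" for i
    unfolding dmult_def[abs_def] using has_hat_dist_pdiff[OF d0 a that] by simp
  have du: "has_hat d (dist_pdiff i (u j)) (dmult i (\<lambda>\<eta>. snd (S \<eta>) j))" if "i < d" "j < d" for i j
    unfolding dmult_def[abs_def] using has_hat_dist_pdiff[OF d0 u[OF that(2)] that(1)] by simp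
  have key: "prod_defined d v w" "has_hat d (dist_prod d v w) (conv d f g)"
    if v: "has_hat d v f" "has_hat d w g" and c: "conv_ok K \<sigma> e f g" and e: "e = e3 \<or> e = e3 + 1" for v w f g e
  proof -
    have e': "0 \<le> e" "e < real d" using e e_bounds by auto
    have m: "conv d f g \<in> borel_measurable borel" using c by (intro measurable_conv) (auto simp: conv_ok_def)
    have t: "tame d (conv d f g)" by (rule tame_decay[OF m \<sigma> K e' conv_ok_bound[OF c]])
    have i: "integrable (leb d) (\<lambda>\<eta>. f (\<lambda>i. \<xi> i - \<eta> i) * g \<eta>)" if "\<xi> \<in> Rd d" "enorm d \<xi> > 0" for \<xi>
      by (rule conv_ok_int[OF c]) (use that in \<open>simp add: good_def\<close>)
    show "prod_defined d v w" "has_hat d (dist_prod d v w) (conv d f g)"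
      using prod_definedI[OF d0 v i t] has_hat_dist_prod[OF d0 v i t] by auto
  qed
  have ok1: "conv_ok K \<sigma> e3 (\<lambda>\<eta>. snd (S \<eta>) i) (dmult i (\<lambda>\<eta>. fst (S \<eta>)))"
    and ok2: "conv_ok K \<sigma> (e3 + 1) (dmult i (\<lambda>\<eta>. fst (S \<eta>))) (dmult i (\<lambda>\<eta>. fst (S \<eta>)))"
    and ok3: "j < d \<Longrightarrow> conv_ok K \<sigma> e3 (\<lambda>\<eta>. snd (S \<eta>) i) (dmult i (\<lambda>\<eta>. snd (S \<eta>) j))"
    and ok4: "j < d \<Longrightarrow> conv_ok K \<sigma> e3 (dmult i (\<lambda>\<eta>. fst (S \<eta>))) (dmult i (\<lambda>\<eta>. snd (S \<eta>) j))"
    and ok5: "j < d \<Longrightarrow> conv_ok K \<sigma> e3 (dmult i (\<lambda>\<eta>. fst (S \<eta>))) (dmult j (\<lambda>\<eta>. snd (S \<eta>) i))"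
    if "i < d" for i j using ok that by (auto simp: B_ok_def)
  note k1 = key[OF u da ok1 disjI1[OF refl]] and k2 = key[OF da da ok2 disjI2[OF refl]]
    and k3 = key[OF u du ok3 disjI1[OF refl]] and k4 = key[OF da du ok4 disjI1[OF refl]] and k5 = key[OF da du ok5 disjI1[OF refl]]
  show "nonlinearity_defined d u a"
    unfolding nonlinearity_defined_def using k1(1) k2(1) k3(1) k4(1) k5(1) by simp
  show "has_hat d (nsk_f d u a) (\<lambda>\<xi>. fst (B S S \<xi>))"
    unfolding nsk_f_def B_def fst_conv B_fst_def by (intro has_hat_minus has_hat_sum k1(2))
  show "has_hat d (nsk_g d \<mu> \<nu> \<kappa> u a j) (\<lambda>\<xi>. snd (B S S \<xi>) j)" if j: "j < d"
    unfolding nsk_g_def B_def snd_conv B_snd_def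
    by (intro has_hat_add has_hat_minus has_hat_scale has_hat_dist_pdiff[OF d0 _ j] has_hat_sum k2(2) k3(2) k4(2) k5(2) j)
qed

text \<open>The chosen transforms agree with \<open>S\<close> almost everywhere and below index
  \<open>d\<close> only; \<open>W_cong\<close> and the invariance of tameness under null sets
  transfer the statements.\<close>

lemma
  assumes f: "has_hat d (fst bw) (\<lambda>\<xi>. fst (S \<xi>))" and s: "\<And>j. j < d \<Longrightarrow> has_hat d (snd bw j) (\<lambda>\<xi>. snd (S \<xi>) j)"
    and t: "tame d (\<lambda>\<xi>. fst (W d \<tau> \<xi> (S \<xi>)))" "\<And>j. j < d \<Longrightarrow> tame d (\<lambda>\<xi>. snd (W d \<tau> \<xi> (S \<xi>)) j)"
  shows W_definedI: "W_defined d \<mu> \<nu> \<kappa> \<alpha> \<tau> bw"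
    and has_hat_W_fst: "has_hat d (fst (W_op d \<mu> \<nu> \<kappa> \<alpha> \<tau> bw)) (\<lambda>\<xi>. fst (W d \<tau> \<xi> (S \<xi>)))"
    and has_hat_W_snd: "j < d \<Longrightarrow> has_hat d (snd (W_op d \<mu> \<nu> \<kappa> \<alpha> \<tau> bw) j) (\<lambda>\<xi>. snd (W d \<tau> \<xi> (S \<xi>)) j)"
proof -
  let ?h = "\<lambda>\<xi>. W_hat d \<mu> \<nu> \<kappa> \<alpha> \<tau> bw \<xi>"
  have m: "(\<lambda>\<xi>. fst (?h \<xi>)) \<in> borel_measurable borel" "j < d \<Longrightarrow> (\<lambda>\<xi>. snd (?h \<xi>) j) \<in> borel_measurable borel" for j
    unfolding W_hat_def by (intro measurable_W; (intro hat_measurable[OF f] hat_measurable[OF s])?; simp)+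
  have ae: "AE \<xi> in leb d. hat d (fst bw) \<xi> = fst (S \<xi>) \<and> (\<forall>j\<in>{..<d}. hat d (snd bw j) \<xi> = snd (S \<xi>) j)"
    by (intro AE_conjI AE_hat_eq[OF d0 f] AE_finite_allI AE_hat_eq[OF d0 s]) auto
  have eq: "AE \<xi> in leb d. fst (?h \<xi>) = fst (W d \<tau> \<xi> (S \<xi>))" "AE \<xi> in leb d. snd (?h \<xi>) j = snd (W d \<tau> \<xi> (S \<xi>)) j" if "j < d" for j
    using ae by (eventually_elim, use that in \<open>auto simp: W_hat_def intro!: W_cong\<close>)+
  have eq1: "AE \<xi> in leb d. fst (?h \<xi>) = fst (W d \<tau> \<xi> (S \<xi>))" using eq(1)[OF d0] .
  note T1 = tame_cong_AE[OF t(1) m(1) eq1]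
  have T2: "tame d (\<lambda>\<xi>. snd (?h \<xi>) j)" if "j < d" for j by (rule tame_cong_AE[OF t(2) m(2) eq(2)]) (fact that)+
  show "W_defined d \<mu> \<nu> \<kappa> \<alpha> \<tau> bw"
    unfolding W_defined_def using f s tame_has_inv_hat[OF d0 T1] tame_has_inv_hat[OF d0 T2] by blast
  have eq1': "AE \<xi> in leb d. fst (W d \<tau> \<xi> (S \<xi>)) = fst (?h \<xi>)" using eq1 by eventually_elim simp
  show "has_hat d (fst (W_op d \<mu> \<nu> \<kappa> \<alpha> \<tau> bw)) (\<lambda>\<xi>. fst (W d \<tau> \<xi> (S \<xi>)))"
    unfolding W_op_def fst_conv by (rule has_hat_cong_AE[OF has_hat_inv_hat[OF d0 T1] tame_measurable[OF t(1)] eq1'])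
  show "has_hat d (snd (W_op d \<mu> \<nu> \<kappa> \<alpha> \<tau> bw) j) (\<lambda>\<xi>. snd (W d \<tau> \<xi> (S \<xi>)) j)" if j: "j < d"
  proof -
    have "AE \<xi> in leb d. snd (W d \<tau> \<xi> (S \<xi>)) j = snd (?h \<xi>) j" using eq(2)[OF j] by eventually_elim simp
    then show ?thesis
      unfolding W_op_def snd_conv by (rule has_hat_cong_AE[OF has_hat_inv_hat[OF d0 T2[OF j]] tame_measurable[OF t(2)[OF j]]])
  qed
qed

text \<open>After pairing with a test function, moved to the Fourier side, the claim is an exchange
  of the integrals in s and \<xi>. The integrand is dominated by a product: in time the Beta
  integrand, in frequency a locally integrable power times a Schwartz function.\<close>

lemma weak_integralI:
  fixes k :: "real \<Rightarrow> point \<Rightarrow> complex"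
  assumes m: "(\<lambda>z. k (fst z) (snd z)) \<in> borel_measurable (borel \<Otimes>\<^sub>M borel)"
    and t: "t > 0" and C: "C \<ge> 0"
    and b: "\<And>s \<xi>. 0 < s \<Longrightarrow> s < t \<Longrightarrow> good \<xi> \<Longrightarrow>
      cmod (k s \<xi>) \<le> (C * enorm d \<xi> powr (-e1)) * ((t - s) powr (- (1 - 1 / p)) * s powr (- (2 / p)))"
    and F: "\<And>s. 0 < s \<Longrightarrow> s < t \<Longrightarrow> has_hat d (F s) (k s)"
    and I: "has_hat d I (\<lambda>\<xi>. LINT s:{0<..<t}|lborel. k s \<xi>)"
  shows "has_weak_integral d t F I"
  unfolding has_weak_integral_def
proof (intro ballI)
  fix \<phi> assume \<phi>: "\<phi> \<in> schwartz d"
  define \<psi> where "\<psi> = inv_fourier d \<phi>"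
  have \<psi>: "\<psi> \<in> schwartz d" unfolding \<psi>_def by (rule inv_fourier_schwartz[OF d0 \<phi>])
  note [measurable] = schwartz_measurable[OF \<psi>]
  let ?M = "lborel \<Otimes>\<^sub>M leb d :: (real \<times> point) measure"
  define H :: "real \<times> point \<Rightarrow> complex" where "H = (\<lambda>(s, \<xi>). indicator {0<..<t} s *\<^sub>R (k s \<xi> * \<psi> \<xi>))"
  have mk: "(\<lambda>z. k (fst z) (snd z)) \<in> borel_measurable ?M"
    using m measurable_cong_sets[OF sets_pair_measure_cong[OF sets_lborel sets_leb] refl] by blast
  note [measurable] = mk
  have mH: "H \<in> borel_measurable ?M"
    unfolding H_def case_prod_unfold by measurable
  define h1 :: "real \<Rightarrow> real" where "h1 s = norm (indicator {0<..<t} s *\<^sub>R complex_of_real ((t - s) powr (- (1 - 1 / p)) * s powr (- (2 / p))))" for s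
  have h1: "integrable lborel h1"
    unfolding h1_def
    using time_integral_bound(1)[where \<phi>="\<lambda>s. complex_of_real ((t - s) powr (- (1 - 1 / p)) * s powr (- (2 / p)))" and t=t and c=1]
    by (intro integrable_norm) (auto simp: set_integrable_def t norm_mult)
  define h2 :: "point \<Rightarrow> real" where "h2 \<xi> = C * cmod (complex_of_real (enorm d \<xi> powr (-e1)) * \<psi> \<xi>)" for \<xi>
  have h2: "integrable (leb d) h2"
    unfolding h2_def
  proof (intro integrable_mult_right integrable_norm tame_schwartz[OF _ \<psi>])
    show "tame d (\<lambda>\<xi>. complex_of_real (enorm d \<xi> powr (-e1)))"
      by (rule tame_powr[OF d0 _ less_imp_le[OF e_bounds(1)] e_bounds(2), where C=1]) auto
  qed
  have H_le: "AE \<xi> in leb d. cmod (H (s, \<xi>)) \<le> h1 s * h2 \<xi>" for s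
    using AE_good
  proof eventually_elim
    case (elim \<xi>)
    show ?case
    proof (cases "0 < s \<and> s < t")
      case True
      then have "cmod (k s \<xi>) * cmod (\<psi> \<xi>) \<le> (C * enorm d \<xi> powr (-e1)) * ((t - s) powr (- (1 - 1 / p)) * s powr (- (2 / p))) * cmod (\<psi> \<xi>)"
        using b[of s \<xi>] elim by (intro mult_right_mono) auto
      then show ?thesis using True by (simp add: H_def h1_def h2_def norm_mult mult_ac)
    qed (auto simp: H_def h1_def indicator_def)
  qed
  have Hint: "integrable (leb d) (\<lambda>\<xi>. H (s, \<xi>))" for s
  proof (cases "0 < s \<and> s < t")
    case True
    then show ?thesis using has_hat_integrable[OF F \<psi>, of s] by (simp add: H_def)
  qed (auto simp: H_def indicator_def)
  have int: "integrable ?M H"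
  proof (rule lborel_leb.Fubini_integrable[OF mH])
    show "integrable lborel (\<lambda>x. LINT y|leb d. norm (H (x, y)))"
    proof (rule Bochner_Integration.integrable_bound)
      show "integrable lborel (\<lambda>s. h1 s * (LINT \<xi>|leb d. h2 \<xi>))" using h1 by simp
      have "(\<lambda>(x, y). norm (H (x, y))) \<in> borel_measurable ?M" using mH by (simp add: case_prod_unfold)
      then show "(\<lambda>x. LINT y|leb d. norm (H (x, y))) \<in> borel_measurable lborel"
        by (rule leb.borel_measurable_lebesgue_integral)
      show "AE s in lborel. norm (LINT y|leb d. norm (H (s, y))) \<le> norm (h1 s * (LINT \<xi>|leb d. h2 \<xi>))"
      proof (rule AE_I2)
        fix s
        have "(LINT y|leb d. norm (H (s, y))) \<le> (LINT \<xi>|leb d. h1 s * h2 \<xi>)"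
          by (rule integral_mono_AE[OF integrable_norm[OF Hint] _ H_le]) (use h2 in simp)
        moreover have "(LINT y|leb d. norm (H (s, y))) \<ge> 0" by (rule integral_nonneg_AE) simp
        ultimately show "norm (LINT y|leb d. norm (H (s, y))) \<le> norm (h1 s * (LINT \<xi>|leb d. h2 \<xi>))"
          by simp
      qed
    qed
    show "AE x in lborel. integrable (leb d) (\<lambda>y. H (x, y))" using Hint by simp
  qed
  have in1: "(LINT \<xi>|leb d. H (s, \<xi>)) = indicator {0<..<t} s *\<^sub>R F s \<phi>" for s
  proof (cases "0 < s \<and> s < t")
    case True
    then show ?thesis using has_hat_apply[OF d0 F \<phi>, of s] by (simp add: H_def \<psi>_def)
  qed (auto simp: H_def indicator_def)
  have in2: "(LINT s|lborel. H (s, \<xi>)) = (LINT s:{0<..<t}|lborel. k s \<xi>) * \<psi> \<xi>" for \<xi>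
    unfolding set_lebesgue_integral_def H_def prod.case
    by (subst integral_mult_left_zero[symmetric]) (intro Bochner_Integration.integral_cong refl, simp)
  have "set_integrable lborel {0<..<t} (\<lambda>s. F s \<phi>)"
    unfolding set_integrable_def using lborel_leb.integrable_fst'[OF int] by (simp only: in1)
  moreover have "I \<phi> = (LINT s:{0<..<t}|lborel. F s \<phi>)"
    unfolding has_hat_apply[OF d0 I \<phi>] \<psi>_def[symmetric] set_lebesgue_integral_def[of lborel "{0<..<t}" "\<lambda>s. F s \<phi>"]
    using lborel_leb.Fubini_integral[where f="\<lambda>s \<xi>. H (s, \<xi>)"] int by (simp add: in1 in2)
  ultimately show "set_integrable lborel {0<..<t} (\<lambda>s. F s \<phi>) \<and> I \<phi> = (LINT s:{0<..<t}|lborel. F s \<phi>)" ..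
qed


section \<open>The fixed point as a mild solution in the sense of distributions\<close>

lemma W_NL_bound:
  assumes U: "ball M U" and s: "0 < s" "s < t" and \<xi>: "good \<xi>"
  shows "nrm d \<xi> (W d (t - s) \<xi> (NL U s \<xi>)) \<le>
    (kernel_const * (NL_const * M\<^sup>2) * profile e1 (sqrt t) \<xi>) * ((t - s) powr (- (1 - 1 / p)) * s powr (- (2 / p)))"
  using NL_const_nonneg by (intro kernel_bound s \<xi> nrm_NL_le[OF U s(1) \<xi>]) simp

lemma tame_W:
  assumes S: "state_meas S" and \<sigma>: "\<sigma> \<ge> 0" and C: "C \<ge> 0"
    and b: "\<And>\<xi>. good \<xi> \<Longrightarrow> nrm d \<xi> (W d \<tau> \<xi> (S \<xi>)) \<le> C * profile e1 \<sigma> \<xi>"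
  shows "tame d (\<lambda>\<xi>. fst (W d \<tau> \<xi> (S \<xi>)))" "j < d \<Longrightarrow> tame d (\<lambda>\<xi>. snd (W d \<tau> \<xi> (S \<xi>)) j)"
proof -
  have "state_meas (\<lambda>\<xi>. W d \<tau> \<xi> (S \<xi>))"
    using smeas_slice(3)[OF smeas_lin[OF S]] .
  then have D: "decays \<sigma> C (\<lambda>\<xi>. W d \<tau> \<xi> (S \<xi>))" using C b by (simp add: decays_def)
  show "tame d (\<lambda>\<xi>. fst (W d \<tau> \<xi> (S \<xi>)))" "j < d \<Longrightarrow> tame d (\<lambda>\<xi>. snd (W d \<tau> \<xi> (S \<xi>)) j)"
    using decays_tame[OF D \<sigma>] by auto
qed

definition sol_a :: "(real \<Rightarrow> point \<Rightarrow> state) \<Rightarrow> real \<Rightarrow> distn" where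
  "sol_a U t = inv_hat d (\<lambda>\<xi>. fst (U t \<xi>))"

definition sol_u :: "(real \<Rightarrow> point \<Rightarrow> state) \<Rightarrow> real \<Rightarrow> nat \<Rightarrow> distn" where
  "sol_u U t j = inv_hat d (\<lambda>\<xi>. snd (U t \<xi>) j)"

lemma
  assumes U: "ball M U" and t: "t > 0"
  shows has_hat_sol_a: "has_hat d (sol_a U t) (\<lambda>\<xi>. fst (U t \<xi>))"
    and has_hat_sol_u: "j < d \<Longrightarrow> has_hat d (sol_u U t j) (\<lambda>\<xi>. snd (U t \<xi>) j)"
    and tempered_sol_a: "sol_a U t \<in> tempered d"
    and tempered_sol_u: "j < d \<Longrightarrow> sol_u U t j \<in> tempered d"
proof -
  have s: "sqrt t \<ge> 0" using t by simp
  note T = decays_tame[OF ball_decays[OF U t] s]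
  show "has_hat d (sol_a U t) (\<lambda>\<xi>. fst (U t \<xi>))" "sol_a U t \<in> tempered d"
    unfolding sol_a_def by (rule has_hat_inv_hat[OF d0 T(1)] inv_hat_tempered[OF d0 T(1)])+
  show "j < d \<Longrightarrow> has_hat d (sol_u U t j) (\<lambda>\<xi>. snd (U t \<xi>) j)" "j < d \<Longrightarrow> sol_u U t j \<in> tempered d"
    unfolding sol_u_def by (rule has_hat_inv_hat[OF d0 T(2)] inv_hat_tempered[OF d0 T(2)], assumption)+
qed

lemma sol_nonlinearity:
  assumes U: "ball M U" and s: "s > 0"
  shows "nonlinearity_defined d (sol_u U s) (sol_a U s)"
    and "has_hat d (nsk_f d (sol_u U s) (sol_a U s)) (\<lambda>\<xi>. fst (NL U s \<xi>))"
    and "j < d \<Longrightarrow> has_hat d (nsk_g d \<mu> \<nu> \<kappa> (sol_u U s) (sol_a U s) j) (\<lambda>\<xi>. snd (NL U s \<xi>) j)"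
proof -
  have s0: "sqrt s \<ge> 0" using s by simp
  note D = ball_decays[OF U s]
  note ok = B_ok_const(2)[OF s0 D D]
  have M: "M \<ge> 0" using U by (simp add: ball_def)
  have K: "B_ok_const * (M * s powr (- (1 / p)) * (M * s powr (- (1 / p)))) \<ge> 0"
    using B_ok_const(1) M by simp
  note nonlinearity_definedI[OF ok K s0] has_hat_nsk_f[OF ok K s0] has_hat_nsk_g[OF ok K s0]
  then show "nonlinearity_defined d (sol_u U s) (sol_a U s)"
    "has_hat d (nsk_f d (sol_u U s) (sol_a U s)) (\<lambda>\<xi>. fst (NL U s \<xi>))"
    "j < d \<Longrightarrow> has_hat d (nsk_g d \<mu> \<nu> \<kappa> (sol_u U s) (sol_a U s) j) (\<lambda>\<xi>. snd (NL U s \<xi>) j)"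
    using has_hat_sol_a[OF U s] has_hat_sol_u[OF U s] by (simp_all add: NL_def)
qed

lemma sol_mild:
  assumes U: "ball M U" and mild: "mild_hat U0 U" and U0: "state_meas U0" and R: "R \<ge> 0"
    and U0b: "\<And>\<xi>. good \<xi> \<Longrightarrow> nrm d \<xi> (U0 \<xi>) \<le> R * enorm d \<xi> powr (-(real d - 1))"
    and a0: "has_hat d a0 (\<lambda>\<xi>. fst (U0 \<xi>))" and u0: "\<And>j. j < d \<Longrightarrow> has_hat d (u0 j) (\<lambda>\<xi>. snd (U0 \<xi>) j)"
    and t: "t > 0"
  defines "N \<equiv> \<lambda>s. (nsk_f d (sol_u U s) (sol_a U s), nsk_g d \<mu> \<nu> \<kappa> (sol_u U s) (sol_a U s))"
  shows "W_defined d \<mu> \<nu> \<kappa> \<alpha> t (a0, u0)"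
    and "0 < s \<Longrightarrow> s < t \<Longrightarrow> W_defined d \<mu> \<nu> \<kappa> \<alpha> (t - s) (N s)"
    and "has_weak_integral d t (\<lambda>s. fst (W_op d \<mu> \<nu> \<kappa> \<alpha> (t - s) (N s)))
          (\<lambda>\<phi>. sol_a U t \<phi> - fst (W_op d \<mu> \<nu> \<kappa> \<alpha> t (a0, u0)) \<phi>)"
    and "j < d \<Longrightarrow> has_weak_integral d t (\<lambda>s. snd (W_op d \<mu> \<nu> \<kappa> \<alpha> (t - s) (N s)) j)
          (\<lambda>\<phi>. sol_u U t j \<phi> - snd (W_op d \<mu> \<nu> \<kappa> \<alpha> t (a0, u0)) j \<phi>)"
proof -
  have s0: "sqrt t \<ge> 0" using t by simp
  have M: "M \<ge> 0" and sU: "smeas U" using U by (auto simp: ball_def)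
  have sN: "smeas (NL U)" by (rule smeas_NL[OF sU])
  have L: "nrm d \<xi> (W d t \<xi> (U0 \<xi>)) \<le> (lin_const * R * t powr (- (1 / p))) * profile e1 (sqrt t) \<xi>" if "good \<xi>" for \<xi>
    using nrm_lin_le[OF t that U0b[OF that] R] by (simp add: wt_def mult.assoc)
  have c0: "lin_const * R * t powr (- (1 / p)) \<ge> 0" using lin_const_pos R by simp
  have T0: "tame d (\<lambda>\<xi>. fst (W d t \<xi> (U0 \<xi>)))" "\<And>j. j < d \<Longrightarrow> tame d (\<lambda>\<xi>. snd (W d t \<xi> (U0 \<xi>)) j)"
    using tame_W[OF U0 s0 c0 L] by auto
  have h0: "has_hat d (fst (a0, u0)) (\<lambda>\<xi>. fst (U0 \<xi>))" "\<And>j. j < d \<Longrightarrow> has_hat d (snd (a0, u0) j) (\<lambda>\<xi>. snd (U0 \<xi>) j)"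
    using a0 u0 by auto
  have W0: "W_defined d \<mu> \<nu> \<kappa> \<alpha> t (a0, u0)"
    "has_hat d (fst (W_op d \<mu> \<nu> \<kappa> \<alpha> t (a0, u0))) (\<lambda>\<xi>. fst (W d t \<xi> (U0 \<xi>)))"
    "\<And>j. j < d \<Longrightarrow> has_hat d (snd (W_op d \<mu> \<nu> \<kappa> \<alpha> t (a0, u0)) j) (\<lambda>\<xi>. snd (W d t \<xi> (U0 \<xi>)) j)"
    using W_definedI[OF h0 T0] has_hat_W_fst[OF h0 T0] has_hat_W_snd[OF h0 T0] by auto
  show "W_defined d \<mu> \<nu> \<kappa> \<alpha> t (a0, u0)" by (rule W0(1))
  define C where "C = kernel_const * (NL_const * M\<^sup>2)"
  have C: "C \<ge> 0" using kernel_const_pos NL_const_nonneg by (simp add: C_def)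
  have kb: "nrm d \<xi> (W d (t - s) \<xi> (NL U s \<xi>)) \<le>
    (C * profile e1 (sqrt t) \<xi>) * ((t - s) powr (- (1 - 1 / p)) * s powr (- (2 / p)))"
    if "0 < s" "s < t" "good \<xi>" for s \<xi>
    using W_NL_bound[OF U that] by (simp add: C_def)
  \<comment> \<open>Dropping the exponential leaves the form that \<open>weak_integralI\<close>
    expects, a function of time times a power of the frequency.\<close>
  have kb': "nrm d \<xi> (W d (t - s) \<xi> (NL U s \<xi>)) \<le>
    (C * enorm d \<xi> powr (-e1)) * ((t - s) powr (- (1 - 1 / p)) * s powr (- (2 / p)))"
    if "0 < s" "s < t" "good \<xi>" for s \<xi>
  proof -
    have "exp (- (sqrt t * enorm d \<xi>)) * enorm d \<xi> powr (-e1) \<le> 1 * enorm d \<xi> powr (-e1)"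
      using t by (intro mult_right_mono) auto
    then show ?thesis using C
      by (intro order_trans[OF kb[OF that]] mult_right_mono mult_left_mono) auto
  qed
  have h: "has_hat d (fst (N s)) (\<lambda>\<xi>. fst (NL U s \<xi>))" "\<And>j. j < d \<Longrightarrow> has_hat d (snd (N s) j) (\<lambda>\<xi>. snd (NL U s \<xi>) j)"
    and T: "tame d (\<lambda>\<xi>. fst (W d (t - s) \<xi> (NL U s \<xi>)))" "\<And>j. j < d \<Longrightarrow> tame d (\<lambda>\<xi>. snd (W d (t - s) \<xi> (NL U s \<xi>)) j)"
    if s: "0 < s" "s < t" for s
  proof -
    show "has_hat d (fst (N s)) (\<lambda>\<xi>. fst (NL U s \<xi>))" "\<And>j. j < d \<Longrightarrow> has_hat d (snd (N s) j) (\<lambda>\<xi>. snd (NL U s \<xi>) j)"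
      unfolding N_def using sol_nonlinearity(2,3)[OF U s(1)] by simp_all
    have c: "C * ((t - s) powr (- (1 - 1 / p)) * s powr (- (2 / p))) \<ge> 0" using C by simp
    show "tame d (\<lambda>\<xi>. fst (W d (t - s) \<xi> (NL U s \<xi>)))" "\<And>j. j < d \<Longrightarrow> tame d (\<lambda>\<xi>. snd (W d (t - s) \<xi> (NL U s \<xi>)) j)"
      by (rule tame_W[OF smeas_slice(3)[OF sN] s0 c], use kb[OF s] in \<open>simp add: mult_ac\<close>)+
  qed
  show "0 < s \<Longrightarrow> s < t \<Longrightarrow> W_defined d \<mu> \<nu> \<kappa> \<alpha> (t - s) (N s)"
    by (rule W_definedI[OF h T])
  let ?B = "borel \<Otimes>\<^sub>M borel :: (real \<times> point) measure"
  have mW: "(\<lambda>z. fst (W d (t - fst z) (snd z) (NL U (fst z) (snd z)))) \<in> borel_measurable ?B"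
    "j < d \<Longrightarrow> (\<lambda>z. snd (W d (t - fst z) (snd z) (NL U (fst z) (snd z))) j) \<in> borel_measurable ?B" for j
  proof -
    have \<tau>: "(\<lambda>z. t - fst z) \<in> borel_measurable ?B" and X: "snd \<in> borel_measurable ?B" by measurable
    note K = measurable_W[OF \<tau> X, where b="\<lambda>z. fst (NL U (fst z) (snd z))" and w="\<lambda>z. snd (NL U (fst z) (snd z))" and d=d]
    show "(\<lambda>z. fst (W d (t - fst z) (snd z) (NL U (fst z) (snd z)))) \<in> borel_measurable ?B"
      "j < d \<Longrightarrow> (\<lambda>z. snd (W d (t - fst z) (snd z) (NL U (fst z) (snd z))) j) \<in> borel_measurable ?B"
      using K sN by (simp_all add: smeas_def)
  qed
  have sD: "state_meas (Dh (NL U) t)" by (rule smeas_slice(3)[OF smeas_Dh[OF sN]])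
  show "has_weak_integral d t (\<lambda>s. fst (W_op d \<mu> \<nu> \<kappa> \<alpha> (t - s) (N s)))
          (\<lambda>\<phi>. sol_a U t \<phi> - fst (W_op d \<mu> \<nu> \<kappa> \<alpha> t (a0, u0)) \<phi>)"
  proof (rule weak_integralI[where k="\<lambda>s \<xi>. fst (W d (t - s) \<xi> (NL U s \<xi>))", OF mW(1) t C order_trans[OF nrm_fst_le(1) kb']])
    fix s assume s: "0 < s" "s < t"
    show "has_hat d (fst (W_op d \<mu> \<nu> \<kappa> \<alpha> (t - s) (N s))) (\<lambda>\<xi>. fst (W d (t - s) \<xi> (NL U s \<xi>)))"
      by (rule has_hat_W_fst[OF h[OF s] T[OF s]])
  next
    \<comment> \<open>The mild equation on the Fourier side identifies the Duhamel integral as the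
      transform of the difference to the free evolution.\<close>
    have "AE \<xi> in leb d. fst (Dh (NL U) t \<xi>) = fst (U t \<xi>) - fst (W d t \<xi> (U0 \<xi>))"
      using AE_good by eventually_elim (use mild t in \<open>simp add: mild_hat_def\<close>)
    from has_hat_cong_AE[OF has_hat_diff[OF has_hat_sol_a[OF U t] W0(2)] _ this]
    show "has_hat d (\<lambda>\<phi>. sol_a U t \<phi> - fst (W_op d \<mu> \<nu> \<kappa> \<alpha> t (a0, u0)) \<phi>)
      (\<lambda>\<xi>. LINT s:{0<..<t}|lborel. fst (W d (t - s) \<xi> (NL U s \<xi>)))"
      using sD by (simp add: state_meas_def Dh_def)
  qed
  show "has_weak_integral d t (\<lambda>s. snd (W_op d \<mu> \<nu> \<kappa> \<alpha> (t - s) (N s)) j)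
          (\<lambda>\<phi>. sol_u U t j \<phi> - snd (W_op d \<mu> \<nu> \<kappa> \<alpha> t (a0, u0)) j \<phi>)" if j: "j < d"
  proof (rule weak_integralI[where k="\<lambda>s \<xi>. snd (W d (t - s) \<xi> (NL U s \<xi>)) j", OF mW(2)[OF j] t C order_trans[OF nrm_snd[OF j] kb']])
    fix s assume s: "0 < s" "s < t"
    show "has_hat d (snd (W_op d \<mu> \<nu> \<kappa> \<alpha> (t - s) (N s)) j) (\<lambda>\<xi>. snd (W d (t - s) \<xi> (NL U s \<xi>)) j)"
      by (rule has_hat_W_snd[OF h[OF s] T[OF s] j])
  next
    have "AE \<xi> in leb d. snd (Dh (NL U) t \<xi>) j = snd (U t \<xi>) j - snd (W d t \<xi> (U0 \<xi>)) j"
      using AE_good by eventually_elim (use mild t j in \<open>simp add: mild_hat_def\<close>)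
    from has_hat_cong_AE[OF has_hat_diff[OF has_hat_sol_u[OF U t j] W0(3)[OF j]] _ this]
    show "has_hat d (\<lambda>\<phi>. sol_u U t j \<phi> - snd (W_op d \<mu> \<nu> \<kappa> \<alpha> t (a0, u0)) j \<phi>)
      (\<lambda>\<xi>. LINT s:{0<..<t}|lborel. snd (W d (t - s) \<xi> (NL U s \<xi>)) j)"
      using sD j by (simp add: state_meas_def Dh_def)
  qed
qed


section \<open>Continuity in time and membership in the solution space\<close>

lemma Duhamel_difference_le:
  fixes k :: "real \<Rightarrow> real \<Rightarrow> complex"
  assumes t: "0 < t'" "t' \<le> t''"
    and int: "set_integrable lborel {0<..<t'} (k t')" "set_integrable lborel {0<..<t''} (k t'')"
    and lip: "\<And>s. 0 < s \<Longrightarrow> s < t' \<Longrightarrow> cmod (k t'' s - k t' s) \<le> a * s powr (- (2 / p))"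
    and bd: "\<And>s. t' \<le> s \<Longrightarrow> s < t'' \<Longrightarrow> cmod (k t'' s) \<le> b"
    and ab: "a \<ge> 0" "b \<ge> 0"
  shows "cmod ((LINT s:{0<..<t''}|lborel. k t'' s) - (LINT s:{0<..<t'}|lborel. k t' s))
    \<le> a * (2 / (1 - 2 / p) * t' powr (1 - 2 / p)) + b * (t'' - t')"
proof -
  \<comment> \<open>The later integral is split at t'. Before t' both integrands are present and
    differ by the Lipschitz bound, whose singularity at 0 is integrable because 2/p < 1; after t'
    only the bounded new integrand remains.\<close>
  have int1: "set_integrable lborel {0<..<t'} (k t'')" and int2: "set_integrable lborel {t'..<t''} (k t'')"
    by (rule set_integrable_subset[OF int(2)], use t in auto)+
  have "{0<..<t''} = {0<..<t'} \<union> {t'..<t''}" using t by auto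
  then have "(LINT s:{0<..<t''}|lborel. k t'' s) = (LINT s:{0<..<t'}|lborel. k t'' s) + (LINT s:{t'..<t''}|lborel. k t'' s)"
    using set_integral_Un[OF ivl_disj_int_two(1) int1 int2] by simp
  then have eq: "(LINT s:{0<..<t''}|lborel. k t'' s) - (LINT s:{0<..<t'}|lborel. k t' s)
    = (LINT s:{0<..<t'}|lborel. k t'' s - k t' s) + (LINT s:{t'..<t''}|lborel. k t'' s)"
    using set_integral_diff(2)[OF int1 int(1)] by simp
  have "cmod (LINT s:{0<..<t'}|lborel. k t'' s - k t' s) \<le> a * (2 / (1 - 2 / p) * t' powr (1 - 2 / p))"
    unfolding set_lebesgue_integral_def
  proof (rule integral_bound_of_nn(2))
    show "(\<lambda>s. indicator {0<..<t'} s *\<^sub>R (k t'' s - k t' s)) \<in> borel_measurable lborel"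
      using set_integral_diff(1)[OF int1 int(1)] unfolding set_integrable_def by (rule borel_measurable_integrable)
    have "(\<integral>\<^sup>+s. ennreal (cmod (indicator {0<..<t'} s *\<^sub>R (k t'' s - k t' s))) \<partial>lborel)
      \<le> (\<integral>\<^sup>+s. ennreal a * (ennreal (\<bar>s\<bar> powr (- (2 / p))) * indicator {..t'} \<bar>s\<bar>) \<partial>lborel)"
      using lip ab by (intro nn_integral_mono) (auto simp: indicator_def ennreal_mult'[symmetric] intro!: ennreal_leI)
    also have "\<dots> = ennreal a * (\<integral>\<^sup>+s. ennreal (\<bar>s\<bar> powr (- (2 / p))) * indicator {..t'} \<bar>s\<bar> \<partial>lborel)"
      by (rule nn_integral_cmult) measurable
    also have "\<dots> \<le> ennreal a * ennreal (2 / (1 - 2 / p) * t' powr (1 - 2 / p))"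
      using nn_integral_powr_near[of "2 / p" t'] p_bounds t by (intro mult_left_mono) auto
    finally show "(\<integral>\<^sup>+s. ennreal (cmod (indicator {0<..<t'} s *\<^sub>R (k t'' s - k t' s))) \<partial>lborel)
      \<le> ennreal (a * (2 / (1 - 2 / p) * t' powr (1 - 2 / p)))" by (simp only: ennreal_mult'[OF ab(1)])
    show "0 \<le> a * (2 / (1 - 2 / p) * t' powr (1 - 2 / p))" using ab p_bounds by simp
  qed
  moreover have "cmod (LINT s:{t'..<t''}|lborel. k t'' s) \<le> b * (t'' - t')"
    unfolding set_lebesgue_integral_def
  proof (rule integral_bound_of_nn(2))
    show "(\<lambda>s. indicator {t'..<t''} s *\<^sub>R k t'' s) \<in> borel_measurable lborel"
      using int2 unfolding set_integrable_def by (rule borel_measurable_integrable)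
    have "(\<integral>\<^sup>+s. ennreal (cmod (indicator {t'..<t''} s *\<^sub>R k t'' s)) \<partial>lborel) \<le> (\<integral>\<^sup>+s. ennreal b * indicator {t'..<t''} s \<partial>lborel)"
      using bd by (intro nn_integral_mono) (auto simp: indicator_def intro!: ennreal_leI)
    also have "\<dots> = ennreal (b * (t'' - t'))"
      using t ab by (simp add: nn_integral_cmult_indicator ennreal_mult')
    finally show "(\<integral>\<^sup>+s. ennreal (cmod (indicator {t'..<t''} s *\<^sub>R k t'' s)) \<partial>lborel) \<le> ennreal (b * (t'' - t'))" .
    show "0 \<le> b * (t'' - t')" using ab t by simp
  qed
  ultimately show ?thesis
    unfolding eq by (intro order_trans[OF norm_triangle_ineq] add_mono)
qed

text \<open>The functional \<open>c\<close> with weight \<theta> covers two uses: the scalar part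
  with \<theta> = 1 + |\<xi>| and a vector component with \<theta> = 1. After multiplication by
  |\<xi>|^e1 the data and the nonlinearity leave the powers 2/p and 2 - 2/p of |\<xi>|; these are
  nonnegative, so R bounds them, and the Lipschitz constant is uniform over low frequencies and
  times between t1 and t2.\<close>

lemma mild_component_lipschitz:
  fixes c :: "state \<Rightarrow> complex"
  assumes U: "ball M U" and t: "0 < t1" "t1 \<le> t'" "t' \<le> t''" "t'' \<le> t2"
    and U0b: "nrm d \<xi> (U0 \<xi>) \<le> R0 * enorm d \<xi> powr (-(real d - 1))" and R0: "R0 \<ge> 0"
    and \<xi>: "good \<xi>" "enorm d \<xi> \<le> R"
    and \<theta>: "\<theta> \<ge> 0" and c: "\<And>x. \<theta> * cmod (c x) \<le> nrm d \<xi> x"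
    and cW: "\<And>s t x. 0 \<le> s \<Longrightarrow> s \<le> t \<Longrightarrow> \<theta> * cmod (c (W d t \<xi> x) - c (W d s \<xi> x)) \<le> A_bound d (enorm d \<xi>) * W_const d * nrm d \<xi> x * (t - s)"
    and int: "\<And>t. t > 0 \<Longrightarrow> set_integrable lborel {0<..<t} (\<lambda>s. c (W d (t - s) \<xi> (NL U s \<xi>)))"
    and eq: "\<And>t. t > 0 \<Longrightarrow> c (U t \<xi>) = c (W d t \<xi> (U0 \<xi>)) + (LINT s:{0<..<t}|lborel. c (W d (t - s) \<xi> (NL U s \<xi>)))"
  shows "enorm d \<xi> powr e1 * (\<theta> * cmod (c (U t'' \<xi>) - c (U t' \<xi>))) \<le>
    (A_bound d R * W_const d * (R0 * R powr (2 / p))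
     + A_bound d R * W_const d * (NL_const * M\<^sup>2 * R powr (2 - 2 / p)) * (2 / (1 - 2 / p) * t2 powr (1 - 2 / p))
     + W_const d * (NL_const * M\<^sup>2 * R powr (2 - 2 / p)) * t1 powr (- (2 / p))) * (t'' - t')"
proof -
  define r where "r = enorm d \<xi>"
  have r: "0 < r" "r \<le> R" using \<xi> by (auto simp: good_def r_def)
  define \<Delta> where "\<Delta> = t'' - t'"
  have \<Delta>: "\<Delta> \<ge> 0" using t by (simp add: \<Delta>_def)
  define K where "K = NL_const * M\<^sup>2"
  have K: "K \<ge> 0" using NL_const_nonneg by (simp add: K_def)
  have Wc: "W_const d \<ge> 0" using W_const_pos[OF d0] by simp
  define a where "a = A_bound d r * W_const d"
  have a: "0 \<le> a" "a \<le> A_bound d R * W_const d"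
    using r Wc A_bound_nonneg[of r d] A_bound_mono[of r R d] by (auto simp: a_def intro: mult_right_mono)
  have N: "nrm d \<xi> (NL U s \<xi>) \<le> K * r powr (-e3) * s powr (- (2 / p))" if "s > 0" for s
  proof -
    have "exp (- (sqrt s * r)) * r powr (-e3) \<le> 1 * r powr (-e3)" using that r by (intro mult_right_mono) auto
    then have "K * wtN s r \<le> K * (s powr (- (2 / p)) * r powr (-e3))"
      using K by (auto simp: wtN_def intro!: mult_left_mono)
    then show ?thesis using nrm_NL_le[OF U that \<xi>(1)] by (simp add: K_def r_def mult_ac)
  qed
  let ?k = "\<lambda>\<tau> s. complex_of_real \<theta> * c (W d (\<tau> - s) \<xi> (NL U s \<xi>))"
  have ki: "set_integrable lborel {0<..<\<tau>} (?k \<tau>)" if "\<tau> > 0" for \<tau>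
    using int[OF that] unfolding set_integrable_def by (simp add: mult.left_commute scaleR_conv_of_real)
  have D: "cmod ((LINT s:{0<..<t''}|lborel. ?k t'' s) - (LINT s:{0<..<t'}|lborel. ?k t' s))
    \<le> (a * \<Delta> * (K * r powr (-e3))) * (2 / (1 - 2 / p) * t' powr (1 - 2 / p)) + (W_const d * (K * r powr (-e3) * t1 powr (- (2 / p)))) * (t'' - t')"
  proof (rule Duhamel_difference_le)
    fix s assume s: "0 < s" "s < t'"
    have "cmod (?k t'' s - ?k t' s) = \<theta> * cmod (c (W d (t'' - s) \<xi> (NL U s \<xi>)) - c (W d (t' - s) \<xi> (NL U s \<xi>)))"
      using \<theta> by (simp add: right_diff_distrib[symmetric] norm_mult)
    also have "\<dots> \<le> a * nrm d \<xi> (NL U s \<xi>) * \<Delta>"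
      using cW[of "t' - s" "t'' - s" "NL U s \<xi>"] s t by (simp add: a_def r_def \<Delta>_def)
    also have "\<dots> \<le> a * (K * r powr (-e3) * s powr (- (2 / p))) * \<Delta>"
      by (intro mult_right_mono mult_left_mono N s a \<Delta>)
    finally show "cmod (?k t'' s - ?k t' s) \<le> (a * \<Delta> * (K * r powr (-e3))) * s powr (- (2 / p))" by (simp add: mult_ac)
  next
    fix s assume s: "t' \<le> s" "s < t''"
    have "cmod (?k t'' s) \<le> nrm d \<xi> (W d (t'' - s) \<xi> (NL U s \<xi>))" using c \<theta> by (simp add: norm_mult)
    also have "\<dots> \<le> W_const d * nrm d \<xi> (NL U s \<xi>)" using s by (intro nrm_W_le') simp
    also have "\<dots> \<le> W_const d * (K * r powr (-e3) * s powr (- (2 / p)))" using s t by (intro mult_left_mono N Wc) simp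
    also have "s powr (- (2 / p)) \<le> t1 powr (- (2 / p))" using s t p_bounds by (intro powr_mono2') auto
    finally show "cmod (?k t'' s) \<le> W_const d * (K * r powr (-e3) * t1 powr (- (2 / p)))"
      using K Wc by (simp add: mult_left_mono)
  qed (use t ki a \<Delta> K Wc in auto)
  have "\<theta> * cmod (c (U t'' \<xi>) - c (U t' \<xi>)) = cmod (complex_of_real \<theta> * (c (U t'' \<xi>) - c (U t' \<xi>)))"
    using \<theta> by (simp add: norm_mult)
  also have "complex_of_real \<theta> * (c (U t'' \<xi>) - c (U t' \<xi>)) = complex_of_real \<theta> * (c (W d t'' \<xi> (U0 \<xi>)) - c (W d t' \<xi> (U0 \<xi>)))
     + ((LINT s:{0<..<t''}|lborel. ?k t'' s) - (LINT s:{0<..<t'}|lborel. ?k t' s))"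
    using eq[of t''] eq[of t'] t by (simp add: algebra_simps)
  also have "cmod \<dots> \<le> \<theta> * cmod (c (W d t'' \<xi> (U0 \<xi>)) - c (W d t' \<xi> (U0 \<xi>)))
     + ((a * \<Delta> * (K * r powr (-e3))) * (2 / (1 - 2 / p) * t' powr (1 - 2 / p)) + (W_const d * (K * r powr (-e3) * t1 powr (- (2 / p)))) * \<Delta>)"
    using D \<theta> by (intro order_trans[OF norm_triangle_ineq] add_mono) (auto simp: norm_mult \<Delta>_def)
  also have "\<theta> * cmod (c (W d t'' \<xi> (U0 \<xi>)) - c (W d t' \<xi> (U0 \<xi>))) \<le> a * (R0 * r powr (-(real d - 1))) * \<Delta>"
  proof -
    have "\<theta> * cmod (c (W d t'' \<xi> (U0 \<xi>)) - c (W d t' \<xi> (U0 \<xi>))) \<le> a * nrm d \<xi> (U0 \<xi>) * \<Delta>"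
      using cW[of t' t'' "U0 \<xi>"] t by (simp add: a_def r_def \<Delta>_def)
    also have "\<dots> \<le> a * (R0 * r powr (-(real d - 1))) * \<Delta>"
      using U0b by (intro mult_right_mono mult_left_mono a \<Delta>) (simp add: r_def)
    finally show ?thesis .
  qed
  finally have "\<theta> * cmod (c (U t'' \<xi>) - c (U t' \<xi>)) \<le> a * (R0 * r powr (-(real d - 1))) * \<Delta>
     + ((a * \<Delta> * (K * r powr (-e3))) * (2 / (1 - 2 / p) * t' powr (1 - 2 / p)) + (W_const d * (K * r powr (-e3) * t1 powr (- (2 / p)))) * \<Delta>)"
    by simp
  then have "r powr e1 * (\<theta> * cmod (c (U t'' \<xi>) - c (U t' \<xi>))) \<le> r powr e1 * (a * (R0 * r powr (-(real d - 1))) * \<Delta>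
     + ((a * \<Delta> * (K * r powr (-e3))) * (2 / (1 - 2 / p) * t' powr (1 - 2 / p)) + (W_const d * (K * r powr (-e3) * t1 powr (- (2 / p)))) * \<Delta>))"
    by (rule mult_left_mono) simp
  also have "\<dots> = (a * (R0 * (r powr e1 * r powr (-(real d - 1))))
     + a * (K * (r powr e1 * r powr (-e3))) * (2 / (1 - 2 / p) * t' powr (1 - 2 / p))
     + W_const d * (K * (r powr e1 * r powr (-e3))) * t1 powr (- (2 / p))) * \<Delta>"
    by (simp add: algebra_simps)
  also have "r powr e1 * r powr (-(real d - 1)) = r powr (2 / p)"
    by (simp add: powr_add[symmetric] e1_def)
  also have "r powr e1 * r powr (-e3) = r powr (2 - 2 / p)"
  proof -
    have "e1 - e3 = 2 - 2 / p" using e_bounds(12) by simp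
    then show ?thesis by (simp add: powr_add[symmetric])
  qed
  also have "(a * (R0 * r powr (2 / p))
     + a * (K * r powr (2 - 2 / p)) * (2 / (1 - 2 / p) * t' powr (1 - 2 / p))
     + W_const d * (K * r powr (2 - 2 / p)) * t1 powr (- (2 / p))) * \<Delta>
    \<le> (A_bound d R * W_const d * (R0 * R powr (2 / p))
     + A_bound d R * W_const d * (K * R powr (2 - 2 / p)) * (2 / (1 - 2 / p) * t2 powr (1 - 2 / p))
     + W_const d * (K * R powr (2 - 2 / p)) * t1 powr (- (2 / p))) * \<Delta>"
  proof (intro mult_right_mono[OF _ \<Delta>] add_mono)
    have q: "r powr (2 / p) \<le> R powr (2 / p)" "r powr (2 - 2 / p) \<le> R powr (2 - 2 / p)" "t' powr (1 - 2 / p) \<le> t2 powr (1 - 2 / p)"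
      by (rule powr_mono2, use r t p_bounds in linarith, use r t in linarith, use r t in linarith)+
    show "a * (R0 * r powr (2 / p)) \<le> A_bound d R * W_const d * (R0 * R powr (2 / p))"
      using a R0 q by (intro mult_mono) auto
    show "a * (K * r powr (2 - 2 / p)) * (2 / (1 - 2 / p) * t' powr (1 - 2 / p))
      \<le> A_bound d R * W_const d * (K * R powr (2 - 2 / p)) * (2 / (1 - 2 / p) * t2 powr (1 - 2 / p))"
      using a K q p_bounds r Wc A_bound_nonneg[of R d] by (intro mult_mono mult_nonneg_nonneg) auto
    show "W_const d * (K * r powr (2 - 2 / p)) * t1 powr (- (2 / p)) \<le> W_const d * (K * R powr (2 - 2 / p)) * t1 powr (- (2 / p))"
      using K Wc q by (intro mult_right_mono mult_left_mono) auto
  qed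
  finally show ?thesis unfolding r_def K_def \<Delta>_def .
qed

text \<open>Up to a frequency R the equation gives a Lipschitz bound in time that is uniform in
  \<xi>; beyond R the factor exp(- sqrt t |\<xi>|) makes both values small separately. This requires
  times bounded away from 0.\<close>

lemma mild_continuous:
  assumes U: "ball M U" and mild: "mild_hat U0 U" and R0: "R0 \<ge> 0"
    and U0b: "\<And>\<xi>. good \<xi> \<Longrightarrow> nrm d \<xi> (U0 \<xi>) \<le> R0 * enorm d \<xi> powr (-(real d - 1))"
    and s: "s > 0" and \<gamma>: "\<gamma> > 0"
  obtains \<delta> where "\<delta> > 0" "\<And>t \<xi>. t > 0 \<Longrightarrow> \<bar>t - s\<bar> < \<delta> \<Longrightarrow> good \<xi> \<Longrightarrow>
      enorm d \<xi> powr e1 * ((1 + enorm d \<xi>) * cmod (fst (U t \<xi>) - fst (U s \<xi>))) \<le> \<gamma>"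
    "\<And>t \<xi> j. t > 0 \<Longrightarrow> \<bar>t - s\<bar> < \<delta> \<Longrightarrow> good \<xi> \<Longrightarrow> j < d \<Longrightarrow>
      enorm d \<xi> powr e1 * cmod (snd (U t \<xi>) j - snd (U s \<xi>) j) \<le> \<gamma>"
proof -
  have M: "M \<ge> 0" and sU: "smeas U" using U by (auto simp: ball_def)
  define C where "C = 2 * (M * (s / 2) powr (- (1 / p)))"
  have C: "C \<ge> 0" using M by (simp add: C_def)
  \<comment> \<open>From x \<le> exp x with x = sqrt(s/2) |\<xi>|: as soon as x \<ge> C/\<gamma>,
    the high-frequency bound C exp(- x) is at most \<gamma>.\<close>
  define R where "R = C / (\<gamma> * sqrt (s / 2))"
  have R: "R \<ge> 0" using C \<gamma> s by (simp add: R_def)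
  define L where "L = A_bound d R * W_const d * (R0 * R powr (2 / p))
     + A_bound d R * W_const d * (NL_const * M\<^sup>2 * R powr (2 - 2 / p)) * (2 / (1 - 2 / p) * (2 * s) powr (1 - 2 / p))
     + W_const d * (NL_const * M\<^sup>2 * R powr (2 - 2 / p)) * (s / 2) powr (- (2 / p))"
  have L: "L \<ge> 0"
    using A_bound_nonneg[OF R, of d] W_const_pos[OF d0] R0 NL_const_nonneg p_bounds by (simp add: L_def)
  \<comment> \<open>The first entry keeps t between s/2 and 2 s, where L is a valid Lipschitz
    constant; L + 1 avoids a zero denominator.\<close>
  define \<delta> where "\<delta> = min (s / 2) (\<gamma> / (L + 1))"
  have \<delta>: "\<delta> > 0" using s \<gamma> L by (simp add: \<delta>_def add_nonneg_pos)
  have L\<delta>: "L * \<delta> \<le> \<gamma>"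
  proof -
    have "L * \<delta> \<le> (L + 1) * (\<gamma> / (L + 1))" using L \<gamma> s by (intro mult_mono) (auto simp: \<delta>_def)
    then show ?thesis using L by simp
  qed
  have high: "enorm d \<xi> powr e1 * (\<theta> * cmod (c (U t \<xi>) - c (U s \<xi>))) \<le> \<gamma>"
    if t: "t \<ge> s / 2" and \<xi>: "good \<xi>" "enorm d \<xi> > R"
      and \<theta>: "\<theta> \<ge> 0" and c: "\<And>x. \<theta> * cmod (c x) \<le> nrm d \<xi> x"
    for t \<xi> \<theta> and c :: "state \<Rightarrow> complex"
  proof -
    define r where "r = enorm d \<xi>"
    have r: "r > 0" "r > R" using \<xi> by (auto simp: good_def r_def)
    have b: "r powr e1 * nrm d \<xi> (U \<tau> \<xi>) \<le> C / 2 * exp (- (sqrt (s / 2) * r))" if \<tau>: "\<tau> \<ge> s / 2" for \<tau>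
    proof -
      have "\<tau> > 0" using \<tau> s by simp
      then have "nrm d \<xi> (U \<tau> \<xi>) \<le> M * wt \<tau> r" using U \<xi> by (simp add: ball_def r_def)
      then have "r powr e1 * nrm d \<xi> (U \<tau> \<xi>) \<le> r powr e1 * (M * wt \<tau> r)" by (rule mult_left_mono) simp
      also have "\<dots> = M * (\<tau> powr (- (1 / p)) * exp (- (sqrt \<tau> * r))) * (r powr e1 * r powr (-e1))"
        by (simp add: wt_def mult_ac)
      also have "r powr e1 * r powr (-e1) = 1" using r by (simp add: powr_add[symmetric])
      also have "M * (\<tau> powr (- (1 / p)) * exp (- (sqrt \<tau> * r))) * 1 \<le> M * ((s / 2) powr (- (1 / p)) * exp (- (sqrt (s / 2) * r))) * 1"
        using \<tau> s M r p_bounds by (intro mult_right_mono mult_left_mono mult_mono) (auto intro!: powr_mono2')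
      finally show ?thesis by (simp add: C_def mult_ac)
    qed
    have "\<theta> * cmod (c (U t \<xi>) - c (U s \<xi>)) \<le> \<theta> * (cmod (c (U t \<xi>)) + cmod (c (U s \<xi>)))"
      using \<theta> by (intro mult_left_mono norm_triangle_ineq4)
    also have "\<dots> \<le> nrm d \<xi> (U t \<xi>) + nrm d \<xi> (U s \<xi>)" using add_mono[OF c c] by (simp add: distrib_left)
    finally have "r powr e1 * (\<theta> * cmod (c (U t \<xi>) - c (U s \<xi>))) \<le> r powr e1 * (nrm d \<xi> (U t \<xi>) + nrm d \<xi> (U s \<xi>))"
      by (rule mult_left_mono) simp
    also have "\<dots> \<le> C * exp (- (sqrt (s / 2) * r))" using b[OF t] b[of s] s by (simp add: distrib_left)
    also have "\<dots> \<le> \<gamma>"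
    proof -
      have "C = \<gamma> * (sqrt (s / 2) * R)" using \<gamma> s by (simp add: R_def)
      also have "\<dots> \<le> \<gamma> * exp (sqrt (s / 2) * r)"
      proof (rule mult_left_mono)
        have "sqrt (s / 2) * R \<le> sqrt (s / 2) * r" using r s by (intro mult_left_mono) auto
        also have "\<dots> \<le> exp (sqrt (s / 2) * r)" using exp_ge_add_one_self[of "sqrt (s / 2) * r"] by linarith
        finally show "sqrt (s / 2) * R \<le> exp (sqrt (s / 2) * r)" .
      qed (use \<gamma> in simp)
      finally show ?thesis by (simp add: exp_minus field_simps)
    qed
    finally show ?thesis by (simp add: r_def)
  qed
  have main: "enorm d \<xi> powr e1 * (\<theta> * cmod (c (U t \<xi>) - c (U s \<xi>))) \<le> \<gamma>"
    if t: "t > 0" "\<bar>t - s\<bar> < \<delta>" and \<xi>: "good \<xi>"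
      and \<theta>: "\<theta> \<ge> 0" and c: "\<And>x. \<theta> * cmod (c x) \<le> nrm d \<xi> x"
      and cW: "\<And>s t x. 0 \<le> s \<Longrightarrow> s \<le> t \<Longrightarrow> \<theta> * cmod (c (W d t \<xi> x) - c (W d s \<xi> x)) \<le> A_bound d (enorm d \<xi>) * W_const d * nrm d \<xi> x * (t - s)"
      and int: "\<And>t. t > 0 \<Longrightarrow> set_integrable lborel {0<..<t} (\<lambda>s. c (W d (t - s) \<xi> (NL U s \<xi>)))"
      and eq: "\<And>t. t > 0 \<Longrightarrow> c (U t \<xi>) = c (W d t \<xi> (U0 \<xi>)) + (LINT s:{0<..<t}|lborel. c (W d (t - s) \<xi> (NL U s \<xi>)))"
    for t \<xi> \<theta> and c :: "state \<Rightarrow> complex"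
  proof (cases "enorm d \<xi> \<le> R")
    case True
    have "\<bar>t - s\<bar> < s / 2" using t by (simp add: \<delta>_def)
    then have ts: "s / 2 \<le> t" "t \<le> 2 * s" by linarith+
    have K: "enorm d \<xi> powr e1 * (\<theta> * cmod (c (U t'' \<xi>) - c (U t' \<xi>))) \<le> L * (t'' - t')"
      if t': "s / 2 \<le> t'" "t' \<le> t''" "t'' \<le> 2 * s" for t' t''
      unfolding L_def
    proof (rule mild_component_lipschitz[where c=c and \<theta>=\<theta> and U=U and ?U0.0=U0 and \<xi>=\<xi>])
      show "0 < s / 2" using s by simp
    qed (fact U t' U0b[OF \<xi>] R0 \<xi> True \<theta> c cW int eq)+
    have "enorm d \<xi> powr e1 * (\<theta> * cmod (c (U t \<xi>) - c (U s \<xi>))) \<le> L * \<bar>t - s\<bar>"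
    proof (cases "s \<le> t")
      case True
      then show ?thesis using K[of s t] s ts by simp
    next
      case False
      then show ?thesis using K[of t s] s ts by (simp add: norm_minus_commute)
    qed
    also have "\<dots> \<le> L * \<delta>" using t L by (intro mult_left_mono) auto
    finally show ?thesis using L\<delta> by simp
  next
    case False
    have "\<bar>t - s\<bar> < s / 2" using t by (simp add: \<delta>_def)
    then have "t \<ge> s / 2" by linarith
    then show ?thesis using high[OF _ \<xi> _ \<theta> c] False by simp
  qed
  have K: "NL_const * M\<^sup>2 \<ge> 0" using NL_const_nonneg by simp
  have int: "set_integrable lborel {0<..<\<tau>} (\<lambda>s. fst (W d (\<tau> - s) \<xi> (NL U s \<xi>)))"
    "\<And>j. j < d \<Longrightarrow> set_integrable lborel {0<..<\<tau>} (\<lambda>s. snd (W d (\<tau> - s) \<xi> (NL U s \<xi>)) j)" if "\<tau> > 0" "good \<xi>" for \<tau> \<xi>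
    by (rule Dh_int_fst[OF smeas_NL[OF sU] K that] Dh_int_snd[OF smeas_NL[OF sU] K that], rule nrm_NL_le[OF U _ that(2)], assumption+)+
  show ?thesis
  proof (rule that[OF \<delta>])
    fix t \<xi> assume t: "0 < t" "\<bar>t - s\<bar> < \<delta>" and \<xi>: "good \<xi>"
    show "enorm d \<xi> powr e1 * ((1 + enorm d \<xi>) * cmod (fst (U t \<xi>) - fst (U s \<xi>))) \<le> \<gamma>"
      by (rule main[OF t \<xi> _ nrm_fst W_lipschitz(1) int(1)[OF _ \<xi>]])
         (use mild \<xi> in \<open>auto simp: mild_hat_def Dh_def\<close>)
    fix j assume j: "j < d"
    have "enorm d \<xi> powr e1 * (1 * cmod (snd (U t \<xi>) j - snd (U s \<xi>) j)) \<le> \<gamma>"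
    proof (rule main[where c="\<lambda>x. snd x j", OF t \<xi>])
      fix \<tau> :: real assume \<tau>: "\<tau> > 0"
      show "set_integrable lborel {0<..<\<tau>} (\<lambda>s. snd (W d (\<tau> - s) \<xi> (NL U s \<xi>)) j)"
        by (rule int(2)[OF \<tau> \<xi> j])
      show "snd (U \<tau> \<xi>) j = snd (W d \<tau> \<xi> (U0 \<xi>)) j + (LINT s:{0<..<\<tau>}|lborel. snd (W d (\<tau> - s) \<xi> (NL U s \<xi>)) j)"
        using mild \<xi> \<tau> j by (auto simp: mild_hat_def Dh_def)
    qed (use W_lipschitz(2)[OF _ _ j] nrm_snd[OF j] in auto)
    then show "enorm d \<xi> powr e1 * cmod (snd (U t \<xi>) j - snd (U s \<xi>) j) \<le> \<gamma>" by simp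
  qed
qed

text \<open>One criterion for both unknowns: the density uses it with m = 1 and two exponents, the
  velocity with m = d. Bounds at single good frequencies replace the essential suprema.\<close>

lemma K_spaceI:
  assumes e: "q + 2 / p = e" and M: "M \<ge> 0"
    and hat: "\<And>t j. t > 0 \<Longrightarrow> j < m \<Longrightarrow> has_hat d (v t j) (V t j)"
    and temp: "\<And>t j. t > 0 \<Longrightarrow> j < m \<Longrightarrow> v t j \<in> tempered d"
    and bnd: "\<And>t \<xi> j. t > 0 \<Longrightarrow> good \<xi> \<Longrightarrow> j < m \<Longrightarrow> enorm d \<xi> powr e * cmod (V t j \<xi>) \<le> M * t powr (- (1 / p))"
    and cont: "\<And>s \<gamma>. s > 0 \<Longrightarrow> \<gamma> > 0 \<Longrightarrow> \<exists>\<delta>>0. \<forall>t>0. \<bar>t - s\<bar> < \<delta> \<longrightarrow>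
      (\<forall>\<xi>. good \<xi> \<longrightarrow> (\<forall>j<m. enorm d \<xi> powr e * cmod (V t j \<xi> - V s j \<xi>) \<le> \<gamma>))"
  shows "v \<in> K_space d m p q \<infinity>"
proof -
  have T: "time_set \<infinity> = {0<..}" by (auto simp: time_set_def)
  have N: "PM_norm d m e (v t) \<le> ereal (real m * (M * t powr (- (1 / p))))" if "t > 0" for t
    by (rule PM_norm_le_componentwise[OF d0 hat[OF that]]) (use bnd that in \<open>auto simp: good_def\<close>)
  show ?thesis
    unfolding K_space_def T e mem_Collect_eq
  proof (intro conjI ballI)
    fix t :: real assume "t \<in> {0<..}"
    then have t: "t > 0" by simp
    have "PM_norm d m e (v t) < \<infinity>" using N[OF t] by (rule le_less_trans) simp
    then show "v t \<in> PM d m e" unfolding PM_def using hat[OF t] temp[OF t] by blast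
  next
    fix s :: real assume "s \<in> {0<..}"
    then have s: "s > 0" by simp
    show "((\<lambda>t. PM_norm d m e (\<lambda>j \<phi>. v t j \<phi> - v s j \<phi>)) \<longlongrightarrow> 0) (at s within {0<..})"
    proof (rule order_tendstoI)
      fix y :: ereal assume y: "y < 0"
      have "0 \<le> PM_norm d m e (\<lambda>j \<phi>. v t j \<phi> - v s j \<phi>)" if "t > 0" for t
        by (rule PM_norm_ge_0[OF has_hat_diff[OF hat hat]]) (use that s in auto)
      then show "\<forall>\<^sub>F t in at s within {0<..}. y < PM_norm d m e (\<lambda>j \<phi>. v t j \<phi> - v s j \<phi>)"
        using y by (auto simp: eventually_at_filter intro!: always_eventually intro: less_le_trans)
    next
      fix y :: ereal assume y: "0 < y"
      obtain \<gamma> where \<gamma>: "\<gamma> > 0" "ereal \<gamma> < y" using ereal_dense2[OF y] by (metis ereal_less(2))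
      \<comment> \<open>m + 1 in place of m keeps the quotient meaningful for m = 0.\<close>
      have m1: "real m + 1 > 0" by simp
      obtain \<delta> where \<delta>: "\<delta> > 0" "\<And>t \<xi> j. t > 0 \<Longrightarrow> \<bar>t - s\<bar> < \<delta> \<Longrightarrow> good \<xi> \<Longrightarrow> j < m \<Longrightarrow>
          enorm d \<xi> powr e * cmod (V t j \<xi> - V s j \<xi>) \<le> \<gamma> / (real m + 1)"
        using cont[OF s, of "\<gamma> / (real m + 1)"] \<gamma> m1 by (auto simp: divide_pos_pos)
      have "PM_norm d m e (\<lambda>j \<phi>. v t j \<phi> - v s j \<phi>) < y" if t: "t > 0" "\<bar>t - s\<bar> < \<delta>" for t
      proof -
        have "PM_norm d m e (\<lambda>j \<phi>. v t j \<phi> - v s j \<phi>) \<le> ereal (real m * (\<gamma> / (real m + 1)))"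
          by (rule PM_norm_le_componentwise[OF d0 has_hat_diff[OF hat[OF t(1)] hat[OF s]]])
             (use \<delta>(2)[OF t] in \<open>auto simp: good_def\<close>)
        also have "\<dots> \<le> ereal \<gamma>" using \<gamma> by (simp add: field_simps)
        finally show ?thesis using \<gamma>(2) by (rule le_less_trans)
      qed
      then show "\<forall>\<^sub>F t in at s within {0<..}. PM_norm d m e (\<lambda>j \<phi>. v t j \<phi> - v s j \<phi>) < y"
        unfolding eventually_at by (intro exI[of _ \<delta>]) (use \<delta> in \<open>auto simp: dist_real_def\<close>)
    qed
  next
    have "ereal (t powr (1 / p)) * PM_norm d m e (v t) \<le> ereal (real m * M)" if t: "t > 0" for t
    proof -
      have "ereal (t powr (1 / p)) * PM_norm d m e (v t) \<le> ereal (t powr (1 / p)) * ereal (real m * (M * t powr (- (1 / p))))"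
        by (intro ereal_mult_left_mono N t) simp
      also have "\<dots> = ereal (real m * M * (t powr (1 / p) * t powr (- (1 / p))))" by (simp add: mult_ac)
      also have "t powr (1 / p) * t powr (- (1 / p)) = 1" using t by (simp add: powr_add[symmetric])
      finally show ?thesis by simp
    qed
    then have "(SUP t\<in>{0<..}. ereal (t powr (1 / p)) * PM_norm d m e (v t)) \<le> ereal (real m * M)"
      by (intro SUP_least) simp
    then show "(SUP t\<in>{0<..}. ereal (t powr (1 / p)) * PM_norm d m e (v t)) < \<infinity>" by (rule le_less_trans) simp
  qed
qed

lemma ball_powr_le:
  assumes U: "ball M U" and t: "t > 0" and \<xi>: "good \<xi>"
  shows "enorm d \<xi> powr e1 * nrm d \<xi> (U t \<xi>) \<le> M * t powr (- (1 / p))"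
proof -
  define r where "r = enorm d \<xi>"
  have r: "r > 0" using \<xi> by (simp add: good_def r_def)
  have M: "M \<ge> 0" using U by (simp add: ball_def)
  have "r powr e1 * nrm d \<xi> (U t \<xi>) \<le> r powr e1 * (M * wt t r)"
    using U t \<xi> by (intro mult_left_mono) (auto simp: ball_def r_def)
  also have "\<dots> = M * (t powr (- (1 / p)) * exp (- (sqrt t * r))) * (r powr e1 * r powr (-e1))"
    by (simp add: wt_def mult_ac)
  also have "r powr e1 * r powr (-e1) = 1" using r by (simp add: powr_add[symmetric])
  also have "M * (t powr (- (1 / p)) * exp (- (sqrt t * r))) * 1 \<le> M * (t powr (- (1 / p)) * 1) * 1"
    using t M r by (intro mult_right_mono mult_left_mono) auto
  finally show ?thesis by (simp add: r_def)
qed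

lemma sol_X_space:
  assumes U: "ball M U" and mild: "mild_hat U0 U" and R0: "R0 \<ge> 0"
    and U0b: "\<And>\<xi>. good \<xi> \<Longrightarrow> nrm d \<xi> (U0 \<xi>) \<le> R0 * enorm d \<xi> powr (-(real d - 1))"
  shows "(sol_a U, sol_u U) \<in> X_space d p \<infinity>"
proof -
  have cont: "\<exists>\<delta>>0. \<forall>t>0. \<bar>t - s\<bar> < \<delta> \<longrightarrow> (\<forall>\<xi>. good \<xi> \<longrightarrow>
      enorm d \<xi> powr e1 * ((1 + enorm d \<xi>) * cmod (fst (U t \<xi>) - fst (U s \<xi>))) \<le> \<gamma> \<and>
      (\<forall>j<d. enorm d \<xi> powr e1 * cmod (snd (U t \<xi>) j - snd (U s \<xi>) j) \<le> \<gamma>))" if "s > 0" "\<gamma> > 0" for s \<gamma>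
  proof (rule mild_continuous[OF U mild R0 _ that])
    fix \<delta> assume "\<delta> > 0" "\<And>t \<xi>. t > 0 \<Longrightarrow> \<bar>t - s\<bar> < \<delta> \<Longrightarrow> good \<xi> \<Longrightarrow>
      enorm d \<xi> powr e1 * ((1 + enorm d \<xi>) * cmod (fst (U t \<xi>) - fst (U s \<xi>))) \<le> \<gamma>"
      "\<And>t \<xi> j. t > 0 \<Longrightarrow> \<bar>t - s\<bar> < \<delta> \<Longrightarrow> good \<xi> \<Longrightarrow> j < d \<Longrightarrow>
      enorm d \<xi> powr e1 * cmod (snd (U t \<xi>) j - snd (U s \<xi>) j) \<le> \<gamma>"
    then show ?thesis by (intro exI[of _ \<delta>]) auto
  qed (fact U0b)
  have M: "M \<ge> 0" using U by (simp add: ball_def)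
  have E1: "real d - 1 + 2 / p = e1" and E2: "real d + 2 / p = e1 + 1" by (simp_all add: e1_def)
  \<comment> \<open>The weight 1 + |\<xi>| dominates both 1 and |\<xi>|, so one statement about the
    scalar part serves the exponents e1 and e1 + 1.\<close>
  have e1': "enorm d \<xi> powr (e1 + 1) * x \<le> enorm d \<xi> powr e1 * ((1 + enorm d \<xi>) * x)"
    and e1'': "enorm d \<xi> powr e1 * x \<le> enorm d \<xi> powr e1 * ((1 + enorm d \<xi>) * x)" if "x \<ge> 0" for \<xi> x
    using that by (auto simp: powr_add algebra_simps)
  have F: "enorm d \<xi> powr e1 * ((1 + enorm d \<xi>) * cmod (fst (U t \<xi>))) \<le> M * t powr (- (1 / p))"
    and S: "j < d \<Longrightarrow> enorm d \<xi> powr e1 * cmod (snd (U t \<xi>) j) \<le> M * t powr (- (1 / p))"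
    if "t > 0" "good \<xi>" for t \<xi> j
    by (rule order_trans[OF mult_left_mono ball_powr_le[OF U that]], use nrm_fst nrm_snd in auto)+
  have a: "(\<lambda>t _. sol_a U t) \<in> K_space d 1 p q \<infinity>"
    if q: "q + 2 / p = e" and le: "\<And>\<xi> x. x \<ge> 0 \<Longrightarrow> enorm d \<xi> powr e * x \<le> enorm d \<xi> powr e1 * ((1 + enorm d \<xi>) * x)" for q e
  proof (rule K_spaceI[OF q M has_hat_sol_a[OF U] tempered_sol_a[OF U] order_trans[OF le F]])
    fix s \<gamma> :: real assume "s > 0" "\<gamma> > 0"
    with cont[of s \<gamma>] obtain \<delta> where "\<delta> > 0" "\<And>t \<xi>. t > 0 \<Longrightarrow> \<bar>t - s\<bar> < \<delta> \<Longrightarrow> good \<xi> \<Longrightarrow>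
      enorm d \<xi> powr e1 * ((1 + enorm d \<xi>) * cmod (fst (U t \<xi>) - fst (U s \<xi>))) \<le> \<gamma>" by metis
    then show "\<exists>\<delta>>0. \<forall>t>0. \<bar>t - s\<bar> < \<delta> \<longrightarrow> (\<forall>\<xi>. good \<xi> \<longrightarrow> (\<forall>j<1. enorm d \<xi> powr e * cmod (fst (U t \<xi>) - fst (U s \<xi>)) \<le> \<gamma>))"
      using order_trans[OF le] by (intro exI[of _ \<delta>]) auto
  qed auto
  have 3: "sol_u U \<in> K_space d d p (real d - 1) \<infinity>"
  proof (rule K_spaceI[OF E1 M has_hat_sol_u[OF U] tempered_sol_u[OF U] S])
    fix s \<gamma> :: real assume "s > 0" "\<gamma> > 0"
    with cont[of s \<gamma>] obtain \<delta> where "\<delta> > 0" "\<And>t \<xi> j. t > 0 \<Longrightarrow> \<bar>t - s\<bar> < \<delta> \<Longrightarrow> good \<xi> \<Longrightarrow> j < d \<Longrightarrow>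
      enorm d \<xi> powr e1 * cmod (snd (U t \<xi>) j - snd (U s \<xi>) j) \<le> \<gamma>" by metis
    then show "\<exists>\<delta>>0. \<forall>t>0. \<bar>t - s\<bar> < \<delta> \<longrightarrow> (\<forall>\<xi>. good \<xi> \<longrightarrow> (\<forall>j<d. enorm d \<xi> powr e1 * cmod (snd (U t \<xi>) j - snd (U s \<xi>) j) \<le> \<gamma>))"
      by (intro exI[of _ \<delta>]) auto
  qed auto
  show ?thesis using a[OF E1 e1''] a[OF E2 e1'] 3 by (simp add: X_space_def)
qed

end

section \<open>Analyticity\<close>

text \<open>The multi-index term w^m / m! of the exponential series in d variables.\<close>

definition exp_term :: "nat \<Rightarrow> (nat \<Rightarrow> 'a::{real_normed_field,banach}) \<Rightarrow> (nat \<Rightarrow> nat) \<Rightarrow> 'a" where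
  "exp_term d w m = (\<Prod>i<d. w i ^ m i /\<^sub>R fact (m i))"

lemma norm_exp_term: "norm (exp_term d w m) = exp_term d (\<lambda>i. norm (w i)) m"
  by (simp add: exp_term_def prod_norm[symmetric] norm_power)

abbreviation multi_indices :: "nat \<Rightarrow> (nat \<Rightarrow> nat) set" where
  "multi_indices d \<equiv> {m. \<forall>i\<ge>d. m i = 0}"

text \<open>The exponential of a sum is the product of the exponentials. The induction splits off
  the last index and carries absolute summability along, which permits summation over the product of
  the index sets.\<close>

lemma exp_term_has_sum:
  fixes w :: "nat \<Rightarrow> 'a::{real_normed_field,banach}"
  shows "(exp_term d w has_sum exp (\<Sum>i<d. w i)) (multi_indices d) \<and> (\<lambda>m. norm (exp_term d w m)) summable_on multi_indices d"
proof (induction d)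
  case 0
  have "multi_indices 0 = {\<lambda>_. 0}" by auto
  then show ?case using has_sum_finite[of "{\<lambda>_. 0}" "exp_term 0 w"] by (simp add: exp_term_def[abs_def])
next
  case (Suc d)
  let ?T = "multi_indices d"
  let ?e = "\<lambda>k. w d ^ k /\<^sub>R fact k"
  define f where "f = (\<lambda>(m, k). exp_term d w m * ?e k)"
  have E: "(?e has_sum exp (w d)) UNIV" "(\<lambda>k. norm (?e k)) summable_on UNIV"
    using norm_summable_imp_has_sum[OF summable_norm_exp exp_converges, of "w d"] norm_summable_imp_summable_on[of "\<lambda>k. norm (?e k)"]
      summable_norm_exp[of "w d"] by auto
  have abs: "(\<lambda>z. norm (f z)) summable_on ?T \<times> UNIV"
  proof (rule Infinite_Sum.abs_summable_on_Sigma_iff[THEN iffD2], intro conjI ballI)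
    fix m
    show "(\<lambda>k. norm (f (m, k))) summable_on UNIV"
      unfolding f_def prod.case norm_mult by (intro summable_on_cmult_right E)
    have "(\<lambda>m. norm (exp_term d w m) * infsum (\<lambda>k. norm (?e k)) UNIV) summable_on ?T"
      using Suc by (intro summable_on_cmult_left) simp
    then show "(\<lambda>m. norm (infsum (\<lambda>k. norm (f (m, k))) UNIV)) summable_on ?T"
      unfolding f_def prod.case norm_mult infsum_cmult_right' by (simp add: infsum_nonneg)
  qed
  have "(f has_sum exp (\<Sum>i<d. w i) * exp (w d)) (?T \<times> UNIV)"
  proof (rule has_sum_SigmaI)
    show "((\<lambda>k. f (m, k)) has_sum exp_term d w m * exp (w d)) UNIV" for m
      unfolding f_def prod.case by (intro has_sum_cmult_right E)
    show "((\<lambda>m. exp_term d w m * exp (w d)) has_sum exp (\<Sum>i<d. w i) * exp (w d)) ?T"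
      using Suc by (intro has_sum_cmult_left) simp
    show "f summable_on ?T \<times> UNIV" by (rule abs_summable_summable[OF abs])
  qed
  moreover have bij: "bij_betw (\<lambda>(m, k). m(d := k)) (?T \<times> UNIV) (multi_indices (Suc d))"
    by (rule bij_betwI[where g="\<lambda>m. (m(d := 0), m d)"]) auto
  have eq: "exp_term (Suc d) w (case z of (m, k) \<Rightarrow> m(d := k)) = f z" for z
  proof (cases z)
    case (Pair m k)
    have "(\<Prod>i<d. w i ^ (m(d := k)) i /\<^sub>R fact ((m(d := k)) i)) = (\<Prod>i<d. w i ^ m i /\<^sub>R fact (m i))"
      by (intro prod.cong) auto
    then show ?thesis by (simp add: Pair f_def exp_term_def)
  qed
  ultimately show ?case
    using has_sum_reindex_bij_betw[OF bij, of "exp_term (Suc d) w"] abs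
      summable_on_reindex_bij_betw[OF bij, of "\<lambda>m. norm (exp_term (Suc d) w m)"]
    by (simp add: eq exp_add)
qed

text \<open>Together with countability this gives an enumeration of the multi-indices: termwise
  integration works along a sequence, whereas analyticity asks for an unordered sum.\<close>

lemma infinite_multi_indices:
  assumes "d > 0" shows "infinite (multi_indices d)"
proof -
  have "inj (\<lambda>k::nat. (\<lambda>_. 0)(0 := k) :: nat \<Rightarrow> nat)" by (rule injI) (metis fun_upd_same)
  then have "infinite (range (\<lambda>k::nat. (\<lambda>_. 0)(0 := k) :: nat \<Rightarrow> nat))" by (rule range_inj_infinite)
  moreover have "range (\<lambda>k::nat. (\<lambda>_. 0)(0 := k) :: nat \<Rightarrow> nat) \<subseteq> multi_indices d" using assms by auto
  ultimately show ?thesis using infinite_super by blast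
qed

lemma countable_multi_indices: "countable (multi_indices d)"
proof -
  have "multi_indices d \<subseteq> (\<lambda>l i. if i < length l then l ! i else 0) ` UNIV"
  proof
    fix m :: "nat \<Rightarrow> nat" assume "m \<in> multi_indices d"
    then have "m = (\<lambda>i. if i < length (map m [0..<d]) then map m [0..<d] ! i else 0)" by (auto simp: fun_eq_iff)
    then show "m \<in> (\<lambda>l i. if i < length l then l ! i else 0) ` UNIV" by blast
  qed
  then show ?thesis by (rule countable_subset) auto
qed

text \<open>Expand exp(i (y - x) . \<xi>) in powers of y - x and integrate term by term. The
  absolute values of the terms add up to |h| times the exponential of the sum of |y_i - x_i|
  |\<xi>_i|, which exp(\<sigma> |\<xi>|) |h| dominates for y near x.\<close>

lemma real_analytic_fourier_integral:
  assumes d: "d > 0" and h: "h \<in> borel_measurable borel" and \<sigma>: "\<sigma> > 0"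
    and int: "integrable (leb d) (\<lambda>\<xi>. exp (\<sigma> * enorm d \<xi>) * cmod (h \<xi>))"
  shows "real_analytic d (\<lambda>x. (LINT \<xi>|leb d. cis (\<Sum>i<d. x i * \<xi> i) * h \<xi>) / (2 * pi) ^ d)"
  unfolding real_analytic_def
proof (intro ballI)
  fix x assume x: "x \<in> Rd d"
  note [measurable] = h
  \<comment> \<open>If every |y_i - x_i| is at most \<sigma>/d, the sum of the d terms |y_i - x_i|
    |\<xi>_i| is at most \<sigma> |\<xi>|.\<close>
  define \<epsilon> where "\<epsilon> = \<sigma> / real d"
  have \<epsilon>: "\<epsilon> > 0" using d \<sigma> by (simp add: \<epsilon>_def)
  define c where "c m = (LINT \<xi>|leb d. cis (\<Sum>i<d. x i * \<xi> i) * h \<xi> * exp_term d (\<lambda>i. \<i> * complex_of_real (\<xi> i)) m) / (2 * pi) ^ d" for m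
  show "\<exists>\<epsilon>>0. \<exists>c. \<forall>y\<in>Rd d. enorm d (\<lambda>i. y i - x i) < \<epsilon> \<longrightarrow>
      ((\<lambda>m. c m * (\<Prod>i<d. complex_of_real (y i - x i) ^ m i)) has_sum
        (LINT \<xi>|leb d. cis (\<Sum>i<d. y i * \<xi> i) * h \<xi>) / (2 * pi) ^ d) (multi_indices d)"
  proof (intro exI[of _ \<epsilon>] conjI \<epsilon> exI[of _ c] ballI impI)
    fix y assume y: "y \<in> Rd d" "enorm d (\<lambda>i. y i - x i) < \<epsilon>"
    define z where "z i = y i - x i" for i
    define w where "w \<xi> i = \<i> * complex_of_real (z i * \<xi> i)" for \<xi> :: point and i
    define f where "f m \<xi> = cis (\<Sum>i<d. x i * \<xi> i) * h \<xi> * exp_term d (w \<xi>) m" for m \<xi>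
    define D where "D \<xi> = exp (\<sigma> * enorm d \<xi>) * cmod (h \<xi>)" for \<xi>
    have Dint: "integrable (leb d) D" using int unfolding D_def .
    define e where "e = from_nat_into (multi_indices d)"
    have e: "bij_betw e UNIV (multi_indices d)"
      unfolding e_def by (intro bij_betw_from_nat_into countable_multi_indices infinite_multi_indices d)
    have [measurable]: "(\<lambda>\<xi>. exp_term d (w \<xi>) m) \<in> borel_measurable (leb d)" for m
      unfolding exp_term_def w_def
      by (intro borel_measurable_prod borel_measurable_scaleR borel_measurable_const borel_measurable_power borel_measurable_times
          measurable_compose[OF _ borel_measurable_of_real] borel_measurable_coord) measurable
    have [measurable]: "f m \<in> borel_measurable (leb d)" for m
      unfolding f_def
      by (intro borel_measurable_times borel_measurable_cis borel_measurable_ip) measurable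
    have zs: "(\<Sum>i<d. \<bar>z i * \<xi> i\<bar>) \<le> \<sigma> * enorm d \<xi>" for \<xi>
    proof -
      have "\<bar>z i * \<xi> i\<bar> \<le> \<epsilon> * enorm d \<xi>" if "i < d" for i
      proof -
        have "\<bar>z i\<bar> \<le> \<epsilon>" using abs_coord_le_enorm[OF that, of "\<lambda>i. y i - x i"] y by (simp add: z_def)
        then show ?thesis unfolding abs_mult using \<epsilon> by (intro mult_mono abs_coord_le_enorm that) auto
      qed
      then have "(\<Sum>i<d. \<bar>z i * \<xi> i\<bar>) \<le> (\<Sum>i<d. \<epsilon> * enorm d \<xi>)" by (intro sum_mono) auto
      then show ?thesis using d by (simp add: \<epsilon>_def)
    qed
    have nf: "((\<lambda>n. cmod (f (e n) \<xi>)) has_sum cmod (h \<xi>) * exp (\<Sum>i<d. \<bar>z i * \<xi> i\<bar>)) UNIV" for \<xi>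
    proof -
      have "((\<lambda>m. cmod (h \<xi>) * exp_term d (\<lambda>i. \<bar>z i * \<xi> i\<bar>) m) has_sum cmod (h \<xi>) * exp (\<Sum>i<d. \<bar>z i * \<xi> i\<bar>)) (multi_indices d)"
        using exp_term_has_sum by (intro has_sum_cmult_right) blast
      moreover have "cmod (f m \<xi>) = cmod (h \<xi>) * exp_term d (\<lambda>i. \<bar>z i * \<xi> i\<bar>) m" for m
        by (simp add: f_def norm_mult norm_exp_term w_def abs_mult)
      ultimately show ?thesis using has_sum_reindex_bij_betw[OF e, of "\<lambda>m. cmod (f m \<xi>)"] by simp
    qed
    have fin: "(\<Sum>n\<in>F. cmod (f (e n) \<xi>)) \<le> D \<xi>" if "finite F" for F \<xi>
    proof -
      have "(\<Sum>n\<in>F. cmod (f (e n) \<xi>)) \<le> cmod (h \<xi>) * exp (\<Sum>i<d. \<bar>z i * \<xi> i\<bar>)"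
        by (rule finite_sum_le_has_sum[OF nf that]) auto
      also have "\<dots> \<le> cmod (h \<xi>) * exp (\<sigma> * enorm d \<xi>)" using zs[of \<xi>] by (intro mult_left_mono) auto
      finally show ?thesis by (simp add: D_def mult.commute)
    qed
    have fint: "integrable (leb d) (f (e n))" for n
    proof (rule Bochner_Integration.integrable_bound[OF Dint])
      show "AE \<xi> in leb d. norm (f (e n) \<xi>) \<le> norm (D \<xi>)"
        using fin[of "{n}"] by (intro AE_I2) (simp add: order_trans[OF _ abs_ge_self])
    qed measurable
    have sn: "summable (\<lambda>n. LINT \<xi>|leb d. cmod (f (e n) \<xi>))"
    proof (rule summableI_nonneg_bounded)
      fix n
      have "(\<Sum>i<n. (LINT \<xi>|leb d. cmod (f (e i) \<xi>))) = (LINT \<xi>|leb d. (\<Sum>i<n. cmod (f (e i) \<xi>)))"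
        by (rule Bochner_Integration.integral_sum[symmetric]) (intro integrable_norm fint)
      also have "\<dots> \<le> (LINT \<xi>|leb d. D \<xi>)"
        by (intro integral_mono Dint Bochner_Integration.integrable_sum integrable_norm fint fin) simp
      finally show "(\<Sum>i<n. (LINT \<xi>|leb d. cmod (f (e i) \<xi>))) \<le> (LINT \<xi>|leb d. D \<xi>)" .
    qed (simp add: integral_nonneg_AE)
    have sumn: "summable (\<lambda>n. cmod (f (e n) \<xi>))" for \<xi> using has_sum_imp_sums[OF nf] by (rule sums_summable)
    have fs: "(\<Sum>n. f (e n) \<xi>) = cis (\<Sum>i<d. y i * \<xi> i) * h \<xi>" for \<xi>
    proof -
      have "((\<lambda>m. f m \<xi>) has_sum cis (\<Sum>i<d. x i * \<xi> i) * h \<xi> * exp (\<Sum>i<d. w \<xi> i)) (multi_indices d)"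
        unfolding f_def using exp_term_has_sum by (intro has_sum_cmult_right) blast
      then have "((\<lambda>n. f (e n) \<xi>) has_sum cis (\<Sum>i<d. x i * \<xi> i) * h \<xi> * exp (\<Sum>i<d. w \<xi> i)) UNIV"
        using has_sum_reindex_bij_betw[OF e, of "\<lambda>m. f m \<xi>"] by simp
      from has_sum_imp_sums[OF this]
      have "(\<Sum>n. f (e n) \<xi>) = cis (\<Sum>i<d. x i * \<xi> i) * h \<xi> * exp (\<Sum>i<d. w \<xi> i)" by (rule sums_unique[symmetric])
      also have "exp (\<Sum>i<d. w \<xi> i) = cis (\<Sum>i<d. z i * \<xi> i)"
        by (simp add: w_def cis_conv_exp sum_distrib_left)
      also have "cis (\<Sum>i<d. x i * \<xi> i) * h \<xi> * cis (\<Sum>i<d. z i * \<xi> i) = cis ((\<Sum>i<d. x i * \<xi> i) + (\<Sum>i<d. z i * \<xi> i)) * h \<xi>"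
        by (simp only: cis_mult[symmetric] mult_ac)
      also have "(\<Sum>i<d. x i * \<xi> i) + (\<Sum>i<d. z i * \<xi> i) = (\<Sum>i<d. y i * \<xi> i)"
        by (simp add: z_def sum.distrib[symmetric] algebra_simps)
      finally show ?thesis .
    qed
    have "(\<lambda>n. LINT \<xi>|leb d. f (e n) \<xi>) sums (LINT \<xi>|leb d. (\<Sum>n. f (e n) \<xi>))"
      by (rule sums_integral[OF fint AE_I2[OF sumn] sn])
    then have "(\<lambda>n. LINT \<xi>|leb d. f (e n) \<xi>) sums (LINT \<xi>|leb d. cis (\<Sum>i<d. y i * \<xi> i) * h \<xi>)"
      by (simp only: fs)
    moreover have "summable (\<lambda>n. norm (LINT \<xi>|leb d. f (e n) \<xi>))"
      by (rule summable_comparison_test'[OF sn, of 0]) (simp add: integral_norm_bound)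
    ultimately have "((\<lambda>n. LINT \<xi>|leb d. f (e n) \<xi>) has_sum (LINT \<xi>|leb d. cis (\<Sum>i<d. y i * \<xi> i) * h \<xi>)) UNIV"
      by (intro norm_summable_imp_has_sum)
    then have "((\<lambda>m. LINT \<xi>|leb d. f m \<xi>) has_sum (LINT \<xi>|leb d. cis (\<Sum>i<d. y i * \<xi> i) * h \<xi>)) (multi_indices d)"
      using has_sum_reindex_bij_betw[OF e, of "\<lambda>m. LINT \<xi>|leb d. f m \<xi>"] by simp
    then have S: "((\<lambda>m. (LINT \<xi>|leb d. f m \<xi>) * (1 / (2 * pi) ^ d)) has_sum (LINT \<xi>|leb d. cis (\<Sum>i<d. y i * \<xi> i) * h \<xi>) * (1 / (2 * pi) ^ d)) (multi_indices d)"
      by (rule has_sum_cmult_left)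
    have fc: "(LINT \<xi>|leb d. f m \<xi>) * (1 / (2 * pi) ^ d) = c m * (\<Prod>i<d. complex_of_real (y i - x i) ^ m i)" for m
    proof -
      have "exp_term d (w \<xi>) m = exp_term d (\<lambda>i. \<i> * complex_of_real (\<xi> i)) m * (\<Prod>i<d. complex_of_real (y i - x i) ^ m i)" for \<xi>
        unfolding exp_term_def w_def z_def prod.distrib[symmetric] of_real_mult power_mult_distrib by (simp add: mult_ac)
      then have "f m \<xi> = (cis (\<Sum>i<d. x i * \<xi> i) * h \<xi> * exp_term d (\<lambda>i. \<i> * complex_of_real (\<xi> i)) m) * (\<Prod>i<d. complex_of_real (y i - x i) ^ m i)" for \<xi>
        by (simp add: f_def mult.assoc)
      then show ?thesis by (simp add: c_def)
    qed
    show "((\<lambda>m. c m * (\<Prod>i<d. complex_of_real (y i - x i) ^ m i)) has_sum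
        (LINT \<xi>|leb d. cis (\<Sum>i<d. y i * \<xi> i) * h \<xi>) / (2 * pi) ^ d) (multi_indices d)"
      using S unfolding fc by (simp only: of_real_divide of_real_1 times_divide_eq_right mult_1_right)
  qed
qed

text \<open>The inverse transform of an integrable function is bounded, hence tame, and Fubini's
  theorem moves it from the test function onto \<open>h\<close>.\<close>

lemma is_regular_fourier_integral:
  assumes d: "d > 0" and g: "has_hat d g h" and int: "integrable (leb d) h"
  shows "is_regular d g (\<lambda>x. (LINT \<xi>|leb d. cis (\<Sum>i<d. x i * \<xi> i) * h \<xi>) / (2 * pi) ^ d)"
proof -
  define F where "F x = (LINT \<xi>|leb d. cis (\<Sum>i<d. x i * \<xi> i) * h \<xi>) / (2 * pi) ^ d" for x
  note [measurable] = has_hat_measurable[OF g]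
  have ip: "(\<lambda>z. \<Sum>i<d. fst z i * snd z i) \<in> borel_measurable (M \<Otimes>\<^sub>M leb d)" if "sets M = sets borel" for M :: "point measure"
  proof -
    have [measurable_cong]: "sets M = sets borel" by (fact that)
    show ?thesis by (intro borel_measurable_sum borel_measurable_times borel_measurable_coord) measurable
  qed
  have "(\<lambda>(x, \<xi>). cis (\<Sum>i<d. x i * \<xi> i) * h \<xi>) \<in> borel_measurable (borel \<Otimes>\<^sub>M leb d)"
    unfolding case_prod_unfold by (intro borel_measurable_times borel_measurable_cis ip refl) measurable
  from leb.borel_measurable_lebesgue_integral[OF this]
  have Fm: "F \<in> borel_measurable borel" unfolding F_def by simp
  have Fb: "cmod (F x) \<le> (LINT \<xi>|leb d. cmod (h \<xi>)) / (2 * pi) ^ d" for x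
  proof -
    have "cmod (LINT \<xi>|leb d. cis (\<Sum>i<d. x i * \<xi> i) * h \<xi>) \<le> (LINT \<xi>|leb d. cmod (h \<xi>))"
      using integral_norm_bound[of "leb d" "\<lambda>\<xi>. cis (\<Sum>i<d. x i * \<xi> i) * h \<xi>"] by (simp add: norm_mult)
    then show ?thesis by (simp add: F_def norm_divide norm_power norm_mult divide_right_mono)
  qed
  have t: "tame d F"
  proof (rule tame_powr[OF d Fm, where a=0])
    show "AE \<xi> in leb d. cmod (F \<xi>) \<le> (LINT \<xi>|leb d. cmod (h \<xi>)) / (2 * pi) ^ d * enorm d \<xi> powr (- 0)"
      using AE_leb_enorm_pos[OF d] by eventually_elim (use Fb in simp)
  qed (use d in auto)
  have "g \<phi> = (LINT x|leb d. F x * \<phi> x)" if \<phi>: "\<phi> \<in> schwartz d" for \<phi>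
  proof -
    note [measurable] = schwartz_measurable[OF \<phi>]
    let ?k = "\<lambda>z. cis (\<Sum>i<d. fst z i * snd z i)"
    have k: "?k \<in> borel_measurable (leb d \<Otimes>\<^sub>M leb d)" by (intro borel_measurable_cis ip) simp
    have P: "integrable (leb d \<Otimes>\<^sub>M leb d) (\<lambda>(\<xi>, x). ?k (\<xi>, x) * h \<xi> * \<phi> x)"
      by (rule integrable_pair_product[OF int schwartz_integrable[OF d \<phi>] k]) simp
    have "g \<phi> = (LINT \<xi>|leb d. h \<xi> * inv_fourier d \<phi> \<xi>)" by (rule has_hat_apply[OF d g \<phi>])
    also have "\<dots> = (LINT \<xi>|leb d. (LINT x|leb d. cis (\<Sum>i<d. \<xi> i * x i) * h \<xi> * \<phi> x) / (2 * pi) ^ d)"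
    proof (rule integral_cong_AE)
      show "AE \<xi> in leb d. h \<xi> * inv_fourier d \<phi> \<xi> = (LINT x|leb d. cis (\<Sum>i<d. \<xi> i * x i) * h \<xi> * \<phi> x) / (2 * pi) ^ d"
        using AE_leb_Rd
      proof eventually_elim
        case (elim \<xi>)
        then have "(\<lambda>k. - \<xi> k) \<in> Rd d" by (simp add: Rd_iff)
        then have "h \<xi> * inv_fourier d \<phi> \<xi> = h \<xi> * (LINT x|leb d. cis (\<Sum>i<d. \<xi> i * x i) * \<phi> x) / (2 * pi) ^ d"
          by (simp add: inv_fourier_def fourier_def sum_negf mult.commute)
        also have "h \<xi> * (LINT x|leb d. cis (\<Sum>i<d. \<xi> i * x i) * \<phi> x) = (LINT x|leb d. cis (\<Sum>i<d. \<xi> i * x i) * h \<xi> * \<phi> x)"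
          by (simp add: mult_ac flip: integral_mult_right_zero)
        finally show ?case .
      qed
      have "(\<lambda>(\<xi>, x). cis (\<Sum>i<d. \<xi> i * x i) * h \<xi> * \<phi> x) \<in> borel_measurable (leb d \<Otimes>\<^sub>M leb d)"
        using borel_measurable_integrable[OF P] by simp
      from leb.borel_measurable_lebesgue_integral[OF this]
      show "(\<lambda>\<xi>. (LINT x|leb d. cis (\<Sum>i<d. \<xi> i * x i) * h \<xi> * \<phi> x) / (2 * pi) ^ d) \<in> borel_measurable (leb d)" by measurable
      have [measurable]: "inv_fourier d \<phi> \<in> borel_measurable borel" by (rule schwartz_measurable[OF inv_fourier_schwartz[OF d \<phi>]])
      show "(\<lambda>\<xi>. h \<xi> * inv_fourier d \<phi> \<xi>) \<in> borel_measurable (leb d)" by measurable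
    qed
    also have "\<dots> = (LINT x|leb d. (LINT \<xi>|leb d. cis (\<Sum>i<d. \<xi> i * x i) * h \<xi> * \<phi> x)) / (2 * pi) ^ d"
      using leb_pair.Fubini_integral[where f="\<lambda>\<xi> x. cis (\<Sum>i<d. \<xi> i * x i) * h \<xi> * \<phi> x"] P by simp
    also have "\<dots> = (LINT x|leb d. F x * \<phi> x)"
      by (simp add: F_def mult.commute)
    finally show ?thesis .
  qed
  then show ?thesis
    unfolding is_regular_def F_def[symmetric]
    using tame_measurable[OF t] tame_set_integrable[OF t] tame_schwartz[OF t] by simp
qed

text \<open>The unknown polynomial weight in \<open>tame\<close> is paid by the gap between
  \<open>c\<close> and \<sigma>.\<close>

lemma integrable_of_tame_exp:
  assumes h: "h \<in> borel_measurable borel" and t: "tame d (\<lambda>\<xi>. complex_of_real (exp (\<sigma> * enorm d \<xi>)) * h \<xi>)"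
    and c: "c < \<sigma>"
  shows "integrable (leb d) (\<lambda>\<xi>. exp (c * enorm d \<xi>) * cmod (h \<xi>))"
proof -
  note [measurable] = h
  obtain k where k: "integrable (leb d) (\<lambda>\<xi>. cmod (complex_of_real (exp (\<sigma> * enorm d \<xi>)) * h \<xi>) / (1 + enorm d \<xi>) ^ k)"
    using t by (auto simp: tame_def)
  define \<delta> where "\<delta> = \<sigma> - c"
  have \<delta>: "\<delta> > 0" using c by (simp add: \<delta>_def)
  \<comment> \<open>From x^k \<le> k! exp x at x = \<delta> (1 + |\<xi>|).\<close>
  define C where "C = fact k * exp \<delta> / \<delta> ^ k"
  show ?thesis
  proof (rule Bochner_Integration.integrable_bound[OF integrable_mult_right[OF k, of C]])
    show "AE \<xi> in leb d. norm (exp (c * enorm d \<xi>) * cmod (h \<xi>))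
      \<le> norm (C * (cmod (complex_of_real (exp (\<sigma> * enorm d \<xi>)) * h \<xi>) / (1 + enorm d \<xi>) ^ k))"
    proof (rule AE_I2)
      fix \<xi>
      define r where "r = enorm d \<xi>"
      have r: "r \<ge> 0" by (simp add: r_def)
      have "\<delta> ^ k * (1 + r) ^ k \<le> fact k * exp (\<delta> * (1 + r))"
        unfolding power_mult_distrib[symmetric] using \<delta> r by (intro power_le_fact_exp) simp
      also have "exp (\<delta> * (1 + r)) = exp \<delta> * exp (\<delta> * r)" by (simp add: distrib_left exp_add)
      finally have "\<delta> ^ k * (1 + r) ^ k \<le> fact k * (exp \<delta> * exp (\<delta> * r))" .
      then have "(1 + r) ^ k \<le> C * exp (\<delta> * r)"
        using \<delta> by (simp add: C_def field_simps)
      then have "exp (c * r) * (1 + r) ^ k \<le> exp (c * r) * (C * exp (\<delta> * r))" by (intro mult_left_mono) auto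
      also have "\<dots> = C * exp (\<sigma> * r)" by (simp add: \<delta>_def algebra_simps exp_add[symmetric])
      finally have "exp (c * r) \<le> C * (exp (\<sigma> * r) / (1 + r) ^ k)" using r by (simp add: pos_le_divide_eq)
      then have "exp (c * r) * cmod (h \<xi>) \<le> C * (exp (\<sigma> * r) / (1 + r) ^ k) * cmod (h \<xi>)" by (rule mult_right_mono) simp
      also have "\<dots> = C * (cmod (complex_of_real (exp (\<sigma> * r)) * h \<xi>) / (1 + r) ^ k)" by (simp add: norm_mult)
      also have "\<dots> \<le> \<bar>\<dots>\<bar>" by (rule abs_ge_self)
      finally show "norm (exp (c * enorm d \<xi>) * cmod (h \<xi>))
        \<le> norm (C * (cmod (complex_of_real (exp (\<sigma> * enorm d \<xi>)) * h \<xi>) / (1 + enorm d \<xi>) ^ k))"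
        by (simp add: r_def)
    qed
  qed measurable
qed

lemma analytic_of_exponential_decay:
  assumes d: "d > 0" and g: "has_hat d g h" and \<sigma>: "\<sigma> > 0"
    and t: "tame d (\<lambda>\<xi>. complex_of_real (exp (\<sigma> * enorm d \<xi>)) * h \<xi>)"
  shows "analytic_distn d g"
proof -
  note [measurable] = has_hat_measurable[OF g]
  note I = integrable_of_tame_exp[OF has_hat_measurable[OF g] t]
  have "integrable (leb d) (\<lambda>\<xi>. cmod (h \<xi>))" using I[OF \<sigma>] by simp
  then have "integrable (leb d) h" by (rule integrable_norm_cancel) measurable
  moreover have "integrable (leb d) (\<lambda>\<xi>. exp (\<sigma> / 2 * enorm d \<xi>) * cmod (h \<xi>))" using \<sigma> by (intro I) simp
  ultimately show ?thesis
    unfolding analytic_distn_def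
    using real_analytic_fourier_integral[OF d has_hat_measurable[OF g], of "\<sigma> / 2"] is_regular_fourier_integral[OF d g] \<sigma> by auto
qed

context nsk_dim
begin

text \<open>Undoing the exponential leaves M |\<xi>|^(-e1), which is tame because e1 < d and has
  finite \<open>PM\<close> norm of order e1. So \<sigma> itself is admissible in \<open>rad\<close>,
  and the same tameness yields analyticity.\<close>

lemma
  assumes g: "has_hat d g h" and \<sigma>: "\<sigma> > 0" and M: "M \<ge> 0"
    and b: "\<And>\<xi>. good \<xi> \<Longrightarrow> cmod (h \<xi>) \<le> M * profile e1 \<sigma> \<xi>"
  shows analytic_of_decay: "analytic_distn d g" and rad_ge_of_decay: "ereal \<sigma> \<le> rad d e1 g"
proof -
  note [measurable] = has_hat_measurable[OF g] hat_measurable[OF g]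
  define H where "H \<xi> = complex_of_real (exp (\<sigma> * enorm d \<xi>)) * h \<xi>" for \<xi>
  have Hm: "H \<in> borel_measurable borel" unfolding H_def by measurable
  have Hb: "cmod (H \<xi>) \<le> M * profile e1 0 \<xi>" if "good \<xi>" for \<xi>
  proof -
    have "cmod (H \<xi>) \<le> exp (\<sigma> * enorm d \<xi>) * (M * profile e1 \<sigma> \<xi>)"
      using b[OF that] by (simp add: H_def norm_mult)
    also have "\<dots> = M * ((exp (\<sigma> * enorm d \<xi>) * exp (- (\<sigma> * enorm d \<xi>))) * enorm d \<xi> powr (-e1))"
      by (simp only: mult_ac)
    also have "exp (\<sigma> * enorm d \<xi>) * exp (- (\<sigma> * enorm d \<xi>)) = 1" by (simp add: exp_add[symmetric])
    finally show ?thesis by simp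
  qed
  have t: "tame d H"
    by (rule tame_decay[OF Hm order_refl M less_imp_le[OF e_bounds(1)] e_bounds(2) Hb])
  show "analytic_distn d g"
    by (rule analytic_of_exponential_decay[OF d0 g \<sigma>]) (use t in \<open>simp add: H_def[abs_def]\<close>)
  define w where "w = inv_hat d H"
  have w: "has_hat d w H" "w \<in> tempered d"
    unfolding w_def by (rule has_hat_inv_hat[OF d0 t] inv_hat_tempered[OF d0 t])+
  have "AE \<xi> in leb d. complex_of_real (exp (\<sigma> * enorm d \<xi>)) * hat d g \<xi> = H \<xi>"
    using AE_hat_eq[OF d0 g] by eventually_elim (simp add: H_def)
  then have w': "has_hat d w (\<lambda>\<xi>. complex_of_real (exp (\<sigma> * enorm d \<xi>)) * hat d g \<xi>)"
    by (rule has_hat_cong_AE[OF w(1), rotated]) measurable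
  have "PM_norm d 1 e1 (\<lambda>_. w) \<le> ereal (real 1 * M)"
  proof (rule PM_norm_le_componentwise[OF d0 w(1)])
    fix \<xi> assume \<xi>: "\<xi> \<in> Rd d" "enorm d \<xi> > 0"
    have "enorm d \<xi> powr e1 * cmod (H \<xi>) \<le> enorm d \<xi> powr e1 * (M * enorm d \<xi> powr (-e1))"
      using Hb[of \<xi>] \<xi> by (intro mult_left_mono) (auto simp: good_def)
    also have "\<dots> = M * (enorm d \<xi> powr e1 * enorm d \<xi> powr (-e1))" by (simp only: mult_ac)
    also have "enorm d \<xi> powr e1 * enorm d \<xi> powr (-e1) = 1" using \<xi> by (simp add: powr_add[symmetric])
    finally show "enorm d \<xi> powr e1 * cmod (H \<xi>) \<le> M" by simp
  qed
  then have "PM_norm d 1 e1 (\<lambda>_. w) < \<infinity>" by (rule le_less_trans) simp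
  then have "(\<lambda>_. w) \<in> PM d 1 e1" using w by (auto simp: PM_def)
  then show "ereal \<sigma> \<le> rad d e1 g"
    unfolding rad_def using w' \<sigma> by (intro Sup_upper) blast
qed

text \<open>|b|, |\<xi>| |b| and each of the d velocity components are bounded by the Euclidean norm
  inside \<open>data_norm\<close>, which gives the factor 2 + d. Its power of |\<xi>| can be divided
  out at nonzero frequencies.\<close>

lemma data_bound:
  assumes a: "has_hat d a ha" and u: "\<And>j. j < d \<Longrightarrow> has_hat d (u j) (hu j)"
    and le: "data_norm d (real d - 1) a u \<le> ereal \<rho>"
  shows "AE \<xi> in leb d. nrm d \<xi> (hat d a \<xi>, \<lambda>j. hat d (u j) \<xi>) \<le> (2 + real d) * \<rho> * enorm d \<xi> powr (-(real d - 1))"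
proof -
  define X where "X \<xi> = sqrt ((cmod (hat d a \<xi>))\<^sup>2 + (enorm d \<xi> * cmod (hat d a \<xi>))\<^sup>2 + (\<Sum>j<d. (cmod (hat d (u j) \<xi>))\<^sup>2))" for \<xi>
  have "AE \<xi> in leb d. ereal (enorm d \<xi> powr (real d - 1) * X \<xi>) \<le> data_norm d (real d - 1) a u"
    unfolding data_norm_def X_def by (rule esssup_AE)
  then show ?thesis
    using AE_good
  proof eventually_elim
    case (elim \<xi>)
    define r where "r = enorm d \<xi>"
    have r: "r > 0" using elim by (simp add: good_def r_def)
    have "r powr (real d - 1) * X \<xi> \<le> \<rho>"
      using order_trans[OF elim(1) le] by (simp add: r_def)
    then have "r powr (-(real d - 1)) * (r powr (real d - 1) * X \<xi>) \<le> r powr (-(real d - 1)) * \<rho>" by (rule mult_left_mono) simp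
    moreover have "r powr (-(real d - 1)) * r powr (real d - 1) = 1" using r by (simp only: powr_add[symmetric]) simp
    ultimately have X: "X \<xi> \<le> \<rho> * r powr (-(real d - 1))" by (simp only: mult.assoc[symmetric] mult_1_left) (simp add: mult.commute)
    have s: "0 \<le> (\<Sum>j<d. (cmod (hat d (u j) \<xi>))\<^sup>2)" by (intro sum_nonneg) simp
    have a1: "cmod (hat d a \<xi>) \<le> X \<xi>" "r * cmod (hat d a \<xi>) \<le> X \<xi>"
      unfolding X_def r_def using s by (auto intro!: real_le_rsqrt simp: add_nonneg_nonneg)
    have u1: "cmod (hat d (u j) \<xi>) \<le> X \<xi>" if "j < d" for j
    proof -
      have "(cmod (hat d (u j) \<xi>))\<^sup>2 \<le> (\<Sum>j<d. (cmod (hat d (u j) \<xi>))\<^sup>2)"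
        by (rule member_le_sum) (use that in auto)
      also have "\<dots> \<le> (cmod (hat d a \<xi>))\<^sup>2 + (enorm d \<xi> * cmod (hat d a \<xi>))\<^sup>2 + (\<Sum>j<d. (cmod (hat d (u j) \<xi>))\<^sup>2)" by simp
      finally show ?thesis unfolding X_def by (rule real_le_rsqrt)
    qed
    have "(\<Sum>j<d. cmod (hat d (u j) \<xi>)) \<le> (\<Sum>j<d. X \<xi>)" by (intro sum_mono u1) simp
    then have "nrm d \<xi> (hat d a \<xi>, \<lambda>j. hat d (u j) \<xi>) \<le> (2 + real d) * X \<xi>"
      using a1 by (simp add: nrm_def r_def algebra_simps)
    also have "\<dots> \<le> (2 + real d) * (\<rho> * r powr (-(real d - 1)))" by (intro mult_left_mono X) simp
    finally show ?case by (simp add: r_def mult.assoc)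
  qed
qed

theorem global_solution:
  "\<exists>\<rho>>0. \<forall>a\<^sub>0 u\<^sub>0.
     (\<lambda>_. a\<^sub>0) \<in> PM d 1 (real d - 1) \<inter> PM d 1 (real d) \<and> u\<^sub>0 \<in> PM d d (real d - 1) \<and>
     data_norm d (real d - 1) a\<^sub>0 u\<^sub>0 \<le> ereal \<rho> \<longrightarrow>
     (\<exists>a u. mild_solution d p \<mu> \<nu> \<kappa> \<alpha> \<infinity> a\<^sub>0 u\<^sub>0 a u \<and>
        (\<forall>t>0. analytic_distn d (a t) \<and> (\<forall>j<d. analytic_distn d (u t j))) \<and>
        (\<forall>t>0. rad_pair d (real d - 1 + 2 / p) (a t) (u t) \<ge> ereal (1 * sqrt t)))"
proof -
  obtain \<rho> where \<rho>: "\<rho> > 0" "\<And>U0. state_meas U0 \<Longrightarrow> (\<And>\<xi>. good \<xi> \<Longrightarrow> nrm d \<xi> (U0 \<xi>) \<le> \<rho> * enorm d \<xi> powr (-(real d - 1)))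
     \<Longrightarrow> \<exists>M U. ball M U \<and> mild_hat U0 U"
    using mild_hat_exists by blast
  show ?thesis
  \<comment> \<open>Compensates the factor 2 + d of \<open>data_bound\<close>.\<close>
  proof (intro exI[of _ "\<rho> / (2 + real d)"] conjI allI impI)
    show "\<rho> / (2 + real d) > 0" using \<rho>(1) by simp
    fix a\<^sub>0 u\<^sub>0
    assume asm: "(\<lambda>_. a\<^sub>0) \<in> PM d 1 (real d - 1) \<inter> PM d 1 (real d) \<and> u\<^sub>0 \<in> PM d d (real d - 1) \<and>
     data_norm d (real d - 1) a\<^sub>0 u\<^sub>0 \<le> ereal (\<rho> / (2 + real d))"
    have ha: "has_hat d a\<^sub>0 (hat d a\<^sub>0)" and hu: "\<And>j. j < d \<Longrightarrow> has_hat d (u\<^sub>0 j) (hat d (u\<^sub>0 j))"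
      using asm has_hat_hat by (auto simp: PM_def)
    note ma = has_hat_measurable[OF ha] and mu = has_hat_measurable[OF hu]
    define V where "V \<xi> = (hat d a\<^sub>0 \<xi>, \<lambda>j. hat d (u\<^sub>0 j) \<xi>)" for \<xi>
    define n where "n \<xi> = nrm d \<xi> (V \<xi>)" for \<xi>
    \<comment> \<open>The data bound holds almost everywhere only, while the iteration asks for it
      at every good frequency. Off \<open>P\<close> the data are replaced by 0, which alters the
      representatives on a null set and not the distributions.\<close>
    define P where "P \<xi> \<longleftrightarrow> n \<xi> \<le> \<rho> * enorm d \<xi> powr (-(real d - 1))" for \<xi>
    define U0 :: "point \<Rightarrow> state" where "U0 \<xi> = (if P \<xi> then V \<xi> else (0, \<lambda>_. 0))" for \<xi>
    have AEP: "AE \<xi> in leb d. P \<xi>"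
      using data_bound[OF ha hu, where \<rho>="\<rho> / (2 + real d)"] asm by (simp add: P_def n_def V_def)
    have "n \<in> borel_measurable borel"
      unfolding n_def nrm_def V_def fst_conv snd_conv
      by (intro borel_measurable_add borel_measurable_times borel_measurable_sum measurable_compose[OF _ borel_measurable_norm] ma mu) auto
    note [measurable] = this
    have [measurable]: "Measurable.pred borel P"
      unfolding P_def using borel_measurable_le[of n borel "\<lambda>\<xi>. \<rho> * enorm d \<xi> powr - (real d - 1)"] by (simp add: pred_def)
    have m: "state_meas U0"
      unfolding state_meas_def
    proof (intro conjI allI impI)
      note [measurable] = ma
      have "(\<lambda>\<xi>. if P \<xi> then hat d a\<^sub>0 \<xi> else 0) \<in> borel_measurable borel" by measurable
      moreover have "(\<lambda>\<xi>. fst (U0 \<xi>)) = (\<lambda>\<xi>. if P \<xi> then hat d a\<^sub>0 \<xi> else 0)" by (auto simp: U0_def V_def)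
      ultimately show "(\<lambda>\<xi>. fst (U0 \<xi>)) \<in> borel_measurable borel" by simp
      fix j assume "j < d"
      note [measurable] = mu[OF this]
      have "(\<lambda>\<xi>. if P \<xi> then hat d (u\<^sub>0 j) \<xi> else 0) \<in> borel_measurable borel" by measurable
      moreover have "(\<lambda>\<xi>. snd (U0 \<xi>) j) = (\<lambda>\<xi>. if P \<xi> then hat d (u\<^sub>0 j) \<xi> else 0)" by (auto simp: U0_def V_def)
      ultimately show "(\<lambda>\<xi>. snd (U0 \<xi>) j) \<in> borel_measurable borel" by simp
    qed
    have b: "nrm d \<xi> (U0 \<xi>) \<le> \<rho> * enorm d \<xi> powr (-(real d - 1))" for \<xi>
    proof (cases "P \<xi>")
      case True
      then show ?thesis by (simp add: U0_def P_def n_def)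
    next
      case False
      then show ?thesis using \<rho>(1) by (simp add: U0_def nrm_def)
    qed
    have "AE \<xi> in leb d. fst (U0 \<xi>) = hat d a\<^sub>0 \<xi>" using AEP by eventually_elim (simp add: U0_def V_def)
    then have a0: "has_hat d a\<^sub>0 (\<lambda>\<xi>. fst (U0 \<xi>))"
      by (rule has_hat_cong_AE[OF ha, rotated]) (use m in \<open>simp add: state_meas_def\<close>)
    have u0: "has_hat d (u\<^sub>0 j) (\<lambda>\<xi>. snd (U0 \<xi>) j)" if "j < d" for j
    proof -
      have "AE \<xi> in leb d. snd (U0 \<xi>) j = hat d (u\<^sub>0 j) \<xi>" using AEP by eventually_elim (simp add: U0_def V_def)
      then show ?thesis
        by (rule has_hat_cong_AE[OF hu[OF that], rotated]) (use m that in \<open>simp add: state_meas_def\<close>)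
    qed
    obtain M U where U: "ball M U" "mild_hat U0 U" using \<rho>(2)[OF m b] by blast
    have M: "M \<ge> 0" using U by (simp add: ball_def)
    have T: "time_set \<infinity> = {0<..}" by (auto simp: time_set_def)
    note S = sol_mild[OF U m less_imp_le[OF \<rho>(1)] b a0 u0]
    have "mild_solution d p \<mu> \<nu> \<kappa> \<alpha> \<infinity> a\<^sub>0 u\<^sub>0 (sol_a U) (sol_u U)"
      unfolding mild_solution_def Let_def T
      using sol_X_space[OF U less_imp_le[OF \<rho>(1)] b] sol_nonlinearity(1)[OF U(1)] S by auto
    moreover have "analytic_distn d (sol_a U t)" "ereal (sqrt t) \<le> rad d e1 (sol_a U t)"
      and "j < d \<Longrightarrow> analytic_distn d (sol_u U t j)" "j < d \<Longrightarrow> ereal (sqrt t) \<le> rad d e1 (sol_u U t j)"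
      if t: "t > 0" for t j
    proof -
      note D = ball_decays[OF U(1) t]
      have s: "sqrt t > 0" and c: "M * t powr (- (1 / p)) \<ge> 0" using t M by auto
      note A = has_hat_sol_a[OF U(1) t] and B = has_hat_sol_u[OF U(1) t]
      show "analytic_distn d (sol_a U t)" "ereal (sqrt t) \<le> rad d e1 (sol_a U t)"
        using analytic_of_decay[OF A s c decays_fst[OF D]] rad_ge_of_decay[OF A s c decays_fst[OF D]] by auto
      show "j < d \<Longrightarrow> analytic_distn d (sol_u U t j)" "j < d \<Longrightarrow> ereal (sqrt t) \<le> rad d e1 (sol_u U t j)"
        using analytic_of_decay[OF B s c decays_snd[OF D]] rad_ge_of_decay[OF B s c decays_snd[OF D]] by auto
    qed
    moreover have "real d - 1 + 2 / p = e1" by (simp add: e1_def)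
    ultimately show "\<exists>a u. mild_solution d p \<mu> \<nu> \<kappa> \<alpha> \<infinity> a\<^sub>0 u\<^sub>0 a u \<and>
        (\<forall>t>0. analytic_distn d (a t) \<and> (\<forall>j<d. analytic_distn d (u t j))) \<and>
        (\<forall>t>0. rad_pair d (real d - 1 + 2 / p) (a t) (u t) \<ge> ereal (1 * sqrt t))"
      by (intro exI[of _ "sol_a U"] exI[of _ "sol_u U"]) (auto simp: rad_pair_def)
  qed
qed

end

theorem theorem1p5p1:
  fixes \<mu> \<nu> \<kappa> \<alpha> :: real
  assumes "\<mu> > 0" and "\<mu> + \<nu> > 0" and "\<kappa> > 0" and "\<alpha> > 0"
  shows "\<exists>c\<^sub>0::real. c\<^sub>0 > 0 \<and>
    (\<forall>(d::nat) (p::real). d \<ge> 2 \<and> p > 2 \<and> real d - 3 + 4 / p > 0 \<longrightarrow>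
      (\<exists>\<rho>::real. \<rho> > 0 \<and>
        (\<forall>a\<^sub>0 u\<^sub>0.
          (\<lambda>_. a\<^sub>0) \<in> PM d 1 (real d - 1) \<inter> PM d 1 (real d) \<and>
          u\<^sub>0 \<in> PM d d (real d - 1) \<and>
          data_norm d (real d - 1) a\<^sub>0 u\<^sub>0 \<le> ereal \<rho> \<longrightarrow>
          (\<exists>a u. mild_solution d p \<mu> \<nu> \<kappa> \<alpha> \<infinity> a\<^sub>0 u\<^sub>0 a u \<and>
            (\<forall>t>0. analytic_distn d (a t) \<and> (\<forall>j<d. analytic_distn d (u t j))) \<and>
            (\<forall>t>0. rad_pair d (real d - 1 + 2 / p) (a t) (u t) \<ge> ereal (c\<^sub>0 * sqrt t))))))"
proof -
  have dim: "nsk_dim \<mu> \<nu> \<kappa> \<alpha> d p" if "d \<ge> 2 \<and> p > 2 \<and> real d - 3 + 4 / p > 0" for d p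
    using assms that by unfold_locales auto
  \<comment> \<open>The constant 1 can be fixed before \<open>d\<close> and \<open>p\<close>:
    carrying the exponential through the estimates costs factors that enter the smallness threshold
    and leave the rate sqrt t untouched.\<close>
  show ?thesis
    by (rule exI[of _ 1], intro conjI allI impI zero_less_one nsk_dim.global_solution dim; simp)
qed

end
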